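(* Suppose that $k\in\mathbb N$, $r\in\mathbb N_0$, $N\in\mathbb N$, $1\le p\le\infty$, and $\alpha,\beta\in J_p$ are such that $r/2+\alpha\ge0$ and $r/2+\beta\ge0$. If $f\in L_p^{\alpha,\beta}$ is such that, for some $N\in\mathbb N$ and $r<\gamma<k+r$, $$E_n(f)_{\alpha,\beta,p}\le n^{-\gamma},\quad n\ge N,$$ then $f\in\mathbb B_p^r(w_{\alpha,\beta})$, and $$\omega_{k,r}^{\varphi}(f^{(r)},t)_{\alpha,\beta,p}\le c\,t^{\gamma-r}+c(N)\,t^kE_{k+r}(f)_{\alpha,\beta,p},\quad t>0.$$ In particular, if $N\le k+r$, then $$\omega_{k,r}^{\varphi}(f^{(r)},t)_{\alpha,\beta,p}\le c\,t^{\gamma-r},\quad t>0.$$ Here the constants $c$ may depend only on $k,r,p,\alpha,\beta$, and $c(N)$ may depend only on $k,r,p,\alpha,\beta$ and $N$.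
   Context: $J_p=(-1/p,\infty)$ if $0<p<\infty$ and $J_\infty=[0,\infty)$. Jacobi weight: $w_{\alpha,\beta}(x)=(1-x)^\alpha(1+x)^\beta$. $\varphi(x)=\sqrt{1-x^2}$. $\|\cdot\|_p$ is the usual $L_p$ norm on $[-1,1]$ (essential supremum if $p=\infty$). $L_p^{\alpha,\beta}=\{f:\|w_{\alpha,\beta}f\|_p<\infty\}$ (functions on $[-1,1]$, identified if equal a.e.). $\mathbb P_n$ is the set of algebraic polynomials of degree not more than $n-1$, and $E_n(f)_{\alpha,\beta,p}=\inf_{p_n\in\mathbb P_n}\|w_{\alpha,\beta}(f-p_n)\|_p$ (also written $E_n(f)_{w_{\alpha,\beta},p}$). $\mathbb B_p^0(w_{\alpha,\beta})=L_p^{\alpha,\beta}$ and, for $r\ge1$, $\mathbb B_p^r(w_{\alpha,\beta})=\{f: f^{(r-1)}\in AC_{loc}(-1,1)\text{ and }\varphi^rf^{(r)}\in L_p^{\alpha,\beta}\}$, where $AC_{loc}(-1,1)$ is the set of functions locally absolutely continuous in $(-1,1)$. A function in $\mathbb B_p^r(w_{\alpha,\beta})$ is not distinguished from functions equal to it a.e. (so "$f\in\mathbb B_p^r(w_{\alpha,\beta})$" means that $f$ coincides a.e. with such a function). Symmetric difference: $\Delta_h^k(g,x)=\sum_{i=0}^k\binom ki(-1)^{k-i}g(x-\frac{kh}2+ih)$ if $[x-\frac{kh}2,x+\frac{kh}2]\subseteq[-1,1]$, and $\Delta_h^k(g,x)=0$ otherwise. $\mathcal W_\delta^{\xi,\zeta}(x)=(1-x-\delta\varphi(x)/2)^\xi(1+x-\delta\varphi(x)/2)^\zeta$.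 Modulus: for $k\in\mathbb N$, $r\in\mathbb N_0$, $f\in\mathbb B_p^r(w_{\alpha,\beta})$ and $t>0$, $$\omega_{k,r}^{\varphi}(f^{(r)},t)_{\alpha,\beta,p}=\sup_{0\le h\le t}\big\|\mathcal W_{kh}^{r/2+\alpha,r/2+\beta}(\cdot)\,\Delta_{h\varphi(\cdot)}^k(f^{(r)},\cdot)\big\|_p,$$ where the expression under the norm is understood to be $0$ at points $x$ where $\Delta^k_{h\varphi(x)}(f^{(r)},x)$ is set to $0$ because $[x-\frac{kh\varphi(x)}{2},x+\frac{kh\varphi(x)}{2}]\not\subseteq[-1,1]$.
   Formalization: The constant c may here depend also on γ, besides k, r, p, α, β; with c independent of γ the claim is false (k=1, r=0, p=∞, α=β=0, N=1, f a small multiple of Σ 4^{-j}T_{4^j}, let γ→1). c(N) is as stated. *)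

theory Defs
  imports
    "HOL-Analysis.Analysis"
    "HOL-Probability.Essential_Supremum"
    "HOL-Computational_Algebra.Polynomial"
begin

text \<open>
  Functions on $[-1,1]$ are represented by functions of type real to real whose values outside
  $[-1,1]$ are irrelevant. Exponents $p$ are extended nonnegative reals; the real value of a finite
  $p$ is \<open>enn2real p\<close>. Norms and moduli take values in \<open>ennreal\<close>, so an upper bound by a real number
  includes finiteness.
\<close>

definition J :: "ennreal \<Rightarrow> real set" where
  "J p = (if p = \<infinity> then {0..} else {- 1 / enn2real p<..})"

definition jacobi_weight :: "real \<Rightarrow> real \<Rightarrow> real \<Rightarrow> real" where
  "jacobi_weight \<alpha> \<beta> x = (1 - x) powr \<alpha> * (1 + x) powr \<beta>"

definition \<phi> :: "real \<Rightarrow> real" where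
  "\<phi> x = sqrt (1 - x\<^sup>2)"

text \<open>
  As for \<open>esssup\<close> in the library, the value for a function that is not Lebesgue measurable is
  infinity. Thus finiteness of the norm includes measurability.
\<close>

definition Lp_norm :: "ennreal \<Rightarrow> (real \<Rightarrow> real) \<Rightarrow> ennreal" where
  "Lp_norm p g =
    (if g \<notin> borel_measurable (lebesgue_on {-1..1}) then \<infinity>
     else if p = \<infinity> then esssup (lebesgue_on {-1..1}) (\<lambda>x. ennreal \<bar>g x\<bar>)
     else (let I = (\<integral>\<^sup>+x. ennreal (\<bar>g x\<bar> powr enn2real p) \<partial>lebesgue_on {-1..1})
           in if I = \<infinity> then \<infinity> else ennreal (enn2real I powr (1 / enn2real p))))"

definition weighted_norm :: "ennreal \<Rightarrow> real \<Rightarrow> real \<Rightarrow> (real \<Rightarrow> real) \<Rightarrow> ennreal" where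
  "weighted_norm p \<alpha> \<beta> f = Lp_norm p (\<lambda>x. jacobi_weight \<alpha> \<beta> x * f x)"

definition weighted_Lp :: "ennreal \<Rightarrow> real \<Rightarrow> real \<Rightarrow> (real \<Rightarrow> real) set" where
  "weighted_Lp p \<alpha> \<beta> = {f. weighted_norm p \<alpha> \<beta> f < \<infinity>}"

text \<open>Degree at most $n-1$. The library gives the zero polynomial degree 0.\<close>

definition polys :: "nat \<Rightarrow> real poly set" where
  "polys n = {q. q = 0 \<or> degree q < n}"

definition best_approx :: "nat \<Rightarrow> (real \<Rightarrow> real) \<Rightarrow> real \<Rightarrow> real \<Rightarrow> ennreal \<Rightarrow> ennreal" where
  "best_approx n f \<alpha> \<beta> p = (INF q\<in>polys n. weighted_norm p \<alpha> \<beta> (\<lambda>x. f x - poly q x))"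

definition absolutely_continuous_on :: "real set \<Rightarrow> (real \<Rightarrow> real) \<Rightarrow> bool" where
  "absolutely_continuous_on S f \<longleftrightarrow>
    (\<forall>\<epsilon>>0. \<exists>\<delta>>0. \<forall>(I :: nat set) l u.
        finite I \<longrightarrow>
        (\<forall>i\<in>I. l i \<le> u i \<and> {l i..u i} \<subseteq> S) \<longrightarrow>
        disjoint_family_on (\<lambda>i. {l i<..<u i}) I \<longrightarrow>
        (\<Sum>i\<in>I. u i - l i) < \<delta> \<longrightarrow>
        (\<Sum>i\<in>I. \<bar>f (u i) - f (l i)\<bar>) < \<epsilon>)"

definition AC_loc :: "(real \<Rightarrow> real) set" where
  "AC_loc = {f. \<forall>a b. -1 < a \<longrightarrow> a \<le> b \<longrightarrow> b < 1 \<longrightarrow> absolutely_continuous_on {a..b} f}"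

text \<open>
  The functions $g$ with $g^{(r-1)} \in AC_{loc}(-1,1)$ (no condition if $r = 0$). Existence of the
  derivatives up to order $r-1$ has to be demanded explicitly because \<open>deriv\<close> is a total function.
  The $r$-th derivative then exists almost everywhere, and the values of \<open>(deriv ^^ r) g\<close> on the
  exceptional null set do not matter below.
\<close>

definition AC_derivs :: "nat \<Rightarrow> (real \<Rightarrow> real) set" where
  "AC_derivs r = {g. r \<ge> 1 \<longrightarrow>
     (\<forall>j < r - 1. \<forall>x\<in>{-1<..<1}. (deriv ^^ j) g field_differentiable at x) \<and>
     (deriv ^^ (r - 1)) g \<in> AC_loc}"

definition ae_eq :: "(real \<Rightarrow> real) \<Rightarrow> (real \<Rightarrow> real) \<Rightarrow> bool" where
  "ae_eq f g \<longleftrightarrow> (AE x in lebesgue_on {-1..1}. f x = g x)"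

text \<open>
  The derivative $f^{(r)}$ of a function $f$ given up to equality almost everywhere: it is taken of
  a representative of $f$ in \<open>AC_derivs r\<close>, which for $r \ge 1$ is unique on $(-1,1)$ by continuity.
\<close>

definition ae_deriv :: "nat \<Rightarrow> (real \<Rightarrow> real) \<Rightarrow> real \<Rightarrow> real" where
  "ae_deriv r f = (deriv ^^ r) (SOME g. g \<in> AC_derivs r \<and> ae_eq f g)"

definition B_space :: "nat \<Rightarrow> ennreal \<Rightarrow> real \<Rightarrow> real \<Rightarrow> (real \<Rightarrow> real) set" where
  "B_space r p \<alpha> \<beta> =
    (if r = 0 then weighted_Lp p \<alpha> \<beta>
     else {f. \<exists>g\<in>AC_derivs r. ae_eq f g \<and>
                (\<lambda>x. \<phi> x ^ r * (deriv ^^ r) g x) \<in> weighted_Lp p \<alpha> \<beta>})"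

definition sym_diff :: "nat \<Rightarrow> real \<Rightarrow> (real \<Rightarrow> real) \<Rightarrow> real \<Rightarrow> real" where
  "sym_diff k h g x =
    (if {x - real k * h / 2 .. x + real k * h / 2} \<subseteq> {-1..1}
     then (\<Sum>i=0..k. real (k choose i) * (-1) ^ (k - i) * g (x - real k * h / 2 + real i * h))
     else 0)"

text \<open>
  The library has \<open>0 powr 0 = 0\<close>, and \<open>powr\<close> is not meaningful for a negative base. In the modulus
  below a base vanishes only on a null set, and wherever a base is negative the difference is 0.
\<close>

definition mod_weight :: "real \<Rightarrow> real \<Rightarrow> real \<Rightarrow> real \<Rightarrow> real" where
  "mod_weight \<delta> \<xi> \<zeta> x =
    (1 - x - \<delta> * \<phi> x / 2) powr \<xi> * (1 + x - \<delta> * \<phi> x / 2) powr \<zeta>"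

text \<open>The argument \<open>g\<close> is the derivative $f^{(r)}$.\<close>

definition jacobi_modulus ::
  "nat \<Rightarrow> nat \<Rightarrow> (real \<Rightarrow> real) \<Rightarrow> real \<Rightarrow> real \<Rightarrow> real \<Rightarrow> ennreal \<Rightarrow> ennreal" where
  "jacobi_modulus k r g t \<alpha> \<beta> p =
    (SUP h\<in>{0..t}.
       Lp_norm p (\<lambda>x. mod_weight (real k * h) (real r / 2 + \<alpha>) (real r / 2 + \<beta>) x *
                       sym_diff k (h * \<phi> x) g x))"

end

theory Submission
  imports Defs
begin

text \<open>
  The substitution \<open>x = cos \<theta>\<close> turns polynomials into trigonometric polynomials. A rapidly decaying reproducing
  kernel controls \<open>T'(\<theta>)\<close> by local averages of \<open>T\<close> on the scale \<open>1 / n\<close>, and on this scale Jacobi weights are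
  essentially constant except very close to the end points, a region whose contribution can be absorbed. This
  gives the weighted Bernstein inequality \<open>\<parallel>w \<phi>\<^sup>i P\<^sup>(\<^sup>i\<^sup>)\<parallel> \<le> c n\<^sup>i \<parallel>w P\<parallel>\<close>. Applied to the differences of near-best
  approximants of degree \<open>2^j\<close>, it makes the telescoping series for \<open>f\<close> converge together with its derivatives
  up to order \<open>r\<close>. The modulus of \<open>f\<^sup>(\<^sup>r\<^sup>)\<close> at \<open>t\<close> is estimated by splitting the series at \<open>2^j \<approx> 1 / t\<close>: the tail is
  bounded by its norm, the polynomial part by \<open>t\<^sup>k\<close> times the norm of its derivative of order \<open>k + r\<close>.
\<close>


subsection \<open>Localized reproduction of trigonometric polynomials\<close>

text \<open>The obstacle is the weight: it may be unbounded at the end points, and there it is not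
  essentially constant on the scale 1/n whatever the signs of \<alpha> and \<beta>. An intermediary
  is the weight in which \<theta> and pi - \<theta> are replaced by \<theta> + 1/n and pi - \<theta>
  + 1/n. It varies only polynomially in n |v - \<theta>|, which a fast kernel outweighs. For finite
  p, kernel averages of the true weight are bounded by it, because \<alpha>, \<beta> > -1/p makes
  the singularities integrable; for polynomials it can be exchanged for the true weight by
  absorption. Since \<phi> is a Jacobi weight with exponents 1/2, the inequality for one derivative
  can be iterated. In the series, derivatives of order r decay with ratio 2^(r-\<gamma>) < 1 and
  those of order k+r grow with ratio 2^(k+r-\<gamma>) > 1; at 2^j of size 1/t both contribute
  t^(\<gamma>-r). The block of lowest degree matters only modulo polynomials annihilated by k+r
  derivatives, which is the origin of the term with the best approximation of order k+r.\<close>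

inductive trig_poly :: "nat \<Rightarrow> (real \<Rightarrow> complex) \<Rightarrow> bool" for M where
  zero: "trig_poly M (\<lambda>_. 0)"
| add_term: "trig_poly M F \<Longrightarrow> \<bar>j\<bar> \<le> int M \<Longrightarrow> trig_poly M (\<lambda>v. F v + c * cis (of_int j * v))"

lemma trig_poly_term: "\<bar>j\<bar> \<le> int M \<Longrightarrow> trig_poly M (\<lambda>v. c * cis (of_int j * v))"
  using trig_poly.add_term[OF trig_poly.zero, of j M c] by simp

lemma trig_poly_const: "trig_poly M (\<lambda>_. c)"
  using trig_poly_term[of 0 M c] by simp

lemma trig_poly_add:
  assumes "trig_poly M F" "trig_poly M G"
  shows "trig_poly M (\<lambda>v. F v + G v)"
  using assms(2)
proof induction
  case zero
  then show ?case using assms(1) by simp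
next
  case (add_term G j c)
  show ?case
    using trig_poly.add_term[OF add_term.IH add_term.hyps(2), of c] by (simp add: add.assoc)
qed

lemma trig_poly_sum:
  "(\<And>i. i \<in> A \<Longrightarrow> trig_poly M (F i)) \<Longrightarrow> trig_poly M (\<lambda>v. \<Sum>i\<in>A. F i v)"
  by (induction A rule: infinite_finite_induct)
     (auto intro: trig_poly.zero trig_poly_add)

lemma trig_poly_mult_term:
  assumes "trig_poly M F" "\<bar>j\<bar> \<le> int L"
  shows "trig_poly (M + L) (\<lambda>v. F v * (c * cis (of_int j * v)))"
  using assms(1)
proof induction
  case zero
  then show ?case by (simp add: trig_poly.zero)
next
  case (add_term F i d)
  have "\<bar>i + j\<bar> \<le> int (M + L)" using add_term.hyps assms(2) by simp
  from trig_poly.add_term[OF add_term.IH this, of "d * c"]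
  show ?case by (simp add: algebra_simps cis_mult[symmetric])
qed

lemma trig_poly_mult:
  assumes "trig_poly M F" "trig_poly L G"
  shows "trig_poly (M + L) (\<lambda>v. F v * G v)"
  using assms(2)
proof induction
  case zero
  then show ?case by (simp add: trig_poly.zero)
next
  case (add_term G j c)
  from trig_poly_add[OF add_term.IH trig_poly_mult_term[OF assms(1) add_term.hyps(2), of c]]
  show ?case by (simp add: algebra_simps)
qed

lemma trig_poly_mono: "trig_poly M F \<Longrightarrow> M \<le> L \<Longrightarrow> trig_poly L F"
  by (induction rule: trig_poly.induct) (auto intro: trig_poly.intros)

lemma trig_poly_power: "trig_poly M F \<Longrightarrow> trig_poly (m * M) (\<lambda>v. F v ^ m)"
  by (induction m) (auto intro: trig_poly_const dest: trig_poly_mult[of M F])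

lemma trig_poly_cos: "trig_poly 1 (\<lambda>v. complex_of_real (cos v))"
proof -
  have "trig_poly 1 (\<lambda>v. 1/2 * cis (of_int 1 * v) + 1/2 * cis (of_int (-1) * v))"
    by (intro trig_poly_add trig_poly_term) auto
  moreover have "(\<lambda>v. 1/2 * cis (of_int 1 * v) + 1/2 * cis (of_int (-1) * v)) = (\<lambda>v. complex_of_real (cos v))"
    by (auto simp: fun_eq_iff complex_eq_iff)
  ultimately show ?thesis by simp
qed

lemma trig_poly_poly_cos:
  "trig_poly (degree P) (\<lambda>v. complex_of_real (poly P (cos v)))"
proof (induction P)
  case 0
  then show ?case by (simp add: trig_poly.zero)
next
  case (pCons a P)
  show ?case
  proof (cases "P = 0")
    case True
    then show ?thesis by (simp add: trig_poly_const)
  next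
    case False
    have "trig_poly (1 + degree P) (\<lambda>v. complex_of_real a + cos v * poly P (cos v))"
      by (rule trig_poly_add[OF trig_poly_const])
         (use trig_poly_mult[OF trig_poly_cos pCons.IH] in simp)
    with False show ?thesis by simp
  qed
qed

lemma cis_has_vector_derivative:
  "((\<lambda>v. cis (a * v)) has_vector_derivative \<i> * a * cis (a * v)) (at v within S)"
proof -
  have "((\<lambda>z. exp (\<i> * (a * z))) has_field_derivative \<i> * a * exp (\<i> * (a * v))) (at (of_real v))"
    by (auto intro!: derivative_eq_intros)
  from has_vector_derivative_real_field[OF this, of S]
  show ?thesis by (simp add: cis_conv_exp)
qed

lemma has_integral_cis:
  "((\<lambda>v. cis (of_int j * v)) has_integral (if j = 0 then 2 * pi else 0)) {-pi..pi}"
proof (cases "j = 0")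
  case True
  show ?thesis
    using has_integral_const_real[of "1::complex" "-pi" pi] True
    by (simp add: scaleR_conv_of_real)
next
  case False
  have "((\<lambda>v. cis (of_int j * v)) has_integral
        (cis (of_int j * pi) / (\<i> * of_int j) - cis (of_int j * (-pi)) / (\<i> * of_int j))) {-pi..pi}"
  proof (rule fundamental_theorem_of_calculus)
    fix x
    show "((\<lambda>v. cis (of_int j * v) / (\<i> * of_int j)) has_vector_derivative cis (of_int j * x)) (at x within {-pi..pi})"
      by (rule has_vector_derivative_eq_rhs, rule has_vector_derivative_divide, rule cis_has_vector_derivative)
         (use False in simp)
  qed simp
  moreover have "cis (of_int j * pi) = cis (of_int j * (-pi))"
    using sin_npi_int[of j] by (simp add: complex_eq_iff mult.commute)
  ultimately show ?thesis using False by simp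
qed

text \<open>Orthogonality of the exponentials: a linear functional that multiplies the exponential
  of frequency \<open>j\<close> by \<open>b j\<close> and evaluates it at \<open>\<theta>\<close> is
  convolution with the kernel whose coefficients are \<open>b\<close>. The choice
  \<open>b j = 1\<close> gives evaluation at \<open>\<theta>\<close> and
  \<open>b j = \<i> * j\<close> gives the derivative there. By linearity only single exponentials
  have to be checked, which the inductive form of \<open>trig_poly\<close> reflects.\<close>

lemma trig_poly_reproduce:
  fixes \<theta> :: real and b :: "int \<Rightarrow> complex" and L :: "(real \<Rightarrow> complex) \<Rightarrow> complex"
  assumes "trig_poly M F"
    and L_add: "\<And>F G. trig_poly M F \<Longrightarrow> trig_poly M G \<Longrightarrow> L (\<lambda>v. F v + G v) = L F + L G"
    and L_term: "\<And>j c. \<bar>j\<bar> \<le> int M \<Longrightarrow> L (\<lambda>v. c * cis (of_int j * v)) = c * b j * cis (of_int j * \<theta>)"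
  shows "((\<lambda>v. F v * (\<Sum>l=-int M..int M. b l * cis (of_int l * (\<theta> - v)))) has_integral 2 * pi * L F) {-pi..pi}"
  using assms(1)
proof induction
  case zero
  have "L (\<lambda>v. 0) = 0" using L_term[of 0 0] by simp
  then show ?case by simp
next
  case (add_term F j c)
  have eq: "c * cis (of_int j * v) * (\<Sum>l=-int M..int M. b l * cis (of_int l * (\<theta> - v)))
      = (\<Sum>l=-int M..int M. c * b l * cis (of_int l * \<theta>) * cis (of_int (j - l) * v))" for v
    unfolding sum_distrib_left
    by (intro sum.cong refl) (simp add: mult.assoc mult.left_commute cis_mult algebra_simps)
  have "((\<lambda>v. c * cis (of_int j * v) * (\<Sum>l=-int M..int M. b l * cis (of_int l * (\<theta> - v))))
     has_integral (\<Sum>l=-int M..int M. c * b l * cis (of_int l * \<theta>) * (if j - l = 0 then 2 * pi else 0))) {-pi..pi}"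
    unfolding eq by (intro has_integral_sum has_integral_mult_right has_integral_cis) auto
  also have "(\<Sum>l=-int M..int M. c * b l * cis (of_int l * \<theta>) * (if j - l = 0 then 2 * pi else 0))
     = (\<Sum>l=-int M..int M. if j = l then c * b l * cis (of_int l * \<theta>) * (2 * pi) else 0)"
    by (intro sum.cong) auto
  also have "\<dots> = 2 * pi * L (\<lambda>v. c * cis (of_int j * v))"
    using add_term.hyps(2) by (subst sum.delta') (auto simp: L_term)
  finally have "((\<lambda>v. c * cis (of_int j * v) * (\<Sum>l=-int M..int M. b l * cis (of_int l * (\<theta> - v))))
     has_integral 2 * pi * L (\<lambda>v. c * cis (of_int j * v))) {-pi..pi}" .
  from has_integral_add[OF add_term.IH this]
  have "((\<lambda>v. (F v + c * cis (of_int j * v)) * (\<Sum>l=-int M..int M. b l * cis (of_int l * (\<theta> - v))))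
     has_integral 2 * pi * (L F + L (\<lambda>v. c * cis (of_int j * v)))) {-pi..pi}"
    by (simp only: distrib_left distrib_right)
  then show ?case
    by (simp only: L_add[OF add_term.hyps(1) trig_poly_term[OF add_term.hyps(2)]])
qed

lemma trig_poly_differentiable:
  assumes "trig_poly M F" shows "F differentiable (at x)"
  using assms
  by induction
     (auto intro!: derivative_intros
       intro: differentiableI_vector[OF cis_has_vector_derivative])

section \<open>Jordan's inequality and the Jackson kernel\<close>

lemma sin_ge_linear: "0 \<le> y \<Longrightarrow> y \<le> pi / 2 \<Longrightarrow> 2 / pi * y \<le> sin y"
proof -
  assume y: "0 \<le> y" "y \<le> pi / 2"
  have c: "concave_on {0..pi} sin"
    unfolding concave_on_def
    by (rule f''_ge0_imp_convex[where f' = "\<lambda>x. - cos x" and f'' = sin])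
       (auto intro!: derivative_eq_intros sin_ge_zero)
  define t where "t = 2 / pi * y"
  have t: "0 \<le> t" "t \<le> 1" "y = t * (pi/2)" using y by (auto simp: t_def field_simps)
  from concave_onD[OF c, of t 0 "pi/2"] t have "t \<le> sin (t * (pi / 2))" by (simp add: algebra_simps)
  then have "t \<le> sin y" by (simp only: t(3)[symmetric])
  then show ?thesis by (simp add: t_def)
qed

text \<open>The hypotheses on \<open>u\<close> say that its distance from the multiples of 2 pi is
  at least \<open>d\<close>; the part beyond pi is reflected by sin(pi - y) = sin y before Jordan's
  inequality is used.\<close>

lemma sin_half_ge:
  assumes "0 \<le> d" "d \<le> pi" "d \<le> \<bar>u\<bar>" "\<bar>u\<bar> \<le> 2 * pi - d"
  shows "d / pi \<le> \<bar>sin (u / 2)\<bar>"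
proof -
  have "d / pi \<le> sin (d / 2)" using sin_ge_linear[of "d/2"] assms by simp
  also have "\<dots> \<le> sin (\<bar>u\<bar> / 2)"
  proof (cases "\<bar>u\<bar> / 2 \<le> pi / 2")
    case True
    then show ?thesis using assms by (intro sin_monotone_2pi_le) auto
  next
    case False
    have "sin (d / 2) \<le> sin (pi - \<bar>u\<bar> / 2)"
      using assms False by (intro sin_monotone_2pi_le) auto
    then show ?thesis by simp
  qed
  also have "\<dots> \<le> \<bar>sin (u / 2)\<bar>"
    by (cases "u \<ge> 0") (auto simp: abs_if)
  finally show ?thesis .
qed

text \<open>The generalized Jackson kernel, a power of sin(n u / 2) / (n sin(u / 2)). The geometric
  sum defines it also where sin(u / 2) vanishes. It is normalized by its value 1 at 0 and not by its
  integral, because it serves as a multiplier.\<close>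

definition jackson :: "nat \<Rightarrow> nat \<Rightarrow> real \<Rightarrow> real" where
  "jackson n m u = (cmod (\<Sum>j<n. cis (real j * u)) / n) ^ (2 * m)"

lemma cmod_sum_cis_le: "cmod (\<Sum>j<n. cis (real j * u)) \<le> n"
  using norm_sum[of "\<lambda>j. cis (real j * u)" "{..<n}"] by simp

text \<open>Multiplication by \<open>cis u - 1\<close> collapses the geometric sum to
  \<open>cis (n * u) - 1\<close>, of modulus at most 2, while \<open>cis u - 1\<close> has modulus
  twice that of sin(u / 2).\<close>

lemma cmod_sum_cis_sin_le: "cmod (\<Sum>j<n. cis (real j * u)) * \<bar>sin (u / 2)\<bar> \<le> 1"
proof -
  have "(\<Sum>j<n. cis u ^ j) * (cis u - 1) = cis u ^ n - 1"
    by (metis mult.commute power_diff_1_eq)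
  then have "cmod (\<Sum>j<n. cis (real j * u)) * cmod (cis u - 1) = cmod (cis (n * u) - 1)"
    by (metis (no_types, lifting) Complex.DeMoivre norm_mult sum.cong)
  also have "\<dots> \<le> 2"
    using norm_triangle_ineq4[of "cis (n * u)" 1] by simp
  also have "cmod (cis u - 1) = 2 * \<bar>sin (u / 2)\<bar>"
    using dist_exp_i_1[of u] by (simp add: cis_conv_exp)
  finally show ?thesis by simp
qed

text \<open>The trivial bound \<open>n\<close> for the sum and the bound pi / \<open>d\<close> from
  its geometric form are added into one estimate that is valid at every distance; its power then
  decays like (n d)^(-2m).\<close>

lemma jackson_bound:
  assumes "n \<ge> 1" "0 \<le> d" "d \<le> pi" "d \<le> \<bar>u\<bar>" "\<bar>u\<bar> \<le> 2 * pi - d"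
  shows "jackson n m u \<le> (2 * pi) ^ (2 * m) / (1 + n * d) ^ (2 * m)"
proof -
  let ?A = "cmod (\<Sum>j<n. cis (real j * u))"
  have "?A * (d / pi) \<le> ?A * \<bar>sin (u / 2)\<bar>"
    using sin_half_ge[OF assms(2-5)] by (intro mult_left_mono) auto
  also have "\<dots> \<le> 1" by (rule cmod_sum_cis_sin_le)
  finally have "?A * d \<le> pi" by (simp add: field_simps)
  then have "n * (?A * d) \<le> n * pi" by (intro mult_left_mono) auto
  moreover have "?A \<le> n" by (rule cmod_sum_cis_le)
  moreover have "real n \<le> n * pi" using mult_left_mono[of 1 pi "real n"] pi_ge_two by simp
  ultimately have "?A * (1 + n * d) \<le> n * (2 * pi)" by (simp add: algebra_simps)
  then have "?A / n \<le> 2 * pi / (1 + n * d)"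
    using assms by (simp add: field_simps add_pos_nonneg)
  then have "(?A / n) ^ (2 * m) \<le> (2 * pi / (1 + n * d)) ^ (2 * m)"
    by (intro power_mono) auto
  then show ?thesis by (simp add: jackson_def power_divide)
qed

lemma jackson_0: "n \<ge> 1 \<Longrightarrow> jackson n m 0 = 1"
  by (simp add: jackson_def)

lemma jackson_nonneg: "0 \<le> jackson n m u"
  by (simp add: jackson_def)

text \<open>An even power of the modulus is a power of the sum times its conjugate, hence a
  trigonometric polynomial.\<close>

lemma trig_poly_jackson: "trig_poly (m * (2 * n)) (\<lambda>v. complex_of_real (jackson n m (v - \<theta>)))"
proof -
  let ?A = "\<lambda>v. (\<Sum>j<n. cis (real j * (v - \<theta>)))"
  have 1: "trig_poly n ?A"
  proof (rule trig_poly_sum)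
    fix j assume "j \<in> {..<n}"
    then have "trig_poly n (\<lambda>v. cis (- real j * \<theta>) * cis (of_int (int j) * v))"
      by (intro trig_poly_term) auto
    then show "trig_poly n (\<lambda>v. cis (real j * (v - \<theta>)))"
      by (simp add: cis_mult algebra_simps)
  qed
  have 2: "trig_poly n (\<lambda>v. cnj (?A v))"
    unfolding cnj_sum
  proof (rule trig_poly_sum)
    fix j assume "j \<in> {..<n}"
    then have "trig_poly n (\<lambda>v. cis (real j * \<theta>) * cis (of_int (- int j) * v))"
      by (intro trig_poly_term) auto
    then show "trig_poly n (\<lambda>v. cnj (cis (real j * (v - \<theta>))))"
      by (simp add: cis_mult cis_cnj algebra_simps)
  qed
  have "trig_poly (0 + m * (n + n)) (\<lambda>v. complex_of_real (1 / n ^ (2 * m)) * (?A v * cnj (?A v)) ^ m)"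
    by (intro trig_poly_mult trig_poly_const trig_poly_power 1 2)
  moreover have "complex_of_real (1 / n ^ (2 * m)) * (?A v * cnj (?A v)) ^ m = complex_of_real (jackson n m (v - \<theta>))" for v
    unfolding complex_norm_square[symmetric] jackson_def
    by (simp add: power_divide power_mult)
  ultimately show ?thesis by (simp add: mult_2)
qed

text \<open>The kernel attains its maximum at 0 and is differentiable there because it is a
  trigonometric polynomial.\<close>

lemma jackson_deriv_0:
  assumes "n \<ge> 1"
  shows "(jackson n m has_real_derivative 0) (at 0)"
proof -
  have "(\<lambda>v. complex_of_real (jackson n m (v - 0))) differentiable (at 0)"
    by (rule trig_poly_differentiable[OF trig_poly_jackson])
  then obtain D where "((\<lambda>v. complex_of_real (jackson n m v)) has_vector_derivative D) (at 0)"
    by (auto simp: vector_derivative_works)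
  then have "((\<lambda>v. Re (complex_of_real (jackson n m v))) has_vector_derivative Re D) (at 0)"
    by (rule bounded_linear.has_vector_derivative[OF bounded_linear_Re])
  then have D: "(jackson n m has_real_derivative Re D) (at 0)"
    by (simp add: has_real_derivative_iff_has_vector_derivative)
  have "jackson n m y \<le> jackson n m 0" for y
    using jackson_bound[OF assms, of 0 0 m] cmod_sum_cis_le[of y n] assms
    by (auto simp: jackson_0 jackson_def intro!: power_le_one)
  then have "Re D = 0" using DERIV_local_max[OF D, of 1] by auto
  with D show ?thesis by simp
qed


lemma norm_integral_le_integral:
  fixes F G :: "real \<Rightarrow> complex" and g :: "real \<Rightarrow> real"
  assumes "(F has_integral I) S" "g integrable_on S" "\<And>v. v \<in> S \<Longrightarrow> cmod (F v) \<le> g v"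
  shows "cmod I \<le> integral S g"
  using integral_norm_bound_integral[OF has_integral_integrable[OF assms(1)] assms(2,3)]
    integral_unique[OF assms(1)] by simp

lemma integral_even_abs:
  fixes f :: "real \<Rightarrow> real"
  assumes "continuous_on {0..a} f" "0 \<le> a"
  shows "integral {-a..a} (\<lambda>v. f \<bar>v\<bar>) = 2 * integral {0..a} f" "(\<lambda>v. f \<bar>v\<bar>) integrable_on {-a..a}"
proof -
  have f: "(f has_integral integral {0..a} f) {0..a}"
    using assms by (intro integrable_integral integrable_continuous_real)
  have 1: "((\<lambda>v. f \<bar>v\<bar>) has_integral integral {0..a} f) {0..a}"
    by (rule has_integral_eq[OF _ f]) auto
  have "((\<lambda>v. f (- v)) has_integral integral {0..a} f) {-a..-0}"
    by (rule iffD2[OF has_integral_reflect_real f])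
  then have 2: "((\<lambda>v. f \<bar>v\<bar>) has_integral integral {0..a} f) {-a..0}"
    by (subst has_integral_cong[of _ _ "\<lambda>v. f (- v)"]) auto
  from has_integral_combine[OF _ _ 2 1] assms(2)
  have "((\<lambda>v. f \<bar>v\<bar>) has_integral 2 * integral {0..a} f) {-a..a}" by simp
  then show "integral {-a..a} (\<lambda>v. f \<bar>v\<bar>) = 2 * integral {0..a} f" "(\<lambda>v. f \<bar>v\<bar>) integrable_on {-a..a}"
    by (rule integral_unique, rule has_integral_integrable)
qed

text \<open>
  Multiplying by the Jackson kernel centred at \<open>\<theta>\<close> changes neither the value nor the first derivative
  at \<open>\<theta>\<close>, so the (non-decaying) Dirichlet kernel of a larger degree yields a rapidly decaying
  reproducing kernel.
\<close>

lemma cos_poly_localized: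
  fixes P :: "real poly" and n m :: nat and I C :: real
  assumes n: "n \<ge> 1" "degree P < n" and \<theta>: "\<theta> \<in> {0..pi}"
  defines "I \<equiv> integral {0..pi} (\<lambda>v. \<bar>poly P (cos v)\<bar> / (1 + n * \<bar>v - \<theta>\<bar>) ^ (2 * m))"
    and "C \<equiv> (4 * real m + 3) ^ 2 * (2 * pi) ^ (2 * m)"
  shows "\<bar>poly P (cos \<theta>)\<bar> \<le> C * n * I" "\<bar>sin \<theta> * poly (pderiv P) (cos \<theta>)\<bar> \<le> C * n\<^sup>2 * I"
proof -
  define F where "F v = complex_of_real (poly P (cos v) * jackson n m (v - \<theta>))" for v
  define M where "M = n + m * (2 * n)"
  have M: "real M = (2 * m + 1) * n" by (simp add: M_def algebra_simps)
  have F: "trig_poly M F"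
    unfolding F_def M_def of_real_mult
    by (rule trig_poly_mult[OF trig_poly_mono[OF trig_poly_poly_cos] trig_poly_jackson]) (use n in simp)
  define g where "g v = \<bar>poly P (cos v)\<bar> / (1 + n * \<bar>v - \<theta>\<bar>) ^ (2 * m)" for v
  have nz: "1 + n * \<bar>x\<bar> \<noteq> 0" for x :: real
    using mult_nonneg_nonneg[of "real n" "\<bar>x\<bar>"] by linarith
  have g: "continuous_on {0..pi} g"
    unfolding g_def by (intro continuous_intros) (simp add: nz)
  have I0: "0 \<le> I" unfolding I_def by (intro integral_nonneg integrable_continuous_real g[unfolded g_def]) auto
  \<comment> \<open>The majorant has to be even in \<open>v\<close> so that the integral can be
    folded onto \<open>{0..pi}\<close>. For \<open>\<theta>\<close> in \<open>{0..pi}\<close> the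
    number \<open>\<bar>\<bar>v\<bar> - \<theta>\<bar>\<close> is at most the distance of
    \<open>v - \<theta>\<close> from the multiples of 2 pi.\<close>
  have Fg: "cmod (F v) \<le> (2 * pi) ^ (2 * m) * g \<bar>v\<bar>" if "v \<in> {-pi..pi}" for v
  proof -
    have "jackson n m (v - \<theta>) \<le> (2 * pi) ^ (2 * m) / (1 + n * \<bar>\<bar>v\<bar> - \<theta>\<bar>) ^ (2 * m)"
    proof (rule jackson_bound[OF n(1)])
      have v: "\<bar>v\<bar> \<le> pi" and t: "0 \<le> \<theta>" "\<theta> \<le> pi" using that \<theta> by auto
      show "\<bar>\<bar>v\<bar> - \<theta>\<bar> \<le> pi" using v t by linarith
      show "\<bar>\<bar>v\<bar> - \<theta>\<bar> \<le> \<bar>v - \<theta>\<bar>" using t by linarith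
      show "\<bar>v - \<theta>\<bar> \<le> 2 * pi - \<bar>\<bar>v\<bar> - \<theta>\<bar>" using v t by linarith
    qed simp
    then have "\<bar>poly P (cos v)\<bar> * jackson n m (v - \<theta>) \<le>
        \<bar>poly P (cos v)\<bar> * ((2 * pi) ^ (2 * m) / (1 + n * \<bar>\<bar>v\<bar> - \<theta>\<bar>) ^ (2 * m))"
      by (rule mult_left_mono) simp
    moreover have "cmod (F v) = \<bar>poly P (cos v)\<bar> * jackson n m (v - \<theta>)"
      unfolding F_def norm_of_real by (simp add: abs_mult jackson_nonneg)
    ultimately show ?thesis unfolding g_def by (simp add: mult_ac)
  qed
  \<comment> \<open>The reproducing kernel is estimated crudely, by the number of its terms times
    the largest coefficient; all decay comes from the Jackson factor contained in
    \<open>F\<close>.\<close>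
  have main: "cmod L' \<le> K * (2 * pi) ^ (2 * m) * I"
    if "((\<lambda>v. F v * (\<Sum>l=-int M..int M. b l * cis (of_int l * (\<theta> - v)))) has_integral 2 * pi * L') {-pi..pi}"
      and b: "\<And>l. \<bar>l\<bar> \<le> int M \<Longrightarrow> cmod (b l) \<le> K'" and K: "K = (2 * M + 1) * K'" and K': "K' \<ge> 0" for b and L' :: complex and K K' :: real
  proof -
    have B: "cmod (\<Sum>l=-int M..int M. b l * cis (of_int l * (\<theta> - v))) \<le> K" for v
    proof -
      have "cmod (\<Sum>l=-int M..int M. b l * cis (of_int l * (\<theta> - v))) \<le> (\<Sum>l=-int M..int M. K')"
        by (rule sum_norm_le) (auto simp: norm_mult intro!: b)
      also have "\<dots> = K" by (simp add: K algebra_simps)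
      finally show ?thesis .
    qed
    have "cmod (2 * pi * L') \<le> integral {-pi..pi} (\<lambda>v. K * (2 * pi) ^ (2 * m) * g \<bar>v\<bar>)"
    proof (rule norm_integral_le_integral[OF that(1)])
      show "(\<lambda>v. K * (2 * pi) ^ (2 * m) * g \<bar>v\<bar>) integrable_on {-pi..pi}"
        by (intro integrable_on_mult_right integral_even_abs(2) g) auto
      show "cmod (F v * (\<Sum>l=-int M..int M. b l * cis (of_int l * (\<theta> - v)))) \<le> K * (2 * pi) ^ (2 * m) * g \<bar>v\<bar>"
        if "v \<in> {-pi..pi}" for v
      proof -
        have "cmod (F v) * cmod (\<Sum>l=-int M..int M. b l * cis (of_int l * (\<theta> - v)))
            \<le> ((2 * pi) ^ (2 * m) * g \<bar>v\<bar>) * K"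
          by (rule mult_mono[OF Fg[OF that] B[of v]]) (auto simp: g_def)
        then show ?thesis unfolding norm_mult by (simp only: mult_ac)
      qed
    qed
    also have "\<dots> = K * (2 * pi) ^ (2 * m) * (2 * I)"
      using integral_even_abs(1)[OF g pi_ge_zero] by (simp only: integral_mult_right) (simp add: I_def g_def[abs_def])
    finally have "2 * pi * cmod L' \<le> 2 * (K * (2 * pi) ^ (2 * m) * I)"
      by (simp add: norm_mult)
    moreover have "2 * cmod L' \<le> 2 * pi * cmod L'"
      using mult_right_mono[of 2 "2 * pi" "cmod L'"] pi_ge_two by simp
    ultimately show ?thesis by simp
  qed
  have n1: "real n \<ge> 1" using n by simp
  have L1: "((\<lambda>v. F v * (\<Sum>l=-int M..int M. 1 * cis (of_int l * (\<theta> - v)))) has_integral 2 * pi * F \<theta>) {-pi..pi}"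
    by (rule trig_poly_reproduce[OF F, where L = "\<lambda>F. F \<theta>" and b = "\<lambda>_. 1"]) auto
  define Y where "Y = (2 * pi) ^ (2 * m) * I"
  have Y: "Y \<ge> 0" using I0 by (simp add: Y_def)
  have MC: "2 * real M + 1 \<le> (4 * real m + 3) * real n"
    using n1 by (simp add: M algebra_simps)
  have "cmod (F \<theta>) \<le> (2 * real M + 1) * 1 * (2 * pi) ^ (2 * m) * I"
    by (rule main[OF L1]) auto
  also have "\<dots> = (2 * real M + 1) * Y" by (simp add: Y_def)
  also have "\<dots> \<le> (4 * real m + 3) * real n * Y"
    by (rule mult_right_mono[OF MC Y])
  \<comment> \<open>One factor would do for the value; the second is inserted so that value and
    derivative share the constant \<open>C\<close>.\<close>
  also have "\<dots> \<le> (4 * real m + 3) * ((4 * real m + 3) * real n * Y)"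
    using Y mult_right_mono[of 1 "4 * real m + 3" "(4 * real m + 3) * real n * Y"] by simp
  also have "\<dots> = C * n * I" unfolding C_def Y_def power2_eq_square by (simp only: mult_ac)
  also have "cmod (F \<theta>) = \<bar>poly P (cos \<theta>)\<bar>" using n by (simp add: F_def jackson_0)
  finally show "\<bar>poly P (cos \<theta>)\<bar> \<le> C * n * I" .
  define L where "L F = vector_derivative F (at \<theta>)" for F :: "real \<Rightarrow> complex"
  have L2: "((\<lambda>v. F v * (\<Sum>l=-int M..int M. (\<i> * l) * cis (of_int l * (\<theta> - v)))) has_integral 2 * pi * L F) {-pi..pi}"
  proof (rule trig_poly_reproduce[OF F, where L = L and b = "\<lambda>l. \<i> * of_int l"])
    show "L (\<lambda>v. F v + G v) = L F + L G" if "trig_poly M F" "trig_poly M G" for F G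
      unfolding L_def
      using that by (intro vector_derivative_add_at trig_poly_differentiable)
    show "L (\<lambda>v. c * cis (of_int j * v)) = c * (\<i> * of_int j) * cis (of_int j * \<theta>)" for c j
      unfolding L_def
      using vector_derivative_at[OF has_vector_derivative_mult_right[OF cis_has_vector_derivative, of c "of_int j" \<theta>]]
      by (simp add: mult.assoc)
  qed
  have "cmod (L F) \<le> (2 * real M + 1) * M * (2 * pi) ^ (2 * m) * I"
  proof (rule main[OF L2])
    show "cmod (\<i> * of_int l) \<le> real M" if "\<bar>l\<bar> \<le> int M" for l
      using that by (simp add: norm_mult)
  qed auto
  also have "\<dots> = (2 * real M + 1) * M * Y" by (simp add: Y_def)
  also have "\<dots> \<le> ((4 * real m + 3) * real n) * ((4 * real m + 3) * real n) * Y"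
    using MC Y by (intro mult_right_mono mult_mono MC) auto
  also have "\<dots> = C * n\<^sup>2 * I" unfolding C_def Y_def power2_eq_square by (simp only: of_nat_mult mult_ac)
  also have "cmod (L F) = \<bar>sin \<theta> * poly (pderiv P) (cos \<theta>)\<bar>"
  proof -
    \<comment> \<open>Value 1 and derivative 0 of the multiplier at \<open>\<theta>\<close>: the
      product rule then returns the derivative of \<open>poly P (cos v)\<close> alone.\<close>
    have j: "((\<lambda>v. jackson n m (v - \<theta>)) has_real_derivative 0) (at \<theta>)"
    proof -
      have "((\<lambda>v. jackson n m (v - \<theta>)) has_real_derivative 0 * 1) (at \<theta>)"
        by (rule DERIV_chain2[where g = "\<lambda>v. v - \<theta>"])
           (use jackson_deriv_0[OF n(1), of m] in \<open>auto intro!: derivative_eq_intros\<close>)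
      then show ?thesis by simp
    qed
    have "((\<lambda>v. poly P (cos v) * jackson n m (v - \<theta>)) has_real_derivative
        - sin \<theta> * poly (pderiv P) (cos \<theta>)) (at \<theta>)"
      using DERIV_mult[OF DERIV_chain2[OF poly_DERIV DERIV_cos] j, of P] n by (simp add: jackson_0 mult.commute)
    then have "(F has_vector_derivative complex_of_real (- sin \<theta> * poly (pderiv P) (cos \<theta>))) (at \<theta>)"
      unfolding F_def has_real_derivative_iff_has_vector_derivative
      by (rule bounded_linear.has_vector_derivative[OF bounded_linear_of_real])
    then have "L F = complex_of_real (- sin \<theta> * poly (pderiv P) (cos \<theta>))"
      unfolding L_def by (rule vector_derivative_at)
    then show ?thesis by (simp add: norm_mult abs_mult)
  qed
  finally show "\<bar>sin \<theta> * poly (pderiv P) (cos \<theta>)\<bar> \<le> C * n\<^sup>2 * I" .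
qed

subsection \<open>Norm bounds\<close>

text \<open>The graph of the convex power lies above its tangent at 1 (Bernoulli's inequality).
  Jensen's inequality and the triangle inequality below both come from it, by choosing the point of
  tangency.\<close>

lemma powr_tangent:
  fixes x q :: real
  assumes "0 \<le> x" "1 \<le> q"
  shows "q * x \<le> x powr q + (q - 1)"
proof (cases "x = 0")
  case True
  then show ?thesis using assms by simp
next
  case False
  have "((\<lambda>x. x powr q) has_real_derivative q * 1 powr (q - 1)) (at 1 within {0<..})"
    by (auto intro!: derivative_eq_intros)
  from convex_on_imp_above_tangent[OF powr_convex[OF assms(2)] _ _ _ this, of x] False assms
  show ?thesis by (simp add: connected_Ioi interior_open algebra_simps)
qed

lemma powr_tangent_scaled:
  fixes x m q :: real
  assumes "0 \<le> x" "0 < m" "1 \<le> q"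
  shows "q * m powr (q - 1) * x \<le> x powr q + (q - 1) * m powr q"
proof -
  have "m powr q * (q * (x / m)) \<le> m powr q * ((x / m) powr q + (q - 1))"
    using assms by (intro mult_left_mono powr_tangent) auto
  then show ?thesis using assms
    by (simp add: powr_divide powr_diff algebra_simps)
qed

text \<open>Jensen's inequality for a kernel whose mass is merely bounded by \<open>A\<close>: the
  tangent inequality at the mean \<open>S / A\<close> is integrated against \<open>\<kappa>\<close>.
  \<open>S\<close> is only a real lower bound of the integral, so an infinite integral is covered as
  well.\<close>

lemma jensen_powr_nn_integral:
  fixes f \<kappa> :: "'a \<Rightarrow> real"
  assumes [measurable]: "f \<in> borel_measurable M" "\<kappa> \<in> borel_measurable M"
    and f: "\<And>x. 0 \<le> f x" and \<kappa>: "\<And>x. 0 \<le> \<kappa> x"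
    and A: "(\<integral>\<^sup>+x. \<kappa> x \<partial>M) \<le> ennreal A" "0 \<le> A" and q: "1 \<le> q"
    and S: "0 \<le> S" "ennreal S \<le> (\<integral>\<^sup>+x. \<kappa> x * f x \<partial>M)"
  shows "ennreal (S powr q) \<le> ennreal (A powr (q - 1)) * (\<integral>\<^sup>+x. \<kappa> x * f x powr q \<partial>M)"
proof (cases "S = 0 \<or> A = 0")
  case True
  have "S = 0"
  proof (rule ccontr)
    assume "S \<noteq> 0"
    with True A have "(\<integral>\<^sup>+x. \<kappa> x \<partial>M) = 0" by simp
    then have "AE x in M. ennreal (\<kappa> x) = 0" by (simp add: nn_integral_0_iff_AE)
    then have "(\<integral>\<^sup>+x. \<kappa> x * f x \<partial>M) = 0"
      by (subst nn_integral_0_iff_AE) (auto simp: \<kappa> elim!: eventually_mono)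
    with S \<open>S \<noteq> 0\<close> show False by simp
  qed
  then show ?thesis by simp
next
  case False
  then have SA: "S > 0" "A > 0" using S A by auto
  \<comment> \<open>At this point of tangency \<open>m powr (q - 1) * S\<close> equals
    \<open>m powr q * A\<close>, so the terms with coefficient \<open>q\<close> and
    \<open>q - 1\<close> leave exactly one copy.\<close>
  define m where "m = S / A"
  have m: "m > 0" using SA by (simp add: m_def)
  let ?X = "\<integral>\<^sup>+x. \<kappa> x * f x powr q \<partial>M"
  have "ennreal (q * m powr (q - 1) * S) \<le> ennreal (q * m powr (q - 1)) * (\<integral>\<^sup>+x. \<kappa> x * f x \<partial>M)"
    using S q m by (subst ennreal_mult) (auto intro!: mult_left_mono)
  also have "\<dots> = (\<integral>\<^sup>+x. ennreal (q * m powr (q - 1)) * ennreal (\<kappa> x * f x) \<partial>M)"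
    by (intro nn_integral_cmult[symmetric]) auto
  also have "\<dots> \<le> (\<integral>\<^sup>+x. ennreal (\<kappa> x * f x powr q) + ennreal ((q - 1) * m powr q) * ennreal (\<kappa> x) \<partial>M)"
  proof (intro nn_integral_mono)
    fix x
    have "q * m powr (q - 1) * (\<kappa> x * f x) \<le> \<kappa> x * f x powr q + (q - 1) * m powr q * \<kappa> x"
      using mult_left_mono[OF powr_tangent_scaled[OF f[of x] m q] \<kappa>[of x]] by (simp add: algebra_simps)
    then show "ennreal (q * m powr (q - 1)) * ennreal (\<kappa> x * f x)
        \<le> ennreal (\<kappa> x * f x powr q) + ennreal ((q - 1) * m powr q) * ennreal (\<kappa> x)"
      using q \<kappa> f by (simp add: ennreal_mult[symmetric] ennreal_plus[symmetric] del: ennreal_plus)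
  qed
  also have "\<dots> = ?X + ennreal ((q - 1) * m powr q) * (\<integral>\<^sup>+x. \<kappa> x \<partial>M)"
    by (subst nn_integral_add) (auto simp: nn_integral_cmult)
  also have "\<dots> \<le> ?X + ennreal ((q - 1) * m powr q) * ennreal A"
    by (intro add_left_mono mult_left_mono A) auto
  finally have le: "ennreal (q * m powr (q - 1) * S) \<le> ?X + ennreal ((q - 1) * m powr q * A)"
    using q A by (simp add: ennreal_mult)
  have mS: "m powr (q - 1) * S = m powr q * A"
    using m SA by (simp add: m_def powr_diff field_simps)
  show ?thesis
  proof (cases ?X)
    case top
    have "ennreal (A powr (q - 1)) \<noteq> 0" using SA by simp
    with top show ?thesis by (simp add: ennreal_mult_top)
  next
    case (real X)
    have "ennreal (q * m powr (q - 1) * S) \<le> ennreal (X + (q - 1) * m powr q * A)"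
      using le real q SA by (simp add: ennreal_plus[symmetric] del: ennreal_plus)
    then have "q * (m powr q * A) \<le> X + (q - 1) * m powr q * A"
      using real q SA mS by (subst (asm) ennreal_le_iff) (auto simp: mult.assoc)
    then have "m powr q * A \<le> X" by (simp add: algebra_simps)
    then have "A powr (q - 1) * (m powr q * A) \<le> A powr (q - 1) * X"
      by (intro mult_left_mono) auto
    moreover have "A powr (q - 1) * (m powr q * A) = S powr q"
      using SA by (simp add: m_def powr_divide powr_diff field_simps)
    ultimately show ?thesis using real by (simp add: ennreal_mult[symmetric])
  qed
qed

section \<open>Calculus of real bounds on L_p norms\<close>

lemma nn_integral_lebesgue_on:
  fixes S :: "real set"
  assumes "S \<in> sets borel"
  shows "(\<integral>\<^sup>+x. F x \<partial>lebesgue_on S) = (\<integral>\<^sup>+x. F x * indicator S x \<partial>lborel)"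
  using assms by (subst nn_integral_restrict_space) (auto simp: nn_integral_completion)

lemma AE_lebesgue_on:
  fixes S :: "real set"
  assumes "S \<in> sets borel"
  shows "(AE x in lebesgue_on S. P x) \<longleftrightarrow> (AE x in lborel. x \<in> S \<longrightarrow> P x)"
  using assms by (subst AE_restrict_space_iff) (auto simp: AE_completion_iff)

text \<open>Expresses that the L_p norm is at most the real number \<open>K\<close>. For finite
  \<open>p\<close> it compares p-th powers, so that neither roots nor infinite values have to be
  handled; as in \<open>Lp_norm\<close>, measurability is part of the condition.\<close>

definition Lp_le :: "ennreal \<Rightarrow> (real \<Rightarrow> real) \<Rightarrow> real \<Rightarrow> bool" where
  "Lp_le p g K \<longleftrightarrow> 0 \<le> K \<and> g \<in> borel_measurable (lebesgue_on {-1..1}) \<and>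
     (if p = \<infinity> then AE x in lebesgue_on {-1..1}. \<bar>g x\<bar> \<le> K
      else (\<integral>\<^sup>+x. ennreal (\<bar>g x\<bar> powr enn2real p) \<partial>lebesgue_on {-1..1}) \<le> ennreal (K powr enn2real p))"

lemma enn2real_ge_1: "1 \<le> p \<Longrightarrow> p \<noteq> \<infinity> \<Longrightarrow> 1 \<le> enn2real p"
  by (cases p) auto

lemma Lp_norm_le_iff:
  assumes p: "1 \<le> p" and K: "0 \<le> K"
  shows "Lp_norm p g \<le> ennreal K \<longleftrightarrow> Lp_le p g K"
proof (cases "g \<in> borel_measurable (lebesgue_on {-1..1})")
  case False
  then show ?thesis by (simp add: Lp_norm_def Lp_le_def top_unique)
next
  case g: True
  show ?thesis
  proof (cases "p = \<infinity>")
    case True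
    have m: "(\<lambda>x. ennreal \<bar>g x\<bar>) \<in> borel_measurable (lebesgue_on {-1..1})" using g by simp
    have "esssup (lebesgue_on {-1..1}) (\<lambda>x. ennreal \<bar>g x\<bar>) \<le> ennreal K \<longleftrightarrow>
        (AE x in lebesgue_on {-1..1}. ennreal \<bar>g x\<bar> \<le> ennreal K)"
      using esssup_AE[of "\<lambda>x. ennreal \<bar>g x\<bar>" "lebesgue_on {-1..1}"] esssup_I[OF m, of "ennreal K"]
      by (auto elim!: eventually_mono intro: order_trans)
    then show ?thesis using True g K by (simp add: Lp_norm_def Lp_le_def)
  next
    case False
    define q where "q = enn2real p"
    have q: "q \<ge> 1" using enn2real_ge_1[OF p False] by (simp add: q_def)
    define I where "I = (\<integral>\<^sup>+x. ennreal (\<bar>g x\<bar> powr q) \<partial>lebesgue_on {-1..1})"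
    have "Lp_norm p g = (if I = \<infinity> then \<infinity> else ennreal (enn2real I powr (1 / q)))"
      using g False by (simp add: Lp_norm_def I_def q_def Let_def)
    moreover have "Lp_le p g K \<longleftrightarrow> I \<le> ennreal (K powr q)"
      using g False K by (simp add: Lp_le_def I_def q_def)
    moreover have "(if I = \<infinity> then \<infinity> else ennreal (enn2real I powr (1 / q))) \<le> ennreal K \<longleftrightarrow> I \<le> ennreal (K powr q)"
    proof (cases I)
      case top
      then show ?thesis by (simp add: top_unique)
    next
      case (real i)
      have "i powr (1 / q) \<le> K \<longleftrightarrow> i \<le> K powr q"
      proof
        assume "i powr (1 / q) \<le> K"
        then have "(i powr (1 / q)) powr q \<le> K powr q" using q by (intro powr_mono2) auto
        then show "i \<le> K powr q" using q real by (simp add: powr_powr)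
      next
        assume "i \<le> K powr q"
        then have "i powr (1 / q) \<le> (K powr q) powr (1 / q)" using q real by (intro powr_mono2) auto
        then show "i powr (1 / q) \<le> K" using q K by (simp add: powr_powr)
      qed
      then show ?thesis using real K by simp
    qed
    ultimately show ?thesis by simp
  qed
qed

lemma Lp_leD:
  assumes "Lp_le p g K"
  shows Lp_le_nonneg: "0 \<le> K" and Lp_le_measurable: "g \<in> borel_measurable (lebesgue_on {-1..1})"
  using assms by (auto simp: Lp_le_def)

lemma Lp_le_mono:
  assumes f: "Lp_le p f K" and p: "1 \<le> p" and g: "g \<in> borel_measurable (lebesgue_on {-1..1})"
    and le: "AE x in lebesgue_on {-1..1}. \<bar>g x\<bar> \<le> \<bar>f x\<bar>" and K: "K \<le> K'"
  shows "Lp_le p g K'"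
proof (cases "p = \<infinity>")
  case True
  have "AE x in lebesgue_on {-1..1}. \<bar>f x\<bar> \<le> K" using f True by (simp add: Lp_le_def)
  with le have "AE x in lebesgue_on {-1..1}. \<bar>g x\<bar> \<le> K'" by eventually_elim (use K in linarith)
  then show ?thesis using True f g K by (simp add: Lp_le_def)
next
  case False
  have q: "enn2real p \<ge> 1" using enn2real_ge_1[OF p False] .
  have "(\<integral>\<^sup>+x. ennreal (\<bar>g x\<bar> powr enn2real p) \<partial>lebesgue_on {-1..1})
      \<le> (\<integral>\<^sup>+x. ennreal (\<bar>f x\<bar> powr enn2real p) \<partial>lebesgue_on {-1..1})"
    by (rule nn_integral_mono_AE) (use le q in \<open>auto elim!: eventually_mono intro!: powr_mono2\<close>)
  also have "\<dots> \<le> ennreal (K powr enn2real p)" using f False by (simp add: Lp_le_def)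
  also have "\<dots> \<le> ennreal (K' powr enn2real p)"
    using K q Lp_leD[OF f] by (intro ennreal_leI powr_mono2) auto
  finally show ?thesis using False f g K by (simp add: Lp_le_def)
qed

lemma Lp_le_cmult:
  assumes f: "Lp_le p f K" and p: "1 \<le> p"
  shows "Lp_le p (\<lambda>x. c * f x) (\<bar>c\<bar> * K)"
proof (cases "p = \<infinity>")
  case True
  then show ?thesis using f
    by (auto simp: Lp_le_def abs_mult elim!: eventually_mono intro!: mult_left_mono)
next
  case False
  note [measurable] = Lp_leD(2)[OF f]
  let ?q = "enn2real p"
  have "(\<integral>\<^sup>+x. ennreal (\<bar>c * f x\<bar> powr ?q) \<partial>lebesgue_on {-1..1})
      = (\<integral>\<^sup>+x. ennreal (\<bar>c\<bar> powr ?q) * ennreal (\<bar>f x\<bar> powr ?q) \<partial>lebesgue_on {-1..1})"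
    by (simp add: abs_mult powr_mult ennreal_mult[symmetric])
  also have "\<dots> = ennreal (\<bar>c\<bar> powr ?q) * (\<integral>\<^sup>+x. ennreal (\<bar>f x\<bar> powr ?q) \<partial>lebesgue_on {-1..1})"
    by (rule nn_integral_cmult) auto
  also have "\<dots> \<le> ennreal (\<bar>c\<bar> powr ?q) * ennreal (K powr ?q)"
    using f False by (intro mult_left_mono) (auto simp: Lp_le_def)
  also have "\<dots> = ennreal ((\<bar>c\<bar> * K) powr ?q)"
    using Lp_leD[OF f] by (simp add: powr_mult ennreal_mult[symmetric])
  finally show ?thesis using False f by (auto simp: Lp_le_def)
qed

text \<open>Convexity: (a + b) / (K + L) is the mean of a / K and b / L with weights
  \<open>K\<close> and \<open>L\<close>. It is obtained by adding the two tangent inequalities at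
  this mean. Integrated with \<open>K\<close> and \<open>L\<close> as norm bounds, it gives
  Minkowski's inequality.\<close>

lemma powr_add_le_weighted:
  fixes a b q :: real
  assumes "0 \<le> a" "0 \<le> b" "0 < K" "0 < L" "1 \<le> q"
  shows "(a + b) powr q \<le> (K + L) powr (q - 1) * (K powr (1 - q) * a powr q + L powr (1 - q) * b powr q)"
proof (cases "a + b = 0")
  case True
  then show ?thesis using assms by (simp add: add_nonneg_eq_0_iff)
next
  case False
  define m where "m = (a + b) / (K + L)"
  have m: "m > 0" using assms False by (simp add: m_def add_nonneg_eq_0_iff add_pos_pos divide_pos_pos less_le)
  have 1: "q * m powr (q - 1) * (a / K) \<le> a powr q / K powr q + (q - 1) * m powr q"
    using powr_tangent_scaled[of "a / K" m q] assms m by (simp add: powr_divide)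
  have 2: "q * m powr (q - 1) * (b / L) \<le> b powr q / L powr q + (q - 1) * m powr q"
    using powr_tangent_scaled[of "b / L" m q] assms m by (simp add: powr_divide)
  have "K * (q * m powr (q - 1) * (a / K)) + L * (q * m powr (q - 1) * (b / L))
     \<le> K * (a powr q / K powr q + (q - 1) * m powr q) + L * (b powr q / L powr q + (q - 1) * m powr q)"
    using assms by (intro add_mono mult_left_mono 1 2) auto
  moreover have "K * (q * m powr (q - 1) * (a / K)) = q * m powr (q - 1) * a"
    "L * (q * m powr (q - 1) * (b / L)) = q * m powr (q - 1) * b" using assms by simp_all
  moreover have "K * (a powr q / K powr q + Z) = K powr (1 - q) * a powr q + K * Z"
    "L * (b powr q / L powr q + Z) = L powr (1 - q) * b powr q + L * Z" for Z
    using assms by (simp_all add: powr_diff field_simps)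
  ultimately have 3: "q * m powr (q - 1) * (a + b) \<le> K powr (1 - q) * a powr q + L powr (1 - q) * b powr q + (q - 1) * (m powr q * (K + L))"
    by (simp add: algebra_simps)
  have "m powr (q - 1) * (a + b) = m powr q * (K + L)"
    using m assms by (simp add: m_def powr_diff field_simps)
  then have "q * m powr (q - 1) * (a + b) = q * (m powr q * (K + L))" by (simp only: mult.assoc)
  with 3 have "q * (m powr q * (K + L)) \<le> K powr (1 - q) * a powr q + L powr (1 - q) * b powr q + (q - 1) * (m powr q * (K + L))"
    by (simp only:)
  then have "m powr q * (K + L) \<le> K powr (1 - q) * a powr q + L powr (1 - q) * b powr q"
    unfolding left_diff_distrib by linarith
  then have "(K + L) powr (q - 1) * (m powr q * (K + L)) \<le> (K + L) powr (q - 1) * (K powr (1 - q) * a powr q + L powr (1 - q) * b powr q)"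
    by (intro mult_left_mono) auto
  moreover have "(K + L) powr (q - 1) * (m powr q * (K + L)) = (a + b) powr q"
    using assms by (simp add: m_def powr_divide powr_diff)
  ultimately show ?thesis by simp
qed

lemma Lp_le_add_pos:
  assumes f: "Lp_le p f K" and g: "Lp_le p g L" and p: "1 \<le> p" and pos: "0 < K" "0 < L"
  shows "Lp_le p (\<lambda>x. f x + g x) (K + L)"
proof (cases "p = \<infinity>")
  case True
  have "AE x in lebesgue_on {-1..1}. \<bar>f x\<bar> \<le> K" "AE x in lebesgue_on {-1..1}. \<bar>g x\<bar> \<le> L"
    using f g True by (auto simp: Lp_le_def)
  then have "AE x in lebesgue_on {-1..1}. \<bar>f x + g x\<bar> \<le> K + L"
    by eventually_elim linarith
  then show ?thesis using True f g by (auto simp: Lp_le_def)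
next
  case False
  note [measurable] = Lp_leD(2)[OF f] Lp_leD(2)[OF g]
  define q where "q = enn2real p"
  have q: "q \<ge> 1" using enn2real_ge_1[OF p False] by (simp add: q_def)
  have If: "(\<integral>\<^sup>+x. ennreal (\<bar>f x\<bar> powr q) \<partial>lebesgue_on {-1..1}) \<le> ennreal (K powr q)"
    using f False by (simp add: Lp_le_def q_def)
  have Ig: "(\<integral>\<^sup>+x. ennreal (\<bar>g x\<bar> powr q) \<partial>lebesgue_on {-1..1}) \<le> ennreal (L powr q)"
    using g False by (simp add: Lp_le_def q_def)
  have "(\<integral>\<^sup>+x. ennreal (\<bar>f x + g x\<bar> powr q) \<partial>lebesgue_on {-1..1})
    \<le> (\<integral>\<^sup>+x. ennreal ((K + L) powr (q - 1)) * (ennreal (K powr (1 - q)) * ennreal (\<bar>f x\<bar> powr q)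
         + ennreal (L powr (1 - q)) * ennreal (\<bar>g x\<bar> powr q)) \<partial>lebesgue_on {-1..1})"
  proof (intro nn_integral_mono)
    fix x
    have "\<bar>f x + g x\<bar> powr q \<le> (\<bar>f x\<bar> + \<bar>g x\<bar>) powr q" using q by (intro powr_mono2) auto
    also have "\<dots> \<le> (K + L) powr (q - 1) * (K powr (1 - q) * \<bar>f x\<bar> powr q + L powr (1 - q) * \<bar>g x\<bar> powr q)"
      using q pos by (intro powr_add_le_weighted) auto
    finally show "ennreal (\<bar>f x + g x\<bar> powr q) \<le> ennreal ((K + L) powr (q - 1)) * (ennreal (K powr (1 - q)) * ennreal (\<bar>f x\<bar> powr q)
         + ennreal (L powr (1 - q)) * ennreal (\<bar>g x\<bar> powr q))"
      by (simp add: ennreal_mult[symmetric] ennreal_plus[symmetric] del: ennreal_plus)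
  qed
  also have "\<dots> = ennreal ((K + L) powr (q - 1)) * (ennreal (K powr (1 - q)) * (\<integral>\<^sup>+x. ennreal (\<bar>f x\<bar> powr q) \<partial>lebesgue_on {-1..1})
         + ennreal (L powr (1 - q)) * (\<integral>\<^sup>+x. ennreal (\<bar>g x\<bar> powr q) \<partial>lebesgue_on {-1..1}))"
    by (simp add: nn_integral_cmult nn_integral_add)
  also have "\<dots> \<le> ennreal ((K + L) powr (q - 1)) * (ennreal (K powr (1 - q)) * ennreal (K powr q)
         + ennreal (L powr (1 - q)) * ennreal (L powr q))"
    by (intro mult_left_mono add_mono If Ig) auto
  also have "ennreal (K powr (1 - q)) * ennreal (K powr q) = ennreal K"
    using pos by (simp add: ennreal_mult[symmetric] powr_add[symmetric])
  also have "ennreal (L powr (1 - q)) * ennreal (L powr q) = ennreal L"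
    using pos by (simp add: ennreal_mult[symmetric] powr_add[symmetric])
  also have "ennreal ((K + L) powr (q - 1)) * (ennreal K + ennreal L) = ennreal ((K + L) powr q)"
    using pos by (simp add: ennreal_mult[symmetric] ennreal_plus[symmetric] powr_diff del: ennreal_plus)
  finally show ?thesis using False f g by (auto simp: Lp_le_def q_def)
qed

text \<open>Removes the positivity required by the weighted convexity inequality, and later turns
  approximate identities into exact ones.\<close>

lemma Lp_le_epsilon:
  assumes p: "1 \<le> p" and K: "0 \<le> K" and f: "\<And>\<epsilon>. 0 < \<epsilon> \<Longrightarrow> Lp_le p f (K + \<epsilon>)"
  shows "Lp_le p f K"
proof -
  have "Lp_norm p f \<le> ennreal K + ennreal e" if "0 < e" for e
    using f[OF that] Lp_norm_le_iff[OF p, of "K + e" f] that K by simp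
  then have "Lp_norm p f \<le> ennreal K" by (rule ennreal_le_epsilon)
  then show ?thesis using Lp_norm_le_iff[OF p K] by simp
qed

lemma Lp_le_add:
  assumes f: "Lp_le p f K" and g: "Lp_le p g L" and p: "1 \<le> p"
  shows "Lp_le p (\<lambda>x. f x + g x) (K + L)"
proof (rule Lp_le_epsilon[OF p])
  fix e :: real assume e: "0 < e"
  have "Lp_le p (\<lambda>x. f x + g x) ((K + e / 2) + (L + e / 2))"
  proof (rule Lp_le_add_pos[OF _ _ p])
    show "Lp_le p f (K + e / 2)"
      using e by (intro Lp_le_mono[OF f p Lp_leD(2)[OF f]]) auto
    show "Lp_le p g (L + e / 2)"
      using e by (intro Lp_le_mono[OF g p Lp_leD(2)[OF g]]) auto
  qed (use e Lp_leD(1)[OF f] Lp_leD(1)[OF g] in auto)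
  then show "Lp_le p (\<lambda>x. f x + g x) (K + L + e)" by (simp add: algebra_simps)
qed (use Lp_leD(1)[OF f] Lp_leD(1)[OF g] in auto)

lemma Lp_le_diff:
  assumes f: "Lp_le p f K" and g: "Lp_le p g L" and p: "1 \<le> p"
  shows "Lp_le p (\<lambda>x. f x - g x) (K + L)"
  using Lp_le_add[OF f Lp_le_cmult[OF g p, of "-1"] p] by simp

lemma Lp_le_zero: "1 \<le> p \<Longrightarrow> Lp_le p (\<lambda>_. 0) 0"
  using enn2real_ge_1[of p] by (auto simp: Lp_le_def)

lemma Lp_le_sum:
  assumes p: "1 \<le> p" and "\<And>i. i \<in> I \<Longrightarrow> Lp_le p (F i) (K i)"
  shows "Lp_le p (\<lambda>x. \<Sum>i\<in>I. F i x) (\<Sum>i\<in>I. K i)"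
  using assms(2)
  by (induction I rule: infinite_finite_induct) (auto intro: Lp_le_zero[OF p] Lp_le_add[OF _ _ p])

text \<open>Fatou's lemma for finite \<open>p\<close>; for infinite \<open>p\<close> the exceptional
  null sets of the countably many functions are united.\<close>

lemma Lp_le_tendsto:
  assumes p: "1 \<le> p" and F: "\<And>n. Lp_le p (F n) K"
    and g: "g \<in> borel_measurable (lebesgue_on {-1..1})"
    and lim: "AE x in lebesgue_on {-1..1}. (\<lambda>n. F n x) \<longlonglongrightarrow> g x"
  shows "Lp_le p g K"
proof (cases "p = \<infinity>")
  case True
  have "AE x in lebesgue_on {-1..1}. \<forall>n. \<bar>F n x\<bar> \<le> K"
    using F True by (auto simp: Lp_le_def AE_all_countable)
  with lim have "AE x in lebesgue_on {-1..1}. \<bar>g x\<bar> \<le> K"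
  proof eventually_elim
    case (elim x)
    then show ?case by (intro tendsto_upperbound[OF tendsto_rabs[of "\<lambda>n. F n x"]]) auto
  qed
  then show ?thesis using True g Lp_leD[OF F] by (auto simp: Lp_le_def)
next
  case False
  note [measurable] = Lp_leD(2)[OF F]
  define q where "q = enn2real p"
  have q: "q \<ge> 1" using enn2real_ge_1[OF p False] by (simp add: q_def)
  have "(\<integral>\<^sup>+x. ennreal (\<bar>g x\<bar> powr q) \<partial>lebesgue_on {-1..1})
      \<le> (\<integral>\<^sup>+x. liminf (\<lambda>n. ennreal (\<bar>F n x\<bar> powr q)) \<partial>lebesgue_on {-1..1})"
  proof (rule nn_integral_mono_AE)
    show "AE x in lebesgue_on {-1..1}. ennreal (\<bar>g x\<bar> powr q) \<le> liminf (\<lambda>n. ennreal (\<bar>F n x\<bar> powr q))"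
      using lim
    proof eventually_elim
      case (elim x)
      have "(\<lambda>n. ennreal (\<bar>F n x\<bar> powr q)) \<longlonglongrightarrow> ennreal (\<bar>g x\<bar> powr q)"
        using q by (intro tendsto_ennrealI tendsto_powr2 tendsto_rabs elim) auto
      from lim_imp_Liminf[OF _ this] show ?case by simp
    qed
  qed
  also have "\<dots> \<le> liminf (\<lambda>n. \<integral>\<^sup>+x. ennreal (\<bar>F n x\<bar> powr q) \<partial>lebesgue_on {-1..1})"
    by (rule nn_integral_liminf) auto
  also have "\<dots> \<le> liminf (\<lambda>n::nat. ennreal (K powr q))"
    using F False by (intro Liminf_mono) (auto simp: Lp_le_def q_def)
  also have "\<dots> = ennreal (K powr q)" by (simp add: Liminf_const)
  finally show ?thesis using False g Lp_leD(1)[OF F] by (auto simp: Lp_le_def q_def)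
qed

text \<open>Jensen's inequality with the constant kernel 1 of mass 2. The resulting factor 2^(1 -
  1/p) is rounded up to 2. Real numbers \<open>S\<close> below the integral are used because its
  finiteness is part of the claim.\<close>

lemma Lp_le_L1:
  assumes f: "Lp_le p f K" and p: "1 \<le> p"
  shows "(\<integral>\<^sup>+x. ennreal \<bar>f x\<bar> \<partial>lebesgue_on {-1..1}) \<le> ennreal (2 * K)"
proof (cases "p = \<infinity>")
  case True
  have "(\<integral>\<^sup>+x. ennreal \<bar>f x\<bar> \<partial>lebesgue_on {-1..1}) \<le> (\<integral>\<^sup>+x. ennreal K \<partial>lebesgue_on {-1..1::real})"
  proof (rule nn_integral_mono_AE)
    have "AE x in lebesgue_on {-1..1}. \<bar>f x\<bar> \<le> K" using f True by (simp add: Lp_le_def)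
    then show "AE x in lebesgue_on {-1..1}. ennreal \<bar>f x\<bar> \<le> ennreal K"
      by eventually_elim (rule ennreal_leI)
  qed
  also have "\<dots> = ennreal (2 * K)"
    using Lp_leD(1)[OF f] by (simp add: emeasure_restrict_space ennreal_mult[symmetric] mult.commute flip: ennreal_numeral)
  finally show ?thesis .
next
  case False
  note [measurable] = Lp_leD(2)[OF f]
  define q where "q = enn2real p"
  have q: "q \<ge> 1" using enn2real_ge_1[OF p False] by (simp add: q_def)
  have K: "0 \<le> K" by (rule Lp_leD(1)[OF f])
  have If: "(\<integral>\<^sup>+x. ennreal (\<bar>f x\<bar> powr q) \<partial>lebesgue_on {-1..1}) \<le> ennreal (K powr q)"
    using f False by (simp add: Lp_le_def q_def)
  have S: "S \<le> 2 * K" if "0 \<le> S" "ennreal S \<le> (\<integral>\<^sup>+x. ennreal \<bar>f x\<bar> \<partial>lebesgue_on {-1..1})" for S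
  proof -
    have "ennreal (S powr q) \<le> ennreal (2 powr (q - 1)) * (\<integral>\<^sup>+x. ennreal (1 * \<bar>f x\<bar> powr q) \<partial>lebesgue_on {-1..1})"
      using that q by (intro jensen_powr_nn_integral) (auto simp: emeasure_restrict_space simp flip: ennreal_numeral)
    also have "\<dots> \<le> ennreal (2 powr (q - 1)) * ennreal (K powr q)"
      using If by (intro mult_left_mono) auto
    also have "\<dots> \<le> ennreal (2 powr q) * ennreal (K powr q)"
      by (intro mult_right_mono ennreal_leI powr_mono) auto
    also have "\<dots> = ennreal ((2 * K) powr q)" using K by (simp add: powr_mult ennreal_mult[symmetric])
    finally have "S powr q \<le> (2 * K) powr q" by simp
    then show ?thesis using q that K by (metis powr_less_mono2 less_le_trans linorder_not_le zero_less_one mult_nonneg_nonneg zero_le_numeral)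
  qed
  show ?thesis
  proof (rule ccontr)
    assume "\<not> ?thesis"
    then have "ennreal (2 * K) < (\<integral>\<^sup>+x. ennreal \<bar>f x\<bar> \<partial>lebesgue_on {-1..1})" by simp
    then obtain z where z: "ennreal (2 * K) < z" "z < (\<integral>\<^sup>+x. ennreal \<bar>f x\<bar> \<partial>lebesgue_on {-1..1})"
      using dense by blast
    then have "z \<noteq> top" by auto
    then have "ennreal (enn2real z) = z" by (simp add: less_top)
    with S[of "enn2real z"] z have "enn2real z \<le> 2 * K" by simp
    then have "z \<le> ennreal (2 * K)" using \<open>ennreal (enn2real z) = z\<close> by (metis ennreal_leI)
    with z show False by simp
  qed
qed

text \<open>Minkowski's integral inequality: an average of functions has norm at most the mass of
  the kernel times a common norm bound. For finite \<open>p\<close> this is Jensen's inequality in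
  \<open>s\<close> followed by Fubini's theorem in \<open>x\<close> and \<open>s\<close>.\<close>

lemma Lp_le_average:
  fixes H :: "real \<Rightarrow> real \<Rightarrow> real" and \<kappa> :: "real \<Rightarrow> real"
  assumes p: "1 \<le> p"
    and H[measurable]: "case_prod H \<in> borel_measurable (lborel \<Otimes>\<^sub>M lborel)" and \<kappa>[measurable]: "\<kappa> \<in> borel_measurable lborel"
    and H0: "\<And>x s. 0 \<le> H x s" and \<kappa>0: "\<And>s. 0 \<le> \<kappa> s"
    and A: "(\<integral>\<^sup>+s. \<kappa> s \<partial>lborel) \<le> ennreal A" "0 \<le> A"
    and K: "0 \<le> K" "\<And>s. \<kappa> s \<noteq> 0 \<Longrightarrow> Lp_le p (\<lambda>x. H x s) K"
    and g[measurable]: "g \<in> borel_measurable (lebesgue_on {-1..1})"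
    and le: "AE x in lebesgue_on {-1..1}. ennreal \<bar>g x\<bar> \<le> (\<integral>\<^sup>+s. \<kappa> s * H x s \<partial>lborel)"
  shows "Lp_le p g (A * K)"
proof (cases "p = \<infinity>")
  case True
  have [measurable]: "(\<lambda>z. H (fst z) (snd z)) \<in> borel_measurable (lborel \<Otimes>\<^sub>M lborel)"
    using H by (simp add: case_prod_beta')
  let ?P = "\<lambda>x s. x \<in> {-1..1::real} \<longrightarrow> \<kappa> s \<noteq> 0 \<longrightarrow> H x s \<le> K"
  have ms: "{z \<in> space (lborel \<Otimes>\<^sub>M lborel). ?P (fst z) (snd z)} \<in> sets (lborel \<Otimes>\<^sub>M lborel)"
    by measurable
  have "AE s in lborel. AE x in lborel. ?P x s"
  proof (rule AE_I2)
    fix s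
    show "AE x in lborel. ?P x s"
      using K(2)[of s] True by (cases "\<kappa> s = 0") (auto simp: Lp_le_def AE_lebesgue_on elim!: eventually_mono)
  qed
  \<comment> \<open>For each \<open>s\<close> the essential bound fails on a null set of
    \<open>x\<close> depending on \<open>s\<close>; Fubini's theorem for null sets exchanges the two
    quantifiers, so that the integral over \<open>s\<close> can be estimated at almost every
    \<open>x\<close>.\<close>
  then have 2: "AE x in lborel. AE s in lborel. ?P x s"
    by (rule iffD2[OF lborel_pair.AE_commute[of ?P, OF ms]])
  have pt: "\<bar>g x\<bar> \<le> A * K"
    if x: "x \<in> {-1..1}" and 1: "ennreal \<bar>g x\<bar> \<le> (\<integral>\<^sup>+s. \<kappa> s * H x s \<partial>lborel)" and 2: "AE s in lborel. ?P x s" for x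
  proof -
    note 1
    also have "(\<integral>\<^sup>+s. \<kappa> s * H x s \<partial>lborel) \<le> (\<integral>\<^sup>+s. ennreal K * \<kappa> s \<partial>lborel)"
    proof (rule nn_integral_mono_AE)
      show "AE s in lborel. ennreal (\<kappa> s * H x s) \<le> ennreal K * ennreal (\<kappa> s)"
        using 2
      proof eventually_elim
        case (elim s)
        have "\<kappa> s * H x s \<le> \<kappa> s * K"
          using elim x \<kappa>0[of s] by (cases "\<kappa> s = 0") (auto intro!: mult_left_mono)
        then show ?case using K(1) \<kappa>0[of s] by (simp add: ennreal_mult[symmetric] mult.commute)
      qed
    qed
    also have "\<dots> = ennreal K * (\<integral>\<^sup>+s. \<kappa> s \<partial>lborel)" by (rule nn_integral_cmult) auto
    also have "\<dots> \<le> ennreal K * ennreal A" by (intro mult_left_mono A) auto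
    also have "\<dots> = ennreal (A * K)" using A K by (simp add: ennreal_mult[symmetric] mult.commute)
    finally show "\<bar>g x\<bar> \<le> A * K" using A K by simp
  qed
  have "AE x in lborel. x \<in> {-1..1} \<longrightarrow> ennreal \<bar>g x\<bar> \<le> (\<integral>\<^sup>+s. \<kappa> s * H x s \<partial>lborel)"
    using le by (simp add: AE_lebesgue_on)
  from AE_conjI[OF this 2] have "AE x in lborel. x \<in> {-1..1} \<longrightarrow> \<bar>g x\<bar> \<le> A * K"
    by (rule AE_mp) (rule AE_I2, use pt in blast)
  then show ?thesis using True A K g by (auto simp: Lp_le_def AE_lebesgue_on)
next
  case False
  define q where "q = enn2real p"
  have q: "q \<ge> 1" using enn2real_ge_1[OF p False] by (simp add: q_def)
  have [measurable]: "(\<lambda>s. H x s) \<in> borel_measurable lborel" for x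
    using measurable_compose[OF measurable_Pair1' H, of x] by simp
  have "(\<integral>\<^sup>+x. ennreal (\<bar>g x\<bar> powr q) \<partial>lebesgue_on {-1..1})
      \<le> (\<integral>\<^sup>+x. ennreal (A powr (q - 1)) * (\<integral>\<^sup>+s. \<kappa> s * H x s powr q \<partial>lborel) \<partial>lebesgue_on {-1..1})"
  proof (rule nn_integral_mono_AE)
    show "AE x in lebesgue_on {-1..1}. ennreal (\<bar>g x\<bar> powr q) \<le> ennreal (A powr (q - 1)) * (\<integral>\<^sup>+s. \<kappa> s * H x s powr q \<partial>lborel)"
      using le by eventually_elim (rule jensen_powr_nn_integral; (simp add: A q H0 \<kappa>0)?; measurable?)
  qed
  also have "\<dots> = ennreal (A powr (q - 1)) * (\<integral>\<^sup>+x. (\<integral>\<^sup>+s. \<kappa> s * H x s powr q \<partial>lborel) * indicator {-1..1} x \<partial>lborel)"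
    unfolding nn_integral_lebesgue_on[OF borel_closed[OF closed_atLeastAtMost]]
    by (subst nn_integral_cmult[symmetric]) (auto simp: mult.assoc)
  also have "(\<integral>\<^sup>+x. (\<integral>\<^sup>+s. \<kappa> s * H x s powr q \<partial>lborel) * indicator {-1..1} x \<partial>lborel)
     = (\<integral>\<^sup>+x. (\<integral>\<^sup>+s. ennreal (\<kappa> s * H x s powr q) * indicator {-1..1} x \<partial>lborel) \<partial>lborel)"
    by (simp add: nn_integral_multc)
  also have "\<dots> = (\<integral>\<^sup>+s. (\<integral>\<^sup>+x. ennreal (\<kappa> s * H x s powr q) * indicator {-1..1} x \<partial>lborel) \<partial>lborel)"
    by (rule lborel_pair.Fubini'[symmetric]) measurable
  also have "\<dots> \<le> (\<integral>\<^sup>+s. ennreal (K powr q) * \<kappa> s \<partial>lborel)"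
  proof (intro nn_integral_mono)
    fix s
    show "(\<integral>\<^sup>+x. ennreal (\<kappa> s * H x s powr q) * indicator {-1..1} x \<partial>lborel) \<le> ennreal (K powr q) * ennreal (\<kappa> s)"
    proof (cases "\<kappa> s = 0")
      case nz: False
      have [measurable]: "(\<lambda>x. H x s) \<in> borel_measurable lborel"
        using measurable_compose[OF measurable_Pair2' H, of s] by simp
      have "(\<integral>\<^sup>+x. ennreal (\<kappa> s * H x s powr q) * indicator {-1..1} x \<partial>lborel)
         = ennreal (\<kappa> s) * (\<integral>\<^sup>+x. ennreal (H x s powr q) * indicator {-1..1} x \<partial>lborel)"
        by (subst nn_integral_cmult[symmetric]) (auto simp: ennreal_mult \<kappa>0 mult.assoc)
      also have "\<dots> \<le> ennreal (\<kappa> s) * ennreal (K powr q)"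
        using K(2)[OF nz] False H0 by (intro mult_left_mono) (auto simp: Lp_le_def q_def nn_integral_lebesgue_on)
      finally show ?thesis by (simp add: mult.commute)
    qed simp
  qed
  also have "\<dots> = ennreal (K powr q) * (\<integral>\<^sup>+s. \<kappa> s \<partial>lborel)" by (rule nn_integral_cmult) auto
  also have "\<dots> \<le> ennreal (K powr q) * ennreal A" by (intro mult_left_mono A) auto
  finally have "(\<integral>\<^sup>+x. ennreal (\<bar>g x\<bar> powr q) \<partial>lebesgue_on {-1..1}) \<le> ennreal (A powr (q - 1)) * (ennreal (K powr q) * ennreal A)"
    by (simp add: mult_left_mono)
  also have "\<dots> = ennreal ((A * K) powr q)"
    using A K by (cases "A = 0") (auto simp: ennreal_mult[symmetric] powr_mult powr_diff)
  finally show ?thesis using False g A K by (auto simp: Lp_le_def q_def)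
qed

subsection \<open>Regularized weights\<close>

text \<open>For \<open>d = 0\<close> this models a Jacobi weight at \<open>cos \<theta>\<close>,
  since 1 - cos \<theta> and 1 + cos \<theta> are comparable to the squares of \<theta> and pi -
  \<theta>. With \<open>d = 1 / n\<close> it is the regularization, bounded and positive up to the
  end points.\<close>

definition edge_weight :: "real \<Rightarrow> real \<Rightarrow> real \<Rightarrow> real \<Rightarrow> real" where
  "edge_weight a b d \<theta> = (\<theta> + d) powr a * (pi - \<theta> + d) powr b"

lemma edge_weight_nonneg: "0 \<le> edge_weight a b d \<theta>"
  by (simp add: edge_weight_def)

lemma borel_measurable_edge_weight [measurable]: "edge_weight a b d \<in> borel_measurable borel"
  unfolding edge_weight_def[abs_def] by measurable

text \<open>Exponents of either sign are covered: nonnegative ones use \<open>x \<le> r * y\<close>,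
  negative ones \<open>y \<le> r * x\<close>.\<close>

lemma powr_le_powr_ratio:
  fixes x y r a :: real
  assumes "0 < x" "0 < y" "x \<le> r * y" "y \<le> r * x"
  shows "x powr a \<le> r powr \<bar>a\<bar> * y powr a"
proof -
  have r: "r > 0" using assms by (smt (verit) mult_nonpos_nonneg)
  show ?thesis
  proof (cases "a \<ge> 0")
    case True
    then show ?thesis using assms powr_mono2[OF True _ assms(3)] r by (simp add: powr_mult)
  next
    case False
    then have "x powr a \<le> (y / r) powr a"
      using assms r by (intro powr_mono2') (auto simp: field_simps)
    also have "\<dots> = r powr \<bar>a\<bar> * y powr a"
      using False assms r by (simp add: powr_divide powr_minus field_simps)
    finally show ?thesis .
  qed
qed

text \<open>Both regularized distances are at least \<open>d\<close>, so a displacement by |v -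
  \<theta>| changes each by a factor of at most 1 + |v - \<theta>| / d. This slow variation is what
  fails for \<open>d = 0\<close>.\<close>

lemma edge_weight_le:
  assumes "0 < d" "\<theta> \<in> {0..pi}" "v \<in> {0..pi}"
  shows "edge_weight a b d \<theta> \<le> edge_weight a b d v * (1 + \<bar>v - \<theta>\<bar> / d) powr (\<bar>a\<bar> + \<bar>b\<bar>)"
proof -
  let ?r = "1 + \<bar>v - \<theta>\<bar> / d"
  have *: "x + d \<le> ?r * (y + d)" if "\<bar>x - y\<bar> = \<bar>v - \<theta>\<bar>" "0 \<le> y" for x y
  proof -
    have "x + d \<le> y + d + \<bar>x - y\<bar>" by linarith
    also have "\<dots> \<le> (y + d) + \<bar>v - \<theta>\<bar> / d * (y + d)"
      using that assms by (simp add: field_simps)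
    finally show ?thesis by (simp add: algebra_simps)
  qed
  have 1: "(\<theta> + d) powr a \<le> ?r powr \<bar>a\<bar> * (v + d) powr a"
    using assms by (intro powr_le_powr_ratio *) auto
  have 2: "(pi - \<theta> + d) powr b \<le> ?r powr \<bar>b\<bar> * (pi - v + d) powr b"
    using assms by (intro powr_le_powr_ratio *) auto
  have "edge_weight a b d \<theta> \<le> (?r powr \<bar>a\<bar> * (v + d) powr a) * (?r powr \<bar>b\<bar> * (pi - v + d) powr b)"
    unfolding edge_weight_def by (intro mult_mono 1 2) auto
  then show ?thesis by (simp add: edge_weight_def powr_add mult_ac)
qed

text \<open>The shape of the bound for the Jackson kernel; the factor \<open>n\<close> makes its
  mass bounded independently of \<open>n\<close> as soon as \<open>l\<close> is at least 2.\<close>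

definition decay_kernel :: "nat \<Rightarrow> nat \<Rightarrow> real \<Rightarrow> real" where
  "decay_kernel l n u = n / (1 + n * \<bar>u\<bar>) ^ l"

lemma decay_kernel_nonneg: "0 \<le> decay_kernel l n u"
  by (simp add: decay_kernel_def)

lemma borel_measurable_decay_kernel [measurable]: "decay_kernel l n \<in> borel_measurable borel"
  unfolding decay_kernel_def[abs_def] by measurable

lemma decay_kernel_minus: "decay_kernel l n (v - \<theta>) = decay_kernel l n (\<theta> - v)"
  by (simp add: decay_kernel_def abs_minus_commute)

lemma decay_kernel_le: "decay_kernel l n u \<le> n"
  by (simp add: decay_kernel_def divide_le_eq mult_left_le_one_le one_le_power add_pos_nonneg mult_left_mono[of 1 _ "real n", simplified])

text \<open>Moving the regularized weight from \<open>\<theta>\<close> to \<open>v\<close> consumes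
  |a| + |b| powers of the decay; two powers are kept for integrability.\<close>

lemma decay_kernel_edge_weight:
  assumes "n \<ge> 1" "\<theta> \<in> {0..pi}" "v \<in> {0..pi}" "\<bar>a\<bar> + \<bar>b\<bar> + 2 \<le> real l"
  shows "decay_kernel l n (v - \<theta>) * edge_weight a b (1 / n) \<theta> \<le> edge_weight a b (1 / n) v * decay_kernel 2 n (v - \<theta>)"
proof -
  define r where "r = 1 + n * \<bar>v - \<theta>\<bar>"
  have r: "r \<ge> 1" by (simp add: r_def)
  have "decay_kernel l n (v - \<theta>) * edge_weight a b (1 / n) \<theta>
      \<le> decay_kernel l n (v - \<theta>) * (edge_weight a b (1 / n) v * r powr (\<bar>a\<bar> + \<bar>b\<bar>))"
    using edge_weight_le[of "1 / n" \<theta> v a b] assms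
    by (intro mult_left_mono decay_kernel_nonneg) (auto simp: r_def mult.commute)
  also have "\<dots> = edge_weight a b (1 / n) v * (n * (r powr (\<bar>a\<bar> + \<bar>b\<bar>) / r powr real l))"
    using r by (simp add: decay_kernel_def r_def[symmetric] powr_realpow)
  also have "\<dots> \<le> edge_weight a b (1 / n) v * (n * (1 / r powr 2))"
  proof (intro mult_left_mono edge_weight_nonneg)
    have "r powr (\<bar>a\<bar> + \<bar>b\<bar>) * r powr 2 \<le> r powr real l"
      unfolding powr_add[symmetric] using r assms by (intro powr_mono) auto
    then show "r powr (\<bar>a\<bar> + \<bar>b\<bar>) / r powr real l \<le> 1 / r powr 2"
      using r by (simp add: divide_simps)
  qed auto
  also have "\<dots> = edge_weight a b (1 / n) v * decay_kernel 2 n (v - \<theta>)"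
    using r by (simp add: decay_kernel_def r_def[symmetric])
  finally show ?thesis .
qed

lemma nn_integral_has_integral_on:
  fixes f :: "real \<Rightarrow> real"
  assumes [measurable]: "f \<in> borel_measurable borel" "S \<in> sets borel" and "\<And>x. 0 \<le> f x" "(f has_integral I) S"
  shows "(\<integral>\<^sup>+x. ennreal (f x) * indicator S x \<partial>lborel) = ennreal I"
proof -
  have "(\<integral>\<^sup>+x. ennreal (if x \<in> S then f x else 0) \<partial>lborel) = ennreal I"
    using assms by (intro nn_integral_has_integral_lborel) (auto simp: has_integral_restrict_UNIV)
  moreover have "ennreal (if x \<in> S then f x else 0) = ennreal (f x) * indicator S x" for x by simp
  ultimately show ?thesis by simp
qed

text \<open>On each side of \<open>\<theta>\<close> the kernel has the antiderivative 1 / (1 + n |v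
  - \<theta>|) up to sign, so each side contributes at most 1.\<close>

lemma nn_integral_decay_kernel_2:
  assumes n: "n \<ge> 1" and \<theta>: "\<theta> \<in> {0..pi}"
  shows "(\<integral>\<^sup>+v. ennreal (decay_kernel 2 n (v - \<theta>)) * indicator {0..pi} v \<partial>lborel) \<le> ennreal 2"
proof -
  have nz: "1 + n * x > 0" if "x \<ge> 0" for x :: real using that n by (simp add: add_pos_nonneg)
  have 1: "((\<lambda>v. decay_kernel 2 n (v - \<theta>)) has_integral (1 - 1 / (1 + n * \<theta>))) {0..\<theta>}"
  proof -
    have "((\<lambda>v. decay_kernel 2 n (v - \<theta>)) has_integral (1 / (1 + n * (\<theta> - \<theta>)) - 1 / (1 + n * (\<theta> - 0)))) {0..\<theta>}"
    proof (rule fundamental_theorem_of_calculus)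
      fix v assume v: "v \<in> {0..\<theta>}"
      have "1 + n * (\<theta> - v) > 0" using v by (intro nz) auto
      then have "((\<lambda>v. 1 / (1 + n * (\<theta> - v))) has_real_derivative n / (1 + n * (\<theta> - v))\<^sup>2) (at v within {0..\<theta>})"
        by (auto intro!: derivative_eq_intros simp: power2_eq_square)
      then show "((\<lambda>v. 1 / (1 + n * (\<theta> - v))) has_vector_derivative decay_kernel 2 n (v - \<theta>)) (at v within {0..\<theta>})"
        using v by (simp add: decay_kernel_def has_real_derivative_iff_has_vector_derivative)
    qed (use \<theta> in auto)
    then show ?thesis by simp
  qed
  have 2: "((\<lambda>v. decay_kernel 2 n (v - \<theta>)) has_integral (1 - 1 / (1 + n * (pi - \<theta>)))) {\<theta>..pi}"
  proof -
    have "((\<lambda>v. decay_kernel 2 n (v - \<theta>)) has_integral (- 1 / (1 + n * (pi - \<theta>)) - (- 1 / (1 + n * (\<theta> - \<theta>))))) {\<theta>..pi}"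
    proof (rule fundamental_theorem_of_calculus)
      fix v assume v: "v \<in> {\<theta>..pi}"
      have "1 + n * (v - \<theta>) > 0" using v by (intro nz) auto
      then have "((\<lambda>v. - 1 / (1 + n * (v - \<theta>))) has_real_derivative n / (1 + n * (v - \<theta>))\<^sup>2) (at v within {\<theta>..pi})"
        by (auto intro!: derivative_eq_intros simp: power2_eq_square)
      then show "((\<lambda>v. - 1 / (1 + n * (v - \<theta>))) has_vector_derivative decay_kernel 2 n (v - \<theta>)) (at v within {\<theta>..pi})"
        using v by (simp add: decay_kernel_def has_real_derivative_iff_has_vector_derivative)
    qed (use \<theta> in auto)
    then show ?thesis by simp
  qed
  have "((\<lambda>v. decay_kernel 2 n (v - \<theta>)) has_integral (1 - 1 / (1 + n * \<theta>)) + (1 - 1 / (1 + n * (pi - \<theta>)))) {0..pi}"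
    using \<theta> by (intro has_integral_combine[OF _ _ 1 2]) auto
  from nn_integral_has_integral_on[OF _ _ _ this]
  have "(\<integral>\<^sup>+v. ennreal (decay_kernel 2 n (v - \<theta>)) * indicator {0..pi} v \<partial>lborel)
      = ennreal ((1 - 1 / (1 + n * \<theta>)) + (1 - 1 / (1 + n * (pi - \<theta>))))"
    by (simp add: decay_kernel_nonneg)
  also have "\<dots> \<le> ennreal 2"
  proof (rule ennreal_leI)
    have "0 \<le> 1 / (1 + n * \<theta>)" "0 \<le> 1 / (1 + n * (pi - \<theta>))"
      using nz[of \<theta>] nz[of "pi - \<theta>"] \<theta> by auto
    then show "(1 - 1 / (1 + n * \<theta>)) + (1 - 1 / (1 + n * (pi - \<theta>))) \<le> 2" by linarith
  qed
  finally show ?thesis .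
qed

text \<open>Removing the shift by \<open>d\<close> costs a bounded factor if the exponent is
  nonnegative, and otherwise also the singular factor (x / d)^a. The expression
  \<open>max 0 (- a)\<close> treats both signs at once, and -1 < a keeps the singularity
  integrable.\<close>

lemma powr_ratio_le:
  fixes x d a :: real
  assumes x: "0 < x" "0 < d" and a: "-1 < a"
  shows "x powr a \<le> (x + d) powr a * (2 * (1 + (x / d) powr (- max 0 (- a))))"
proof (cases "a \<ge> 0")
  case True
  have "x powr a \<le> (x + d) powr a * 1" using x True by (simp add: powr_mono2)
  also have "\<dots> \<le> (x + d) powr a * (2 * (1 + (x / d) powr (- max 0 (- a))))"
    by (intro mult_left_mono) (auto simp: add_increasing2)
  finally show ?thesis .
next
  case False
  define s where "s = - a"
  have s: "0 < s" "s < 1" using a False by (auto simp: s_def)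
  have "(1 + d / x) powr s \<le> (2 * max 1 (d / x)) powr s" using s x by (intro powr_mono2) auto
  also have "\<dots> = 2 powr s * max 1 (d / x) powr s" using x by (subst powr_mult) auto
  also have "\<dots> \<le> 2 powr 1 * (1 + (d / x) powr s)"
    using s by (intro mult_mono powr_mono) (auto simp: max_def)
  also have "(d / x) powr s = (x / d) powr (- s)"
    using x by (simp add: powr_minus powr_divide field_simps)
  finally have le: "(1 + d / x) powr s \<le> 2 * (1 + (x / d) powr (- s))" by simp
  have "x powr a = (x + d) powr a * (1 + d / x) powr s"
  proof -
    have "(1 + d / x) = (x + d) / x" using x by (simp add: field_simps)
    then show ?thesis using x by (simp add: s_def powr_divide powr_minus field_simps)
  qed
  also have "\<dots> \<le> (x + d) powr a * (2 * (1 + (x / d) powr (- s)))"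
    by (intro mult_left_mono le) auto
  finally show ?thesis using s by (simp add: s_def max_def)
qed

text \<open>The two end points each contribute a factor of the form 1 + X. Their product is bounded
  by a sum, because at any point at most one of the two can be large; sums can then be integrated
  separately.\<close>

lemma edge_weight_0_le:
  assumes \<theta>: "0 < \<theta>" "\<theta> < pi" and d: "0 < d" "d \<le> 1" and ab: "-1 < a" "-1 < b"
  shows "edge_weight a b 0 \<theta> \<le> edge_weight a b d \<theta> *
     (8 * (1 + (\<theta> / d) powr (- max 0 (- a)) + ((pi - \<theta>) / d) powr (- max 0 (- b))))"
proof -
  define X where "X = (\<theta> / d) powr (- max 0 (- a))"
  define Y where "Y = ((pi - \<theta>) / d) powr (- max 0 (- b))"
  have XY: "X \<ge> 0" "Y \<ge> 0" by (auto simp: X_def Y_def)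
  have le1: "(x / d) powr (- s) \<le> 1" if "1 \<le> x" "0 \<le> s" for x s
    using powr_mono2'[of "- s" 1 "x / d"] that d by (auto simp: field_simps)
  \<comment> \<open>One of the distances \<open>\<theta>\<close> and \<open>pi - \<theta>\<close> is
    at least pi / 2, hence at least 1 and at least \<open>d\<close>.\<close>
  have "X \<le> 1 \<or> Y \<le> 1"
  proof (cases "\<theta> \<ge> pi / 2")
    case True
    then have "X \<le> 1" unfolding X_def using pi_ge_two by (intro le1) auto
    then show ?thesis ..
  next
    case False
    then have "Y \<le> 1" unfolding Y_def using pi_ge_two by (intro le1) auto
    then show ?thesis ..
  qed
  then have "(1 + X) * (1 + Y) \<le> 2 * (1 + X + Y)"
    using XY mult_right_mono[of X 1 Y] mult_left_mono[of Y 1 X] by (auto simp: algebra_simps)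
  then have 2: "(2 * (1 + X)) * (2 * (1 + Y)) \<le> 8 * (1 + X + Y)" by (simp add: algebra_simps)
  have "\<theta> powr a \<le> (\<theta> + d) powr a * (2 * (1 + X))"
    "(pi - \<theta>) powr b \<le> (pi - \<theta> + d) powr b * (2 * (1 + Y))"
    unfolding X_def Y_def using \<theta> d ab by (auto intro!: powr_ratio_le simp del: distrib_left_numeral)
  then have "edge_weight a b 0 \<theta> \<le> ((\<theta> + d) powr a * (2 * (1 + X))) * ((pi - \<theta> + d) powr b * (2 * (1 + Y)))"
    unfolding edge_weight_def using XY by (simp only: add_0_right) (intro mult_mono; simp)
  also have "\<dots> = edge_weight a b d \<theta> * ((2 * (1 + X)) * (2 * (1 + Y)))"
    by (simp add: edge_weight_def mult_ac)
  also have "\<dots> \<le> edge_weight a b d \<theta> * (8 * (1 + X + Y))"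
    by (intro mult_left_mono 2 edge_weight_nonneg)
  finally show ?thesis by (simp add: X_def Y_def)
qed

text \<open>The prefactor 1 / d makes the integral independent of \<open>d\<close>, hence of the
  degree when \<open>d = 1 / n\<close>.\<close>

lemma nn_integral_scaled_powr:
  assumes "0 < d" "0 \<le> s" "s < 1"
  shows "(\<integral>\<^sup>+\<theta>. ennreal (1 / d * (\<theta> / d) powr (- s)) * indicator {0..d} \<theta> \<partial>lborel) = ennreal (1 / (1 - s))"
proof -
  have "((\<lambda>\<theta>. 1 / d * d powr s * \<theta> powr (- s)) has_integral (1 / d * d powr s * (d powr (- s + 1) / (- s + 1)))) {0..d}"
    using assms by (intro has_integral_mult_right has_integral_powr_from_0) auto
  then have "((\<lambda>\<theta>. 1 / d * (\<theta> / d) powr (- s)) has_integral 1 / (1 - s)) {0..d}"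
  proof (rule has_integral_eq_rhs[OF has_integral_eq, rotated])
    show "1 / (1 - s) = 1 / d * d powr s * (d powr (- s + 1) / (- s + 1))"
      using assms by (simp add: powr_diff field_simps)
    show "1 / d * d powr s * \<theta> powr (- s) = 1 / d * (\<theta> / d) powr (- s)" if "\<theta> \<in> {0..d}" for \<theta>
      using assms that by (simp add: powr_divide powr_minus field_simps)
  qed
  from nn_integral_has_integral_on[OF _ _ _ this] assms
  show ?thesis by simp
qed


text \<open>First half of the comparison of the weights: averaging the true weight with the kernel
  gives at most the regularized weight. Away from the end points the two weights are comparable;
  near them the kernel is at most \<open>n\<close> and the integrable singularity, scaled to length
  1 / n, contributes a constant. In \<open>C\<close> the 6 collects the kernel mass 2 three times
  and the fractions are the integrals of the singularities.\<close>

lemma nn_integral_kernel_edge_weight_0: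
  fixes a b :: real
  assumes n: "n \<ge> 1" and v: "v \<in> {0..pi}" and ab: "-1 < a" "-1 < b" and l: "\<bar>a\<bar> + \<bar>b\<bar> + 2 \<le> real l"
  defines "C \<equiv> 8 * (6 + 1 / (1 - max 0 (- a)) + 1 / (1 - max 0 (- b)))"
  shows "(\<integral>\<^sup>+\<theta>. ennreal (decay_kernel l n (v - \<theta>) * edge_weight a b 0 \<theta>) * indicator {0..pi} \<theta> \<partial>lborel)
    \<le> ennreal C * ennreal (edge_weight a b (1 / n) v)"
proof -
  define s t where "s = max 0 (- a)" and "t = max 0 (- b)"
  have st: "0 \<le> s" "s < 1" "0 \<le> t" "t < 1" using ab by (auto simp: s_def t_def)
  define d where "d = 1 / real n"
  have d: "0 < d" "d \<le> 1" using n by (auto simp: d_def)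
  define X where "X \<theta> = ennreal (1 / d * (\<theta> / d) powr (- s)) * indicator {0..d} \<theta>" for \<theta>
  define Y where "Y \<theta> = ennreal (1 / d * ((pi - \<theta>) / d) powr (- t)) * indicator {0..d} (pi - \<theta>)" for \<theta>
  have [measurable]: "X \<in> borel_measurable borel" "Y \<in> borel_measurable borel"
    unfolding X_def[abs_def] Y_def[abs_def] by measurable
  let ?k = "\<lambda>\<theta>. decay_kernel 2 n (v - \<theta>)"
  \<comment> \<open>Within distance \<open>d\<close> of the end point the kernel is replaced by its
    maximum 1 / d; farther away the singular factor is at most 1.\<close>
  have sing: "ennreal (?k \<theta> * (x / d) powr (- r)) \<le> ennreal (?k \<theta>) + ennreal (1 / d * (x / d) powr (- r)) * indicator {0..d} x"
    if "0 < x" "0 \<le> r" for x r \<theta>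
  proof (cases "x \<le> d")
    case True
    have "?k \<theta> * (x / d) powr (- r) \<le> 1 / d * (x / d) powr (- r)"
      using decay_kernel_le[of 2 n] by (intro mult_right_mono) (auto simp: d_def)
    then show ?thesis using True that by (auto intro!: add_increasing ennreal_leI)
  next
    case False
    then have "(x / d) powr (- r) \<le> 1" using that d powr_mono2'[of "- r" 1 "x / d"] by (simp add: field_simps)
    then have "?k \<theta> * (x / d) powr (- r) \<le> ?k \<theta>"
      using mult_left_mono[of _ 1 "?k \<theta>"] decay_kernel_nonneg by simp
    then show ?thesis by (auto intro!: add_increasing2 ennreal_leI)
  qed
  have pt: "ennreal (decay_kernel l n (v - \<theta>) * edge_weight a b 0 \<theta>) * indicator {0..pi} \<theta>
      \<le> ennreal (8 * edge_weight a b d v) * (3 * (ennreal (?k \<theta>) * indicator {0..pi} \<theta>) + X \<theta> + Y \<theta>)"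
    if "\<theta> \<noteq> 0" "\<theta> \<noteq> pi" for \<theta>
  proof (cases "\<theta> \<in> {0..pi}")
    case True
    then have \<theta>: "0 < \<theta>" "\<theta> < pi" using that by auto
    let ?x = "(\<theta> / d) powr (- s)" and ?y = "((pi - \<theta>) / d) powr (- t)"
    have "decay_kernel l n (v - \<theta>) * edge_weight a b 0 \<theta>
      \<le> decay_kernel l n (v - \<theta>) * (edge_weight a b d \<theta> * (8 * (1 + ?x + ?y)))"
      using edge_weight_0_le[OF \<theta> d ab] by (intro mult_left_mono decay_kernel_nonneg) (simp add: s_def t_def)
    also have "\<dots> = decay_kernel l n (v - \<theta>) * edge_weight a b d \<theta> * (8 * (1 + ?x + ?y))" by (simp only: mult.assoc)
    also have "\<dots> \<le> edge_weight a b d v * ?k \<theta> * (8 * (1 + ?x + ?y))"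
      using decay_kernel_edge_weight[OF n True v l] by (intro mult_right_mono) (auto simp: d_def)
    also have "\<dots> = (8 * edge_weight a b d v) * (?k \<theta> + ?k \<theta> * ?x + ?k \<theta> * ?y)"
      by (simp add: algebra_simps)
    finally have "ennreal (decay_kernel l n (v - \<theta>) * edge_weight a b 0 \<theta>)
       \<le> ennreal ((8 * edge_weight a b d v) * (?k \<theta> + ?k \<theta> * ?x + ?k \<theta> * ?y))" by (rule ennreal_leI)
    also have "\<dots> = ennreal (8 * edge_weight a b d v) * (ennreal (?k \<theta>) + ennreal (?k \<theta> * ?x) + ennreal (?k \<theta> * ?y))"
      by (simp add: ennreal_mult ennreal_plus decay_kernel_nonneg edge_weight_nonneg)
    also have "\<dots> \<le> ennreal (8 * edge_weight a b d v) * (ennreal (?k \<theta>) + (ennreal (?k \<theta>) + X \<theta>) + (ennreal (?k \<theta>) + Y \<theta>))"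
      unfolding X_def Y_def using \<theta> st by (intro mult_left_mono add_mono sing) auto
    also have "ennreal (?k \<theta>) + (ennreal (?k \<theta>) + X \<theta>) + (ennreal (?k \<theta>) + Y \<theta>)
        = (ennreal (?k \<theta>) + (ennreal (?k \<theta>) + ennreal (?k \<theta>))) + X \<theta> + Y \<theta>"
      by (simp only: add_ac)
    also have "ennreal (?k \<theta>) + (ennreal (?k \<theta>) + ennreal (?k \<theta>)) = 3 * ennreal (?k \<theta>)"
      by (simp add: ennreal_plus[symmetric] decay_kernel_nonneg ennreal_mult[symmetric] del: ennreal_plus flip: ennreal_numeral)
    finally show ?thesis using True by simp
  qed simp
  have IX: "(\<integral>\<^sup>+\<theta>. X \<theta> \<partial>lborel) = ennreal (1 / (1 - s))"
    unfolding X_def using nn_integral_scaled_powr[OF d(1) st(1,2)] .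
  have "(\<integral>\<^sup>+\<theta>. ennreal (1 / d * (\<theta> / d) powr (- t)) * indicator {0..d} \<theta> \<partial>lborel) = (\<integral>\<^sup>+\<theta>. Y \<theta> \<partial>lborel)"
    by (subst nn_integral_real_affine[where c = "-1" and t = pi]) (auto simp: Y_def)
  then have IY: "(\<integral>\<^sup>+\<theta>. Y \<theta> \<partial>lborel) = ennreal (1 / (1 - t))"
    using nn_integral_scaled_powr[OF d(1) st(3,4)] by simp
  have "(\<integral>\<^sup>+\<theta>. ennreal (decay_kernel l n (v - \<theta>) * edge_weight a b 0 \<theta>) * indicator {0..pi} \<theta> \<partial>lborel)
     \<le> (\<integral>\<^sup>+\<theta>. ennreal (8 * edge_weight a b d v) * (3 * (ennreal (?k \<theta>) * indicator {0..pi} \<theta>) + X \<theta> + Y \<theta>) \<partial>lborel)"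
  proof (rule nn_integral_mono_AE)
    have "AE \<theta> in lborel. \<theta> \<noteq> 0" "AE \<theta> in lborel. \<theta> \<noteq> pi" by (rule AE_lborel_singleton)+
    then show "AE \<theta> in lborel. ennreal (decay_kernel l n (v - \<theta>) * edge_weight a b 0 \<theta>) * indicator {0..pi} \<theta>
      \<le> ennreal (8 * edge_weight a b d v) * (3 * (ennreal (?k \<theta>) * indicator {0..pi} \<theta>) + X \<theta> + Y \<theta>)"
      by eventually_elim (rule pt)
  qed
  also have "\<dots> = ennreal (8 * edge_weight a b d v) *
     (3 * (\<integral>\<^sup>+\<theta>. ennreal (?k \<theta>) * indicator {0..pi} \<theta> \<partial>lborel) + ennreal (1 / (1 - s)) + ennreal (1 / (1 - t)))"
    by (simp add: nn_integral_cmult nn_integral_add IX IY)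
  also have "\<dots> \<le> ennreal (8 * edge_weight a b d v) * (3 * ennreal 2 + ennreal (1 / (1 - s)) + ennreal (1 / (1 - t)))"
    using nn_integral_decay_kernel_2[OF n v] unfolding decay_kernel_minus[of 2 n _ v]
    by (intro mult_left_mono add_mono) auto
  also have "\<dots> = ennreal C * ennreal (edge_weight a b (1 / n) v)"
  proof -
    define Q where "Q = 6 + 1 / (1 - s) + 1 / (1 - t)"
    have Q: "Q \<ge> 0" using st by (simp add: Q_def)
    have "3 * ennreal 2 + ennreal (1 / (1 - s)) + ennreal (1 / (1 - t)) = ennreal Q"
      using st by (simp add: Q_def ennreal_plus[symmetric] ennreal_mult[symmetric] del: ennreal_plus flip: ennreal_numeral)
    moreover have "ennreal (8 * edge_weight a b d v) * ennreal Q = ennreal (8 * Q) * ennreal (edge_weight a b d v)"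
      using Q by (simp add: ennreal_mult[symmetric] edge_weight_nonneg mult_ac)
    ultimately show ?thesis
      by (simp only: C_def Q_def s_def t_def d_def)
  qed
  finally show ?thesis .
qed


section \<open>From pointwise kernel bounds to weighted integrals, and absorption at the end
  points\<close>

text \<open>Fubini's theorem moves the kernel from \<open>H\<close> to the weight: if
  \<open>U\<close> is dominated by kernel averages of \<open>H\<close>, and kernel averages of
  \<open>g\<close> by \<open>w\<close>, then the integral of \<open>U\<close> against
  \<open>g\<close> is dominated by that of \<open>H\<close> against \<open>w\<close>. It is used
  with the true weight as \<open>g\<close> and with the regularized weight restricted to a
  neighbourhood of the end points.\<close>

lemma nn_integral_kernel_transfer:
  fixes H U :: "real \<Rightarrow> real" and g w :: "real \<Rightarrow> ennreal"
  assumes [measurable]: "H \<in> borel_measurable borel" "U \<in> borel_measurable borel" "g \<in> borel_measurable borel" "w \<in> borel_measurable borel"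
    and H0: "\<And>v. 0 \<le> H v"
    and U: "\<And>\<theta>. \<theta> \<in> {0..pi} \<Longrightarrow> ennreal (U \<theta>) \<le> c * (\<integral>\<^sup>+v. ennreal (decay_kernel l n (v - \<theta>) * H v) * indicator {0..pi} v \<partial>lborel)"
    and g: "\<And>v. v \<in> {0..pi} \<Longrightarrow> (\<integral>\<^sup>+\<theta>. ennreal (decay_kernel l n (v - \<theta>)) * g \<theta> * indicator {0..pi} \<theta> \<partial>lborel) \<le> B * w v"
  shows "(\<integral>\<^sup>+\<theta>. ennreal (U \<theta>) * g \<theta> * indicator {0..pi} \<theta> \<partial>lborel) \<le> c * B * (\<integral>\<^sup>+v. ennreal (H v) * w v * indicator {0..pi} v \<partial>lborel)"
proof -
  let ?I = "indicator {0..pi} :: real \<Rightarrow> ennreal" and ?k = "\<lambda>v \<theta>. ennreal (decay_kernel l n (v - \<theta>))"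
  have "(\<integral>\<^sup>+\<theta>. ennreal (U \<theta>) * g \<theta> * ?I \<theta> \<partial>lborel)
     \<le> (\<integral>\<^sup>+\<theta>. c * (\<integral>\<^sup>+v. ?k v \<theta> * ennreal (H v) * ?I v * (g \<theta> * ?I \<theta>) \<partial>lborel) \<partial>lborel)"
  proof (rule nn_integral_mono)
    fix \<theta>
    show "ennreal (U \<theta>) * g \<theta> * ?I \<theta> \<le> c * (\<integral>\<^sup>+v. ?k v \<theta> * ennreal (H v) * ?I v * (g \<theta> * ?I \<theta>) \<partial>lborel)"
    proof (cases "\<theta> \<in> {0..pi}")
      case True
      have "ennreal (U \<theta>) * (g \<theta> * ?I \<theta>) \<le> c * (\<integral>\<^sup>+v. ?k v \<theta> * ennreal (H v) * ?I v \<partial>lborel) * (g \<theta> * ?I \<theta>)"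
        using U[OF True] by (intro mult_right_mono) (auto simp: ennreal_mult decay_kernel_nonneg H0)
      also have "c * (\<integral>\<^sup>+v. ?k v \<theta> * ennreal (H v) * ?I v \<partial>lborel) * (g \<theta> * ?I \<theta>)
          = c * (\<integral>\<^sup>+v. ?k v \<theta> * ennreal (H v) * ?I v * (g \<theta> * ?I \<theta>) \<partial>lborel)"
        by (subst nn_integral_multc) (auto simp: mult.assoc)
      finally show ?thesis by (simp only: mult.assoc)
    qed simp
  qed
  also have "\<dots> = c * (\<integral>\<^sup>+\<theta>. (\<integral>\<^sup>+v. ?k v \<theta> * ennreal (H v) * ?I v * (g \<theta> * ?I \<theta>) \<partial>lborel) \<partial>lborel)"
    by (rule nn_integral_cmult) measurable
  also have "(\<integral>\<^sup>+\<theta>. (\<integral>\<^sup>+v. ?k v \<theta> * ennreal (H v) * ?I v * (g \<theta> * ?I \<theta>) \<partial>lborel) \<partial>lborel)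
      = (\<integral>\<^sup>+v. (\<integral>\<^sup>+\<theta>. ?k v \<theta> * ennreal (H v) * ?I v * (g \<theta> * ?I \<theta>) \<partial>lborel) \<partial>lborel)"
    by (rule lborel_pair.Fubini'[symmetric]) measurable
  also have "\<dots> \<le> (\<integral>\<^sup>+v. B * (ennreal (H v) * w v * ?I v) \<partial>lborel)"
  proof (rule nn_integral_mono)
    fix v
    have "(\<integral>\<^sup>+\<theta>. ?k v \<theta> * ennreal (H v) * ?I v * (g \<theta> * ?I \<theta>) \<partial>lborel)
        = ennreal (H v) * ?I v * (\<integral>\<^sup>+\<theta>. ?k v \<theta> * g \<theta> * ?I \<theta> \<partial>lborel)"
      by (subst nn_integral_cmult[symmetric]) (auto simp: mult_ac)
    also have "\<dots> \<le> B * (ennreal (H v) * w v * ?I v)"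
    proof (cases "v \<in> {0..pi}")
      case True
      have "ennreal (H v) * (\<integral>\<^sup>+\<theta>. ?k v \<theta> * g \<theta> * ?I \<theta> \<partial>lborel) \<le> ennreal (H v) * (B * w v)"
        by (intro mult_left_mono g True) auto
      then show ?thesis using True by (simp add: mult_ac)
    qed simp
    finally show "(\<integral>\<^sup>+\<theta>. ?k v \<theta> * ennreal (H v) * ?I v * (g \<theta> * ?I \<theta>) \<partial>lborel) \<le> B * (ennreal (H v) * w v * ?I v)" .
  qed
  also have "\<dots> = B * (\<integral>\<^sup>+v. ennreal (H v) * w v * ?I v \<partial>lborel)"
    by (rule nn_integral_cmult) measurable
  finally show ?thesis by (simp add: mult_left_mono mult.assoc)
qed

definition near_edge :: "real \<Rightarrow> real set" where
  "near_edge r = {0..<r} \<union> {pi - r<..pi}"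

lemma near_edge_borel [measurable]: "near_edge r \<in> sets borel"
  by (simp add: near_edge_def)

lemma emeasure_near_edge: "0 \<le> r \<Longrightarrow> emeasure lborel (near_edge r) \<le> ennreal (2 * r)"
  unfolding near_edge_def
  by (rule order.trans[OF emeasure_subadditive]) (auto simp: ennreal_plus[symmetric] simp del: ennreal_plus)

text \<open>A distance of at least \<open>e * d\<close> grows by a factor of at most 1 + 1 / e when
  \<open>d\<close> is added.\<close>

lemma edge_weight_le_off_edge:
  assumes "0 < d" "0 < e" "\<theta> \<in> {0..pi}" "\<theta> \<notin> near_edge (e * d)"
  shows "edge_weight a b d \<theta> \<le> (1 + 1 / e) powr (\<bar>a\<bar> + \<bar>b\<bar>) * edge_weight a b 0 \<theta>"
proof -
  have ed: "e * d > 0" using assms by simp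
  have 1: "(x + d) powr a \<le> (1 + 1 / e) powr \<bar>a\<bar> * x powr a" if "e * d \<le> x" for x a
  proof (rule powr_le_powr_ratio)
    show "x > 0" "0 < x + d" using that ed assms by linarith+
    show "x + d \<le> (1 + 1 / e) * x" using that assms by (simp add: field_simps)
    have "(1 + 1 / e) * (x + d) \<ge> 1 * (x + d)"
      using assms \<open>0 < x + d\<close> by (intro mult_right_mono) auto
    then show "x \<le> (1 + 1 / e) * (x + d)" using assms by simp
  qed
  have "e * d \<le> \<theta>" "e * d \<le> pi - \<theta>" using assms by (auto simp: near_edge_def)
  then have "edge_weight a b d \<theta> \<le> ((1 + 1 / e) powr \<bar>a\<bar> * \<theta> powr a) * ((1 + 1 / e) powr \<bar>b\<bar> * (pi - \<theta>) powr b)"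
    unfolding edge_weight_def by (intro mult_mono 1) auto
  then show ?thesis by (simp add: edge_weight_def powr_add mult_ac)
qed

text \<open>The kernel is at most \<open>n\<close> and the set has measure at most 2 e / n, so the
  factor 2 e can be made small independently of \<open>n\<close>; this smallness drives the
  absorption.\<close>

lemma nn_integral_kernel_near_edge:
  assumes n: "n \<ge> 1" and v: "v \<in> {0..pi}" and l: "\<bar>a\<bar> + \<bar>b\<bar> + 2 \<le> real l" and e: "0 \<le> e"
  shows "(\<integral>\<^sup>+\<theta>. ennreal (decay_kernel l n (v - \<theta>)) * (ennreal (edge_weight a b (1 / n) \<theta>) * indicator (near_edge (e / n)) \<theta>) * indicator {0..pi} \<theta> \<partial>lborel)
    \<le> ennreal (2 * e) * ennreal (edge_weight a b (1 / n) v)"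
proof -
  have "(\<integral>\<^sup>+\<theta>. ennreal (decay_kernel l n (v - \<theta>)) * (ennreal (edge_weight a b (1 / n) \<theta>) * indicator (near_edge (e / n)) \<theta>) * indicator {0..pi} \<theta> \<partial>lborel)
     \<le> (\<integral>\<^sup>+\<theta>. ennreal (edge_weight a b (1 / n) v * n) * indicator (near_edge (e / n)) \<theta> \<partial>lborel)"
  proof (rule nn_integral_mono)
    fix \<theta>
    have "ennreal (decay_kernel l n (v - \<theta>)) * ennreal (edge_weight a b (1 / n) \<theta>) \<le> ennreal (edge_weight a b (1 / n) v * n)"
      if "\<theta> \<in> {0..pi}"
    proof -
      have "decay_kernel l n (v - \<theta>) * edge_weight a b (1 / n) \<theta> \<le> edge_weight a b (1 / n) v * decay_kernel 2 n (v - \<theta>)"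
        by (rule decay_kernel_edge_weight[OF n that v l])
      also have "\<dots> \<le> edge_weight a b (1 / n) v * n"
        by (intro mult_left_mono decay_kernel_le edge_weight_nonneg)
      finally show ?thesis by (simp add: ennreal_mult[symmetric] decay_kernel_nonneg edge_weight_nonneg)
    qed
    then show "ennreal (decay_kernel l n (v - \<theta>)) * (ennreal (edge_weight a b (1 / n) \<theta>) * indicator (near_edge (e / n)) \<theta>) * indicator {0..pi} \<theta>
      \<le> ennreal (edge_weight a b (1 / n) v * n) * indicator (near_edge (e / n)) \<theta>"
      by (auto split: split_indicator)
  qed
  also have "\<dots> = ennreal (edge_weight a b (1 / n) v * n) * emeasure lborel (near_edge (e / n))"
    by (rule nn_integral_cmult_indicator) simp
  also have "\<dots> \<le> ennreal (edge_weight a b (1 / n) v * n) * ennreal (2 * (e / n))"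
    using e by (intro mult_left_mono emeasure_near_edge) auto
  also have "\<dots> = ennreal (2 * e) * ennreal (edge_weight a b (1 / n) v)"
    using n e by (simp add: ennreal_mult[symmetric] edge_weight_nonneg)
  finally show ?thesis .
qed

text \<open>
  The contribution of a sufficiently small neighbourhood of the end points is absorbed into the left-hand
  side, which is why that side has to be finite.
\<close>

lemma edge_weight_regularization_L1:
  fixes H :: "real \<Rightarrow> real"
  assumes [measurable]: "H \<in> borel_measurable borel" and H0: "\<And>v. 0 \<le> H v"
    and n: "n \<ge> 1" and l: "\<bar>a\<bar> + \<bar>b\<bar> + 2 \<le> real l" and c: "0 < c"
    and H: "\<And>\<theta>. \<theta> \<in> {0..pi} \<Longrightarrow> ennreal (H \<theta>) \<le> ennreal c * (\<integral>\<^sup>+v. ennreal (decay_kernel l n (v - \<theta>) * H v) * indicator {0..pi} v \<partial>lborel)"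
    and fin: "(\<integral>\<^sup>+v. ennreal (H v) * ennreal (edge_weight a b (1 / n) v) * indicator {0..pi} v \<partial>lborel) < \<infinity>"
  shows "(\<integral>\<^sup>+v. ennreal (H v) * ennreal (edge_weight a b (1 / n) v) * indicator {0..pi} v \<partial>lborel)
    \<le> ennreal (2 * (1 + 4 * c) powr (\<bar>a\<bar> + \<bar>b\<bar>)) * (\<integral>\<^sup>+v. ennreal (H v) * ennreal (edge_weight a b 0 v) * indicator {0..pi} v \<partial>lborel)"
proof -
  \<comment> \<open>Chosen so that the part near the end points returns with the factor
    \<open>c * (2 * e) = 1 / 2\<close>. The loss 1 + 1 / e away from them is then 1 + 4 c.\<close>
  define e where "e = 1 / (4 * c)"
  have e: "e > 0" using c by (simp add: e_def)
  define h :: real where "h = 1 / 2"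
  have h: "h \<ge> 0" by (simp add: h_def)
  let ?I = "indicator {0..pi} :: real \<Rightarrow> ennreal" and ?N = "near_edge (e / n)" and ?w = "\<lambda>v. ennreal (edge_weight a b (1 / n) v)"
  let ?D = "(1 + 4 * c) powr (\<bar>a\<bar> + \<bar>b\<bar>)"
  define X where "X = (\<integral>\<^sup>+v. ennreal (H v) * ?w v * ?I v \<partial>lborel)"
  define Y where "Y = (\<integral>\<^sup>+v. ennreal (H v) * ennreal (edge_weight a b 0 v) * ?I v \<partial>lborel)"
  have "X \<le> (\<integral>\<^sup>+v. ennreal (H v) * (?w v * indicator ?N v) * ?I v + ennreal ?D * (ennreal (H v) * ennreal (edge_weight a b 0 v) * ?I v) \<partial>lborel)"
    unfolding X_def
  proof (rule nn_integral_mono)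
    fix v
    show "ennreal (H v) * ?w v * ?I v \<le> ennreal (H v) * (?w v * indicator ?N v) * ?I v + ennreal ?D * (ennreal (H v) * ennreal (edge_weight a b 0 v) * ?I v)"
    proof (cases "v \<in> {0..pi} \<and> v \<notin> ?N")
      case True
      have "edge_weight a b (1 / n) v \<le> (1 + 1 / e) powr (\<bar>a\<bar> + \<bar>b\<bar>) * edge_weight a b 0 v"
        using True e n by (intro edge_weight_le_off_edge) auto
      also have "1 + 1 / e = 1 + 4 * c" by (simp add: e_def)
      finally have "H v * edge_weight a b (1 / n) v \<le> H v * (?D * edge_weight a b 0 v)"
        by (rule mult_left_mono[OF _ H0])
      then have "H v * edge_weight a b (1 / n) v \<le> ?D * (H v * edge_weight a b 0 v)"
        by (simp only: mult.left_commute)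
      then show ?thesis using True H0[of v]
        by (simp add: ennreal_mult[symmetric] edge_weight_nonneg)
    qed (auto split: split_indicator)
  qed
  also have "\<dots> = (\<integral>\<^sup>+v. ennreal (H v) * (?w v * indicator ?N v) * ?I v \<partial>lborel) + ennreal ?D * Y"
    unfolding Y_def by (subst nn_integral_add) (auto simp: nn_integral_cmult)
  also have "(\<integral>\<^sup>+v. ennreal (H v) * (?w v * indicator ?N v) * ?I v \<partial>lborel) \<le> ennreal c * ennreal (2 * e) * X"
    unfolding X_def
    by (rule nn_integral_kernel_transfer[where l = l and n = n]) (use H0 H nn_integral_kernel_near_edge[OF n _ l] e in auto)
  also have "ennreal c * ennreal (2 * e) = ennreal h"
    using c by (simp add: ennreal_mult[symmetric] e_def h_def)
  finally have le: "X \<le> ennreal h * X + ennreal ?D * Y" by simp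
  have "X \<noteq> \<infinity>" using fin by (simp add: X_def)
  then obtain x where x: "X = ennreal x" "0 \<le> x" by (cases X) auto
  have "X \<le> ennreal (2 * ?D) * Y"
  proof (cases Y)
    case (real y)
    have "ennreal x \<le> ennreal (h * x + ?D * y)"
      using le x real h by (simp add: ennreal_mult[symmetric] ennreal_plus[symmetric] del: ennreal_plus)
    then have "x \<le> h * x + ?D * y" using x real h by (subst (asm) ennreal_le_iff) auto
    then have "x \<le> 2 * ?D * y" by (simp add: h_def)
    then show ?thesis using x real by (simp add: ennreal_mult[symmetric])
  next
    case top
    have "ennreal (2 * ?D) \<noteq> 0" using c by (simp add: powr_eq_0_iff)
    then show ?thesis using top by (simp add: ennreal_mult_top)
  qed
  then show ?thesis by (simp add: X_def Y_def)
qed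

section \<open>The Bernstein inequality in the variable \<theta>\<close>

lemma borel_measurable_poly [measurable (raw)]:
  fixes P :: "real poly"
  shows "f \<in> borel_measurable M \<Longrightarrow> (\<lambda>x. poly P (f x)) \<in> borel_measurable M"
  by (rule measurable_compose[OF _ borel_measurable_continuous_onI]) (auto intro!: continuous_intros)

lemma borel_measurable_poly_cos [measurable]:
  fixes P :: "real poly"
  shows "(\<lambda>\<theta>. poly P (cos \<theta>)) \<in> borel_measurable borel"
    "(\<lambda>\<theta>. sin \<theta> * poly P (cos \<theta>)) \<in> borel_measurable borel"
  by (intro borel_measurable_continuous_onI continuous_intros)+

lemma decay_kernel_le_2: "l \<ge> 2 \<Longrightarrow> decay_kernel l n u \<le> decay_kernel 2 n u"
  unfolding decay_kernel_def
  by (intro divide_left_mono power_increasing mult_pos_pos zero_less_power) (auto simp: add_pos_nonneg)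

lemma nn_integral_decay_kernel:
  assumes "n \<ge> 1" "\<theta> \<in> {0..pi}" "l \<ge> 2"
  shows "(\<integral>\<^sup>+v. ennreal (decay_kernel l n (v - \<theta>)) * indicator {0..pi} v \<partial>lborel) \<le> ennreal 2"
  by (rule order.trans[OF nn_integral_mono nn_integral_decay_kernel_2[OF assms(1,2)]])
     (auto intro!: mult_right_mono ennreal_leI decay_kernel_le_2[OF assms(3)])

lemma nn_integral_decay_kernel_continuous:
  fixes H :: "real \<Rightarrow> real"
  assumes H: "continuous_on UNIV H" "\<And>v. 0 \<le> H v"
  shows "(\<integral>\<^sup>+v. ennreal (decay_kernel l n (v - \<theta>) * H v) * indicator {0..pi} v \<partial>lborel)
     = ennreal (n * integral {0..pi} (\<lambda>v. H v / (1 + n * \<bar>v - \<theta>\<bar>) ^ l))"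
proof -
  have nz: "1 + n * \<bar>x\<bar> \<noteq> 0" for x :: real
    using mult_nonneg_nonneg[of "real n" "\<bar>x\<bar>"] by linarith
  have [measurable]: "H \<in> borel_measurable borel" using H(1) by (rule borel_measurable_continuous_onI)
  have eq: "n * (H v / (1 + n * \<bar>v - \<theta>\<bar>) ^ l) = decay_kernel l n (v - \<theta>) * H v" for v
    by (simp add: decay_kernel_def)
  have "((\<lambda>v. n * (H v / (1 + n * \<bar>v - \<theta>\<bar>) ^ l)) has_integral n * integral {0..pi} (\<lambda>v. H v / (1 + n * \<bar>v - \<theta>\<bar>) ^ l)) {0..pi}"
    by (intro has_integral_mult_right integrable_integral integrable_continuous_real continuous_intros continuous_on_subset[OF H(1)])
       (auto simp: nz)
  then show ?thesis
    unfolding eq by (intro nn_integral_has_integral_on) (auto simp: decay_kernel_nonneg H)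
qed

definition localization_const :: "nat \<Rightarrow> real" where
  "localization_const m = (4 * real m + 3) ^ 2 * (2 * pi) ^ (2 * m)"

lemma localization_const_pos: "0 < localization_const m"
  by (simp add: localization_const_def zero_less_mult_iff)

text \<open>Dividing the derivative by \<open>n\<close> gives it the same majorant as the value, so
  both can be treated by the same argument.\<close>

lemma cos_poly_localized_nn_integral:
  fixes P :: "real poly" and n m :: nat
  assumes n: "n \<ge> 1" "degree P < n" and \<theta>: "\<theta> \<in> {0..pi}"
  defines "I \<equiv> (\<integral>\<^sup>+v. ennreal (decay_kernel (2 * m) n (v - \<theta>) * \<bar>poly P (cos v)\<bar>) * indicator {0..pi} v \<partial>lborel)"
    and "C \<equiv> localization_const m"
  shows "ennreal (\<bar>poly P (cos \<theta>)\<bar> / C) \<le> I" "ennreal (\<bar>sin \<theta> * poly (pderiv P) (cos \<theta>)\<bar> / n / C) \<le> I"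
proof -
  have C: "C > 0" unfolding C_def by (rule localization_const_pos)
  let ?J = "integral {0..pi} (\<lambda>v. \<bar>poly P (cos v)\<bar> / (1 + n * \<bar>v - \<theta>\<bar>) ^ (2 * m))"
  have I: "I = ennreal (n * ?J)"
    unfolding I_def by (rule nn_integral_decay_kernel_continuous) (auto intro!: continuous_intros)
  have "\<bar>poly P (cos \<theta>)\<bar> \<le> C * n * ?J" "\<bar>sin \<theta> * poly (pderiv P) (cos \<theta>)\<bar> \<le> C * n\<^sup>2 * ?J"
    using cos_poly_localized[OF n \<theta>, of m] by (simp_all add: C_def localization_const_def)
  then show "ennreal (\<bar>poly P (cos \<theta>)\<bar> / C) \<le> I" "ennreal (\<bar>sin \<theta> * poly (pderiv P) (cos \<theta>)\<bar> / n / C) \<le> I"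
    unfolding I using C n by (auto intro!: ennreal_leI simp: field_simps power2_eq_square)
qed

text \<open>Jensen's inequality for the kernel, whose mass on \<open>{0..pi}\<close> is at most 2,
  raises the localized bounds to the power \<open>q\<close>.\<close>

lemma cos_poly_localized_powr:
  fixes P :: "real poly" and n m :: nat
  assumes n: "n \<ge> 1" "degree P < n" and \<theta>: "\<theta> \<in> {0..pi}" and m: "m \<ge> 1" and q: "1 \<le> q"
  defines "I \<equiv> (\<integral>\<^sup>+v. ennreal (decay_kernel (2 * m) n (v - \<theta>) * \<bar>poly P (cos v)\<bar> powr q) * indicator {0..pi} v \<partial>lborel)"
    and "c \<equiv> (2 * localization_const m) powr q"
  shows "ennreal (\<bar>poly P (cos \<theta>)\<bar> powr q) \<le> ennreal c * I"
    "ennreal ((\<bar>sin \<theta> * poly (pderiv P) (cos \<theta>)\<bar> / n) powr q) \<le> ennreal c * I"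
proof -
  let ?C = "localization_const m"
  let ?k = "\<lambda>v. decay_kernel (2 * m) n (v - \<theta>) * indicator {0..pi} v"
  have C: "?C > 0" by (rule localization_const_pos)
  have *: "ennreal (x powr q) \<le> ennreal c * I"
    if x: "0 \<le> x" and le: "ennreal (x / ?C) \<le> (\<integral>\<^sup>+v. ennreal (decay_kernel (2 * m) n (v - \<theta>) * \<bar>poly P (cos v)\<bar>) * indicator {0..pi} v \<partial>lborel)" for x
  proof -
    have ind: "ennreal (a * b) * indicator {0..pi} v = ennreal (a * indicator {0..pi} v * b)" for a b v :: real
      by (simp add: indicator_def)
    have "ennreal ((x / ?C) powr q) \<le> ennreal (2 powr (q - 1)) * (\<integral>\<^sup>+v. ennreal (?k v * \<bar>poly P (cos v)\<bar> powr q) \<partial>lborel)"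
    proof (rule jensen_powr_nn_integral)
      show "(\<integral>\<^sup>+v. ennreal (?k v) \<partial>lborel) \<le> ennreal 2"
        using nn_integral_decay_kernel[OF n(1) \<theta>, of "2 * m"] m by (simp add: ennreal_mult' ennreal_indicator[symmetric] decay_kernel_nonneg)
      show "ennreal (x / ?C) \<le> (\<integral>\<^sup>+v. ennreal (?k v * \<bar>poly P (cos v)\<bar>) \<partial>lborel)"
        using le unfolding ind .
    qed (use x C q in \<open>auto simp: decay_kernel_nonneg\<close>)
    then have "ennreal ((x / ?C) powr q) \<le> ennreal (2 powr (q - 1)) * I"
      unfolding I_def ind .
    then have "ennreal (?C powr q) * ennreal ((x / ?C) powr q) \<le> ennreal (?C powr q) * (ennreal (2 powr (q - 1)) * I)"
      by (rule mult_left_mono) simp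
    also have "ennreal (?C powr q) * ennreal ((x / ?C) powr q) = ennreal (x powr q)"
      using x C by (simp add: ennreal_mult[symmetric] powr_divide)
    also have "ennreal (?C powr q) * (ennreal (2 powr (q - 1)) * I) = ennreal (?C powr q * 2 powr (q - 1)) * I"
      by (simp add: ennreal_mult mult.assoc)
    also have "\<dots> \<le> ennreal c * I"
    proof (intro mult_right_mono ennreal_leI)
      have "?C powr q * 2 powr (q - 1) \<le> ?C powr q * 2 powr q" by (intro mult_left_mono powr_mono) auto
      then show "?C powr q * 2 powr (q - 1) \<le> c" using C by (simp add: c_def powr_mult mult.commute)
    qed simp
    finally show ?thesis .
  qed
  show "ennreal (\<bar>poly P (cos \<theta>)\<bar> powr q) \<le> ennreal c * I"
    using cos_poly_localized_nn_integral(1)[OF n \<theta>] by (intro *) auto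
  show "ennreal ((\<bar>sin \<theta> * poly (pderiv P) (cos \<theta>)\<bar> / n) powr q) \<le> ennreal c * I"
    using cos_poly_localized_nn_integral(2)[OF n \<theta>] by (intro *) auto
qed

text \<open>The regularized weight is continuous on a compact interval. This provides the finiteness
  without which nothing can be absorbed.\<close>

lemma cos_poly_edge_weight_finite:
  assumes "d > 0" and q: "0 < q"
  shows "(\<integral>\<^sup>+v. ennreal (\<bar>poly P (cos v)\<bar> powr q) * ennreal (edge_weight a b d v) * indicator {0..pi} v \<partial>lborel) < \<infinity>"
proof -
  have "continuous_on {0..pi} (\<lambda>v. \<bar>poly P (cos v)\<bar> powr q * edge_weight a b d v)"
    unfolding edge_weight_def using assms q
    by (intro continuous_intros continuous_on_powr') auto
  then obtain B where B: "\<And>v. v \<in> {0..pi} \<Longrightarrow> \<bar>poly P (cos v)\<bar> powr q * edge_weight a b d v \<le> B"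
    using continuous_attains_sup[of "{0..pi}"] by fastforce
  have "(\<integral>\<^sup>+v. ennreal (\<bar>poly P (cos v)\<bar> powr q) * ennreal (edge_weight a b d v) * indicator {0..pi} v \<partial>lborel)
     \<le> (\<integral>\<^sup>+v. ennreal B * indicator {0..pi} v \<partial>lborel)"
    using B by (intro nn_integral_mono) (auto split: split_indicator simp: ennreal_mult[symmetric] edge_weight_nonneg intro!: ennreal_leI)
  also have "\<dots> = ennreal B * emeasure lborel {0..pi}" by (simp add: nn_integral_cmult_indicator)
  also have "\<dots> < \<infinity>" by (simp add: ennreal_mult_less_top)
  finally show ?thesis .
qed

text \<open>The derivative is dominated by kernel averages of the polynomial; integrating against
  the true weight yields the regularized weight on the right-hand side, and since the polynomial
  itself is dominated by such averages, the regularized weight can be exchanged for the true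
  one.\<close>

lemma bernstein_edge_weight:
  fixes a b q :: real
  assumes ab: "-1 < a" "-1 < b" and q: "1 \<le> q"
  shows "\<exists>C\<ge>0. \<forall>n\<ge>1. \<forall>P :: real poly. degree P < n \<longrightarrow>
    (\<integral>\<^sup>+\<theta>. ennreal (\<bar>sin \<theta> * poly (pderiv P) (cos \<theta>)\<bar> powr q) * ennreal (edge_weight a b 0 \<theta>) * indicator {0..pi} \<theta> \<partial>lborel)
    \<le> ennreal (C * n powr q) * (\<integral>\<^sup>+\<theta>. ennreal (\<bar>poly P (cos \<theta>)\<bar> powr q) * ennreal (edge_weight a b 0 \<theta>) * indicator {0..pi} \<theta> \<partial>lborel)"
proof -
  \<comment> \<open>The decay \<open>2 * m\<close> has to exceed the growth |a| + |b| of the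
    regularized weight by the 2 that integrability takes.\<close>
  define m where "m = nat \<lceil>\<bar>a\<bar> + \<bar>b\<bar> + 2\<rceil>"
  have m: "m \<ge> 1" "\<bar>a\<bar> + \<bar>b\<bar> + 2 \<le> real (2 * m)" unfolding m_def by linarith+
  define B where "B = 8 * (6 + 1 / (1 - max 0 (- a)) + 1 / (1 - max 0 (- b)))"
  have B: "B \<ge> 0" unfolding B_def using ab by (intro mult_nonneg_nonneg add_nonneg_nonneg) auto
  define c where "c = (2 * localization_const m) powr q"
  have c: "c > 0" using localization_const_pos[of m] by (simp add: c_def)
  define D where "D = 2 * (1 + 4 * c) powr (\<bar>a\<bar> + \<bar>b\<bar>)"
  have D: "D \<ge> 0" by (simp add: D_def)
  have "(\<integral>\<^sup>+\<theta>. ennreal (\<bar>sin \<theta> * poly (pderiv P) (cos \<theta>)\<bar> powr q) * ennreal (edge_weight a b 0 \<theta>) * indicator {0..pi} \<theta> \<partial>lborel)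
    \<le> ennreal (c * B * D * n powr q) * (\<integral>\<^sup>+\<theta>. ennreal (\<bar>poly P (cos \<theta>)\<bar> powr q) * ennreal (edge_weight a b 0 \<theta>) * indicator {0..pi} \<theta> \<partial>lborel)"
    if n: "n \<ge> 1" "degree P < n" for n and P :: "real poly"
  proof -
    define U where "U \<theta> = (\<bar>sin \<theta> * poly (pderiv P) (cos \<theta>)\<bar> / n) powr q" for \<theta>
    define H where "H \<theta> = \<bar>poly P (cos \<theta>)\<bar> powr q" for \<theta>
    have [measurable]: "U \<in> borel_measurable borel" "H \<in> borel_measurable borel"
      unfolding U_def[abs_def] H_def[abs_def]
      by measurable
    have 1: "(\<integral>\<^sup>+\<theta>. ennreal (U \<theta>) * ennreal (edge_weight a b 0 \<theta>) * indicator {0..pi} \<theta> \<partial>lborel)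
      \<le> ennreal c * ennreal B * (\<integral>\<^sup>+v. ennreal (H v) * ennreal (edge_weight a b (1 / n) v) * indicator {0..pi} v \<partial>lborel)"
    proof (rule nn_integral_kernel_transfer[where l = "2 * m" and n = n])
      show "ennreal (U \<theta>) \<le> ennreal c * (\<integral>\<^sup>+v. ennreal (decay_kernel (2 * m) n (v - \<theta>) * H v) * indicator {0..pi} v \<partial>lborel)"
        if "\<theta> \<in> {0..pi}" for \<theta>
        unfolding U_def H_def c_def by (rule cos_poly_localized_powr(2)[OF n that m(1) q])
      show "(\<integral>\<^sup>+\<theta>. ennreal (decay_kernel (2 * m) n (v - \<theta>)) * ennreal (edge_weight a b 0 \<theta>) * indicator {0..pi} \<theta> \<partial>lborel)
          \<le> ennreal B * ennreal (edge_weight a b (1 / n) v)" if "v \<in> {0..pi}" for v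
        using nn_integral_kernel_edge_weight_0[OF n(1) that ab m(2)]
        by (simp add: ennreal_mult decay_kernel_nonneg edge_weight_nonneg B_def)
    qed (auto simp: H_def)
    have 2: "(\<integral>\<^sup>+v. ennreal (H v) * ennreal (edge_weight a b (1 / n) v) * indicator {0..pi} v \<partial>lborel)
       \<le> ennreal D * (\<integral>\<^sup>+v. ennreal (H v) * ennreal (edge_weight a b 0 v) * indicator {0..pi} v \<partial>lborel)"
      unfolding D_def
    proof (rule edge_weight_regularization_L1[OF _ _ n(1) m(2) c])
      show "ennreal (H \<theta>) \<le> ennreal c * (\<integral>\<^sup>+v. ennreal (decay_kernel (2 * m) n (v - \<theta>) * H v) * indicator {0..pi} v \<partial>lborel)"
        if "\<theta> \<in> {0..pi}" for \<theta>
        unfolding H_def c_def by (rule cos_poly_localized_powr(1)[OF n that m(1) q])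
      show "(\<integral>\<^sup>+v. ennreal (H v) * ennreal (edge_weight a b (1 / n) v) * indicator {0..pi} v \<partial>lborel) < \<infinity>"
        unfolding H_def by (rule cos_poly_edge_weight_finite) (use n q in auto)
    qed (auto simp: H_def)
    have "(\<integral>\<^sup>+\<theta>. ennreal (\<bar>sin \<theta> * poly (pderiv P) (cos \<theta>)\<bar> powr q) * ennreal (edge_weight a b 0 \<theta>) * indicator {0..pi} \<theta> \<partial>lborel)
      = (\<integral>\<^sup>+\<theta>. ennreal (n powr q) * (ennreal (U \<theta>) * ennreal (edge_weight a b 0 \<theta>) * indicator {0..pi} \<theta>) \<partial>lborel)"
    proof (rule nn_integral_cong)
      fix \<theta>
      have "\<bar>sin \<theta> * poly (pderiv P) (cos \<theta>)\<bar> powr q = n powr q * U \<theta>"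
        using n by (simp add: U_def powr_divide)
      then show "ennreal (\<bar>sin \<theta> * poly (pderiv P) (cos \<theta>)\<bar> powr q) * ennreal (edge_weight a b 0 \<theta>) * indicator {0..pi} \<theta>
        = ennreal (n powr q) * (ennreal (U \<theta>) * ennreal (edge_weight a b 0 \<theta>) * indicator {0..pi} \<theta>)"
        by (simp add: ennreal_mult U_def mult.assoc)
    qed
    also have "\<dots> = ennreal (n powr q) * (\<integral>\<^sup>+\<theta>. ennreal (U \<theta>) * ennreal (edge_weight a b 0 \<theta>) * indicator {0..pi} \<theta> \<partial>lborel)"
      by (rule nn_integral_cmult) measurable
    also have "\<dots> \<le> ennreal (n powr q) * (ennreal c * ennreal B * (ennreal D * (\<integral>\<^sup>+v. ennreal (H v) * ennreal (edge_weight a b 0 v) * indicator {0..pi} v \<partial>lborel)))"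
      by (intro mult_left_mono order.trans[OF 1] 2) auto
    also have "\<dots> = ennreal (c * B * D * n powr q) * (\<integral>\<^sup>+v. ennreal (H v) * ennreal (edge_weight a b 0 v) * indicator {0..pi} v \<partial>lborel)"
      using B D c by (simp add: ennreal_mult mult_ac)
    finally show ?thesis by (simp only: H_def)
  qed
  then show ?thesis using B D c by (intro exI[of _ "c * B * D"]) auto
qed


text \<open>Counterpart for the supremum norm: the neighbourhood of the end points contributes its
  measure 2 e / n times the kernel maximum \<open>n\<close> times \<open>S\<close>, the rest the
  kernel mass 2 times \<open>S'\<close>.\<close>

lemma kernel_edge_weight_sup_bound:
  fixes H U :: "real \<Rightarrow> real"
  assumes [measurable]: "H \<in> borel_measurable borel" and H0: "\<And>v. 0 \<le> H v"
    and n: "n \<ge> 1" and \<theta>: "\<theta> \<in> {0..pi}" and l: "\<bar>a\<bar> + \<bar>b\<bar> + 2 \<le> real l" and e: "0 \<le> e" and S: "0 \<le> S" "0 \<le> S'"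
    and near: "\<And>v. v \<in> {0..pi} \<Longrightarrow> v \<in> near_edge (e / n) \<Longrightarrow> H v * edge_weight a b (1 / n) v \<le> S"
    and off: "\<And>v. v \<in> {0..pi} \<Longrightarrow> v \<notin> near_edge (e / n) \<Longrightarrow> H v * edge_weight a b (1 / n) v \<le> S'"
    and x: "0 \<le> x" "ennreal x \<le> (\<integral>\<^sup>+v. ennreal (decay_kernel l n (v - \<theta>) * H v) * indicator {0..pi} v \<partial>lborel)"
  shows "x * edge_weight a b (1 / n) \<theta> \<le> 2 * e * S + 2 * S'"
proof -
  let ?w = "edge_weight a b (1 / n)" and ?N = "near_edge (e / n)"
  have "ennreal (x * ?w \<theta>) = ennreal (?w \<theta>) * ennreal x"
    using x by (simp add: ennreal_mult edge_weight_nonneg mult.commute)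
  also have "\<dots> \<le> ennreal (?w \<theta>) * (\<integral>\<^sup>+v. ennreal (decay_kernel l n (v - \<theta>) * H v) * indicator {0..pi} v \<partial>lborel)"
    by (rule mult_left_mono[OF x(2)]) simp
  also have "\<dots> = (\<integral>\<^sup>+v. ennreal (?w \<theta>) * (ennreal (decay_kernel l n (v - \<theta>) * H v) * indicator {0..pi} v) \<partial>lborel)"
    by (rule nn_integral_cmult[symmetric]) measurable
  also have "\<dots> \<le> (\<integral>\<^sup>+v. ennreal (n * S) * indicator ?N v + ennreal S' * (ennreal (decay_kernel 2 n (v - \<theta>)) * indicator {0..pi} v) \<partial>lborel)"
  proof (rule nn_integral_mono)
    fix v
    show "ennreal (?w \<theta>) * (ennreal (decay_kernel l n (v - \<theta>) * H v) * indicator {0..pi} v)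
      \<le> ennreal (n * S) * indicator ?N v + ennreal S' * (ennreal (decay_kernel 2 n (v - \<theta>)) * indicator {0..pi} v)"
    proof (cases "v \<in> {0..pi}")
      case True
      have "decay_kernel l n (v - \<theta>) * ?w \<theta> \<le> ?w v * decay_kernel 2 n (v - \<theta>)"
        by (rule decay_kernel_edge_weight[OF n \<theta> True l])
      from mult_left_mono[OF this H0[of v]]
      have le: "?w \<theta> * (decay_kernel l n (v - \<theta>) * H v) \<le> decay_kernel 2 n (v - \<theta>) * (H v * ?w v)"
        by (simp add: mult_ac)
      show ?thesis
      proof (cases "v \<in> ?N")
        case N: True
        note le
        also have "decay_kernel 2 n (v - \<theta>) * (H v * ?w v) \<le> n * S"
          by (intro mult_mono near True N decay_kernel_le) (auto simp: H0 edge_weight_nonneg)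
        finally show ?thesis using True N
          by (auto simp: ennreal_mult[symmetric] H0 edge_weight_nonneg decay_kernel_nonneg intro!: add_increasing2 ennreal_leI)
      next
        case N: False
        note le
        also have "decay_kernel 2 n (v - \<theta>) * (H v * ?w v) \<le> decay_kernel 2 n (v - \<theta>) * S'"
          by (intro mult_left_mono off True N decay_kernel_nonneg)
        finally show ?thesis using True N S
          by (simp add: ennreal_mult[symmetric] H0 edge_weight_nonneg decay_kernel_nonneg ennreal_leI mult.commute)
      qed
    qed simp
  qed
  also have "\<dots> = ennreal (n * S) * emeasure lborel ?N + ennreal S' * (\<integral>\<^sup>+v. ennreal (decay_kernel 2 n (v - \<theta>)) * indicator {0..pi} v \<partial>lborel)"
    by (simp add: nn_integral_add nn_integral_cmult nn_integral_cmult_indicator)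
  also have "\<dots> \<le> ennreal (n * S) * ennreal (2 * (e / n)) + ennreal S' * ennreal 2"
    using e by (intro add_mono mult_left_mono emeasure_near_edge nn_integral_decay_kernel_2[OF n \<theta>]) auto
  also have "\<dots> = ennreal (2 * e * S + 2 * S')"
    using n S e by (simp add: ennreal_mult[symmetric] ennreal_plus[symmetric] mult_ac del: ennreal_plus flip: ennreal_numeral)
  finally show ?thesis using S e by (subst (asm) ennreal_le_iff) auto
qed

text \<open>The maximum \<open>S\<close> of the regularized expression is absorbed: the bound at a
  maximum point has \<open>S\<close> on the right with factor 1/2, so \<open>S\<close> is bounded by
  the values away from the end points, where the true weight is comparable. The derivative is then
  bounded in terms of \<open>S\<close>.\<close>

lemma bernstein_edge_weight_sup:
  fixes a b :: real
  assumes ab: "0 \<le> a" "0 \<le> b"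
  shows "\<exists>C\<ge>0. \<forall>n\<ge>1. \<forall>(P :: real poly) K. degree P < n \<longrightarrow> 0 \<le> K \<longrightarrow>
    (\<forall>\<theta>\<in>{0<..<pi}. \<bar>poly P (cos \<theta>)\<bar> * edge_weight a b 0 \<theta> \<le> K) \<longrightarrow>
    (\<forall>\<theta>\<in>{0..pi}. \<bar>sin \<theta> * poly (pderiv P) (cos \<theta>)\<bar> * edge_weight a b 0 \<theta> \<le> C * n * K)"
proof -
  define m where "m = nat \<lceil>\<bar>a\<bar> + \<bar>b\<bar> + 2\<rceil>"
  have m: "\<bar>a\<bar> + \<bar>b\<bar> + 2 \<le> real (2 * m)" unfolding m_def by linarith
  define c where "c = localization_const m"
  have c: "c > 0" using localization_const_pos[of m] by (simp add: c_def)
  define e where "e = 1 / (4 * c)"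
  have e: "e > 0" using c by (simp add: e_def)
  define D where "D = (1 + 1 / e) powr (\<bar>a\<bar> + \<bar>b\<bar>)"
  have D: "D \<ge> 0" by (simp add: D_def)
  have "\<bar>sin \<theta> * poly (pderiv P) (cos \<theta>)\<bar> * edge_weight a b 0 \<theta> \<le> 8 * c\<^sup>2 * D * n * K"
    if n: "n \<ge> 1" "degree P < n" and K: "0 \<le> K" "\<And>\<theta>. \<theta> \<in> {0<..<pi} \<Longrightarrow> \<bar>poly P (cos \<theta>)\<bar> * edge_weight a b 0 \<theta> \<le> K"
      and \<theta>: "\<theta> \<in> {0..pi}" for n K \<theta> and P :: "real poly"
  proof -
    let ?H = "\<lambda>v. \<bar>poly P (cos v)\<bar>" and ?w = "edge_weight a b (1 / n)" and ?N = "near_edge (e / n)"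
    have [measurable]: "?H \<in> borel_measurable borel" by measurable
    have "continuous_on {0..pi} (\<lambda>v. ?H v * ?w v)"
      unfolding edge_weight_def using n by (intro continuous_intros) (auto simp: add_nonneg_eq_0_iff)
    \<comment> \<open>Regularization makes the weight continuous up to the end points, so the
      maximum is attained and finite.\<close>
    then obtain v where v: "v \<in> {0..pi}" "\<And>u. u \<in> {0..pi} \<Longrightarrow> ?H u * ?w u \<le> ?H v * ?w v"
      using continuous_attains_sup[of "{0..pi}" "\<lambda>v. ?H v * ?w v"] by auto
    define S where "S = ?H v * ?w v"
    have S: "S \<ge> 0" by (simp add: S_def edge_weight_nonneg)
    have off: "?H u * ?w u \<le> D * K" if "u \<in> {0..pi}" "u \<notin> ?N" for u
    proof -
      have en: "e / n > 0" using e n by simp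
      have u: "u \<in> {0<..<pi}" using that en by (auto simp: near_edge_def not_less)
      have "?w u \<le> D * edge_weight a b 0 u"
        using edge_weight_le_off_edge[of "1 / n" e u a b] that n e by (simp add: D_def)
      then have "?H u * ?w u \<le> ?H u * (D * edge_weight a b 0 u)" by (rule mult_left_mono) simp
      also have "\<dots> = D * (?H u * edge_weight a b 0 u)" by (simp only: mult.left_commute)
      also have "\<dots> \<le> D * K" using K(2)[OF u] D by (rule mult_left_mono)
      finally show ?thesis .
    qed
    have "?H v / c * ?w v \<le> 2 * e * S + 2 * (D * K)"
      by (rule kernel_edge_weight_sup_bound[where H = ?H and l = "2 * m"])
         (use n v m e S D K off c cos_poly_localized_nn_integral(1)[OF n v(1), of m] in \<open>auto simp: S_def c_def\<close>)
    then have "S \<le> c * (2 * e * S + 2 * (D * K))" using c by (simp add: S_def field_simps)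
    then have SK: "S \<le> 4 * c * D * K" using c by (simp add: e_def field_simps)
    \<comment> \<open>With \<open>e = 0\<close> the neighbourhood of the end points is empty, and
      \<open>S\<close> bounds the expression everywhere.\<close>
    have "\<bar>sin \<theta> * poly (pderiv P) (cos \<theta>)\<bar> / n / c * ?w \<theta> \<le> 2 * 0 * S + 2 * S"
      by (rule kernel_edge_weight_sup_bound[where H = ?H and l = "2 * m"])
         (use n v \<theta> m S c cos_poly_localized_nn_integral(2)[OF n \<theta>, of m] in \<open>auto simp: S_def c_def\<close>)
    then have "\<bar>sin \<theta> * poly (pderiv P) (cos \<theta>)\<bar> * ?w \<theta> \<le> 2 * c * n * S" using c n by (simp add: field_simps)
    also have "\<dots> \<le> 2 * c * n * (4 * c * D * K)" using c by (intro mult_left_mono SK) auto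
    finally have "\<bar>sin \<theta> * poly (pderiv P) (cos \<theta>)\<bar> * ?w \<theta> \<le> 8 * c\<^sup>2 * D * n * K" by (simp add: power2_eq_square mult_ac)
    \<comment> \<open>Nonnegative exponents: the true weight lies below the regularized one, so the
      return to it is free on this side.\<close>
    moreover have "edge_weight a b 0 \<theta> \<le> ?w \<theta>"
      unfolding edge_weight_def using \<theta> ab n by (intro mult_mono powr_mono2) auto
    ultimately show ?thesis
      using mult_left_mono[of "edge_weight a b 0 \<theta>" "?w \<theta>" "\<bar>sin \<theta> * poly (pderiv P) (cos \<theta>)\<bar>"] by linarith
  qed
  then show ?thesis using D by (intro exI[of _ "8 * c\<^sup>2 * D"]) auto
qed

subsection \<open>The weighted Bernstein inequality\<close>

text \<open>The substitution is carried out with the increasing function - cos, after reflecting the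
  variable on the left.\<close>

lemma nn_integral_cos_substitution:
  assumes [measurable]: "F \<in> borel_measurable borel"
  shows "(\<integral>\<^sup>+x. F x * indicator {-1..1} x \<partial>lborel) = (\<integral>\<^sup>+\<theta>. F (cos \<theta>) * ennreal (sin \<theta>) * indicator {0..pi} \<theta> \<partial>lborel)"
proof -
  have "(\<integral>\<^sup>+x. F (- x) * indicator {- cos 0..- cos pi} x \<partial>lborel)
     = (\<integral>\<^sup>+\<theta>. F (- (- cos \<theta>)) * ennreal (sin \<theta>) * indicator {0..pi} \<theta> \<partial>lborel)"
    by (rule nn_integral_substitution_aux) (auto intro!: derivative_eq_intros continuous_intros sin_ge_zero)
  moreover have "(\<integral>\<^sup>+x. F x * indicator {-1..1} x \<partial>lborel) = (\<integral>\<^sup>+x. F (- x) * indicator {- cos 0..- cos pi} x \<partial>lborel)"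
    by (subst nn_integral_real_affine[where c = "-1" and t = 0]) (auto intro!: nn_integral_cong split: split_indicator)
  ultimately show ?thesis by simp
qed

text \<open>1 - cos \<theta> is twice the square of sin(\<theta> / 2), which lies between \<theta> /
  pi and \<theta> / 2. The sharper upper constant 1/2 is relaxed so that one ratio serves in both
  directions.\<close>

lemma one_minus_cos_bounds:
  assumes "0 < \<theta>" "\<theta> < pi"
  shows "0 < 1 - cos \<theta>" "1 - cos \<theta> \<le> pi\<^sup>2 / 2 * \<theta>\<^sup>2" "\<theta>\<^sup>2 \<le> pi\<^sup>2 / 2 * (1 - cos \<theta>)"
proof -
  have eq: "1 - cos \<theta> = 2 * (sin (\<theta> / 2))\<^sup>2"
    using cos_double_sin[of "\<theta> / 2"] by simp
  have s: "\<theta> / pi \<le> sin (\<theta> / 2)" using sin_ge_linear[of "\<theta> / 2"] assms by simp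
  have "0 < sin (\<theta> / 2)" using assms by (intro sin_gt_zero) auto
  then show "0 < 1 - cos \<theta>" unfolding eq by simp
  have "(\<theta> / pi)\<^sup>2 \<le> (sin (\<theta> / 2))\<^sup>2" using s assms by (intro power_mono) auto
  then show "\<theta>\<^sup>2 \<le> pi\<^sup>2 / 2 * (1 - cos \<theta>)" unfolding eq by (simp add: power_divide field_simps)
  have "(sin (\<theta> / 2))\<^sup>2 \<le> (\<theta> / 2)\<^sup>2"
    using sin_x_le_x[of "\<theta> / 2"] \<open>0 < sin (\<theta> / 2)\<close> assms by (intro power_mono) auto
  then have "1 - cos \<theta> \<le> 1 / 2 * \<theta>\<^sup>2" unfolding eq by (simp add: power_divide)
  also have "\<dots> \<le> pi\<^sup>2 / 2 * \<theta>\<^sup>2"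
    using power_mono[of 1 pi 2] pi_ge_two by (intro mult_right_mono) auto
  finally show "1 - cos \<theta> \<le> pi\<^sup>2 / 2 * \<theta>\<^sup>2" .
qed

text \<open>sin \<theta> is twice the product of sin(\<theta> / 2) and sin((pi - \<theta>) / 2), and
  each factor is comparable to the distance from its end point.\<close>

lemma sin_bounds:
  assumes "0 < \<theta>" "\<theta> < pi"
  shows "0 < sin \<theta>" "sin \<theta> \<le> pi\<^sup>2 / 2 * (\<theta> * (pi - \<theta>))" "\<theta> * (pi - \<theta>) \<le> pi\<^sup>2 / 2 * sin \<theta>"
proof -
  have eq: "sin \<theta> = 2 * (sin (\<theta> / 2) * sin ((pi - \<theta>) / 2))"
    using sin_double[of "\<theta> / 2"] by (simp add: cos_sin_eq diff_divide_distrib)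
  show "0 < sin \<theta>" using assms by (intro sin_gt_zero)
  have s: "\<theta> / pi \<le> sin (\<theta> / 2)" "(pi - \<theta>) / pi \<le> sin ((pi - \<theta>) / 2)"
    using sin_ge_linear[of "\<theta> / 2"] sin_ge_linear[of "(pi - \<theta>) / 2"] assms by (simp_all add: field_simps)
  have "(\<theta> / pi) * ((pi - \<theta>) / pi) \<le> sin (\<theta> / 2) * sin ((pi - \<theta>) / 2)"
    using s assms by (intro mult_mono) (auto intro: sin_ge_zero)
  then show "\<theta> * (pi - \<theta>) \<le> pi\<^sup>2 / 2 * sin \<theta>" unfolding eq by (simp add: field_simps power2_eq_square)
  have "sin (\<theta> / 2) * sin ((pi - \<theta>) / 2) \<le> (\<theta> / 2) * ((pi - \<theta>) / 2)"
    using assms by (intro mult_mono sin_x_le_x) (auto intro!: sin_ge_zero)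
  then have "sin \<theta> \<le> 1 / 2 * (\<theta> * (pi - \<theta>))" unfolding eq by simp
  also have "\<dots> \<le> pi\<^sup>2 / 2 * (\<theta> * (pi - \<theta>))"
    using power_mono[of 1 pi 2] pi_ge_two assms by (intro mult_right_mono) auto
  finally show "sin \<theta> \<le> pi\<^sup>2 / 2 * (\<theta> * (pi - \<theta>))" .
qed

text \<open>Powers of the common ratio: |A| and |B| for the two end points, 1 for the factor
  \<open>sin \<theta>\<close>.\<close>

definition cos_weight_ratio :: "real \<Rightarrow> real \<Rightarrow> real" where
  "cos_weight_ratio A B = (pi\<^sup>2 / 2) powr (\<bar>A\<bar> + \<bar>B\<bar> + 1)"

lemma cos_weight_ratio_pos: "0 < cos_weight_ratio A B"
  by (simp add: cos_weight_ratio_def)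

lemma cos_jacobi_powr_bounds:
  assumes \<theta>: "0 < \<theta>" "\<theta> < pi"
  shows "(1 - cos \<theta>) powr A * (1 + cos \<theta>) powr B \<le> (pi\<^sup>2 / 2) powr (\<bar>A\<bar> + \<bar>B\<bar>) * edge_weight (2 * A) (2 * B) 0 \<theta>"
    "edge_weight (2 * A) (2 * B) 0 \<theta> \<le> (pi\<^sup>2 / 2) powr (\<bar>A\<bar> + \<bar>B\<bar>) * ((1 - cos \<theta>) powr A * (1 + cos \<theta>) powr B)"
proof -
  let ?r = "pi\<^sup>2 / 2"
  have sq: "(x\<^sup>2) powr A = x powr (2 * A)" if "0 < x" for x A :: real
    using that powr_powr[of x 2 A] by (simp add: powr_numeral)
  note c = one_minus_cos_bounds[OF \<theta>] and d = one_minus_cos_bounds[of "pi - \<theta>"]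
  have p: "0 < pi - \<theta>" "pi - \<theta> < pi" using \<theta> by auto
  have "(1 - cos \<theta>) powr A \<le> ?r powr \<bar>A\<bar> * \<theta>\<^sup>2 powr A" "\<theta>\<^sup>2 powr A \<le> ?r powr \<bar>A\<bar> * (1 - cos \<theta>) powr A"
    using c \<theta> by (intro powr_le_powr_ratio; simp)+
  moreover have "(1 + cos \<theta>) powr B \<le> ?r powr \<bar>B\<bar> * (pi - \<theta>)\<^sup>2 powr B" "(pi - \<theta>)\<^sup>2 powr B \<le> ?r powr \<bar>B\<bar> * (1 + cos \<theta>) powr B"
    using d[OF p] p by (intro powr_le_powr_ratio; simp)+
  ultimately show "(1 - cos \<theta>) powr A * (1 + cos \<theta>) powr B \<le> ?r powr (\<bar>A\<bar> + \<bar>B\<bar>) * edge_weight (2 * A) (2 * B) 0 \<theta>"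
    "edge_weight (2 * A) (2 * B) 0 \<theta> \<le> ?r powr (\<bar>A\<bar> + \<bar>B\<bar>) * ((1 - cos \<theta>) powr A * (1 + cos \<theta>) powr B)"
    unfolding edge_weight_def powr_add using sq[OF \<theta>(1)] sq[OF p(1)]
     mult_mono[of "(1 - cos \<theta>) powr A" "?r powr \<bar>A\<bar> * \<theta>\<^sup>2 powr A" "(1 + cos \<theta>) powr B" "?r powr \<bar>B\<bar> * (pi - \<theta>)\<^sup>2 powr B"]
     mult_mono[of "\<theta>\<^sup>2 powr A" "?r powr \<bar>A\<bar> * (1 - cos \<theta>) powr A" "(pi - \<theta>)\<^sup>2 powr B" "?r powr \<bar>B\<bar> * (1 + cos \<theta>) powr B"]
    by (simp_all add: mult_ac)
qed

text \<open>The factor \<open>sin \<theta>\<close> is the Jacobian of the substitution. It is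
  comparable to \<theta> (pi - \<theta>), so it raises both exponents by 1, after the doubling that
  comes from 1 - cos \<theta> being of order \<theta> squared.\<close>

lemma cos_jacobi_sin_powr_bounds:
  assumes \<theta>: "0 < \<theta>" "\<theta> < pi"
  shows "(1 - cos \<theta>) powr A * (1 + cos \<theta>) powr B * sin \<theta> \<le> cos_weight_ratio A B * edge_weight (2 * A + 1) (2 * B + 1) 0 \<theta>"
    "edge_weight (2 * A + 1) (2 * B + 1) 0 \<theta> \<le> cos_weight_ratio A B * ((1 - cos \<theta>) powr A * (1 + cos \<theta>) powr B * sin \<theta>)"
proof -
  let ?r = "pi\<^sup>2 / 2"
  have e: "edge_weight (2 * A + 1) (2 * B + 1) 0 \<theta> = edge_weight (2 * A) (2 * B) 0 \<theta> * (\<theta> * (pi - \<theta>))"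
    using \<theta> by (simp add: edge_weight_def powr_add)
  note s = sin_bounds[OF \<theta>] and b = cos_jacobi_powr_bounds[OF \<theta>, of A B]
  have "(1 - cos \<theta>) powr A * (1 + cos \<theta>) powr B * sin \<theta>
     \<le> (?r powr (\<bar>A\<bar> + \<bar>B\<bar>) * edge_weight (2 * A) (2 * B) 0 \<theta>) * (?r * (\<theta> * (pi - \<theta>)))"
    by (intro mult_mono b s) (use s in \<open>auto simp: edge_weight_nonneg\<close>)
  then show "(1 - cos \<theta>) powr A * (1 + cos \<theta>) powr B * sin \<theta> \<le> cos_weight_ratio A B * edge_weight (2 * A + 1) (2 * B + 1) 0 \<theta>"
    unfolding e cos_weight_ratio_def by (simp add: powr_add mult_ac)
  have "edge_weight (2 * A) (2 * B) 0 \<theta> * (\<theta> * (pi - \<theta>))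
     \<le> (?r powr (\<bar>A\<bar> + \<bar>B\<bar>) * ((1 - cos \<theta>) powr A * (1 + cos \<theta>) powr B)) * (?r * sin \<theta>)"
    by (intro mult_mono b s) (use \<theta> in \<open>auto simp: edge_weight_nonneg\<close>)
  then show "edge_weight (2 * A + 1) (2 * B + 1) 0 \<theta> \<le> cos_weight_ratio A B * ((1 - cos \<theta>) powr A * (1 + cos \<theta>) powr B * sin \<theta>)"
    unfolding e cos_weight_ratio_def by (simp add: powr_add mult_ac)
qed

lemma borel_measurable_jacobi_weight [measurable]: "jacobi_weight \<alpha> \<beta> \<in> borel_measurable borel"
  unfolding jacobi_weight_def[abs_def] by measurable

lemma borel_measurable_lebesgue_onI: "f \<in> borel_measurable borel \<Longrightarrow> f \<in> borel_measurable (lebesgue_on S)"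
  by (intro measurable_restrict_space1 measurable_completion) simp

lemma jacobi_weight_nonneg: "0 \<le> jacobi_weight \<alpha> \<beta> x"
  by (simp add: jacobi_weight_def)

lemma jacobi_weight_pos: "-1 < x \<Longrightarrow> x < 1 \<Longrightarrow> 0 < jacobi_weight \<alpha> \<beta> x"
  by (simp add: jacobi_weight_def)

text \<open>Raising both exponents by 1/2 multiplies the weight by \<open>\<phi>\<close>, and
  \<open>\<phi> (cos \<theta>) = sin \<theta>\<close>. Thus the derivative with respect to \<theta>
  corresponds to a Jacobi weight again.\<close>

lemma jacobi_weight_half_cos:
  assumes "0 < \<theta>" "\<theta> < pi"
  shows "jacobi_weight (\<alpha> + 1 / 2) (\<beta> + 1 / 2) (cos \<theta>) = jacobi_weight \<alpha> \<beta> (cos \<theta>) * sin \<theta>"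
proof -
  have c: "0 < 1 - cos \<theta>" "0 < 1 + cos \<theta>"
    using one_minus_cos_bounds(1)[of \<theta>] one_minus_cos_bounds(1)[of "pi - \<theta>"] assms by auto
  have "(1 - cos \<theta>) powr (1 / 2) * (1 + cos \<theta>) powr (1 / 2) = sqrt ((1 - cos \<theta>) * (1 + cos \<theta>))"
    using c by (simp add: powr_half_sqrt real_sqrt_mult)
  also have "(1 - cos \<theta>) * (1 + cos \<theta>) = (sin \<theta>)\<^sup>2"
    by (simp add: sin_squared_eq power2_eq_square algebra_simps)
  also have "sqrt ((sin \<theta>)\<^sup>2) = sin \<theta>" using sin_gt_zero[OF assms] by simp
  finally have "(1 - cos \<theta>) powr (1 / 2) * (1 + cos \<theta>) powr (1 / 2) = sin \<theta>" .
  moreover have "jacobi_weight (\<alpha> + 1 / 2) (\<beta> + 1 / 2) (cos \<theta>) =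
     jacobi_weight \<alpha> \<beta> (cos \<theta>) * ((1 - cos \<theta>) powr (1 / 2) * (1 + cos \<theta>) powr (1 / 2))"
    unfolding jacobi_weight_def powr_add by (simp only: mult_ac)
  ultimately show ?thesis by simp
qed

section \<open>The Bernstein inequality on [-1,1]\<close>

lemma AE_imp_everywhere_continuous:
  fixes f :: "real \<Rightarrow> real"
  assumes ae: "AE x in lborel. x \<in> {a<..<b} \<longrightarrow> f x \<le> K" and f: "continuous_on {a<..<b} f" and x: "x \<in> {a<..<b}"
  shows "f x \<le> K"
proof (rule ccontr)
  assume "\<not> f x \<le> K"
  define U where "U = {a<..<b} \<inter> f -` {K<..}"
  have o: "open U" unfolding U_def using f by (intro continuous_open_preimage) auto
  have "x \<in> U" using x \<open>\<not> f x \<le> K\<close> by (auto simp: U_def)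
  have "AE x in lborel. x \<notin> U" using ae by eventually_elim (auto simp: U_def)
  then have "U \<in> null_sets lborel" using o by (subst (asm) AE_iff_null_sets[symmetric]) auto
  then have "negligible U" by (simp add: negligible_iff_null_sets null_sets_completionI)
  with o \<open>x \<in> U\<close> show False using open_not_negligible by blast
qed

lemma Lp_le_finite_iff_lborel:
  assumes "p \<noteq> \<infinity>" "0 \<le> K" "g \<in> borel_measurable borel"
  shows "Lp_le p g K \<longleftrightarrow> (\<integral>\<^sup>+x. ennreal (\<bar>g x\<bar> powr enn2real p) * indicator {-1..1} x \<partial>lborel) \<le> ennreal (K powr enn2real p)"
  using assms by (simp add: Lp_le_def borel_measurable_lebesgue_onI nn_integral_lebesgue_on)

text \<open>Up to sign, \<open>sin \<theta> * poly (pderiv P) (cos \<theta>)\<close> is the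
  derivative of \<open>poly P (cos \<theta>)\<close>. The ratio \<open>R\<close> enters twice, for
  the passage to \<theta> and for the way back.\<close>

lemma bernstein_step_finite:
  fixes \<alpha> \<beta> :: real
  assumes p: "1 \<le> p" "p \<noteq> \<infinity>" and J: "\<alpha> \<in> J p" "\<beta> \<in> J p"
  shows "\<exists>C\<ge>0. \<forall>n\<ge>1. \<forall>(P :: real poly) K. degree P < n \<longrightarrow>
    Lp_le p (\<lambda>x. jacobi_weight \<alpha> \<beta> x * poly P x) K \<longrightarrow>
    Lp_le p (\<lambda>x. jacobi_weight (\<alpha> + 1 / 2) (\<beta> + 1 / 2) x * poly (pderiv P) x) (C * n * K)"
proof -
  define q where "q = enn2real p"
  have q: "q \<ge> 1" using enn2real_ge_1[OF p] by (simp add: q_def)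
  define A B where "A = \<alpha> * q" and "B = \<beta> * q"
  \<comment> \<open>Membership in \<open>J p\<close> means A > -1 and B > -1, which is precisely
    integrability of the weight after the substitution.\<close>
  have ab: "-1 < 2 * A + 1" "-1 < 2 * B + 1"
    using J p q by (auto simp: J_def A_def B_def q_def[symmetric] field_simps)
  let ?W = "\<lambda>\<theta>. ennreal (edge_weight (2 * A + 1) (2 * B + 1) 0 \<theta>)"
  let ?I = "indicator {0..pi} :: real \<Rightarrow> ennreal"
  define R where "R = cos_weight_ratio A B"
  have R: "R > 0" by (simp add: R_def cos_weight_ratio_pos)
  obtain C where C: "C \<ge> 0" and bern: "\<And>n (P :: real poly). n \<ge> 1 \<Longrightarrow> degree P < n \<Longrightarrow>
    (\<integral>\<^sup>+\<theta>. ennreal (\<bar>sin \<theta> * poly (pderiv P) (cos \<theta>)\<bar> powr q) * ?W \<theta> * ?I \<theta> \<partial>lborel)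
    \<le> ennreal (C * n powr q) * (\<integral>\<^sup>+\<theta>. ennreal (\<bar>poly P (cos \<theta>)\<bar> powr q) * ?W \<theta> * ?I \<theta> \<partial>lborel)"
    using bernstein_edge_weight[OF ab q] by blast
  have jq: "jacobi_weight \<alpha> \<beta> (cos \<theta>) powr q = (1 - cos \<theta>) powr A * (1 + cos \<theta>) powr B" for \<theta>
    by (simp add: jacobi_weight_def powr_mult powr_powr A_def B_def)
  have ae: "AE \<theta> in lborel. \<theta> \<noteq> 0 \<and> \<theta> \<noteq> pi" for \<theta> :: real
    using AE_lborel_singleton[of 0] AE_lborel_singleton[of pi] by eventually_elim auto
  define K' where "K' = (R * C * R) powr (1 / q)"
  have "Lp_le p (\<lambda>x. jacobi_weight (\<alpha> + 1 / 2) (\<beta> + 1 / 2) x * poly (pderiv P) x) (K' * n * K)"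
    if n: "n \<ge> 1" "degree P < n" and P: "Lp_le p (\<lambda>x. jacobi_weight \<alpha> \<beta> x * poly P x) K" for n K and P :: "real poly"
  proof -
    have K: "K \<ge> 0" using Lp_leD(1)[OF P] .
    have "(\<integral>\<^sup>+x. ennreal (\<bar>jacobi_weight (\<alpha> + 1 / 2) (\<beta> + 1 / 2) x * poly (pderiv P) x\<bar> powr q) * indicator {-1..1} x \<partial>lborel)
      = (\<integral>\<^sup>+\<theta>. ennreal (\<bar>jacobi_weight (\<alpha> + 1 / 2) (\<beta> + 1 / 2) (cos \<theta>) * poly (pderiv P) (cos \<theta>)\<bar> powr q) * ennreal (sin \<theta>) * ?I \<theta> \<partial>lborel)"
      by (rule nn_integral_cos_substitution) measurable
    also have "\<dots> \<le> (\<integral>\<^sup>+\<theta>. ennreal R * (ennreal (\<bar>sin \<theta> * poly (pderiv P) (cos \<theta>)\<bar> powr q) * ?W \<theta> * ?I \<theta>) \<partial>lborel)"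
    proof (rule nn_integral_mono_AE)
      show "AE \<theta> in lborel. ennreal (\<bar>jacobi_weight (\<alpha> + 1 / 2) (\<beta> + 1 / 2) (cos \<theta>) * poly (pderiv P) (cos \<theta>)\<bar> powr q) * ennreal (sin \<theta>) * ?I \<theta>
        \<le> ennreal R * (ennreal (\<bar>sin \<theta> * poly (pderiv P) (cos \<theta>)\<bar> powr q) * ?W \<theta> * ?I \<theta>)"
        using ae
      proof eventually_elim
        case (elim \<theta>)
        show ?case
        proof (cases "\<theta> \<in> {0..pi}")
          case True
          with elim have \<theta>: "0 < \<theta>" "\<theta> < pi" by auto
          let ?x = "\<bar>sin \<theta> * poly (pderiv P) (cos \<theta>)\<bar> powr q"
          have "\<bar>jacobi_weight (\<alpha> + 1 / 2) (\<beta> + 1 / 2) (cos \<theta>) * poly (pderiv P) (cos \<theta>)\<bar> powr q * sin \<theta>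
             = ?x * ((1 - cos \<theta>) powr A * (1 + cos \<theta>) powr B * sin \<theta>)"
            unfolding jacobi_weight_half_cos[OF \<theta>] jq[symmetric]
            by (simp add: abs_mult powr_mult jacobi_weight_nonneg mult_ac)
          also have "\<dots> \<le> ?x * (R * edge_weight (2 * A + 1) (2 * B + 1) 0 \<theta>)"
            unfolding R_def by (intro mult_left_mono cos_jacobi_sin_powr_bounds \<theta>) auto
          finally show ?thesis using True R sin_bounds(1)[OF \<theta>]
            by (simp add: ennreal_mult[symmetric] edge_weight_nonneg ennreal_leI mult_ac)
        qed simp
      qed
    qed
    also have "\<dots> = ennreal R * (\<integral>\<^sup>+\<theta>. ennreal (\<bar>sin \<theta> * poly (pderiv P) (cos \<theta>)\<bar> powr q) * ?W \<theta> * ?I \<theta> \<partial>lborel)"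
      by (rule nn_integral_cmult) measurable
    also have "\<dots> \<le> ennreal R * (ennreal (C * n powr q) * (\<integral>\<^sup>+\<theta>. ennreal (\<bar>poly P (cos \<theta>)\<bar> powr q) * ?W \<theta> * ?I \<theta> \<partial>lborel))"
      by (intro mult_left_mono bern n) auto
    also have "(\<integral>\<^sup>+\<theta>. ennreal (\<bar>poly P (cos \<theta>)\<bar> powr q) * ?W \<theta> * ?I \<theta> \<partial>lborel)
      \<le> (\<integral>\<^sup>+\<theta>. ennreal R * (ennreal (\<bar>jacobi_weight \<alpha> \<beta> (cos \<theta>) * poly P (cos \<theta>)\<bar> powr q) * ennreal (sin \<theta>) * ?I \<theta>) \<partial>lborel)"
    proof (rule nn_integral_mono_AE)
      show "AE \<theta> in lborel. ennreal (\<bar>poly P (cos \<theta>)\<bar> powr q) * ?W \<theta> * ?I \<theta>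
         \<le> ennreal R * (ennreal (\<bar>jacobi_weight \<alpha> \<beta> (cos \<theta>) * poly P (cos \<theta>)\<bar> powr q) * ennreal (sin \<theta>) * ?I \<theta>)"
        using ae
      proof eventually_elim
        case (elim \<theta>)
        show ?case
        proof (cases "\<theta> \<in> {0..pi}")
          case True
          with elim have \<theta>: "0 < \<theta>" "\<theta> < pi" by auto
          let ?x = "\<bar>poly P (cos \<theta>)\<bar> powr q"
          have "?x * edge_weight (2 * A + 1) (2 * B + 1) 0 \<theta> \<le> ?x * (R * ((1 - cos \<theta>) powr A * (1 + cos \<theta>) powr B * sin \<theta>))"
            unfolding R_def by (intro mult_left_mono cos_jacobi_sin_powr_bounds \<theta>) auto
          also have "\<dots> = R * (\<bar>jacobi_weight \<alpha> \<beta> (cos \<theta>) * poly P (cos \<theta>)\<bar> powr q * sin \<theta>)"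
            unfolding jq[symmetric] by (simp add: abs_mult powr_mult jacobi_weight_nonneg mult_ac)
          finally show ?thesis using True R sin_bounds(1)[OF \<theta>]
            by (simp add: ennreal_mult[symmetric] edge_weight_nonneg ennreal_leI)
        qed simp
      qed
    qed
    also have "\<dots> = ennreal R * (\<integral>\<^sup>+\<theta>. ennreal (\<bar>jacobi_weight \<alpha> \<beta> (cos \<theta>) * poly P (cos \<theta>)\<bar> powr q) * ennreal (sin \<theta>) * ?I \<theta> \<partial>lborel)"
      by (rule nn_integral_cmult) measurable
    also have "(\<integral>\<^sup>+\<theta>. ennreal (\<bar>jacobi_weight \<alpha> \<beta> (cos \<theta>) * poly P (cos \<theta>)\<bar> powr q) * ennreal (sin \<theta>) * ?I \<theta> \<partial>lborel)
      = (\<integral>\<^sup>+x. ennreal (\<bar>jacobi_weight \<alpha> \<beta> x * poly P x\<bar> powr q) * indicator {-1..1} x \<partial>lborel)"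
      by (rule nn_integral_cos_substitution[symmetric]) measurable
    also have "\<dots> \<le> ennreal (K powr q)"
      using P by (subst (asm) Lp_le_finite_iff_lborel) (use p K in \<open>simp_all add: q_def\<close>)
    finally have "(\<integral>\<^sup>+x. ennreal (\<bar>jacobi_weight (\<alpha> + 1 / 2) (\<beta> + 1 / 2) x * poly (pderiv P) x\<bar> powr q) * indicator {-1..1} x \<partial>lborel)
       \<le> ennreal R * (ennreal (C * n powr q) * (ennreal R * ennreal (K powr q)))"
      by (simp add: mult_left_mono)
    also have "\<dots> = ennreal ((R * C * R) * (n powr q * K powr q))"
      using R C by (simp add: ennreal_mult[symmetric] mult_ac)
    also have "(R * C * R) * (n powr q * K powr q) = (K' * n * K) powr q"
      using R C K q by (simp add: K'_def powr_mult powr_powr)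
    finally show ?thesis
      using K by (subst Lp_le_finite_iff_lborel[OF p(2)]) (auto simp: q_def K'_def)
  qed
  then show ?thesis by (intro exI[of _ K']) (auto simp: K'_def)
qed


text \<open>The supremum norm has no Jacobian, so the exponents are 2 \<alpha> and 2 \<beta> without
  the additional 1. The essential bound holds at every interior point by continuity.\<close>

lemma bernstein_step_infinity:
  fixes \<alpha> \<beta> :: real
  assumes J: "0 \<le> \<alpha>" "0 \<le> \<beta>"
  shows "\<exists>C\<ge>0. \<forall>n\<ge>1. \<forall>(P :: real poly) K. degree P < n \<longrightarrow>
    Lp_le \<infinity> (\<lambda>x. jacobi_weight \<alpha> \<beta> x * poly P x) K \<longrightarrow>
    Lp_le \<infinity> (\<lambda>x. jacobi_weight (\<alpha> + 1 / 2) (\<beta> + 1 / 2) x * poly (pderiv P) x) (C * n * K)"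
proof -
  define R where "R = (pi\<^sup>2 / 2) powr (\<bar>\<alpha>\<bar> + \<bar>\<beta>\<bar>)"
  have R: "R \<ge> 0" by (simp add: R_def)
  have "0 \<le> 2 * \<alpha>" "0 \<le> 2 * \<beta>" using J by auto
  from bernstein_edge_weight_sup[OF this] obtain C where C: "C \<ge> 0" and bern: "\<And>n (P :: real poly) K \<theta>. n \<ge> 1 \<Longrightarrow> degree P < n \<Longrightarrow> 0 \<le> K \<Longrightarrow>
    (\<And>\<theta>. \<theta> \<in> {0<..<pi} \<Longrightarrow> \<bar>poly P (cos \<theta>)\<bar> * edge_weight (2 * \<alpha>) (2 * \<beta>) 0 \<theta> \<le> K) \<Longrightarrow> \<theta> \<in> {0..pi} \<Longrightarrow>
    \<bar>sin \<theta> * poly (pderiv P) (cos \<theta>)\<bar> * edge_weight (2 * \<alpha>) (2 * \<beta>) 0 \<theta> \<le> C * n * K" by metis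
  have "Lp_le \<infinity> (\<lambda>x. jacobi_weight (\<alpha> + 1 / 2) (\<beta> + 1 / 2) x * poly (pderiv P) x) (R * C * R * n * K)"
    if n: "n \<ge> 1" "degree P < n" and P: "Lp_le \<infinity> (\<lambda>x. jacobi_weight \<alpha> \<beta> x * poly P x) K" for n K and P :: "real poly"
  proof -
    have K: "K \<ge> 0" using Lp_leD(1)[OF P] .
    have "AE x in lborel. x \<in> {-1..1} \<longrightarrow> \<bar>jacobi_weight \<alpha> \<beta> x * poly P x\<bar> \<le> K"
      using P by (simp add: Lp_le_def AE_lebesgue_on)
    then have ae: "AE x in lborel. x \<in> {-1<..<1} \<longrightarrow> \<bar>jacobi_weight \<alpha> \<beta> x * poly P x\<bar> \<le> K"
      by eventually_elim auto
    have le: "\<bar>jacobi_weight \<alpha> \<beta> x * poly P x\<bar> \<le> K" if "x \<in> {-1<..<1}" for x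
      by (rule AE_imp_everywhere_continuous[OF ae _ that])
         (auto simp: jacobi_weight_def intro!: continuous_intros)
    have T: "\<bar>poly P (cos \<theta>)\<bar> * edge_weight (2 * \<alpha>) (2 * \<beta>) 0 \<theta> \<le> R * K" if "\<theta> \<in> {0<..<pi}" for \<theta>
    proof -
      have \<theta>: "0 < \<theta>" "\<theta> < pi" using that by auto
      have c: "cos \<theta> \<in> {-1<..<1}" using one_minus_cos_bounds(1)[of \<theta>] one_minus_cos_bounds(1)[of "pi - \<theta>"] \<theta> by auto
      have "\<bar>poly P (cos \<theta>)\<bar> * edge_weight (2 * \<alpha>) (2 * \<beta>) 0 \<theta> \<le> \<bar>poly P (cos \<theta>)\<bar> * (R * jacobi_weight \<alpha> \<beta> (cos \<theta>))"
        unfolding R_def jacobi_weight_def by (intro mult_left_mono cos_jacobi_powr_bounds \<theta>) auto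
      also have "\<dots> = R * \<bar>jacobi_weight \<alpha> \<beta> (cos \<theta>) * poly P (cos \<theta>)\<bar>"
        by (simp add: abs_mult jacobi_weight_nonneg)
      also have "\<dots> \<le> R * K" by (intro mult_left_mono le c R)
      finally show ?thesis .
    qed
    have bd: "\<bar>jacobi_weight (\<alpha> + 1 / 2) (\<beta> + 1 / 2) x * poly (pderiv P) x\<bar> \<le> R * C * R * n * K" if x: "x \<noteq> -1" "x \<noteq> 1" "x \<in> {-1..1}" for x
    proof -
      define \<theta> where "\<theta> = arccos x"
      have \<theta>: "0 < \<theta>" "\<theta> < pi" "cos \<theta> = x" using x by (auto simp: \<theta>_def arccos_lt_bounded)
      have "\<bar>jacobi_weight (\<alpha> + 1 / 2) (\<beta> + 1 / 2) x * poly (pderiv P) x\<bar> = \<bar>sin \<theta> * poly (pderiv P) (cos \<theta>)\<bar> * jacobi_weight \<alpha> \<beta> (cos \<theta>)"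
        unfolding \<theta>(3)[symmetric] jacobi_weight_half_cos[OF \<theta>(1,2)] by (simp add: abs_mult jacobi_weight_nonneg)
      also have "\<dots> \<le> \<bar>sin \<theta> * poly (pderiv P) (cos \<theta>)\<bar> * (R * edge_weight (2 * \<alpha>) (2 * \<beta>) 0 \<theta>)"
        unfolding R_def jacobi_weight_def by (intro mult_left_mono cos_jacobi_powr_bounds \<theta>) auto
      also have "\<dots> = R * (\<bar>sin \<theta> * poly (pderiv P) (cos \<theta>)\<bar> * edge_weight (2 * \<alpha>) (2 * \<beta>) 0 \<theta>)" by (simp only: mult_ac)
      also have "\<dots> \<le> R * (C * n * (R * K))"
        using T \<theta> by (intro mult_left_mono bern n R mult_nonneg_nonneg K) auto
      finally show ?thesis by (simp add: mult_ac)
    qed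
    have "AE x in lborel. x \<in> {-1..1} \<longrightarrow> \<bar>jacobi_weight (\<alpha> + 1 / 2) (\<beta> + 1 / 2) x * poly (pderiv P) x\<bar> \<le> R * C * R * n * K"
      using AE_lborel_singleton[of "-1"] AE_lborel_singleton[of 1] by eventually_elim (use bd in blast)
    then show ?thesis using K C R
      by (simp add: Lp_le_def AE_lebesgue_on borel_measurable_lebesgue_onI)
  qed
  then show ?thesis using R C by (intro exI[of _ "R * C * R"]) auto
qed

lemma weighted_bernstein_step:
  fixes \<alpha> \<beta> :: real
  assumes p: "1 \<le> p" and J: "\<alpha> \<in> J p" "\<beta> \<in> J p"
  shows "\<exists>C\<ge>0. \<forall>n\<ge>1. \<forall>(P :: real poly) K. degree P < n \<longrightarrow>
    Lp_le p (\<lambda>x. jacobi_weight \<alpha> \<beta> x * poly P x) K \<longrightarrow>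
    Lp_le p (\<lambda>x. jacobi_weight (\<alpha> + 1 / 2) (\<beta> + 1 / 2) x * poly (pderiv P) x) (C * n * K)"
proof (cases "p = \<infinity>")
  case True
  then show ?thesis using bernstein_step_infinity[of \<alpha> \<beta>] J by (simp add: J_def)
qed (use bernstein_step_finite[OF p _ J] in auto)

lemma J_add: "\<alpha> \<in> J p \<Longrightarrow> 0 \<le> s \<Longrightarrow> \<alpha> + s \<in> J p"
  by (auto simp: J_def split: if_splits)

lemma degree_pderiv_funpow_le: "degree ((pderiv ^^ r) P) \<le> degree (P :: real poly)"
  by (induction r) (auto simp: degree_pderiv)

text \<open>Each derivative raises both exponents by 1/2, which keeps them in \<open>J p\<close>,
  and does not raise the degree, so the same \<open>n\<close> serves in every step.\<close>

lemma weighted_bernstein: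
  fixes \<alpha> \<beta> :: real
  assumes p: "1 \<le> p" and J: "\<alpha> \<in> J p" "\<beta> \<in> J p"
  shows "\<exists>C\<ge>0. \<forall>n\<ge>1. \<forall>(P :: real poly) K. degree P < n \<longrightarrow>
    Lp_le p (\<lambda>x. jacobi_weight \<alpha> \<beta> x * poly P x) K \<longrightarrow>
    Lp_le p (\<lambda>x. jacobi_weight (\<alpha> + r / 2) (\<beta> + r / 2) x * poly ((pderiv ^^ r) P) x) (C * real n ^ r * K)"
proof (induction r)
  case 0
  show ?case by (intro exI[of _ 1]) simp
next
  case (Suc r)
  then obtain C where C: "C \<ge> 0" "\<And>n (P :: real poly) K. n \<ge> 1 \<Longrightarrow> degree P < n \<Longrightarrow>
    Lp_le p (\<lambda>x. jacobi_weight \<alpha> \<beta> x * poly P x) K \<Longrightarrow>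
    Lp_le p (\<lambda>x. jacobi_weight (\<alpha> + r / 2) (\<beta> + r / 2) x * poly ((pderiv ^^ r) P) x) (C * real n ^ r * K)"
    by blast
  obtain D where D: "D \<ge> 0" "\<And>n (P :: real poly) K. n \<ge> 1 \<Longrightarrow> degree P < n \<Longrightarrow>
    Lp_le p (\<lambda>x. jacobi_weight (\<alpha> + r / 2) (\<beta> + r / 2) x * poly P x) K \<Longrightarrow>
    Lp_le p (\<lambda>x. jacobi_weight (\<alpha> + r / 2 + 1 / 2) (\<beta> + r / 2 + 1 / 2) x * poly (pderiv P) x) (D * n * K)"
    using weighted_bernstein_step[OF p J_add[OF J(1)] J_add[OF J(2)], of "r / 2" "r / 2"] by auto
  have half: "x + real r / 2 + 1 / 2 = x + real (Suc r) / 2" for x :: real by (simp add: field_simps)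
  show ?case
  proof (intro exI[of _ "D * C"] conjI allI impI)
    show "0 \<le> D * C" using C D by simp
    fix n :: nat and P :: "real poly" and K
    assume n: "1 \<le> n" and dP: "degree P < n" and P: "Lp_le p (\<lambda>x. jacobi_weight \<alpha> \<beta> x * poly P x) K"
    have "degree ((pderiv ^^ r) P) < n" using degree_pderiv_funpow_le[of r P] dP by simp
    from D(2)[OF n this C(2)[OF n dP P]]
    show "Lp_le p (\<lambda>x. jacobi_weight (\<alpha> + real (Suc r) / 2) (\<beta> + real (Suc r) / 2) x * poly ((pderiv ^^ Suc r) P) x) (D * C * real n ^ Suc r * K)"
      unfolding half by (simp add: mult_ac)
  qed
qed

subsection \<open>Weighted differences\<close>

text \<open>With \<open>\<mu> = k * h / 2\<close> these are the points of the interval at which the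
  difference of order \<open>k\<close> and step \<open>h * \<phi> x\<close> is not set to 0.\<close>

definition diff_domain :: "real \<Rightarrow> real set" where
  "diff_domain \<mu> = {x \<in> {-1..1}. \<mu> * \<phi> x \<le> 1 - \<bar>x\<bar>}"

lemma borel_measurable_phi [measurable]: "\<phi> \<in> borel_measurable borel"
  unfolding \<phi>_def[abs_def] by measurable

lemma sets_diff_domain [measurable]: "diff_domain \<mu> \<in> sets borel"
  unfolding diff_domain_def by measurable

lemma phi_nonneg: "x \<in> {-1..1} \<Longrightarrow> 0 \<le> \<phi> x"
  using abs_square_le_1[of x] by (auto simp: \<phi>_def)

lemma phi_pos: "\<bar>x\<bar> < 1 \<Longrightarrow> 0 < \<phi> x"
  by (auto simp: \<phi>_def abs_square_less_1)

lemma phi_sq: "\<bar>x\<bar> \<le> 1 \<Longrightarrow> (\<phi> x)\<^sup>2 = (1 - \<bar>x\<bar>) * (1 + \<bar>x\<bar>)"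
proof -
  assume "\<bar>x\<bar> \<le> 1"
  then have "x\<^sup>2 \<le> 1" by (simp only: abs_square_le_1)
  then have "(\<phi> x)\<^sup>2 = 1 - \<bar>x\<bar> * \<bar>x\<bar>" by (simp add: \<phi>_def power2_eq_square)
  then show ?thesis by (simp add: algebra_simps)
qed

lemma diff_domain_shift:
  assumes "x \<in> diff_domain \<mu>" "\<bar>\<nu>\<bar> \<le> \<mu>"
  shows "x + \<nu> * \<phi> x \<in> {-1..1}" "\<bar>\<nu> * \<phi> x\<bar> \<le> \<mu> * \<phi> x" "\<mu> * \<phi> x \<le> 1 - \<bar>x\<bar>" "\<bar>x\<bar> \<le> 1"
proof -
  have x: "\<bar>x\<bar> \<le> 1" "\<mu> * \<phi> x \<le> 1 - \<bar>x\<bar>" "0 \<le> \<phi> x"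
    using assms phi_nonneg[of x] by (auto simp: diff_domain_def)
  then show l: "\<bar>\<nu> * \<phi> x\<bar> \<le> \<mu> * \<phi> x" using assms by (simp add: abs_mult mult_right_mono)
  show "x + \<nu> * \<phi> x \<in> {-1..1}" using l x by auto
qed (use assms in \<open>auto simp: diff_domain_def\<close>)

text \<open>Squaring the defining inequality and cancelling the positive factor 1 - |x|, which also
  divides the square of \<open>\<phi> x\<close>.\<close>

lemma diff_domain_bound:
  assumes "x \<in> diff_domain \<mu>" "0 \<le> \<mu>" "\<bar>x\<bar> < 1"
  shows "\<mu>\<^sup>2 * (1 + \<bar>x\<bar>) \<le> 1 - \<bar>x\<bar>"
proof -
  have "(\<mu> * \<phi> x)\<^sup>2 \<le> (1 - \<bar>x\<bar>)\<^sup>2"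
    using diff_domain_shift(3)[OF assms(1), of 0] assms(2) phi_pos[OF assms(3)] by (intro power_mono) auto
  then have "(1 - \<bar>x\<bar>) * (\<mu>\<^sup>2 * (1 + \<bar>x\<bar>)) \<le> (1 - \<bar>x\<bar>) * (1 - \<bar>x\<bar>)"
    using phi_sq[of x] assms(3) by (simp add: power_mult_distrib power2_eq_square mult_ac)
  then show ?thesis using assms(3) by (subst (asm) mult_le_cancel_left_pos) auto
qed

text \<open>Change of variables \<open>y = x + \<nu> * \<phi> x\<close>. Where both shifts by \<mu>
  \<phi> remain in the interval, 2 \<mu> |x| is at most \<open>\<phi> x\<close>, so the derivative 1
  - \<nu> x / \<phi> x is at least 1/2; this is the origin of the factor 2.\<close>

lemma nn_integral_shift_le:
  fixes F :: "real \<Rightarrow> ennreal"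
  assumes [measurable]: "F \<in> borel_measurable borel" and \<nu>: "\<bar>\<nu>\<bar> \<le> \<mu>"
  shows "(\<integral>\<^sup>+x. F (x + \<nu> * \<phi> x) * indicator (diff_domain \<mu>) x \<partial>lborel) \<le> 2 * (\<integral>\<^sup>+x. F x * indicator {-1..1} x \<partial>lborel)"
proof (cases "\<mu> = 0")
  \<comment> \<open>Separate because for \<open>\<mu> = 0\<close> the interval
    \<open>{-\<rho>..\<rho>}\<close> below would reach the end points, where \<open>\<phi>\<close>
    is not differentiable.\<close>
  case True
  then have "\<nu> = 0" "diff_domain \<mu> = {-1..1}" using \<nu> by (auto simp: diff_domain_def)
  moreover have "X \<le> 2 * X" for X :: ennreal
    using add_increasing[of X X X] by (simp add: mult_2)
  ultimately show ?thesis by simp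
next
  case False
  with \<nu> have \<mu>: "\<mu> > 0" by linarith
  \<comment> \<open>The solution of \<open>\<mu> * \<phi> x = 1 - x\<close> other than 1. If it is
    nonnegative, the domain is \<open>{-\<rho>..\<rho>}\<close> together with the two end
    points.\<close>
  define \<rho> where "\<rho> = (1 - \<mu>\<^sup>2) / (1 + \<mu>\<^sup>2)"
  have \<rho>1: "\<rho> < 1" using \<mu> by (simp add: \<rho>_def field_simps add_pos_nonneg)
  have dom: "\<bar>x\<bar> \<le> \<rho>" if "x \<in> diff_domain \<mu>" "\<bar>x\<bar> < 1" for x
  proof -
    have "1 + \<mu>\<^sup>2 > 0" by (simp add: add_pos_nonneg)
    then show ?thesis
      using diff_domain_bound[OF that(1) _ that(2)] \<mu> by (simp add: \<rho>_def pos_le_divide_eq algebra_simps)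
  qed
  have rev: "\<mu> * \<phi> x \<le> 1 - \<bar>x\<bar>" "\<mu> * \<bar>x\<bar> * 2 \<le> \<phi> x" "\<bar>x\<bar> < 1" if "\<bar>x\<bar> \<le> \<rho>" for x
  proof -
    show x: "\<bar>x\<bar> < 1" using that \<rho>1 by simp
    have p: "1 + \<mu>\<^sup>2 > 0" by (simp add: add_pos_nonneg)
    then have le: "\<mu>\<^sup>2 * (1 + \<bar>x\<bar>) \<le> 1 - \<bar>x\<bar>"
      using that by (simp add: \<rho>_def pos_le_divide_eq algebra_simps)
    have "(\<mu> * \<phi> x)\<^sup>2 \<le> (1 - \<bar>x\<bar>)\<^sup>2"
      using mult_left_mono[OF le, of "1 - \<bar>x\<bar>"] phi_sq[of x] x by (simp add: power_mult_distrib power2_eq_square mult_ac)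
    then show 1: "\<mu> * \<phi> x \<le> 1 - \<bar>x\<bar>" by (rule power2_le_imp_le) (use x in simp)
    have "\<phi> x * (\<mu> * \<bar>x\<bar> * 2) = (\<mu> * \<phi> x) * (2 * \<bar>x\<bar>)" by simp
    also have "\<dots> \<le> (1 - \<bar>x\<bar>) * (1 + \<bar>x\<bar>)"
      using 1 x by (intro mult_mono) auto
    also have "\<dots> = \<phi> x * \<phi> x" using phi_sq[of x] x by (simp add: power2_eq_square)
    finally show "\<mu> * \<bar>x\<bar> * 2 \<le> \<phi> x"
      using phi_pos[OF x] by (subst (asm) mult_le_cancel_left_pos) auto
  qed
  have ae: "AE x in lborel. x \<noteq> 1 \<and> x \<noteq> -1 \<and> x \<noteq> (0::real)"
    using AE_lborel_singleton[of 1] AE_lborel_singleton[of "-1"] AE_lborel_singleton[of 0] by eventually_elim auto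
  show ?thesis
  proof (cases "\<rho> > 0")
    \<comment> \<open>Here \<mu> is at least 1 and the domain is contained in {-1, 0, 1}, a null
      set.\<close>
    case False
    have "(\<integral>\<^sup>+x. F (x + \<nu> * \<phi> x) * indicator (diff_domain \<mu>) x \<partial>lborel) = (\<integral>\<^sup>+x. 0 \<partial>(lborel :: real measure))"
    proof (rule nn_integral_cong_AE)
      show "AE x in lborel. F (x + \<nu> * \<phi> x) * indicator (diff_domain \<mu>) x = 0"
        using ae
      proof eventually_elim
        case (elim x)
        have "x \<notin> diff_domain \<mu>"
        proof
          assume x: "x \<in> diff_domain \<mu>"
          then have "\<bar>x\<bar> < 1" using elim by (auto simp: diff_domain_def abs_if)
          from dom[OF x this] show False using False elim by auto
        qed
        then show ?case by simp
      qed
    qed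
    then show ?thesis by simp
  next
    case True
    let ?g = "\<lambda>x. x + \<nu> * \<phi> x" and ?g' = "\<lambda>x. 1 - \<nu> * (x / \<phi> x)"
    have g': "?g' x \<ge> 1 / 2" if "\<bar>x\<bar> \<le> \<rho>" for x
    proof -
      have f: "\<phi> x > 0" by (rule phi_pos[OF rev(3)[OF that]])
      have "\<bar>\<nu> * x\<bar> \<le> \<mu> * \<bar>x\<bar>" using \<nu> by (simp add: abs_mult mult_right_mono)
      then have "2 * \<bar>\<nu> * x\<bar> \<le> \<phi> x" using rev(2)[OF that] by simp
      then have "2 * (\<nu> * x) \<le> \<phi> x" by linarith
      then have "(\<nu> * x) / \<phi> x \<le> 1 / 2" using f by (subst pos_divide_le_eq) auto
      then show ?thesis unfolding times_divide_eq_right by linarith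
    qed
    have deriv: "(?g has_real_derivative ?g' x) (at x)" if "x \<in> {-\<rho>..\<rho>}" for x
    proof -
      have "\<bar>x\<bar> < 1" using that \<rho>1 by auto
      then have "1 - x\<^sup>2 > 0" by (simp add: abs_square_less_1)
      then show ?thesis unfolding \<phi>_def
        by (auto intro!: derivative_eq_intros simp: field_simps)
    qed
    have "(\<integral>\<^sup>+x. F (?g x) * indicator (diff_domain \<mu>) x \<partial>lborel) \<le> (\<integral>\<^sup>+x. 2 * (F (?g x) * ennreal (?g' x) * indicator {-\<rho>..\<rho>} x) \<partial>lborel)"
    proof (rule nn_integral_mono_AE)
      show "AE x in lborel. F (?g x) * indicator (diff_domain \<mu>) x \<le> 2 * (F (?g x) * ennreal (?g' x) * indicator {-\<rho>..\<rho>} x)"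
        using ae
      proof eventually_elim
        case (elim x)
        show ?case
        proof (cases "x \<in> diff_domain \<mu>")
          case x: True
          then have "\<bar>x\<bar> < 1" using elim by (auto simp: diff_domain_def abs_if)
          from dom[OF x this] have r: "\<bar>x\<bar> \<le> \<rho>" .
          have "1 = 2 * (1 / 2 :: real)" by simp
          also have "\<dots> \<le> 2 * ?g' x" by (rule mult_left_mono[OF g'[OF r]]) simp
          finally have "1 \<le> 2 * ?g' x" .
          then have "ennreal 1 \<le> ennreal (2 * ?g' x)" by (rule ennreal_leI)
          then have "F (?g x) * ennreal 1 \<le> F (?g x) * ennreal (2 * ?g' x)"
            by (rule mult_left_mono) simp
          also have "ennreal (2 * ?g' x) = 2 * ennreal (?g' x)"
            by (subst ennreal_mult') simp_all
          finally show ?thesis using x r by (simp add: mult.left_commute abs_le_iff)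
        qed simp
      qed
    qed
    also have "\<dots> = 2 * (\<integral>\<^sup>+x. F (?g x) * ennreal (?g' x) * indicator {-\<rho>..\<rho>} x \<partial>lborel)"
      by (rule nn_integral_cmult) measurable
    also have "(\<integral>\<^sup>+x. F (?g x) * ennreal (?g' x) * indicator {-\<rho>..\<rho>} x \<partial>lborel) = (\<integral>\<^sup>+x. F x * indicator {?g (-\<rho>)..?g \<rho>} x \<partial>lborel)"
    proof (rule nn_integral_substitution_aux[symmetric])
      show "continuous_on {-\<rho>..\<rho>} ?g'"
      proof -
        have "sqrt (1 - x\<^sup>2) \<noteq> 0" if "x \<in> {-\<rho>..\<rho>}" for x
          using that \<rho>1 abs_square_less_1[of x] by auto
        then show ?thesis unfolding \<phi>_def by (intro continuous_intros) auto
      qed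
      show "0 \<le> ?g' x" if "x \<in> {-\<rho>..\<rho>}" for x
        by (rule order.trans[OF _ g']) (use that in \<open>auto simp: abs_le_iff\<close>)
    qed (use True deriv in auto)
    also have "\<dots> \<le> (\<integral>\<^sup>+x. F x * indicator {-1..1} x \<partial>lborel)"
    proof (rule nn_integral_mono)
      have "-\<rho> \<in> diff_domain \<mu>" "\<rho> \<in> diff_domain \<mu>"
        using rev(1)[of "-\<rho>"] rev(1)[of \<rho>] True \<rho>1 by (auto simp: diff_domain_def)
      then have "?g (-\<rho>) \<in> {-1..1}" "?g \<rho> \<in> {-1..1}"
        using \<nu> by (blast intro: diff_domain_shift(1))+
      then show "F x * indicator {?g (-\<rho>)..?g \<rho>} x \<le> F x * indicator {-1..1} x" for x
        by (intro mult_left_mono) (auto split: split_indicator)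
    qed
    finally show ?thesis by (simp add: mult_left_mono)
  qed
qed

text \<open>The preimage of a null set under the shift is a null set, by the integral bound for its
  indicator.\<close>

lemma AE_shift:
  assumes ae: "AE x in lborel. x \<in> {-1..1} \<longrightarrow> P x" and \<nu>: "\<bar>\<nu>\<bar> \<le> \<mu>"
  shows "AE x in lborel. x \<in> diff_domain \<mu> \<longrightarrow> P (x + \<nu> * \<phi> x)"
proof -
  obtain N where N: "N \<in> null_sets lborel" "\<And>x. x \<in> {-1..1} \<Longrightarrow> \<not> P x \<Longrightarrow> x \<in> N"
    using ae unfolding eventually_ae_filter by auto
  have [measurable]: "N \<in> sets borel" using N(1) by auto
  have "(\<integral>\<^sup>+x. indicator N (x + \<nu> * \<phi> x) * indicator (diff_domain \<mu>) x \<partial>lborel) \<le> 2 * (\<integral>\<^sup>+x. indicator N x * indicator {-1..1} x \<partial>lborel)"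
    by (rule nn_integral_shift_le[OF _ \<nu>]) measurable
  also have "(\<integral>\<^sup>+x. indicator N x * indicator {-1..1} x \<partial>lborel) \<le> (\<integral>\<^sup>+x. indicator N x \<partial>(lborel :: real measure))"
    by (rule nn_integral_mono) (auto split: split_indicator)
  also have "\<dots> = 0" using N(1) by (simp add: null_sets_def)
  finally have "(\<integral>\<^sup>+x. indicator N (x + \<nu> * \<phi> x) * indicator (diff_domain \<mu>) x \<partial>lborel) = (0 :: ennreal)"
    by (simp add: mult_left_mono)
  then have "AE x in lborel. indicator N (x + \<nu> * \<phi> x) * indicator (diff_domain \<mu>) x = (0 :: ennreal)"
    by (subst (asm) nn_integral_0_iff_AE) auto
  then show ?thesis
  proof eventually_elim
    case (elim x)
    show ?case
    proof
      assume x: "x \<in> diff_domain \<mu>"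
      with elim have "x + \<nu> * \<phi> x \<notin> N" by (simp add: indicator_def split: if_split_asm)
      then show "P (x + \<nu> * \<phi> x)" using N(2) diff_domain_shift(1)[OF x \<nu>] by blast
    qed
  qed
qed

lemma lebesgue_on_borel_representative:
  fixes g :: "real \<Rightarrow> real"
  assumes "g \<in> borel_measurable (lebesgue_on {-1..1})"
  obtains g0 where "g0 \<in> borel_measurable borel" "AE x in lborel. x \<in> {-1..1} \<longrightarrow> g x = g0 x"
proof -
  have "(\<lambda>x. if x \<in> {-1..1} then g x else 0) \<in> borel_measurable (completion lborel)"
    using assms by (intro borel_measurable_if_I) auto
  from completion_ex_borel_measurable_real[OF this] obtain g0 where
    "g0 \<in> borel_measurable lborel" "AE x in lborel. (if x \<in> {-1..1} then g x else 0) = g0 x" by auto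
  moreover from this(2) have "AE x in lborel. x \<in> {-1..1} \<longrightarrow> g x = g0 x"
  proof eventually_elim
    case (elim x)
    then show ?case by (auto split: if_split_asm)
  qed
  ultimately show ?thesis using that[of g0] by simp
qed

lemma borel_measurable_lebesgue_on_AE:
  fixes f g :: "real \<Rightarrow> real"
  assumes f: "f \<in> borel_measurable borel" and ae: "AE x in lborel. x \<in> {-1..1} \<longrightarrow> f x = g x"
  shows "g \<in> borel_measurable (lebesgue_on {-1..1})"
proof -
  have "(\<lambda>x. if x \<in> {-1..1} then f x else 0) \<in> borel_measurable lebesgue"
    by (intro measurable_completion) (use f in simp)
  moreover have "AE x in lebesgue. (if x \<in> {-1..1} then f x else 0) = (if x \<in> {-1..1} then g x else 0)"
    unfolding AE_completion_iff using ae by eventually_elim auto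
  ultimately have "(\<lambda>x. if x \<in> {-1..1} then g x else 0) \<in> borel_measurable lebesgue"
    by (rule borel_measurable_AE)
  then show ?thesis by (subst (asm) borel_measurable_if) auto
qed

text \<open>Composition is harmless for a Borel representative; by the preceding fact about null
  sets, changing the function on a null set changes the composition only on a null set.\<close>

lemma shift_measurable:
  fixes g :: "real \<Rightarrow> real"
  assumes g: "g \<in> borel_measurable (lebesgue_on {-1..1})" and \<nu>: "\<bar>\<nu>\<bar> \<le> \<mu>"
  shows "(\<lambda>x. if x \<in> diff_domain \<mu> then g (x + \<nu> * \<phi> x) else 0) \<in> borel_measurable (lebesgue_on {-1..1})"
proof -
  obtain g0 where g0[measurable]: "g0 \<in> borel_measurable borel" and ae: "AE x in lborel. x \<in> {-1..1} \<longrightarrow> g x = g0 x"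
    using lebesgue_on_borel_representative[OF g] .
  show ?thesis
  proof (rule borel_measurable_lebesgue_on_AE)
    show "(\<lambda>x. if x \<in> diff_domain \<mu> then g0 (x + \<nu> * \<phi> x) else 0) \<in> borel_measurable borel" by measurable
    show "AE x in lborel. x \<in> {-1..1} \<longrightarrow> (if x \<in> diff_domain \<mu> then g0 (x + \<nu> * \<phi> x) else 0) = (if x \<in> diff_domain \<mu> then g (x + \<nu> * \<phi> x) else 0)"
      using AE_shift[OF ae \<nu>] by eventually_elim auto
  qed
qed

text \<open>The change of variables costs the factor 2^(1/p) for finite \<open>p\<close> and nothing
  for infinite \<open>p\<close>; 2 covers both.\<close>

lemma Lp_le_shift:
  assumes p: "1 \<le> p" and g: "Lp_le p g K" and \<nu>: "\<bar>\<nu>\<bar> \<le> \<mu>"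
  shows "Lp_le p (\<lambda>x. if x \<in> diff_domain \<mu> then g (x + \<nu> * \<phi> x) else 0) (2 * K)"
proof (cases "p = \<infinity>")
  case True
  have K: "0 \<le> K" by (rule Lp_leD(1)[OF g])
  have "AE x in lborel. x \<in> {-1..1} \<longrightarrow> \<bar>g x\<bar> \<le> K" using g True by (simp add: Lp_le_def AE_lebesgue_on)
  from AE_shift[OF this \<nu>] have "AE x in lborel. x \<in> {-1..1} \<longrightarrow> \<bar>if x \<in> diff_domain \<mu> then g (x + \<nu> * \<phi> x) else 0\<bar> \<le> 2 * K"
    by eventually_elim (use K in auto)
  then show ?thesis using shift_measurable[OF Lp_leD(2)[OF g] \<nu>] True K
    by (simp add: Lp_le_def AE_lebesgue_on)
next
  case False
  define q where "q = enn2real p"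
  have q: "q \<ge> 1" using enn2real_ge_1[OF p False] by (simp add: q_def)
  have K: "0 \<le> K" by (rule Lp_leD(1)[OF g])
  obtain g0 where g0[measurable]: "g0 \<in> borel_measurable borel" and ae: "AE x in lborel. x \<in> {-1..1} \<longrightarrow> g x = g0 x"
    using lebesgue_on_borel_representative[OF Lp_leD(2)[OF g]] .
  have "(\<integral>\<^sup>+x. ennreal (\<bar>if x \<in> diff_domain \<mu> then g (x + \<nu> * \<phi> x) else 0\<bar> powr q) * indicator {-1..1} x \<partial>lborel)
     = (\<integral>\<^sup>+x. ennreal (\<bar>g0 (x + \<nu> * \<phi> x)\<bar> powr q) * indicator (diff_domain \<mu>) x \<partial>lborel)"
  proof (rule nn_integral_cong_AE)
    show "AE x in lborel. ennreal (\<bar>if x \<in> diff_domain \<mu> then g (x + \<nu> * \<phi> x) else 0\<bar> powr q) * indicator {-1..1} x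
       = ennreal (\<bar>g0 (x + \<nu> * \<phi> x)\<bar> powr q) * indicator (diff_domain \<mu>) x"
      using AE_shift[OF ae \<nu>] by eventually_elim (auto simp: diff_domain_def split: split_indicator)
  qed
  also have "\<dots> \<le> 2 * (\<integral>\<^sup>+x. ennreal (\<bar>g0 x\<bar> powr q) * indicator {-1..1} x \<partial>lborel)"
    by (rule nn_integral_shift_le[OF _ \<nu>]) measurable
  also have "(\<integral>\<^sup>+x. ennreal (\<bar>g0 x\<bar> powr q) * indicator {-1..1} x \<partial>lborel) = (\<integral>\<^sup>+x. ennreal (\<bar>g x\<bar> powr q) * indicator {-1..1} x \<partial>lborel)"
    by (rule nn_integral_cong_AE) (use ae in eventually_elim, auto split: split_indicator)
  also have "\<dots> \<le> ennreal (K powr q)"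
    using g False by (simp add: Lp_le_def q_def nn_integral_lebesgue_on)
  finally have "(\<integral>\<^sup>+x. ennreal (\<bar>if x \<in> diff_domain \<mu> then g (x + \<nu> * \<phi> x) else 0\<bar> powr q) * indicator {-1..1} x \<partial>lborel) \<le> 2 * ennreal (K powr q)"
    by (simp add: mult_left_mono)
  also have "2 * ennreal (K powr q) = ennreal (2 powr 1 * K powr q)" by (subst ennreal_mult) auto
  also have "\<dots> \<le> ennreal (2 powr q * K powr q)" using q by (intro ennreal_leI mult_right_mono powr_mono) auto
  also have "2 powr q * K powr q = (2 * K) powr q" using K by (simp add: powr_mult)
  finally show ?thesis using shift_measurable[OF Lp_leD(2)[OF g] \<nu>] False K
    by (simp add: Lp_le_def q_def nn_integral_lebesgue_on)
qed


section \<open>Finite differences, Taylor remainders and the modulus\<close>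

lemma alternating_sum_pascal:
  fixes f :: "nat \<Rightarrow> real"
  shows "(\<Sum>i\<le>Suc k. (-1) ^ i * real (Suc k choose i) * f i) = (\<Sum>i\<le>k. (-1) ^ i * real (k choose i) * (f i - f (Suc i)))"
proof -
  have "(\<Sum>i\<le>Suc k. (-1) ^ i * real (Suc k choose i) * f i)
     = f 0 + (\<Sum>i\<le>k. (-1) ^ Suc i * real (Suc k choose Suc i) * f (Suc i))"
    by (subst sum.atMost_Suc_shift) simp
  also have "(\<Sum>i\<le>k. (-1) ^ Suc i * real (Suc k choose Suc i) * f (Suc i))
     = - (\<Sum>i\<le>k. (-1) ^ i * real (k choose i) * f (Suc i)) + (\<Sum>i\<le>k. (-1) ^ Suc i * real (k choose Suc i) * f (Suc i))"
    by (simp add: sum_negf[symmetric] sum.distrib[symmetric] algebra_simps)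
  also have "f 0 + (- (\<Sum>i\<le>k. (-1) ^ i * real (k choose i) * f (Suc i)) + (\<Sum>i\<le>k. (-1) ^ Suc i * real (k choose Suc i) * f (Suc i)))
     = (\<Sum>i\<le>Suc k. (-1) ^ i * real (k choose i) * f i) - (\<Sum>i\<le>k. (-1) ^ i * real (k choose i) * f (Suc i))"
    by (subst sum.atMost_Suc_shift) simp
  also have "(\<Sum>i\<le>Suc k. (-1) ^ i * real (k choose i) * f i) = (\<Sum>i\<le>k. (-1) ^ i * real (k choose i) * f i)"
    by simp
  finally show ?thesis by (simp add: sum_subtractf[symmetric] algebra_simps)
qed

text \<open>Differences of order \<open>k\<close> annihilate polynomials of degree below
  \<open>k\<close>: a first difference lowers the degree, and a difference of order
  \<open>k + 1\<close> is one of order \<open>k\<close> applied to first differences.\<close>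

lemma alternating_sum_power_eq_0:
  fixes a :: real
  shows "j < k \<Longrightarrow> (\<Sum>i\<le>k. (-1) ^ i * real (k choose i) * (real i + a) ^ j) = 0"
proof (induction k arbitrary: j)
  case (Suc k)
  have diff: "(real i + a) ^ j - (real (Suc i) + a) ^ j = - (\<Sum>l<j. real (j choose l) * (real i + a) ^ l)" for i
  proof -
    have "(real (Suc i) + a) ^ j = ((real i + a) + 1) ^ j" by (simp add: algebra_simps)
    also have "\<dots> = (\<Sum>l\<le>j. real (j choose l) * (real i + a) ^ l)" by (subst binomial_ring) simp
    also have "\<dots> = (\<Sum>l<j. real (j choose l) * (real i + a) ^ l) + (real i + a) ^ j"
      by (simp add: lessThan_Suc_atMost[symmetric])
    finally show ?thesis by simp
  qed
  have "(\<Sum>i\<le>Suc k. (-1) ^ i * real (Suc k choose i) * (real i + a) ^ j)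
     = (\<Sum>i\<le>k. (-1) ^ i * real (k choose i) * - (\<Sum>l<j. real (j choose l) * (real i + a) ^ l))"
    unfolding alternating_sum_pascal diff ..
  also have "\<dots> = - (\<Sum>i\<le>k. \<Sum>l<j. real (j choose l) * ((-1) ^ i * real (k choose i) * (real i + a) ^ l))"
    by (simp add: sum_negf sum_distrib_left mult_ac)
  also have "\<dots> = - (\<Sum>l<j. real (j choose l) * (\<Sum>i\<le>k. (-1) ^ i * real (k choose i) * (real i + a) ^ l))"
    by (subst sum.swap) (simp add: sum_distrib_left)
  also have "\<dots> = 0" using Suc by simp
  finally show ?case .
qed simp

definition taylor_remainder :: "nat \<Rightarrow> real poly \<Rightarrow> real \<Rightarrow> real \<Rightarrow> real" where
  "taylor_remainder k Q x y = poly Q (x + y) - (\<Sum>j<k. y ^ j / fact j * poly ((pderiv ^^ j) Q) x)"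

lemma poly_taylor_remainder:
  fixes Q :: "real poly"
  assumes k: "k \<ge> 1"
  shows "((\<lambda>s. (1 - s) ^ (k - 1) / fact (k - 1) * (y ^ k * poly ((pderiv ^^ k) Q) (x + s * y))) has_integral taylor_remainder k Q x y) {0..1}"
proof -
  let ?D = "\<lambda>m s. y ^ m * poly ((pderiv ^^ m) Q) (x + s * y)"
  have "((\<lambda>s. ((1 - s) ^ (k - 1) / fact (k - 1)) *\<^sub>R ?D k s) has_integral
      ?D 0 1 - (\<Sum>i<k. ((1 - 0) ^ i / fact i) *\<^sub>R ?D i 0)) {0..1}"
  proof (rule Taylor_has_integral[where Df = ?D])
    fix m t
    have "((\<lambda>s. poly ((pderiv ^^ m) Q) (x + s * y)) has_real_derivative poly (pderiv ((pderiv ^^ m) Q)) (x + t * y) * y) (at t within {0..1})"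
      by (rule DERIV_chain2[OF poly_DERIV]) (auto intro!: derivative_eq_intros)
    from DERIV_cmult[OF this, of "y ^ m"]
    show "(?D m has_vector_derivative ?D (Suc m) t) (at t within {0..1})"
      by (simp add: has_real_derivative_iff_has_vector_derivative mult_ac)
  qed (use k in auto)
  then show ?thesis by (simp add: taylor_remainder_def)
qed

text \<open>The Taylor polynomial at \<open>x\<close> has degree below \<open>k\<close> in the
  displacement and is annihilated by the difference, so only remainders survive.\<close>

lemma sym_diff_eq_taylor_remainder:
  assumes k: "k \<ge> 1" and dom: "{x - real k * h / 2 .. x + real k * h / 2} \<subseteq> {-1..1}"
  shows "sym_diff k h (poly Q) x = (\<Sum>i=0..k. real (k choose i) * (-1) ^ (k - i) * taylor_remainder k Q x ((real i - real k / 2) * h))"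
proof -
  have sgn: "(-1) ^ (k - i) = (-1) ^ k * ((-1) ^ i :: real)" if "i \<in> {..k}" for i
    using that by (simp add: power_diff[symmetric] minus_one_power_iff)
  have zero: "(\<Sum>i\<le>k. real (k choose i) * (-1) ^ (k - i) * (\<Sum>j<k. ((real i - real k / 2) * h) ^ j / fact j * poly ((pderiv ^^ j) Q) x)) = 0"
  proof -
    have "(\<Sum>i\<le>k. real (k choose i) * (-1) ^ (k - i) * (\<Sum>j<k. ((real i - real k / 2) * h) ^ j / fact j * poly ((pderiv ^^ j) Q) x))
       = (\<Sum>i\<le>k. \<Sum>j<k. (-1) ^ k * (h ^ j / fact j * poly ((pderiv ^^ j) Q) x) * ((-1) ^ i * real (k choose i) * (real i + - (real k / 2)) ^ j))"
      by (intro sum.cong refl) (simp add: sgn sum_distrib_left power_mult_distrib mult_ac)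
    also have "\<dots> = (\<Sum>j<k. (-1) ^ k * (h ^ j / fact j * poly ((pderiv ^^ j) Q) x) * (\<Sum>i\<le>k. (-1) ^ i * real (k choose i) * (real i + - (real k / 2)) ^ j))"
      by (subst sum.swap) (simp only: sum_distrib_left)
    also have "\<dots> = 0" by (intro sum.neutral ballI) (subst alternating_sum_power_eq_0, auto)
    finally show ?thesis .
  qed
  have "sym_diff k h (poly Q) x = (\<Sum>i\<le>k. real (k choose i) * (-1) ^ (k - i) * poly Q (x + (real i - real k / 2) * h))"
    using dom by (simp add: sym_diff_def atMost_atLeast0 algebra_simps)
  also have "\<dots> = \<dots> - (\<Sum>i\<le>k. real (k choose i) * (-1) ^ (k - i) * (\<Sum>j<k. ((real i - real k / 2) * h) ^ j / fact j * poly ((pderiv ^^ j) Q) x))"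
    unfolding zero by simp
  also have "\<dots> = (\<Sum>i\<le>k. real (k choose i) * (-1) ^ (k - i) * taylor_remainder k Q x ((real i - real k / 2) * h))"
    by (simp add: taylor_remainder_def sum_subtractf[symmetric] right_diff_distrib)
  finally show ?thesis by (simp add: atMost_atLeast0)
qed

lemma diff_domain_iff:
  assumes x: "x \<in> {-1..1}" and h: "0 \<le> h"
  shows "{x - real k * (h * \<phi> x) / 2 .. x + real k * (h * \<phi> x) / 2} \<subseteq> {-1..1} \<longleftrightarrow> x \<in> diff_domain (real k * h / 2)"
proof -
  have "0 \<le> real k * (h * \<phi> x)" using phi_nonneg[OF x] h by simp
  then show ?thesis using x by (auto simp: diff_domain_def)
qed

text \<open>The modulus weight measures both distances from the extreme shifted points, so for
  nonnegative exponents it is below the Jacobi weight at every admissible shift. This is where r/2 +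
  \<alpha> and r/2 + \<beta> being nonnegative enters.\<close>

lemma mod_weight_le_jacobi_weight:
  assumes "\<xi> \<ge> 0" "\<zeta> \<ge> 0" and x: "x \<in> diff_domain (\<delta> / 2)" and \<nu>: "\<bar>\<nu>\<bar> \<le> \<delta> / 2"
  shows "mod_weight \<delta> \<xi> \<zeta> x \<le> jacobi_weight \<xi> \<zeta> (x + \<nu> * \<phi> x)"
  unfolding mod_weight_def jacobi_weight_def
  using diff_domain_shift[OF x \<nu>] assms by (intro mult_mono powr_mono2) auto

lemma mod_weight_nonneg: "0 \<le> mod_weight \<delta> \<xi> \<zeta> x"
  by (simp add: mod_weight_def)

lemma borel_measurable_mod_weight [measurable]: "mod_weight \<delta> \<xi> \<zeta> \<in> borel_measurable borel"
  unfolding mod_weight_def[abs_def] by measurable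

lemma weighted_measurableD:
  assumes "(\<lambda>x. jacobi_weight \<xi> \<zeta> x * g x) \<in> borel_measurable (lebesgue_on {-1..1})"
  shows "g \<in> borel_measurable (lebesgue_on {-1..1})"
proof -
  obtain g0 where g0[measurable]: "g0 \<in> borel_measurable borel" and ae: "AE x in lborel. x \<in> {-1..1} \<longrightarrow> jacobi_weight \<xi> \<zeta> x * g x = g0 x"
    using lebesgue_on_borel_representative[OF assms] .
  show ?thesis
  proof (rule borel_measurable_lebesgue_on_AE)
    show "(\<lambda>x. g0 x / jacobi_weight \<xi> \<zeta> x) \<in> borel_measurable borel" by measurable
    show "AE x in lborel. x \<in> {-1..1} \<longrightarrow> g0 x / jacobi_weight \<xi> \<zeta> x = g x"
      using ae AE_lborel_singleton[of 1] AE_lborel_singleton[of "-1"]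
    proof eventually_elim
      case (elim x)
      show ?case
      proof
        assume x: "x \<in> {-1..1}"
        then have "jacobi_weight \<xi> \<zeta> x > 0" using elim by (intro jacobi_weight_pos) auto
        then show "g0 x / jacobi_weight \<xi> \<zeta> x = g x" using elim x by (simp add: field_simps)
      qed
    qed
  qed
qed

lemma Lp_le_cong:
  assumes "\<And>x. x \<in> {-1..1} \<Longrightarrow> f x = g x"
  shows "Lp_le p f K \<longleftrightarrow> Lp_le p g K"
proof -
  have "f \<in> borel_measurable (lebesgue_on {-1..1}) \<longleftrightarrow> g \<in> borel_measurable (lebesgue_on {-1..1})"
    by (rule measurable_cong) (use assms in simp)
  moreover have "(\<integral>\<^sup>+x. ennreal (\<bar>f x\<bar> powr q) \<partial>lebesgue_on {-1..1}) = (\<integral>\<^sup>+x. ennreal (\<bar>g x\<bar> powr q) \<partial>lebesgue_on {-1..1})" for q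
    by (rule nn_integral_cong) (use assms in simp)
  moreover have "(AE x in lebesgue_on {-1..1}. \<bar>f x\<bar> \<le> K) \<longleftrightarrow> (AE x in lebesgue_on {-1..1}. \<bar>g x\<bar> \<le> K)"
    by (rule AE_cong) (use assms in simp)
  ultimately show ?thesis by (simp add: Lp_le_def)
qed

lemma centred_step_le:
  fixes h :: real
  assumes "i \<in> {0..k}" "0 \<le> h"
  shows "\<bar>(real i - real k / 2) * h\<bar> \<le> real k * h / 2"
proof -
  have "\<bar>real i - real k / 2\<bar> \<le> real k / 2" using assms(1) by (intro abs_leI) auto
  then have "\<bar>real i - real k / 2\<bar> * h \<le> real k / 2 * h" using assms(2) by (intro mult_right_mono)
  then show ?thesis using assms(2) by (simp add: abs_mult)
qed

text \<open>The weight is carried to each shifted point, where the shifted function costs a factor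
  2; the binomial coefficients add up to \<open>2 ^ k\<close>.\<close>

lemma modulus_bound_weighted:
  assumes p: "1 \<le> p" and \<xi>: "0 \<le> \<xi>" "0 \<le> \<zeta>" and h: "0 \<le> h"
    and g: "Lp_le p (\<lambda>x. jacobi_weight \<xi> \<zeta> x * g x) K"
  shows "Lp_le p (\<lambda>x. mod_weight (real k * h) \<xi> \<zeta> x * sym_diff k (h * \<phi> x) g x) (2 ^ (k + 1) * K)"
proof -
  let ?\<mu> = "real k * h / 2" and ?\<nu> = "\<lambda>i. (real i - real k / 2) * h"
  let ?w = "mod_weight (real k * h) \<xi> \<zeta>"
  let ?G = "\<lambda>i x. if x \<in> diff_domain ?\<mu> then jacobi_weight \<xi> \<zeta> (x + ?\<nu> i * \<phi> x) * g (x + ?\<nu> i * \<phi> x) else 0"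
  let ?S = "\<lambda>i x. if x \<in> diff_domain ?\<mu> then g (x + ?\<nu> i * \<phi> x) else 0"
  have gm: "g \<in> borel_measurable (lebesgue_on {-1..1})" by (rule weighted_measurableD[OF Lp_leD(2)[OF g]])
  have \<nu>: "\<bar>?\<nu> i\<bar> \<le> ?\<mu>" if "i \<in> {0..k}" for i
    using centred_step_le[OF that h] by simp
  have "Lp_le p (\<lambda>x. real (k choose i) * (-1) ^ (k - i) * (?w x * ?S i x)) (real (k choose i) * (2 * K))" if i: "i \<in> {0..k}" for i
  proof -
    have "Lp_le p (\<lambda>x. ?w x * ?S i x) (2 * K)"
    proof (rule Lp_le_mono[OF Lp_le_shift[OF p g \<nu>[OF i]] p])
      show "(\<lambda>x. ?w x * ?S i x) \<in> borel_measurable (lebesgue_on {-1..1})"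
        by (intro borel_measurable_times shift_measurable gm \<nu> i borel_measurable_lebesgue_onI borel_measurable_mod_weight)
      show "AE x in lebesgue_on {-1..1}. \<bar>?w x * ?S i x\<bar> \<le> \<bar>?G i x\<bar>"
      proof (rule AE_I2)
        fix x
        show "\<bar>?w x * ?S i x\<bar> \<le> \<bar>?G i x\<bar>"
          using mod_weight_le_jacobi_weight[OF \<xi> _ \<nu>[OF i], of x]
          by (auto simp: abs_mult mod_weight_nonneg jacobi_weight_nonneg intro!: mult_right_mono)
      qed
    qed simp
    from Lp_le_cmult[OF this p, of "real (k choose i) * (-1) ^ (k - i)"] show ?thesis
      by (simp add: abs_mult power_abs)
  qed
  then have "Lp_le p (\<lambda>x. \<Sum>i=0..k. real (k choose i) * (-1) ^ (k - i) * (?w x * ?S i x)) (\<Sum>i=0..k. real (k choose i) * (2 * K))"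
    by (rule Lp_le_sum[OF p])
  moreover have "(\<Sum>i=0..k. real (k choose i) * (2 * K)) = 2 ^ (k + 1) * K"
  proof -
    have "(\<Sum>i=0..k. real (k choose i)) = 2 ^ k"
      using choose_row_sum[of k] by (simp add: atMost_atLeast0 flip: of_nat_sum)
    then show ?thesis by (simp add: sum_distrib_right[symmetric])
  qed
  moreover have eq: "mod_weight (real k * h) \<xi> \<zeta> x * sym_diff k (h * \<phi> x) g x = (\<Sum>i=0..k. real (k choose i) * (-1) ^ (k - i) * (?w x * ?S i x))"
    if "x \<in> {-1..1}" for x
    unfolding sym_diff_def diff_domain_iff[OF that h]
    by (auto simp: sum_distrib_left algebra_simps intro!: sum.cong)
  ultimately show ?thesis by (subst Lp_le_cong[OF eq]) simp_all
qed


text \<open>A shift by the fraction \<open>s\<close> of the admissible step leaves at least the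
  fraction 1 - s of the distance 1 - |x|. If the point moves outwards, the other factor 1 + |x| of
  the square of \<open>\<phi>\<close> grows; if it moves inwards, \<open>\<phi>\<close> itself
  grows.\<close>

lemma phi_shift_ge:
  assumes x: "x \<in> diff_domain \<mu>" and \<mu>: "0 \<le> \<mu>" and s: "0 \<le> s" "s \<le> 1" and \<nu>: "\<bar>\<nu>\<bar> \<le> s * \<mu>"
  shows "sqrt (1 - s) * \<phi> x \<le> \<phi> (x + \<nu> * \<phi> x)"
proof -
  let ?y = "x + \<nu> * \<phi> x"
  have sm: "s * \<mu> \<le> \<mu>" using s \<mu> by (simp add: mult_left_le_one_le)
  have f: "0 \<le> \<phi> x" using x phi_nonneg[of x] by (auto simp: diff_domain_def)
  have y: "\<bar>?y\<bar> \<le> 1" using diff_domain_shift(1)[OF x, of \<nu>] \<nu> sm by (auto simp: abs_le_iff)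
  note d = diff_domain_shift(3,4)[OF x, of 0]
  have "\<bar>\<nu> * \<phi> x\<bar> \<le> s * (\<mu> * \<phi> x)" using \<nu> f by (simp add: abs_mult mult_right_mono mult.assoc[symmetric])
  also have "\<dots> \<le> s * (1 - \<bar>x\<bar>)" using d \<mu> s by (intro mult_left_mono) auto
  finally have n: "\<bar>\<nu> * \<phi> x\<bar> \<le> s * (1 - \<bar>x\<bar>)" .
  have "s * (1 - \<bar>x\<bar>) \<le> 1 * (1 - \<bar>x\<bar>)" using s d \<mu> by (intro mult_right_mono) auto
  then have n1: "\<bar>\<nu> * \<phi> x\<bar> \<le> 1 - \<bar>x\<bar>" using n by simp
  have 1: "(1 - s) * (1 - \<bar>x\<bar>) \<le> 1 - \<bar>?y\<bar>" using n by (simp add: algebra_simps)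
  have "(1 - s) * (\<phi> x)\<^sup>2 \<le> (\<phi> ?y)\<^sup>2"
  proof (cases "\<bar>x\<bar> \<le> \<bar>?y\<bar>")
    case True
    have "((1 - s) * (1 - \<bar>x\<bar>)) * (1 + \<bar>x\<bar>) \<le> (1 - \<bar>?y\<bar>) * (1 + \<bar>?y\<bar>)"
      using True y by (intro mult_mono 1) auto
    then show ?thesis using phi_sq[of x] phi_sq[OF y] d \<mu> by (simp add: mult.assoc)
  next
    case False
    have "(1 - s) * (\<phi> x)\<^sup>2 \<le> 1 * (\<phi> x)\<^sup>2" using s by (intro mult_right_mono) auto
    also have "\<dots> = 1 - \<bar>x\<bar> * \<bar>x\<bar>" using phi_sq[of x] d \<mu> by (simp add: algebra_simps)
    also have "\<dots> \<le> 1 - \<bar>?y\<bar> * \<bar>?y\<bar>" using False mult_mono[of "\<bar>?y\<bar>" "\<bar>x\<bar>" "\<bar>?y\<bar>" "\<bar>x\<bar>"] by auto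
    also have "\<dots> = (\<phi> ?y)\<^sup>2" using phi_sq[OF y] by (simp add: algebra_simps)
    finally show ?thesis .
  qed
  then have "(sqrt (1 - s) * \<phi> x)\<^sup>2 \<le> (\<phi> ?y)\<^sup>2" using s by (simp add: power_mult_distrib)
  then show ?thesis by (rule power2_le_imp_le) (use phi_nonneg[of ?y] y in \<open>auto simp: abs_le_iff\<close>)
qed

lemma jacobi_weight_phi:
  assumes "x \<in> {-1<..<1}"
  shows "jacobi_weight (\<xi> + real k / 2) (\<zeta> + real k / 2) x = jacobi_weight \<xi> \<zeta> x * \<phi> x ^ k"
proof -
  have pos: "0 < 1 - x" "0 < 1 + x" using assms by auto
  have "\<phi> x = sqrt ((1 - x) * (1 + x))" by (simp add: \<phi>_def power2_eq_square algebra_simps)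
  then have "\<phi> x = (1 - x) powr (1 / 2) * (1 + x) powr (1 / 2)"
    using pos by (simp add: real_sqrt_mult powr_half_sqrt)
  then have "\<phi> x ^ k = (1 - x) powr (k / 2) * (1 + x) powr (k / 2)"
    using pos by (simp add: power_mult_distrib powr_power)
  then show ?thesis by (simp add: jacobi_weight_def powr_add)
qed

text \<open>At the end points both sides vanish because \<open>0 powr a = 0\<close> for every
  \<open>a\<close>.\<close>

lemma jacobi_weight_phi_le:
  assumes x: "x \<in> {-1..1}"
  shows "jacobi_weight \<xi> \<zeta> x * \<phi> x ^ k \<le> jacobi_weight (\<xi> + real k / 2) (\<zeta> + real k / 2) x"
proof (cases "x \<in> {-1<..<1}")
  case False
  then have "x = 1 \<or> x = -1" using x by auto
  then show ?thesis by (auto simp: jacobi_weight_def)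
qed (simp add: jacobi_weight_phi)

text \<open>
  Near the end points \<open>\<phi>\<close> may be much smaller at the shifted point \<open>x + s \<nu> \<phi>(x)\<close> than at \<open>x\<close>. The loss is
  at most \<open>(1 - s) powr (-k/2)\<close>, which the Taylor kernel \<open>(1 - s)^(k-1)\<close> makes integrable.
\<close>

lemma taylor_remainder_weight_bound:
  assumes k: "k \<ge> 1" and \<xi>: "0 \<le> \<xi>" "0 \<le> \<zeta>" and x: "x \<in> diff_domain (\<delta> / 2)" and \<delta>: "0 \<le> \<delta>" and \<nu>: "\<bar>\<nu>\<bar> \<le> \<delta> / 2" and s: "0 \<le> s" "s < 1"
  shows "mod_weight \<delta> \<xi> \<zeta> x * ((1 - s) ^ (k - 1) * \<bar>(\<nu> * \<phi> x) ^ k\<bar>)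
    \<le> (\<delta> / 2) ^ k * ((1 - s) powr (- (1 / 2)) * jacobi_weight (\<xi> + real k / 2) (\<zeta> + real k / 2) (x + s * \<nu> * \<phi> x))"
proof -
  let ?y = "x + s * \<nu> * \<phi> x"
  have f: "0 \<le> \<phi> x" using x phi_nonneg[of x] by (auto simp: diff_domain_def)
  have sn: "\<bar>s * \<nu>\<bar> \<le> s * (\<delta> / 2)" using mult_left_mono[OF \<nu> s(1)] s by (simp add: abs_mult)
  moreover have "s * (\<delta> / 2) \<le> \<delta> / 2" using s \<delta> by (simp add: mult_left_le_one_le)
  ultimately have sn': "\<bar>s * \<nu>\<bar> \<le> \<delta> / 2" by linarith
  have w: "mod_weight \<delta> \<xi> \<zeta> x \<le> jacobi_weight \<xi> \<zeta> ?y"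
    by (rule mod_weight_le_jacobi_weight[OF \<xi> x sn'])
  have y: "?y \<in> {-1..1}" by (rule diff_domain_shift(1)[OF x sn'])
  have ph: "sqrt (1 - s) * \<phi> x \<le> \<phi> ?y"
    by (rule phi_shift_ge[OF x _ _ _ sn]) (use \<delta> s in auto)
  have "(sqrt (1 - s) * \<phi> x) ^ k \<le> \<phi> ?y ^ k" by (rule power_mono[OF ph]) (use s f in auto)
  then have ph': "(1 - s) powr (k / 2) * \<phi> x ^ k \<le> \<phi> ?y ^ k"
    using s by (simp add: power_mult_distrib powr_half_sqrt[symmetric] powr_power)
  have "(1 - s) ^ (k - 1) = (1 - s) powr (real k - 1)"
    using k s by (simp add: powr_realpow[symmetric] of_nat_diff)
  \<comment> \<open>One half of the exponent pays for the comparison of \<open>\<phi>\<close> at the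
    two points; what remains, k/2 - 1, is at least -1/2 because \<open>k\<close> is at least
    1.\<close>
  also have "\<dots> = (1 - s) powr (k / 2 - 1) * (1 - s) powr (k / 2)"
    by (simp add: powr_add[symmetric])
  also have "\<dots> \<le> (1 - s) powr (- (1 / 2)) * (1 - s) powr (k / 2)"
    using s k by (intro mult_right_mono powr_mono') auto
  finally have k1: "(1 - s) ^ (k - 1) \<le> (1 - s) powr (- (1 / 2)) * (1 - s) powr (k / 2)" .
  have nk: "\<bar>(\<nu> * \<phi> x) ^ k\<bar> \<le> (\<delta> / 2) ^ k * \<phi> x ^ k"
    unfolding power_mult_distrib abs_mult power_abs using \<nu> f by (intro mult_mono power_mono) auto
  have "(1 - s) ^ (k - 1) * \<bar>(\<nu> * \<phi> x) ^ k\<bar> \<le> ((1 - s) powr (- (1 / 2)) * (1 - s) powr (k / 2)) * ((\<delta> / 2) ^ k * \<phi> x ^ k)"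
    by (intro mult_mono k1 nk) auto
  also have "\<dots> = (\<delta> / 2) ^ k * (1 - s) powr (- (1 / 2)) * ((1 - s) powr (k / 2) * \<phi> x ^ k)" by (simp only: mult_ac)
  also have "\<dots> \<le> (\<delta> / 2) ^ k * (1 - s) powr (- (1 / 2)) * \<phi> ?y ^ k"
    using \<delta> by (intro mult_left_mono ph') auto
  finally have a: "(1 - s) ^ (k - 1) * \<bar>(\<nu> * \<phi> x) ^ k\<bar> \<le> (\<delta> / 2) ^ k * (1 - s) powr (- (1 / 2)) * \<phi> ?y ^ k" .
  have "mod_weight \<delta> \<xi> \<zeta> x * ((1 - s) ^ (k - 1) * \<bar>(\<nu> * \<phi> x) ^ k\<bar>)
     \<le> jacobi_weight \<xi> \<zeta> ?y * ((\<delta> / 2) ^ k * (1 - s) powr (- (1 / 2)) * \<phi> ?y ^ k)"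
    by (rule mult_mono[OF w a]) (use s in \<open>auto simp: jacobi_weight_nonneg\<close>)
  also have "\<dots> = (\<delta> / 2) ^ k * (1 - s) powr (- (1 / 2)) * (jacobi_weight \<xi> \<zeta> ?y * \<phi> ?y ^ k)" by (simp only: mult_ac)
  also have "\<dots> \<le> (\<delta> / 2) ^ k * (1 - s) powr (- (1 / 2)) * jacobi_weight (\<xi> + real k / 2) (\<zeta> + real k / 2) ?y"
    using \<delta> by (intro mult_left_mono jacobi_weight_phi_le y) auto
  finally show ?thesis by (simp only: mult.assoc)
qed

lemma nn_integral_inverse_sqrt:
  "(\<integral>\<^sup>+s. ennreal ((1 - s) powr (- (1 / 2)) * indicator {0..<1} s) \<partial>lborel) \<le> ennreal 2"
proof -
  have "((\<lambda>u. u powr (- (1 / 2))) has_integral (1 powr (- (1 / 2) + 1) / (- (1 / 2) + 1))) {0..1::real}"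
    by (rule has_integral_powr_from_0) auto
  then have "(\<integral>\<^sup>+u. ennreal (u powr (- (1 / 2))) * indicator {0..1::real} u \<partial>lborel) = ennreal (1 powr (- (1 / 2) + 1) / (- (1 / 2) + 1))"
    by (intro nn_integral_has_integral_on) auto
  also have "(\<integral>\<^sup>+u. ennreal (u powr (- (1 / 2))) * indicator {0..1::real} u \<partial>lborel)
     = (\<integral>\<^sup>+s. ennreal ((1 - s) powr (- (1 / 2))) * indicator {0..1} (1 - s) \<partial>lborel)"
    by (subst nn_integral_real_affine[where c = "-1" and t = 1]) auto
  finally have "(\<integral>\<^sup>+s. ennreal ((1 - s) powr (- (1 / 2))) * indicator {0..1} (1 - s) \<partial>lborel) = ennreal 2" by simp
  moreover have "(\<integral>\<^sup>+s. ennreal ((1 - s) powr (- (1 / 2)) * indicator {0..<1} s) \<partial>lborel) \<le> (\<integral>\<^sup>+s. ennreal ((1 - s) powr (- (1 / 2))) * indicator {0..1} (1 - s) \<partial>lborel)"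
    by (rule nn_integral_mono) (auto split: split_indicator)
  ultimately show ?thesis by simp
qed

text \<open>The integral form of the remainder is dominated by an average, over the shift parameter
  \<open>s\<close>, of shifted copies of the weighted derivative of order \<open>k\<close>. In the
  factor 4 one 2 is the mass of the averaging kernel and the other the cost of a shift; the
  factorial in the Taylor kernel is bounded below by 1.\<close>

lemma taylor_remainder_Lp_le:
  assumes p: "1 \<le> p" and k: "k \<ge> 1" and \<xi>: "0 \<le> \<xi>" "0 \<le> \<zeta>" and \<delta>: "0 \<le> \<delta>" and \<nu>: "\<bar>\<nu>\<bar> \<le> \<delta> / 2"
    and Q: "Lp_le p (\<lambda>x. jacobi_weight (\<xi> + real k / 2) (\<zeta> + real k / 2) x * poly ((pderiv ^^ k) Q) x) K"
  shows "Lp_le p (\<lambda>x. if x \<in> diff_domain (\<delta> / 2) then mod_weight \<delta> \<xi> \<zeta> x * taylor_remainder k Q x (\<nu> * \<phi> x) else 0) ((\<delta> / 2) ^ k * (4 * K))"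
proof -
  let ?D = "diff_domain (\<delta> / 2)" and ?W = "mod_weight \<delta> \<xi> \<zeta>" and ?Qk = "poly ((pderiv ^^ k) Q)"
  define F where "F x = jacobi_weight (\<xi> + real k / 2) (\<zeta> + real k / 2) x * ?Qk x" for x
  define H where "H x s = (if x \<in> ?D then \<bar>F (x + s * \<nu> * \<phi> x)\<bar> else 0)" for x s
  \<comment> \<open>The point \<open>s = 1\<close> is left out because the weight comparison
    requires \<open>s < 1\<close>.\<close>
  define \<kappa> where "\<kappa> s = (1 - s) powr (- (1 / 2)) * indicator {0..<1} s" for s :: real
  define g where "g x = (if x \<in> ?D then ?W x * taylor_remainder k Q x (\<nu> * \<phi> x) else 0)" for x
  have [measurable]: "F \<in> borel_measurable borel" unfolding F_def[abs_def] by measurable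
  have [measurable]: "\<kappa> \<in> borel_measurable borel" unfolding \<kappa>_def[abs_def] by measurable
  have [measurable]: "g \<in> borel_measurable borel"
    unfolding g_def[abs_def] taylor_remainder_def by measurable
  have A: "0 \<le> (\<delta> / 2) ^ k" using \<delta> by simp
  have bound: "ennreal \<bar>g x\<bar> \<le> (\<integral>\<^sup>+s. ennreal ((\<delta> / 2) ^ k * \<kappa> s * H x s) \<partial>lborel)" for x
  proof (cases "x \<in> ?D")
    case True
    let ?T = "\<lambda>s. (1 - s) ^ (k - 1) / fact (k - 1) * ((\<nu> * \<phi> x) ^ k * ?Qk (x + s * (\<nu> * \<phi> x)))"
    let ?f = "\<lambda>s. \<bar>?T s\<bar>"
    have T: "(?T has_integral taylor_remainder k Q x (\<nu> * \<phi> x)) {0..1}"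
      by (rule poly_taylor_remainder[OF k])
    have c: "continuous_on {0..1} ?T" by (intro continuous_intros) auto
    have fi: "(?f has_integral integral {0..1} ?f) {0..1}"
      by (intro integrable_integral integrable_continuous_real continuous_on_rabs c)
    have "norm (integral {0..1} ?T) \<le> integral {0..1} ?f"
      by (rule integral_norm_bound_integral[OF has_integral_integrable[OF T] has_integral_integrable[OF fi]]) simp
    then have "\<bar>taylor_remainder k Q x (\<nu> * \<phi> x)\<bar> \<le> integral {0..1} ?f"
      unfolding integral_unique[OF T] real_norm_def .
    then have "?W x * \<bar>taylor_remainder k Q x (\<nu> * \<phi> x)\<bar> \<le> ?W x * integral {0..1} ?f"
      by (rule mult_left_mono) (rule mod_weight_nonneg)
    moreover have "\<bar>g x\<bar> = ?W x * \<bar>taylor_remainder k Q x (\<nu> * \<phi> x)\<bar>"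
      using True by (simp add: g_def abs_mult mod_weight_nonneg)
    ultimately have "ennreal \<bar>g x\<bar> \<le> ennreal (?W x * integral {0..1} ?f)"
      by (simp only: ennreal_leI)
    also have "\<dots> = (\<integral>\<^sup>+s. ennreal (?W x * ?f s) * indicator {0..1} s \<partial>lborel)"
      by (rule nn_integral_has_integral_on[symmetric, OF _ _ _ has_integral_mult_right[OF fi]])
         (auto simp: mod_weight_nonneg)
    also have "\<dots> \<le> (\<integral>\<^sup>+s. ennreal ((\<delta> / 2) ^ k * \<kappa> s * H x s) \<partial>lborel)"
    proof (rule nn_integral_mono_AE)
      show "AE s in lborel. ennreal (?W x * ?f s) * indicator {0..1} s \<le> ennreal ((\<delta> / 2) ^ k * \<kappa> s * H x s)"
        using AE_lborel_singleton[of 1]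
      proof eventually_elim
        case (elim s)
        show ?case
        proof (cases "s \<in> {0..1}")
          case s: True
          then have s': "0 \<le> s" "s < 1" using elim by auto
          have "?W x * ?f s = (?W x * ((1 - s) ^ (k - 1) * \<bar>(\<nu> * \<phi> x) ^ k\<bar>)) * (\<bar>?Qk (x + s * \<nu> * \<phi> x)\<bar> / fact (k - 1))"
            using s' by (simp add: abs_mult mult_ac)
          also have "\<dots> \<le> ((\<delta> / 2) ^ k * ((1 - s) powr (- (1 / 2)) * jacobi_weight (\<xi> + real k / 2) (\<zeta> + real k / 2) (x + s * \<nu> * \<phi> x))) * (\<bar>?Qk (x + s * \<nu> * \<phi> x)\<bar> / 1)"
            using A by (intro mult_mono taylor_remainder_weight_bound[OF k \<xi> True \<delta> \<nu> s'] divide_left_mono)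
              (auto simp: fact_ge_1 jacobi_weight_nonneg)
          also have "\<dots> = (\<delta> / 2) ^ k * \<kappa> s * H x s"
            using True s' by (simp add: H_def F_def \<kappa>_def abs_mult jacobi_weight_nonneg)
          finally show ?thesis using s by (simp add: ennreal_leI)
        qed simp
      qed
    qed
    finally show ?thesis .
  qed (simp add: g_def)
  have "Lp_le p g (((\<delta> / 2) ^ k * 2) * (2 * K))"
  proof (rule Lp_le_average[where \<kappa> = "\<lambda>s. (\<delta> / 2) ^ k * \<kappa> s" and H = H])
    show "case_prod H \<in> borel_measurable (lborel \<Otimes>\<^sub>M lborel)"
      unfolding H_def case_prod_beta' by measurable
    show "(\<integral>\<^sup>+s. ennreal ((\<delta> / 2) ^ k * \<kappa> s) \<partial>lborel) \<le> ennreal ((\<delta> / 2) ^ k * 2)"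
    proof -
      have "(\<integral>\<^sup>+s. ennreal ((\<delta> / 2) ^ k * \<kappa> s) \<partial>lborel) = ennreal ((\<delta> / 2) ^ k) * (\<integral>\<^sup>+s. ennreal (\<kappa> s) \<partial>lborel)"
        using A by (subst nn_integral_cmult[symmetric]) (auto simp: ennreal_mult' )
      also have "\<dots> \<le> ennreal ((\<delta> / 2) ^ k) * ennreal 2"
        unfolding \<kappa>_def by (intro mult_left_mono nn_integral_inverse_sqrt) simp
      finally show ?thesis using A by (subst ennreal_mult) auto
    qed
    show "Lp_le p (\<lambda>x. H x s) (2 * K)" if "(\<delta> / 2) ^ k * \<kappa> s \<noteq> 0" for s
    proof -
      have s: "0 \<le> s" "s < 1" using that by (auto simp: \<kappa>_def indicator_def split: if_splits)
      have "\<bar>s * \<nu>\<bar> \<le> 1 * \<bar>\<nu>\<bar>" using s unfolding abs_mult by (intro mult_right_mono) auto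
      then have sn: "\<bar>s * \<nu>\<bar> \<le> \<delta> / 2" using \<nu> by simp
      show ?thesis
        by (rule Lp_le_mono[OF Lp_le_shift[OF p Q sn] p])
           (auto simp: H_def F_def intro!: AE_I2 borel_measurable_lebesgue_onI)
    qed
    show "AE x in lebesgue_on {-1..1}. ennreal \<bar>g x\<bar> \<le> (\<integral>\<^sup>+s. ennreal ((\<delta> / 2) ^ k * \<kappa> s * H x s) \<partial>lborel)"
      by (rule AE_I2) (rule bound)
  qed (use p A Lp_leD(1)[OF Q] in \<open>auto simp: H_def \<kappa>_def borel_measurable_lebesgue_onI\<close>)
  then show ?thesis by (simp add: g_def[abs_def] mult_ac)
qed

text \<open>The \<open>k + 1\<close> remainders are summed with binomial coefficients; their total
  \<open>2 ^ k\<close> cancels the denominator of \<open>(k * h / 2) ^ k\<close>.\<close>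

lemma modulus_bound_poly:
  assumes p: "1 \<le> p" and k: "k \<ge> 1" and \<xi>: "0 \<le> \<xi>" "0 \<le> \<zeta>" and h: "0 \<le> h"
    and Q: "Lp_le p (\<lambda>x. jacobi_weight (\<xi> + real k / 2) (\<zeta> + real k / 2) x * poly ((pderiv ^^ k) Q) x) K"
  shows "Lp_le p (\<lambda>x. mod_weight (real k * h) \<xi> \<zeta> x * sym_diff k (h * \<phi> x) (poly Q) x) (4 * real k ^ k * h ^ k * K)"
proof -
  let ?\<delta> = "real k * h" and ?\<nu> = "\<lambda>i. (real i - real k / 2) * h"
  let ?R = "\<lambda>i x. if x \<in> diff_domain (?\<delta> / 2) then mod_weight ?\<delta> \<xi> \<zeta> x * taylor_remainder k Q x (?\<nu> i * \<phi> x) else 0"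
  have \<nu>: "\<bar>?\<nu> i\<bar> \<le> ?\<delta> / 2" if "i \<in> {0..k}" for i
    using centred_step_le[OF that h] by simp
  have "Lp_le p (\<lambda>x. real (k choose i) * (-1) ^ (k - i) * ?R i x) (real (k choose i) * ((?\<delta> / 2) ^ k * (4 * K)))" if i: "i \<in> {0..k}" for i
    using Lp_le_cmult[OF taylor_remainder_Lp_le[OF p k \<xi> _ \<nu>[OF i] Q] p, of "real (k choose i) * (-1) ^ (k - i)"] h
    by (simp add: abs_mult power_abs)
  then have "Lp_le p (\<lambda>x. \<Sum>i=0..k. real (k choose i) * (-1) ^ (k - i) * ?R i x) (\<Sum>i=0..k. real (k choose i) * ((?\<delta> / 2) ^ k * (4 * K)))"
    by (rule Lp_le_sum[OF p])
  moreover have "(\<Sum>i=0..k. real (k choose i) * ((?\<delta> / 2) ^ k * (4 * K))) = 4 * real k ^ k * h ^ k * K"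
  proof -
    have "(\<Sum>i=0..k. real (k choose i)) = 2 ^ k"
      using choose_row_sum[of k] by (simp add: atMost_atLeast0 flip: of_nat_sum)
    then show ?thesis by (subst sum_distrib_right[symmetric]) (simp add: power_divide power_mult_distrib)
  qed
  moreover have eq: "mod_weight ?\<delta> \<xi> \<zeta> x * sym_diff k (h * \<phi> x) (poly Q) x = (\<Sum>i=0..k. real (k choose i) * (-1) ^ (k - i) * ?R i x)"
    if x: "x \<in> {-1..1}" for x
  proof (cases "x \<in> diff_domain (?\<delta> / 2)")
    case True
    have "sym_diff k (h * \<phi> x) (poly Q) x = (\<Sum>i=0..k. real (k choose i) * (-1) ^ (k - i) * taylor_remainder k Q x ((real i - real k / 2) * (h * \<phi> x)))"
      by (rule sym_diff_eq_taylor_remainder[OF k]) (use diff_domain_iff[OF x h, of k] True in simp)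
    then show ?thesis using True by (simp add: sum_distrib_left mult_ac)
  next
    case False
    then have "\<not> {x - real k * (h * \<phi> x) / 2 .. x + real k * (h * \<phi> x) / 2} \<subseteq> {-1..1}"
      using diff_domain_iff[OF x h, of k] by blast
    then have "sym_diff k (h * \<phi> x) (poly Q) x = 0"
      by (simp only: sym_diff_def if_False)
    with False show ?thesis by simp
  qed
  ultimately show ?thesis by (subst Lp_le_cong[OF eq]) simp_all
qed

subsection \<open>Series of polynomials\<close>

lemma ennreal_abs_suminf_le:
  fixes u :: "nat \<Rightarrow> real"
  assumes "summable u"
  shows "ennreal \<bar>suminf u\<bar> \<le> (\<Sum>j. ennreal \<bar>u j\<bar>)"
proof (cases "(\<Sum>j. ennreal \<bar>u j\<bar>) = top")
  case False
  then have s: "summable (\<lambda>j. \<bar>u j\<bar>)" by (intro summable_suminf_not_top) auto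
  have "ennreal \<bar>suminf u\<bar> \<le> ennreal (\<Sum>j. \<bar>u j\<bar>)" by (intro ennreal_leI summable_rabs s)
  also have "\<dots> = (\<Sum>j. ennreal \<bar>u j\<bar>)" using s by (intro suminf_ennreal2[symmetric]) auto
  finally show ?thesis .
qed simp

definition abs_integral :: "real \<Rightarrow> real \<Rightarrow> real poly \<Rightarrow> ennreal" where
  "abs_integral a b P = (\<integral>\<^sup>+x. ennreal \<bar>poly P x\<bar> * indicator {a..b} x \<partial>lborel)"

lemma abs_integral_mono: "a' \<le> a \<Longrightarrow> b \<le> b' \<Longrightarrow> abs_integral a b P \<le> abs_integral a' b' P"
  unfolding abs_integral_def by (intro nn_integral_mono) (auto split: split_indicator)

lemma poly_diff_le_abs_integral:
  assumes "x \<le> y"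
  shows "ennreal \<bar>poly P y - poly P x\<bar> \<le> abs_integral x y (pderiv P)"
proof -
  have 1: "(poly (pderiv P) has_integral poly P y - poly P x) {x..y}"
    by (rule fundamental_theorem_of_calculus[OF assms])
       (auto simp: has_real_derivative_iff_has_vector_derivative[symmetric] intro: has_field_derivative_at_within)
  have 2: "((\<lambda>t. \<bar>poly (pderiv P) t\<bar>) has_integral integral {x..y} (\<lambda>t. \<bar>poly (pderiv P) t\<bar>)) {x..y}"
    by (intro integrable_integral integrable_continuous_real continuous_intros)
  have "norm (integral {x..y} (poly (pderiv P))) \<le> integral {x..y} (\<lambda>t. \<bar>poly (pderiv P) t\<bar>)"
    by (rule integral_norm_bound_integral[OF has_integral_integrable[OF 1] has_integral_integrable[OF 2]]) simp
  then have "\<bar>poly P y - poly P x\<bar> \<le> integral {x..y} (\<lambda>t. \<bar>poly (pderiv P) t\<bar>)"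
    unfolding integral_unique[OF 1] real_norm_def .
  then have "ennreal \<bar>poly P y - poly P x\<bar> \<le> ennreal (integral {x..y} (\<lambda>t. \<bar>poly (pderiv P) t\<bar>))"
    by (rule ennreal_leI)
  also have "\<dots> = abs_integral x y (pderiv P)"
    unfolding abs_integral_def by (rule nn_integral_has_integral_on[symmetric, OF _ _ _ 2]) auto
  finally show ?thesis .
qed

lemma poly_diff_le_abs_integral':
  assumes "x \<in> {a..b}" "y \<in> {a..b}"
  shows "ennreal \<bar>poly P y - poly P x\<bar> \<le> abs_integral a b (pderiv P)"
proof (cases "x \<le> y")
  case True
  from poly_diff_le_abs_integral[OF this, of P] abs_integral_mono[of a x y b "pderiv P"] assms
  show ?thesis by (auto intro: order.trans)
next
  case False
  from poly_diff_le_abs_integral[of y x P] abs_integral_mono[of a y x b "pderiv P"] assms False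
  show ?thesis by (auto intro: order.trans simp: abs_minus_commute)
qed

text \<open>The minimum of |P| is at most its average, and the oscillation is at most the integral
  of the absolute derivative.\<close>

lemma poly_le_abs_integral:
  assumes ab: "a < b" and x: "x \<in> {a..b}"
    and 0: "abs_integral a b P \<le> ennreal K0" "0 \<le> K0" and 1: "abs_integral a b (pderiv P) \<le> ennreal K1" "0 \<le> K1"
  shows "\<bar>poly P x\<bar> \<le> K0 / (b - a) + K1"
proof -
  have "continuous_on {a..b} (\<lambda>x. \<bar>poly P x\<bar>)" by (intro continuous_intros)
  then obtain y where y: "y \<in> {a..b}" "\<And>z. z \<in> {a..b} \<Longrightarrow> \<bar>poly P y\<bar> \<le> \<bar>poly P z\<bar>"
    using continuous_attains_inf[of "{a..b}" "\<lambda>x. \<bar>poly P x\<bar>"] ab by auto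
  have "ennreal \<bar>poly P y\<bar> * ennreal (b - a) = (\<integral>\<^sup>+x. ennreal \<bar>poly P y\<bar> * indicator {a..b} x \<partial>lborel)"
    using ab by (subst nn_integral_cmult_indicator) auto
  also have "\<dots> \<le> abs_integral a b P"
    unfolding abs_integral_def using y by (intro nn_integral_mono) (auto split: split_indicator intro: ennreal_leI)
  also note 0(1)
  finally have "\<bar>poly P y\<bar> * (b - a) \<le> K0" using 0 ab by (simp add: ennreal_mult[symmetric])
  then have "\<bar>poly P y\<bar> \<le> K0 / (b - a)" using ab by (simp add: field_simps)
  moreover have "ennreal \<bar>poly P x - poly P y\<bar> \<le> ennreal K1"
    using poly_diff_le_abs_integral'[OF y(1) x, of P] 1(1) by (rule order.trans)
  then have "\<bar>poly P x - poly P y\<bar> \<le> K1" using 1 by simp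
  ultimately show ?thesis by linarith
qed

text \<open>The variation is bounded by the integral of the absolute derivative; end points of the
  intervals, which may be shared, form a null set.\<close>

lemma abs_integral_disjoint_sum:
  fixes l u :: "nat \<Rightarrow> real"
  assumes "finite I" and lu: "\<And>i. i \<in> I \<Longrightarrow> l i \<le> u i \<and> {l i..u i} \<subseteq> {a..b}"
    and disj: "disjoint_family_on (\<lambda>i. {l i<..<u i}) I"
  shows "(\<Sum>i\<in>I. ennreal \<bar>poly P (u i) - poly P (l i)\<bar>) \<le> abs_integral a b (pderiv P)"
proof -
  have "(\<Sum>i\<in>I. ennreal \<bar>poly P (u i) - poly P (l i)\<bar>) \<le> (\<Sum>i\<in>I. \<integral>\<^sup>+x. ennreal \<bar>poly (pderiv P) x\<bar> * indicator {l i<..<u i} x \<partial>lborel)"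
  proof (rule sum_mono)
    fix i assume i: "i \<in> I"
    have "ennreal \<bar>poly P (u i) - poly P (l i)\<bar> \<le> abs_integral (l i) (u i) (pderiv P)"
      using lu[OF i] by (intro poly_diff_le_abs_integral) auto
    also have "\<dots> = (\<integral>\<^sup>+x. ennreal \<bar>poly (pderiv P) x\<bar> * indicator {l i<..<u i} x \<partial>lborel)"
      unfolding abs_integral_def
    proof (rule nn_integral_cong_AE)
      show "AE x in lborel. ennreal \<bar>poly (pderiv P) x\<bar> * indicator {l i..u i} x = ennreal \<bar>poly (pderiv P) x\<bar> * indicator {l i<..<u i} x"
        using AE_lborel_singleton[of "l i"] AE_lborel_singleton[of "u i"] by eventually_elim (auto split: split_indicator)
    qed
    finally show "ennreal \<bar>poly P (u i) - poly P (l i)\<bar> \<le> (\<integral>\<^sup>+x. ennreal \<bar>poly (pderiv P) x\<bar> * indicator {l i<..<u i} x \<partial>lborel)" .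
  qed
  also have "\<dots> = (\<integral>\<^sup>+x. (\<Sum>i\<in>I. ennreal \<bar>poly (pderiv P) x\<bar> * indicator {l i<..<u i} x) \<partial>lborel)"
    by (rule nn_integral_sum[symmetric]) measurable
  also have "\<dots> \<le> abs_integral a b (pderiv P)"
    unfolding abs_integral_def
  proof (rule nn_integral_mono)
    fix x
    have "(\<Sum>i\<in>I. ennreal \<bar>poly (pderiv P) x\<bar> * indicator {l i<..<u i} x) = ennreal \<bar>poly (pderiv P) x\<bar> * indicator (\<Union>i\<in>I. {l i<..<u i}) x"
      by (simp add: indicator_UN_disjoint[OF assms(1) disj] sum_distrib_left)
    also have "\<dots> \<le> ennreal \<bar>poly (pderiv P) x\<bar> * indicator {a..b} x"
      using lu by (intro mult_left_mono) (fastforce split: split_indicator)+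
    finally show "(\<Sum>i\<in>I. ennreal \<bar>poly (pderiv P) x\<bar> * indicator {l i<..<u i} x) \<le> ennreal \<bar>poly (pderiv P) x\<bar> * indicator {a..b} x" .
  qed
  finally show ?thesis .
qed

text \<open>The tail of the series has small total variation on the whole interval, whatever the
  intervals in the definition are, and the finitely many remaining terms are Lipschitz
  continuous.\<close>

lemma absolutely_continuous_on_poly_series:
  fixes T :: "nat \<Rightarrow> real poly"
  assumes sm: "\<And>x. x \<in> {a..b} \<Longrightarrow> summable (\<lambda>j. poly (T j) x)"
    and V: "\<And>j. abs_integral a b (pderiv (T j)) \<le> ennreal (C * \<rho> ^ j)" and \<rho>: "0 \<le> \<rho>" "\<rho> < 1" and C: "0 \<le> C"
  shows "absolutely_continuous_on {a..b} (\<lambda>x. \<Sum>j. poly (T j) x)"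
  unfolding absolutely_continuous_on_def
proof (intro allI impI)
  fix \<epsilon> :: real assume \<epsilon>: "0 < \<epsilon>"
  have sr: "summable (\<lambda>j. C * \<rho> ^ j)" using \<rho> by (intro summable_mult summable_geometric) auto
  \<comment> \<open>The tail beyond \<open>L\<close> takes half of \<open>\<epsilon>\<close>; the
    Lipschitz constant \<open>M\<close> of the initial terms then dictates the length allowed for
    the other half.\<close>
  obtain L where "\<forall>n\<ge>L. norm (\<Sum>j. C * \<rho> ^ (j + n)) < \<epsilon> / 2"
    using suminf_exist_split[OF _ sr, of "\<epsilon> / 2"] \<epsilon> by auto
  then have L: "(\<Sum>j. C * \<rho> ^ (j + L)) < \<epsilon> / 2" by (auto simp: abs_less_iff)
  have "\<exists>B\<ge>0. \<forall>x\<in>{a..b}. \<bar>poly (pderiv (T j)) x\<bar> \<le> B" for j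
  proof -
    have "compact ((\<lambda>x. poly (pderiv (T j)) x) ` {a..b})"
      by (intro compact_continuous_image continuous_intros) auto
    from compact_imp_bounded[OF this] obtain B where "\<forall>x\<in>{a..b}. norm (poly (pderiv (T j)) x) \<le> B"
      unfolding bounded_iff by auto
    then show ?thesis by (intro exI[of _ "max 0 B"]) (auto simp: max.coboundedI2)
  qed
  then obtain B where B: "\<And>j. 0 \<le> B j" "\<And>j x. x \<in> {a..b} \<Longrightarrow> \<bar>poly (pderiv (T j)) x\<bar> \<le> B j" by metis
  define M where "M = (\<Sum>j<L. B j)"
  have M: "0 \<le> M" unfolding M_def using B by (intro sum_nonneg) auto
  have lip: "\<bar>poly (T j) y - poly (T j) x\<bar> \<le> B j * (y - x)" if "x \<le> y" "{x..y} \<subseteq> {a..b}" for j x y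
  proof (cases "x = y")
    case False
    with that have "x < y" by simp
    then obtain z where z: "x < z" "z < y" "poly (T j) y - poly (T j) x = (y - x) * poly (pderiv (T j)) z"
      using MVT2[of x y "poly (T j)" "poly (pderiv (T j))"] by (auto intro: poly_DERIV)
    have "z \<in> {a..b}" using z that by auto
    from mult_left_mono[OF B(2)[OF this], of "y - x" j] show ?thesis
      using z that by (simp add: abs_mult mult.commute)
  qed simp
  show "\<exists>\<delta>>0. \<forall>(I :: nat set) l u. finite I \<longrightarrow> (\<forall>i\<in>I. l i \<le> u i \<and> {l i..u i} \<subseteq> {a..b}) \<longrightarrow>
      disjoint_family_on (\<lambda>i. {l i<..<u i}) I \<longrightarrow> (\<Sum>i\<in>I. u i - l i) < \<delta> \<longrightarrow>
      (\<Sum>i\<in>I. \<bar>(\<Sum>j. poly (T j) (u i)) - (\<Sum>j. poly (T j) (l i))\<bar>) < \<epsilon>"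
  proof (intro exI[of _ "\<epsilon> / (2 * (M + 1))"] conjI allI impI)
    show "0 < \<epsilon> / (2 * (M + 1))" using M \<epsilon> by simp
    fix I :: "nat set" and l u :: "nat \<Rightarrow> real"
    assume fin: "finite I" and lu: "\<forall>i\<in>I. l i \<le> u i \<and> {l i..u i} \<subseteq> {a..b}"
      and disj: "disjoint_family_on (\<lambda>i. {l i<..<u i}) I" and small: "(\<Sum>i\<in>I. u i - l i) < \<epsilon> / (2 * (M + 1))"
    let ?d = "\<lambda>j i. \<bar>poly (T j) (u i) - poly (T j) (l i)\<bar>"
    have tail: "(\<Sum>i\<in>I. ?d j i) \<le> C * \<rho> ^ j" for j
    proof -
      have "ennreal (\<Sum>i\<in>I. ?d j i) = (\<Sum>i\<in>I. ennreal (?d j i))" by (rule sum_ennreal[symmetric]) simp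
      also have "\<dots> \<le> abs_integral a b (pderiv (T j))"
        using lu by (intro abs_integral_disjoint_sum fin disj) auto
      also note V
      finally show ?thesis using C \<rho> by simp
    qed
    have dl: "?d j i \<le> C * \<rho> ^ j" if "i \<in> I" for i j
      using tail[of j] member_le_sum[OF that, of "?d j"] fin by auto
    have sd: "summable (\<lambda>j. ?d j i)" if "i \<in> I" for i
      by (rule summable_comparison_test'[OF sr]) (use dl[OF that] in auto)
    have "(\<Sum>i\<in>I. \<bar>(\<Sum>j. poly (T j) (u i)) - (\<Sum>j. poly (T j) (l i))\<bar>) \<le> (\<Sum>i\<in>I. \<Sum>j. ?d j i)"
    proof (rule sum_mono)
      fix i assume i: "i \<in> I"
      then have "l i \<in> {a..b}" "u i \<in> {a..b}" using lu by auto
      then have "(\<Sum>j. poly (T j) (u i)) - (\<Sum>j. poly (T j) (l i)) = (\<Sum>j. poly (T j) (u i) - poly (T j) (l i))"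
        by (intro suminf_diff sm)
      then show "\<bar>(\<Sum>j. poly (T j) (u i)) - (\<Sum>j. poly (T j) (l i))\<bar> \<le> (\<Sum>j. ?d j i)"
        using summable_rabs[OF sd[OF i]] by simp
    qed
    also have "\<dots> = (\<Sum>j. \<Sum>i\<in>I. ?d j i)" by (rule suminf_sum[symmetric]) (rule sd)
    also have "\<dots> = (\<Sum>j. \<Sum>i\<in>I. ?d (j + L) i) + (\<Sum>j<L. \<Sum>i\<in>I. ?d j i)"
      by (rule suminf_split_initial_segment) (intro summable_sum sd)
    also have "\<dots> < \<epsilon> / 2 + \<epsilon> / 2"
    proof (rule add_less_le_mono)
      have "(\<Sum>j. \<Sum>i\<in>I. ?d (j + L) i) \<le> (\<Sum>j. C * \<rho> ^ (j + L))"
        by (intro suminf_le tail summable_ignore_initial_segment[OF sr]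
            summable_ignore_initial_segment[of "\<lambda>j. \<Sum>i\<in>I. ?d j i"] summable_sum sd)
      then show "(\<Sum>j. \<Sum>i\<in>I. ?d (j + L) i) < \<epsilon> / 2" using L by simp
      have "(\<Sum>j<L. \<Sum>i\<in>I. ?d j i) \<le> (\<Sum>j<L. B j * (\<Sum>i\<in>I. u i - l i))"
        unfolding sum_distrib_left using lu by (intro sum_mono lip) auto
      also have "\<dots> = M * (\<Sum>i\<in>I. u i - l i)" by (simp add: M_def sum_distrib_right)
      also have "\<dots> \<le> M * (\<epsilon> / (2 * (M + 1)))" using M small by (intro mult_left_mono) auto
      also have "\<dots> \<le> \<epsilon> / 2" using M \<epsilon> by (simp add: field_simps)
      finally show "(\<Sum>j<L. \<Sum>i\<in>I. ?d j i) \<le> \<epsilon> / 2" .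
    qed
    finally show "(\<Sum>i\<in>I. \<bar>(\<Sum>j. poly (T j) (u i)) - (\<Sum>j. poly (T j) (l i))\<bar>) < \<epsilon>" by simp
  qed
qed


section \<open>Almost everywhere differentiability of a series of polynomials\<close>

lemma dyadic_scale_exists:
  fixes y :: real
  assumes "0 < y" "y \<le> (1 / 2) ^ J0"
  obtains L where "J0 \<le> L" "(1 / 2) ^ Suc L < y" "y \<le> (1 / 2) ^ L"
proof -
  obtain n where n: "(1 / 2) ^ n < y" using real_arch_pow_inv[OF assms(1), of "1 / 2"] by auto
  define m where "m = (LEAST m. (1 / 2) ^ m < y)"
  have m: "(1 / 2) ^ m < y" unfolding m_def by (rule LeastI[of "\<lambda>m. (1 / 2) ^ m < y", OF n])
  have min: "y \<le> (1 / 2) ^ i" if "i < m" for i using not_less_Least[of i "\<lambda>m. (1 / 2) ^ m < y"] that by (simp add: m_def)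
  have "J0 < m"
  proof (rule ccontr)
    assume "\<not> J0 < m"
    then have "(1 / 2 :: real) ^ J0 \<le> (1 / 2) ^ m" by (intro power_decreasing) auto
    with m assms show False by simp
  qed
  then show ?thesis using that[of "m - 1"] m min[of "m - 1"] by (cases m) auto
qed

definition window_integral :: "real \<Rightarrow> real \<Rightarrow> real poly \<Rightarrow> nat \<Rightarrow> real \<Rightarrow> ennreal" where
  "window_integral a b P L x = (\<integral>\<^sup>+y. ennreal \<bar>poly P y\<bar> * indicator {a..b} y * indicator {x - (1 / 2) ^ L..x + (1 / 2) ^ L} y \<partial>lborel)"

lemma window_indicator_measurable:
  "(\<lambda>(x, y). ennreal \<bar>poly P y\<bar> * indicator {a..b} y * indicator {x - c..x + c} y) \<in> borel_measurable (lborel \<Otimes>\<^sub>M (lborel :: real measure))"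
proof -
  have "indicator {x - c..x + c} y = (if x - c \<le> y \<and> y \<le> x + c then 1 else 0 :: ennreal)" for x y :: real
    by (simp add: indicator_def)
  then show ?thesis by simp
qed

lemma borel_measurable_window_integral [measurable]: "window_integral a b P L \<in> borel_measurable borel"
proof -
  have "window_integral a b P L \<in> borel_measurable lborel"
    unfolding window_integral_def[abs_def]
    by (rule lborel.borel_measurable_nn_integral[OF window_indicator_measurable])
  then show ?thesis by simp
qed

text \<open>Each point \<open>y\<close> lies in the windows of centres filling an interval of length
  \<open>2 * (1 / 2) ^ L\<close> (Tonelli). Hence local bounds at \<open>x\<close> become bounds in
  L_1 that are smaller by the window length.\<close>

lemma nn_integral_window_integral:
  "(\<integral>\<^sup>+x. window_integral a b P L x \<partial>lborel) = ennreal (2 * (1 / 2) ^ L) * abs_integral a b P"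
proof -
  let ?c = "(1 / 2 :: real) ^ L"
  have "(\<integral>\<^sup>+x. window_integral a b P L x \<partial>lborel)
     = (\<integral>\<^sup>+y. (\<integral>\<^sup>+x. ennreal \<bar>poly P y\<bar> * indicator {a..b} y * indicator {x - ?c..x + ?c} y \<partial>lborel) \<partial>lborel)"
    unfolding window_integral_def by (rule lborel_pair.Fubini'[symmetric]) (rule window_indicator_measurable)
  also have "\<dots> = (\<integral>\<^sup>+y. ennreal (2 * ?c) * (ennreal \<bar>poly P y\<bar> * indicator {a..b} y) \<partial>lborel)"
  proof (rule nn_integral_cong)
    fix y
    have "indicator {x - ?c..x + ?c} y = (indicator {y - ?c..y + ?c} x :: ennreal)" for x :: real
      by (auto simp: indicator_def)
    then have "(\<integral>\<^sup>+x. ennreal \<bar>poly P y\<bar> * indicator {a..b} y * indicator {x - ?c..x + ?c} y \<partial>lborel)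
      = ennreal \<bar>poly P y\<bar> * indicator {a..b} y * emeasure lborel {y - ?c..y + ?c}"
      by (simp add: nn_integral_cmult_indicator)
    then show "(\<integral>\<^sup>+x. ennreal \<bar>poly P y\<bar> * indicator {a..b} y * indicator {x - ?c..x + ?c} y \<partial>lborel) = ennreal (2 * ?c) * (ennreal \<bar>poly P y\<bar> * indicator {a..b} y)"
      by (simp add: mult.commute)
  qed
  also have "\<dots> = ennreal (2 * ?c) * abs_integral a b P"
    unfolding abs_integral_def by (rule nn_integral_cmult) measurable
  finally show ?thesis .
qed

lemma window_integral_ge:
  assumes "a \<le> x - (1 / 2) ^ L" "x + (1 / 2) ^ L \<le> b"
  shows "abs_integral (x - (1 / 2) ^ L) (x + (1 / 2) ^ L) P \<le> window_integral a b P L x"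
  unfolding abs_integral_def window_integral_def
  using assms by (intro nn_integral_mono) (auto split: split_indicator)

text \<open>
  On the scale \<open>2^(-L)\<close> the terms \<open>j \<le> L\<close> of the series are controlled by their second derivatives and the
  remaining ones by their first derivatives. The resulting errors are summable in \<open>L\<^sub>1\<close>, which replaces
  the Lebesgue differentiation theorem.
\<close>

definition dyadic_error :: "real \<Rightarrow> real \<Rightarrow> (nat \<Rightarrow> real poly) \<Rightarrow> nat \<Rightarrow> real \<Rightarrow> ennreal" where
  "dyadic_error a b T L x = (\<Sum>j<Suc L. window_integral a b (pderiv (pderiv (T j))) L x)
     + (\<Sum>j. ennreal (2 ^ Suc L) * window_integral a b (pderiv (T (j + Suc L))) L x)"

lemma borel_measurable_dyadic_error [measurable]: "dyadic_error a b T L \<in> borel_measurable borel"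
  unfolding dyadic_error_def[abs_def] by measurable

text \<open>The window length 2^(-L) balances both parts: in the first the geometric sum with ratio
  2 \<rho> > 1 is governed by its last term, (2 \<rho>)^L, and in the second the factor 2^L cancels
  and the tail with ratio \<rho> < 1 starts at \<rho>^L. Both are thus of order \<rho>^L, which is
  why \<rho> lies between 1/2 and 1.\<close>

lemma nn_integral_dyadic_error:
  assumes V: "\<And>j. abs_integral a b (pderiv (T j)) \<le> ennreal (C * \<rho> ^ j)"
    and W: "\<And>j. abs_integral a b (pderiv (pderiv (T j))) \<le> ennreal (C * (2 * \<rho>) ^ j)"
    and \<rho>: "1 / 2 < \<rho>" "\<rho> < 1" and C: "0 \<le> C"
  shows "(\<integral>\<^sup>+x. dyadic_error a b T L x \<partial>lborel) \<le> ennreal ((4 * C * \<rho> / (2 * \<rho> - 1) + 4 * C * \<rho> / (1 - \<rho>)) * \<rho> ^ L)"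
proof -
  have half: "(1 / 2 :: real) ^ L * 2 ^ L = 1" by (simp add: power_mult_distrib[symmetric])
  have 1: "(\<integral>\<^sup>+x. window_integral a b (pderiv (pderiv (T j))) L x \<partial>lborel) \<le> ennreal (2 * (1 / 2) ^ L * C * (2 * \<rho>) ^ j)" for j
  proof -
    have "ennreal (2 * (1 / 2) ^ L) * abs_integral a b (pderiv (pderiv (T j))) \<le> ennreal (2 * (1 / 2) ^ L) * ennreal (C * (2 * \<rho>) ^ j)"
      by (intro mult_left_mono W) simp
    also have "\<dots> = ennreal (2 * (1 / 2) ^ L * C * (2 * \<rho>) ^ j)" using C \<rho> by (subst ennreal_mult[symmetric]) (auto simp: mult.assoc)
    finally show ?thesis unfolding nn_integral_window_integral .
  qed
  have 2: "(\<integral>\<^sup>+x. ennreal (2 ^ Suc L) * window_integral a b (pderiv (T j)) L x \<partial>lborel) \<le> ennreal (4 * C * \<rho> ^ j)" for j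
  proof -
    have "ennreal (2 ^ Suc L) * (ennreal (2 * (1 / 2) ^ L) * abs_integral a b (pderiv (T j))) \<le> ennreal (2 ^ Suc L) * (ennreal (2 * (1 / 2) ^ L) * ennreal (C * \<rho> ^ j))"
      by (intro mult_left_mono V) simp_all
    also have "\<dots> = ennreal (2 ^ Suc L * (2 * (1 / 2) ^ L * (C * \<rho> ^ j)))" using C \<rho> by (simp only: ennreal_mult[symmetric] mult_nonneg_nonneg zero_le_power)
    also have "2 ^ Suc L * (2 * (1 / 2) ^ L * (C * \<rho> ^ j)) = 4 * ((1 / 2) ^ L * 2 ^ L) * C * \<rho> ^ j" by simp
    also have "\<dots> = 4 * C * \<rho> ^ j" unfolding half by simp
    finally show ?thesis by (simp add: nn_integral_cmult nn_integral_window_integral del: power_Suc)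
  qed
  have g1: "(\<Sum>j<Suc L. ennreal (2 * (1 / 2) ^ L * C * (2 * \<rho>) ^ j)) \<le> ennreal (4 * C * \<rho> / (2 * \<rho> - 1) * \<rho> ^ L)"
  proof -
    have "(\<Sum>j<Suc L. 2 * (1 / 2) ^ L * C * (2 * \<rho>) ^ j) = 2 * (1 / 2) ^ L * C * (\<Sum>j<Suc L. (2 * \<rho>) ^ j)"
      by (rule sum_distrib_left[symmetric])
    also have "(\<Sum>j<Suc L. (2 * \<rho>) ^ j) = ((2 * \<rho>) ^ Suc L - 1) / (2 * \<rho> - 1)"
      by (rule geometric_sum) (use \<rho> in auto)
    also have "\<dots> \<le> (2 * \<rho>) ^ Suc L / (2 * \<rho> - 1)" using \<rho> by (intro divide_right_mono) auto
    also have "2 * (1 / 2) ^ L * C * ((2 * \<rho>) ^ Suc L / (2 * \<rho> - 1)) = ((1 / 2) ^ L * 2 ^ L) * (4 * C * \<rho> / (2 * \<rho> - 1) * \<rho> ^ L)"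
      by (simp add: power_mult_distrib)
    also have "\<dots> = 4 * C * \<rho> / (2 * \<rho> - 1) * \<rho> ^ L" unfolding half by simp
    finally have "(\<Sum>j<Suc L. 2 * (1 / 2) ^ L * C * (2 * \<rho>) ^ j) \<le> 4 * C * \<rho> / (2 * \<rho> - 1) * \<rho> ^ L"
      using C by (simp add: mult_left_mono)
    then show ?thesis using C \<rho> by (subst sum_ennreal) (auto intro: ennreal_leI)
  qed
  have g2: "(\<Sum>j. ennreal (4 * C * \<rho> ^ (j + Suc L))) = ennreal (4 * C * \<rho> / (1 - \<rho>) * \<rho> ^ L)"
  proof -
    have "(\<lambda>j. 4 * C * \<rho> ^ Suc L * \<rho> ^ j) sums (4 * C * \<rho> ^ Suc L * (1 / (1 - \<rho>)))"
      using \<rho> by (intro sums_mult geometric_sums) auto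
    then have "(\<lambda>j. 4 * C * \<rho> ^ (j + Suc L)) sums (4 * C * \<rho> / (1 - \<rho>) * \<rho> ^ L)"
      by (simp add: power_add mult_ac)
    then show ?thesis using C \<rho> by (subst suminf_ennreal_eq) auto
  qed
  have "(\<integral>\<^sup>+x. dyadic_error a b T L x \<partial>lborel)
     = (\<Sum>j<Suc L. \<integral>\<^sup>+x. window_integral a b (pderiv (pderiv (T j))) L x \<partial>lborel)
       + (\<Sum>j. \<integral>\<^sup>+x. ennreal (2 ^ Suc L) * window_integral a b (pderiv (T (j + Suc L))) L x \<partial>lborel)"
  proof -
    have "(\<integral>\<^sup>+x. (\<Sum>j<Suc L. window_integral a b (pderiv (pderiv (T j))) L x) \<partial>lborel) = (\<Sum>j<Suc L. \<integral>\<^sup>+x. window_integral a b (pderiv (pderiv (T j))) L x \<partial>lborel)"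
      by (rule nn_integral_sum) measurable
    moreover have "(\<integral>\<^sup>+x. (\<Sum>j. ennreal (2 ^ Suc L) * window_integral a b (pderiv (T (j + Suc L))) L x) \<partial>lborel) = (\<Sum>j. \<integral>\<^sup>+x. ennreal (2 ^ Suc L) * window_integral a b (pderiv (T (j + Suc L))) L x \<partial>lborel)"
      by (rule nn_integral_suminf) measurable
    moreover have "(\<integral>\<^sup>+x. dyadic_error a b T L x \<partial>lborel)
       = (\<integral>\<^sup>+x. (\<Sum>j<Suc L. window_integral a b (pderiv (pderiv (T j))) L x) \<partial>lborel)
       + (\<integral>\<^sup>+x. (\<Sum>j. ennreal (2 ^ Suc L) * window_integral a b (pderiv (T (j + Suc L))) L x) \<partial>lborel)"
      unfolding dyadic_error_def by (rule nn_integral_add) measurable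
    ultimately show ?thesis by (simp only:)
  qed
  also have "\<dots> \<le> (\<Sum>j<Suc L. ennreal (2 * (1 / 2) ^ L * C * (2 * \<rho>) ^ j)) + (\<Sum>j. ennreal (4 * C * \<rho> ^ (j + Suc L)))"
    by (intro add_mono sum_mono suminf_le 1 2) auto
  also have "\<dots> \<le> ennreal (4 * C * \<rho> / (2 * \<rho> - 1) * \<rho> ^ L) + ennreal (4 * C * \<rho> / (1 - \<rho>) * \<rho> ^ L)"
    unfolding g2 by (intro add_right_mono g1)
  also have "\<dots> = ennreal ((4 * C * \<rho> / (2 * \<rho> - 1) + 4 * C * \<rho> / (1 - \<rho>)) * \<rho> ^ L)"
    using C \<rho> by (simp add: ennreal_plus[symmetric] distrib_right del: ennreal_plus)
  finally show ?thesis .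
qed

text \<open>For \<open>j \<le> L\<close> the quotient is a value of the derivative at a nearby
  point, and its deviation is controlled by the second derivative over the window. For larger
  \<open>j\<close> the quotient and the derivative are bounded separately, the former with 1 / |h| <
  2^(L+1).\<close>

lemma difference_quotient_bound:
  fixes T :: "nat \<Rightarrow> real poly"
  assumes sm: "\<And>x. x \<in> {a..b} \<Longrightarrow> summable (\<lambda>j. poly (T j) x)"
    and D: "summable (\<lambda>j. poly (pderiv (T j)) x)"
    and x: "a \<le> x - (1 / 2) ^ L" "x + (1 / 2) ^ L \<le> b"
    and h: "(1 / 2) ^ Suc L < \<bar>h\<bar>" "\<bar>h\<bar> \<le> (1 / 2) ^ L"
  shows "ennreal \<bar>((\<Sum>j. poly (T j) (x + h)) - (\<Sum>j. poly (T j) x)) / h - (\<Sum>j. poly (pderiv (T j)) x)\<bar>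
     \<le> dyadic_error a b T L x + (\<Sum>j. ennreal \<bar>poly (pderiv (T (j + Suc L))) x\<bar>)"
proof -
  let ?c = "(1 / 2 :: real) ^ L"
  have h0: "h \<noteq> 0" using h(1) by (auto simp: not_less)
  have c: "?c > 0" by simp
  have xab: "x \<in> {a..b}" "x + h \<in> {a..b}" using x h(2) c by (auto simp: abs_le_iff simp del: zero_less_power)
  have xc: "x \<in> {x - ?c..x + ?c}" "x + h \<in> {x - ?c..x + ?c}" using h(2) by (auto simp: abs_le_iff)
  define u where "u j = (poly (T j) (x + h) - poly (T j) x) / h - poly (pderiv (T j)) x" for j
  have su: "summable u" unfolding u_def by (intro summable_diff summable_divide sm xab D)
  have "((\<Sum>j. poly (T j) (x + h)) - (\<Sum>j. poly (T j) x)) / h - (\<Sum>j. poly (pderiv (T j)) x) = suminf u"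
  proof -
    have s1: "summable (\<lambda>j. poly (T j) (x + h) - poly (T j) x)" by (intro summable_diff sm xab)
    have "(\<Sum>j. poly (T j) (x + h)) - (\<Sum>j. poly (T j) x) = (\<Sum>j. poly (T j) (x + h) - poly (T j) x)"
      by (intro suminf_diff sm xab)
    then show ?thesis
      unfolding u_def suminf_diff[OF summable_divide[OF s1] D, symmetric] suminf_divide[OF s1] by simp
  qed
  then have "ennreal \<bar>((\<Sum>j. poly (T j) (x + h)) - (\<Sum>j. poly (T j) x)) / h - (\<Sum>j. poly (pderiv (T j)) x)\<bar> \<le> (\<Sum>j. ennreal \<bar>u j\<bar>)"
    using ennreal_abs_suminf_le[OF su] by simp
  also have "\<dots> = (\<Sum>j. ennreal \<bar>u (j + Suc L)\<bar>) + (\<Sum>j<Suc L. ennreal \<bar>u j\<bar>)"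
    by (rule suminf_offset) simp
  also have "\<dots> \<le> (\<Sum>j. ennreal (2 ^ Suc L) * window_integral a b (pderiv (T (j + Suc L))) L x + ennreal \<bar>poly (pderiv (T (j + Suc L))) x\<bar>)
      + (\<Sum>j<Suc L. window_integral a b (pderiv (pderiv (T j))) L x)"
  proof (intro add_mono suminf_le sum_mono)
    fix j
    let ?P = "T (j + Suc L)"
    have "\<bar>u (j + Suc L)\<bar> \<le> \<bar>poly ?P (x + h) - poly ?P x\<bar> / \<bar>h\<bar> + \<bar>poly (pderiv ?P) x\<bar>"
      unfolding u_def by (rule order.trans[OF abs_triangle_ineq4]) (simp add: abs_divide)
    also have "\<dots> \<le> 2 ^ Suc L * \<bar>poly ?P (x + h) - poly ?P x\<bar> + \<bar>poly (pderiv ?P) x\<bar>"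
    proof -
      have "1 / \<bar>h\<bar> \<le> 1 / (1 / 2) ^ Suc L" using h(1) h0 by (intro divide_left_mono) auto
      then have "1 / \<bar>h\<bar> \<le> 2 ^ Suc L" by (simp add: power_divide)
      from mult_right_mono[OF this, of "\<bar>poly ?P (x + h) - poly ?P x\<bar>"] show ?thesis by simp
    qed
    finally have "ennreal \<bar>u (j + Suc L)\<bar> \<le> ennreal (2 ^ Suc L) * ennreal \<bar>poly ?P (x + h) - poly ?P x\<bar> + ennreal \<bar>poly (pderiv ?P) x\<bar>"
      by (simp add: ennreal_mult[symmetric] ennreal_plus[symmetric] ennreal_leI del: ennreal_plus power_Suc)
    also have "ennreal \<bar>poly ?P (x + h) - poly ?P x\<bar> \<le> window_integral a b (pderiv ?P) L x"
      by (rule order.trans[OF poly_diff_le_abs_integral'[OF xc] window_integral_ge[OF x]])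
    finally show "ennreal \<bar>u (j + Suc L)\<bar> \<le> ennreal (2 ^ Suc L) * window_integral a b (pderiv ?P) L x + ennreal \<bar>poly (pderiv ?P) x\<bar>"
      by (simp add: mult_left_mono add_right_mono del: power_Suc)
  next
    fix j
    obtain z where z: "z \<in> {x - ?c..x + ?c}" "poly (T j) (x + h) - poly (T j) x = h * poly (pderiv (T j)) z"
    proof (cases "h > 0")
      case True
      then obtain z where "x < z" "z < x + h" "poly (T j) (x + h) - poly (T j) x = (x + h - x) * poly (pderiv (T j)) z"
        using MVT2[of x "x + h" "poly (T j)" "poly (pderiv (T j))"] by (auto intro: poly_DERIV)
      then show ?thesis using that[of z] xc by auto
    next
      case False
      then obtain z where "x + h < z" "z < x" "poly (T j) x - poly (T j) (x + h) = (x - (x + h)) * poly (pderiv (T j)) z"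
        using MVT2[of "x + h" x "poly (T j)" "poly (pderiv (T j))"] h0 by (auto intro: poly_DERIV)
      then show ?thesis using that[of z] xc by auto
    qed
    have "u j = poly (pderiv (T j)) z - poly (pderiv (T j)) x" unfolding u_def z(2) using h0 by simp
    then show "ennreal \<bar>u j\<bar> \<le> window_integral a b (pderiv (pderiv (T j))) L x"
      using order.trans[OF poly_diff_le_abs_integral'[OF xc(1) z(1)] window_integral_ge[OF x]] by simp
  qed auto
  also have "\<dots> = dyadic_error a b T L x + (\<Sum>j. ennreal \<bar>poly (pderiv (T (j + Suc L))) x\<bar>)"
    unfolding dyadic_error_def by (subst suminf_add[symmetric]) (auto simp: add_ac simp del: power_Suc sum.lessThan_Suc)
  finally show ?thesis .
qed


text \<open>The errors at all dyadic scales have a finite integral in total, so at almost every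
  point their sum is finite and they tend to 0. Every small \<open>h\<close> belongs to some dyadic
  scale, so this forces the difference quotients to converge.\<close>

lemma poly_series_ae_derivative:
  fixes T :: "nat \<Rightarrow> real poly"
  assumes sm: "\<And>x. x \<in> {a..b} \<Longrightarrow> summable (\<lambda>j. poly (T j) x)"
    and V: "\<And>j. abs_integral a b (pderiv (T j)) \<le> ennreal (C * \<rho> ^ j)"
    and W: "\<And>j. abs_integral a b (pderiv (pderiv (T j))) \<le> ennreal (C * (2 * \<rho>) ^ j)"
    and \<rho>: "1 / 2 < \<rho>" "\<rho> < 1" and C: "0 \<le> C"
  shows "AE x in lborel. x \<in> {a<..<b} \<longrightarrow> summable (\<lambda>j. poly (pderiv (T j)) x) \<and>
    ((\<lambda>x. \<Sum>j. poly (T j) x) has_real_derivative (\<Sum>j. poly (pderiv (T j)) x)) (at x)"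
proof -
  define D where "D = 4 * C * \<rho> / (2 * \<rho> - 1) + 4 * C * \<rho> / (1 - \<rho>)"
  have D: "D \<ge> 0" using C \<rho> by (simp add: D_def)
  have geo: "(\<Sum>l. ennreal (K * \<rho> ^ l)) \<noteq> \<infinity>" if "0 \<le> K" for K
  proof -
    have "(\<lambda>l. K * \<rho> ^ l) sums (K * (1 / (1 - \<rho>)))" using \<rho> by (intro sums_mult geometric_sums) auto
    then have "(\<Sum>l. ennreal (K * \<rho> ^ l)) = ennreal (K * (1 / (1 - \<rho>)))"
      using that \<rho> by (subst suminf_ennreal_eq) auto
    then show ?thesis by simp
  qed
  have "(\<integral>\<^sup>+x. (\<Sum>l. dyadic_error a b T l x) \<partial>lborel) = (\<Sum>l. \<integral>\<^sup>+x. dyadic_error a b T l x \<partial>lborel)"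
    by (rule nn_integral_suminf) measurable
  also have "\<dots> \<le> (\<Sum>l. ennreal (D * \<rho> ^ l))"
    unfolding D_def by (intro suminf_le nn_integral_dyadic_error V W \<rho> C) auto
  finally have "(\<integral>\<^sup>+x. (\<Sum>l. dyadic_error a b T l x) \<partial>lborel) \<noteq> \<infinity>"
    using geo[OF D] by (metis infinity_ennreal_def neq_top_trans)
  then have ae1: "AE x in lborel. (\<Sum>l. dyadic_error a b T l x) \<noteq> \<infinity>"
    by (intro nn_integral_noteq_infinite) auto
  have "(\<integral>\<^sup>+x. (\<Sum>j. ennreal \<bar>poly (pderiv (T j)) x\<bar> * indicator {a..b} x) \<partial>lborel) = (\<Sum>j. abs_integral a b (pderiv (T j)))"
    unfolding abs_integral_def by (rule nn_integral_suminf) measurable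
  also have "\<dots> \<le> (\<Sum>l. ennreal (C * \<rho> ^ l))" by (intro suminf_le V) auto
  finally have "(\<integral>\<^sup>+x. (\<Sum>j. ennreal \<bar>poly (pderiv (T j)) x\<bar> * indicator {a..b} x) \<partial>lborel) \<noteq> \<infinity>"
    using geo[OF C] by (metis infinity_ennreal_def neq_top_trans)
  then have ae2: "AE x in lborel. (\<Sum>j. ennreal \<bar>poly (pderiv (T j)) x\<bar> * indicator {a..b} x) \<noteq> \<infinity>"
    by (intro nn_integral_noteq_infinite) auto
  have pt: "summable (\<lambda>j. poly (pderiv (T j)) x) \<and>
      ((\<lambda>x. \<Sum>j. poly (T j) x) has_real_derivative (\<Sum>j. poly (pderiv (T j)) x)) (at x)"
    if x: "x \<in> {a<..<b}" and 1: "(\<Sum>l. dyadic_error a b T l x) \<noteq> \<infinity>"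
      and 2: "(\<Sum>j. ennreal \<bar>poly (pderiv (T j)) x\<bar> * indicator {a..b} x) \<noteq> \<infinity>" for x
  proof
    have "(\<Sum>j. ennreal \<bar>poly (pderiv (T j)) x\<bar>) \<noteq> top" using 2 x by simp
    then have sa: "summable (\<lambda>j. \<bar>poly (pderiv (T j)) x\<bar>)" by (intro summable_suminf_not_top) auto
    then show S: "summable (\<lambda>j. poly (pderiv (T j)) x)" by (rule summable_rabs_cancel)
    have fin: "dyadic_error a b T l x \<noteq> top" for l
    proof
      assume "dyadic_error a b T l x = top"
      moreover have "dyadic_error a b T l x \<le> (\<Sum>l. dyadic_error a b T l x)"
        using sum_le_suminf[of "\<lambda>l. dyadic_error a b T l x" "{l}"] by simp
      ultimately show False using 1 by (simp add: top_unique)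
    qed
    define e where "e l = enn2real (dyadic_error a b T l x)" for l
    have e: "dyadic_error a b T l x = ennreal (e l)" "0 \<le> e l" for l
      using fin[of l] by (simp_all add: e_def less_top)
    \<comment> \<open>Only the convergence of the errors to 0 at this fixed point is extracted from
      the summability.\<close>
    have "summable e"
      by (rule summable_suminf_not_top) (use 1 e in auto)
    then have e0: "e \<longlonglongrightarrow> 0" by (rule summable_LIMSEQ_zero)
    define r where "r l = (\<Sum>j. \<bar>poly (pderiv (T (j + Suc l))) x\<bar>)" for l
    have r0: "r \<longlonglongrightarrow> 0"
    proof -
      have "(\<lambda>l. \<Sum>j. \<bar>poly (pderiv (T (j + l))) x\<bar>) \<longlonglongrightarrow> 0" by (rule suminf_exist_split2[OF sa])
      then show ?thesis unfolding r_def by (rule LIMSEQ_Suc)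
    qed
    have "(\<lambda>l. e l + r l) \<longlonglongrightarrow> 0" using tendsto_add[OF e0 r0] by simp
    let ?F = "\<lambda>x. \<Sum>j. poly (T j) x" and ?D = "\<Sum>j. poly (pderiv (T j)) x"
    have bound: "\<bar>(?F (x + h) - ?F x) / h - ?D\<bar> \<le> e l + r l"
      if "a \<le> x - (1 / 2) ^ l" "x + (1 / 2) ^ l \<le> b" "(1 / 2) ^ Suc l < \<bar>h\<bar>" "\<bar>h\<bar> \<le> (1 / 2) ^ l" for l h
    proof -
      have "(\<Sum>j. ennreal \<bar>poly (pderiv (T (j + Suc l))) x\<bar>) = ennreal (r l)"
        unfolding r_def by (rule suminf_ennreal2) (use summable_ignore_initial_segment[OF sa, of "Suc l"] in auto)
      moreover have "0 \<le> r l" unfolding r_def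
        by (rule suminf_nonneg) (use summable_ignore_initial_segment[OF sa, of "Suc l"] in auto)
      ultimately have "ennreal \<bar>(?F (x + h) - ?F x) / h - ?D\<bar> \<le> ennreal (e l + r l)"
        using difference_quotient_bound[OF sm S that] e[of l] by (simp add: ennreal_plus)
      then show ?thesis using e(2)[of l] \<open>0 \<le> r l\<close> by (subst (asm) ennreal_le_iff) auto
    qed
    show "(?F has_real_derivative ?D) (at x)"
      unfolding DERIV_def LIM_def
    proof (intro allI impI)
      fix \<epsilon> :: real assume \<epsilon>: "0 < \<epsilon>"
      obtain l0 where l0: "\<And>l. l \<ge> l0 \<Longrightarrow> \<bar>e l + r l\<bar> < \<epsilon>"
        using LIMSEQ_D[OF \<open>(\<lambda>l. e l + r l) \<longlonglongrightarrow> 0\<close> \<epsilon>] by auto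
      define \<eta> where "\<eta> = min (x - a) (b - x)"
      have "\<eta> > 0" using x by (simp add: \<eta>_def)
      then obtain l1 where l1: "(1 / 2) ^ l1 < \<eta>" using real_arch_pow_inv[of \<eta> "1 / 2"] by auto
      define l2 where "l2 = max l0 l1"
      show "\<exists>s>0. \<forall>h. h \<noteq> 0 \<and> dist h 0 < s \<longrightarrow> dist ((?F (x + h) - ?F x) / h) ?D < \<epsilon>"
      proof (intro exI[of _ "(1 / 2) ^ l2"] conjI allI impI)
        fix h :: real assume h: "h \<noteq> 0 \<and> dist h 0 < (1 / 2) ^ l2"
        obtain l where l: "l2 \<le> l" "(1 / 2) ^ Suc l < \<bar>h\<bar>" "\<bar>h\<bar> \<le> (1 / 2) ^ l"
          using dyadic_scale_exists[of "\<bar>h\<bar>" l2] h by (auto simp: dist_real_def)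
        have "(1 / 2 :: real) ^ l \<le> (1 / 2) ^ l1" using l(1) by (intro power_decreasing) (auto simp: l2_def)
        then have "(1 / 2) ^ l \<le> \<eta>" using l1 by (meson le_less_trans less_imp_le)
        then have "\<bar>(?F (x + h) - ?F x) / h - ?D\<bar> \<le> e l + r l"
          by (intro bound l) (auto simp: \<eta>_def)
        also have "\<dots> < \<epsilon>" using l0[of l] l(1) by (auto simp: l2_def)
        finally show "dist ((?F (x + h) - ?F x) / h) ?D < \<epsilon>" by (simp add: dist_real_def)
      qed simp
    qed
  qed
  from ae1 ae2 show ?thesis by eventually_elim (use pt in blast)
qed


section \<open>Absolutely continuous derivatives and their uniqueness\<close>

lemma absolutely_continuous_on_cong_subset:
  assumes f: "absolutely_continuous_on S f" and T: "T \<subseteq> S" and eq: "\<And>x. x \<in> T \<Longrightarrow> f x = g x"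
  shows "absolutely_continuous_on T g"
  unfolding absolutely_continuous_on_def
proof (intro allI impI)
  fix \<epsilon> :: real assume "0 < \<epsilon>"
  then obtain \<delta> where \<delta>: "\<delta> > 0" "\<And>(I :: nat set) l u. finite I \<Longrightarrow> (\<forall>i\<in>I. l i \<le> u i \<and> {l i..u i} \<subseteq> S) \<Longrightarrow>
        disjoint_family_on (\<lambda>i. {l i<..<u i}) I \<Longrightarrow> (\<Sum>i\<in>I. u i - l i) < \<delta> \<Longrightarrow> (\<Sum>i\<in>I. \<bar>f (u i) - f (l i)\<bar>) < \<epsilon>"
    using f unfolding absolutely_continuous_on_def by meson
  show "\<exists>\<delta>>0. \<forall>(I :: nat set) l u. finite I \<longrightarrow> (\<forall>i\<in>I. l i \<le> u i \<and> {l i..u i} \<subseteq> T) \<longrightarrow>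
        disjoint_family_on (\<lambda>i. {l i<..<u i}) I \<longrightarrow> (\<Sum>i\<in>I. u i - l i) < \<delta> \<longrightarrow> (\<Sum>i\<in>I. \<bar>g (u i) - g (l i)\<bar>) < \<epsilon>"
  proof (intro exI[of _ \<delta>] conjI allI impI \<delta>(1))
    fix I :: "nat set" and l u :: "nat \<Rightarrow> real"
    assume I: "finite I" "\<forall>i\<in>I. l i \<le> u i \<and> {l i..u i} \<subseteq> T" "disjoint_family_on (\<lambda>i. {l i<..<u i}) I" "(\<Sum>i\<in>I. u i - l i) < \<delta>"
    have "(\<Sum>i\<in>I. \<bar>g (u i) - g (l i)\<bar>) = (\<Sum>i\<in>I. \<bar>f (u i) - f (l i)\<bar>)"
    proof (rule sum.cong[OF refl])
      fix i assume "i \<in> I"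
      then have "l i \<le> u i" "{l i..u i} \<subseteq> T" using I(2) by blast+
      then have "l i \<in> T" "u i \<in> T" by auto
      then show "\<bar>g (u i) - g (l i)\<bar> = \<bar>f (u i) - f (l i)\<bar>" by (simp add: eq)
    qed
    also have "\<dots> < \<epsilon>" using \<delta>(2)[OF I(1) _ I(3,4)] I(2) T by blast
    finally show "(\<Sum>i\<in>I. \<bar>g (u i) - g (l i)\<bar>) < \<epsilon>" .
  qed
qed

text \<open>L_1 bounds for two consecutive orders give geometric bounds uniformly on compact
  intervals, so below order \<open>r\<close> the series is differentiated termwise. At order
  \<open>r - 1\<close> the sum is absolutely continuous, and its derivative exists termwise almost
  everywhere; this last step uses order \<open>r + 1\<close>, whose norms may grow like (2
  \<rho>)^j.\<close>

lemma poly_series_AC_derivs: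
  fixes S :: "nat \<Rightarrow> real poly" and \<rho> :: real
  assumes r: "r \<ge> 1" and \<rho>: "1 / 2 < \<rho>" "\<rho> < 1"
    and V: "\<And>a b i. -1 < a \<Longrightarrow> a < b \<Longrightarrow> b < 1 \<Longrightarrow> i \<le> Suc r \<Longrightarrow>
      \<exists>C\<ge>0. \<forall>j. abs_integral a b ((pderiv ^^ i) (S j)) \<le> ennreal (C * (if i \<le> r then \<rho> else 2 * \<rho>) ^ j)"
  defines "g \<equiv> \<lambda>x. \<Sum>j. poly (S j) x"
  shows "g \<in> AC_derivs r"
    and "\<And>x. x \<in> {-1<..<1} \<Longrightarrow> summable (\<lambda>j. poly (S j) x)"
    and "AE x in lborel. x \<in> {-1<..<1} \<longrightarrow> summable (\<lambda>j. poly ((pderiv ^^ r) (S j)) x) \<and>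
      (deriv ^^ r) g x = (\<Sum>j. poly ((pderiv ^^ r) (S j)) x)"
proof -
  define G where "G i x = (\<Sum>j. poly ((pderiv ^^ i) (S j)) x)" for i x
  have sr: "summable (\<lambda>j. B * \<rho> ^ j)" for B using \<rho> by (intro summable_mult summable_geometric) auto
  have sup: "\<exists>B\<ge>0. \<forall>j. \<forall>x\<in>{a..b}. \<bar>poly ((pderiv ^^ i) (S j)) x\<bar> \<le> B * \<rho> ^ j" if ab: "-1 < a" "a < b" "b < 1" and i: "i < r" for a b i
  proof -
    obtain C0 where C0: "C0 \<ge> 0" "\<And>j. abs_integral a b ((pderiv ^^ i) (S j)) \<le> ennreal (C0 * \<rho> ^ j)"
      using V[OF ab, of i] i by auto
    obtain C1 where C1: "C1 \<ge> 0" "\<And>j. abs_integral a b (pderiv ((pderiv ^^ i) (S j))) \<le> ennreal (C1 * \<rho> ^ j)"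
      using V[OF ab, of "Suc i"] i by auto
    have "\<bar>poly ((pderiv ^^ i) (S j)) x\<bar> \<le> (C0 / (b - a) + C1) * \<rho> ^ j" if "x \<in> {a..b}" for j x
      using poly_le_abs_integral[OF ab(2) that C0(2) _ C1(2)] C0 C1 \<rho> by (simp add: distrib_right)
    then show ?thesis using C0 C1 ab by (intro exI[of _ "C0 / (b - a) + C1"]) auto
  qed
  have nbhd: "\<exists>a b. -1 < a \<and> a < x \<and> x < b \<and> b < 1" if "x \<in> {-1<..<1}" for x :: real
    using that dense[of "-1" x] dense[of x 1] by auto
  have sm: "summable (\<lambda>j. poly ((pderiv ^^ i) (S j)) x)" if x: "x \<in> {-1<..<1}" and i: "i < r" for i x
  proof -
    obtain a b where ab: "-1 < a" "a < x" "x < b" "b < 1" using nbhd[OF x] by auto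
    obtain B where "\<forall>j. \<forall>x\<in>{a..b}. \<bar>poly ((pderiv ^^ i) (S j)) x\<bar> \<le> B * \<rho> ^ j" using sup[of a b i] ab i by auto
    then show ?thesis using ab by (intro summable_comparison_test'[OF sr[of B]]) auto
  qed
  show "summable (\<lambda>j. poly (S j) x)" if "x \<in> {-1<..<1}" for x using sm[OF that, of 0] r by simp
  have der: "(G i has_real_derivative G (Suc i) x) (at x)" if x: "x \<in> {-1<..<1}" and i: "Suc i < r" for i x
  proof -
    obtain a b where ab: "-1 < a" "a < x" "x < b" "b < 1" using nbhd[OF x] by auto
    obtain B where B: "\<forall>j. \<forall>x\<in>{a..b}. \<bar>poly ((pderiv ^^ Suc i) (S j)) x\<bar> \<le> B * \<rho> ^ j" using sup[of a b "Suc i"] ab i by auto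
    show ?thesis unfolding G_def
    proof (rule has_field_derivative_series'(2)[where S = "{a..b}" and x0 = x])
      show "uniformly_convergent_on {a..b} (\<lambda>n x. \<Sum>j<n. poly ((pderiv ^^ Suc i) (S j)) x)"
        by (rule uniformly_convergentI, rule Weierstrass_m_test[OF _ sr[of B]]) (use B in auto)
      show "((\<lambda>x. poly ((pderiv ^^ i) (S n)) x) has_real_derivative poly ((pderiv ^^ Suc i) (S n)) y) (at y within {a..b})" for n y
        by (simp add: poly_DERIV has_field_derivative_at_within)
      show "summable (\<lambda>n. poly ((pderiv ^^ i) (S n)) x)" using i by (intro sm x) auto
    qed (use ab in auto)
  qed
  have transf: "(f has_real_derivative D) (at x)" if "(h has_real_derivative D) (at x)" "\<And>y. y \<in> {-1<..<1} \<Longrightarrow> h y = f y" "x \<in> {-1<..<1}" for f h D x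
    by (rule has_field_derivative_transform_within_open[OF that(1), of "{-1<..<1}"]) (use that in auto)
  have iter: "i < r \<Longrightarrow> x \<in> {-1<..<1} \<Longrightarrow> (deriv ^^ i) g x = G i x" for i x
  proof (induction i arbitrary: x)
    case 0
    then show ?case by (simp add: g_def G_def)
  next
    case (Suc i)
    have "((deriv ^^ i) g has_real_derivative G (Suc i) x) (at x)"
      by (rule transf[OF der[OF Suc.prems(2,1)]]) (use Suc in auto)
    then show ?case by (simp add: DERIV_imp_deriv)
  qed
  obtain r' where r': "r = Suc r'" using r by (cases r) auto
  have AC: "absolutely_continuous_on {a..b} (G r')" if ab: "-1 < a" "a < b" "b < 1" for a b
  proof -
    obtain C where "C \<ge> 0" "\<And>j. abs_integral a b (pderiv ((pderiv ^^ r') (S j))) \<le> ennreal (C * \<rho> ^ j)"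
      using V[OF ab, of r] by (auto simp: r')
    then show ?thesis unfolding G_def
      using \<rho> ab by (intro absolutely_continuous_on_poly_series[where C = C and \<rho> = \<rho>] sm) (auto simp: r')
  qed
  show "g \<in> AC_derivs r"
    unfolding AC_derivs_def
  proof (intro CollectI impI conjI ballI allI)
    fix j x assume j: "j < r - 1" and x: "x \<in> {-1<..<1 :: real}"
    have "((deriv ^^ j) g has_real_derivative G (Suc j) x) (at x)"
      by (rule transf[OF der[OF x]]) (use j x iter in auto)
    then show "(deriv ^^ j) g field_differentiable at x" by (auto simp: field_differentiable_def)
  next
    show "(deriv ^^ (r - 1)) g \<in> AC_loc"
      unfolding AC_loc_def
    proof (intro CollectI allI impI)
      fix a b :: real assume ab: "-1 < a" "a \<le> b" "b < 1"
      \<comment> \<open>A proper interval around \<open>{a..b}\<close>, since \<open>a = b\<close>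
        is allowed in \<open>AC_loc\<close>.\<close>
      have "absolutely_continuous_on {(a - 1) / 2..(b + 1) / 2} (G r')" using ab by (intro AC) auto
      then show "absolutely_continuous_on {a..b} ((deriv ^^ (r - 1)) g)"
        by (rule absolutely_continuous_on_cong_subset) (use ab in \<open>auto simp: r' iter[symmetric]\<close>)
    qed
  qed
  have ae: "AE x in lborel. x \<in> {a<..<b} \<longrightarrow> summable (\<lambda>j. poly ((pderiv ^^ r) (S j)) x) \<and> (deriv ^^ r) g x = G r x"
    if ab: "-1 < a" "a < b" "b < 1" for a b
  proof -
    obtain C1 where C1: "C1 \<ge> 0" "\<And>j. abs_integral a b (pderiv ((pderiv ^^ r') (S j))) \<le> ennreal (C1 * \<rho> ^ j)"
      using V[OF ab, of r] by (auto simp: r')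
    obtain C2 where C2: "C2 \<ge> 0" "\<And>j. abs_integral a b (pderiv (pderiv ((pderiv ^^ r') (S j)))) \<le> ennreal (C2 * (2 * \<rho>) ^ j)"
      using V[OF ab, of "Suc r"] by (auto simp: r')
    have mono: "ennreal (C1 * x) \<le> ennreal (max C1 C2 * x)" "ennreal (C2 * x) \<le> ennreal (max C1 C2 * x)" if "x \<ge> 0" for x
      using that by (auto intro!: ennreal_leI mult_right_mono)
    have "AE x in lborel. x \<in> {a<..<b} \<longrightarrow> summable (\<lambda>j. poly (pderiv ((pderiv ^^ r') (S j))) x) \<and>
      ((\<lambda>x. \<Sum>j. poly ((pderiv ^^ r') (S j)) x) has_real_derivative (\<Sum>j. poly (pderiv ((pderiv ^^ r') (S j))) x)) (at x)"
    proof (rule poly_series_ae_derivative[where C = "max C1 C2" and \<rho> = \<rho>])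
      show "abs_integral a b (pderiv ((pderiv ^^ r') (S j))) \<le> ennreal (max C1 C2 * \<rho> ^ j)" for j
        using \<rho> by (intro order.trans[OF C1(2) mono(1)]) auto
      show "abs_integral a b (pderiv (pderiv ((pderiv ^^ r') (S j)))) \<le> ennreal (max C1 C2 * (2 * \<rho>) ^ j)" for j
        using \<rho> by (intro order.trans[OF C2(2) mono(2)]) auto
    qed (use \<rho> C1 ab sm in \<open>auto simp: r'\<close>)
    then show ?thesis
    proof eventually_elim
      case (elim x)
      show ?case
      proof
        assume x: "x \<in> {a<..<b}"
        then have x': "x \<in> {-1<..<1}" using ab by auto
        have d: "(G r' has_real_derivative G r x) (at x)" using elim x by (simp add: G_def[abs_def] r')
        have "((deriv ^^ r') g has_real_derivative G r x) (at x)"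
          by (rule transf[OF d _ x']) (simp add: iter r')
        then show "summable (\<lambda>j. poly ((pderiv ^^ r) (S j)) x) \<and> (deriv ^^ r) g x = G r x"
          using elim x by (simp add: r' DERIV_imp_deriv)
      qed
    qed
  qed
  \<comment> \<open>Countably many compact intervals exhaust (-1, 1), so their exceptional sets
    unite to a null set.\<close>
  define A where "A n = 1 - 1 / (real n + 2)" for n
  have A: "0 < A n" "A n < 1" for n by (auto simp: A_def field_simps)
  have "AE x in lborel. \<forall>n. x \<in> {- A n<..<A n} \<longrightarrow> summable (\<lambda>j. poly ((pderiv ^^ r) (S j)) x) \<and> (deriv ^^ r) g x = G r x"
    unfolding AE_all_countable
  proof
    fix n
    show "AE x in lborel. x \<in> {- A n<..<A n} \<longrightarrow> summable (\<lambda>j. poly ((pderiv ^^ r) (S j)) x) \<and> (deriv ^^ r) g x = G r x"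
      using A[of n] by (intro ae) auto
  qed
  then show "AE x in lborel. x \<in> {-1<..<1} \<longrightarrow> summable (\<lambda>j. poly ((pderiv ^^ r) (S j)) x) \<and>
      (deriv ^^ r) g x = (\<Sum>j. poly ((pderiv ^^ r) (S j)) x)"
  proof eventually_elim
    case (elim x)
    show ?case
    proof
      assume x: "x \<in> {-1<..<1}"
      then have "0 < 1 - \<bar>x\<bar>" by auto
      then obtain n where "1 / real (Suc n) < 1 - \<bar>x\<bar>" using nat_approx_posE by blast
      moreover have "1 / (real n + 2) \<le> 1 / real (Suc n)" by (intro divide_left_mono) auto
      ultimately have "x \<in> {- A n<..<A n}" by (auto simp: A_def abs_less_iff)
      with elim show "summable (\<lambda>j. poly ((pderiv ^^ r) (S j)) x) \<and> (deriv ^^ r) g x = (\<Sum>j. poly ((pderiv ^^ r) (S j)) x)"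
        unfolding G_def by blast
    qed
  qed
qed

lemma AC_derivs_continuous:
  assumes g: "g \<in> AC_derivs r" and r: "r \<ge> 1"
  shows "continuous_on {-1<..<1} g"
proof (cases "r = 1")
  case False
  then have "\<forall>x\<in>{-1<..<1}. g field_differentiable at x"
    using g r by (auto simp: AC_derivs_def dest!: spec[of _ 0])
  then show ?thesis
    by (intro continuous_at_imp_continuous_on ballI field_differentiable_imp_continuous_at) auto
next
  case True
  have "isCont g x" if x: "x \<in> {-1<..<1}" for x
    unfolding continuous_at_eps_delta
  proof (intro allI impI)
    fix \<epsilon> :: real assume \<epsilon>: "0 < \<epsilon>"
    obtain a b where ab: "-1 < a" "a < x" "x < b" "b < 1"
      using x dense[of "-1" x] dense[of x 1] by auto
    then have "absolutely_continuous_on {a..b} g" using g True by (simp add: AC_derivs_def AC_loc_def)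
    then obtain \<delta> where \<delta>: "\<delta> > 0" "\<And>(I :: nat set) l u. finite I \<Longrightarrow> (\<forall>i\<in>I. l i \<le> u i \<and> {l i..u i} \<subseteq> {a..b}) \<Longrightarrow>
        disjoint_family_on (\<lambda>i. {l i<..<u i}) I \<Longrightarrow> (\<Sum>i\<in>I. u i - l i) < \<delta> \<Longrightarrow> (\<Sum>i\<in>I. \<bar>g (u i) - g (l i)\<bar>) < \<epsilon>"
      using \<epsilon> unfolding absolutely_continuous_on_def by meson
    \<comment> \<open>Absolute continuity tested on a family consisting of one interval.\<close>
    have one: "\<bar>g u - g l\<bar> < \<epsilon>" if "l \<le> u" "{l..u} \<subseteq> {a..b}" "u - l < \<delta>" for l u
      using \<delta>(2)[of "{0}" "\<lambda>_. l" "\<lambda>_. u"] that by (auto simp: disjoint_family_on_def)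
    show "\<exists>d>0. \<forall>x'. dist x' x < d \<longrightarrow> dist (g x') (g x) < \<epsilon>"
    proof (intro exI[of _ "Min {\<delta>, x - a, b - x}"] conjI allI impI)
      show "0 < Min {\<delta>, x - a, b - x}" using \<delta>(1) ab by simp
      fix y assume "dist y x < Min {\<delta>, x - a, b - x}"
      then have y: "\<bar>y - x\<bar> < \<delta>" "a < y" "y < b" using ab by (auto simp: dist_real_def abs_less_iff)
      show "dist (g y) (g x) < \<epsilon>"
      proof (cases "x \<le> y")
        case True
        then show ?thesis using one[of x y] y ab by (auto simp: dist_real_def)
      next
        case False
        then show ?thesis using one[of y x] y ab by (auto simp: dist_real_def abs_minus_commute)
      qed
    qed
  qed
  then show ?thesis by (intro continuous_at_imp_continuous_on) auto
qed

lemma deriv_funpow_cong_on: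
  fixes f g :: "real \<Rightarrow> real"
  assumes "open U" "\<And>x. x \<in> U \<Longrightarrow> f x = g x" "x \<in> U"
  shows "(deriv ^^ r) f x = (deriv ^^ r) g x"
  using assms(3)
proof (induction r arbitrary: x)
  case (Suc r)
  have "eventually (\<lambda>y. y \<in> U) (nhds x)" using assms(1) Suc.prems by (rule eventually_nhds_in_open)
  then have "eventually (\<lambda>y. (deriv ^^ r) f y = (deriv ^^ r) g y) (nhds x)"
    by eventually_elim (rule Suc.IH)
  then show ?case by (simp add: deriv_cong_ev)
qed (simp add: assms)

text \<open>Continuous functions that agree almost everywhere agree on (-1, 1), and so do all their
  derivatives. Therefore the choice made in \<open>ae_deriv\<close> does not affect the derivative
  there.\<close>

lemma AC_derivs_unique:
  assumes f: "f \<in> AC_derivs r" and g: "g \<in> AC_derivs r" and r: "r \<ge> 1" and ae: "AE x in lborel. x \<in> {-1..1} \<longrightarrow> f x = g x"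
    and x: "x \<in> {-1<..<1}"
  shows "(deriv ^^ r) f x = (deriv ^^ r) g x"
proof (rule deriv_funpow_cong_on[OF open_greaterThanLessThan _ x])
  fix y assume y: "y \<in> {-1<..<1 :: real}"
  have "\<bar>f y - g y\<bar> \<le> 0"
  proof (rule AE_imp_everywhere_continuous[OF _ _ y])
    show "AE x in lborel. x \<in> {-1<..<1} \<longrightarrow> \<bar>f x - g x\<bar> \<le> 0" using ae by eventually_elim auto
    show "continuous_on {-1<..<1} (\<lambda>x. \<bar>f x - g x\<bar>)"
      by (intro continuous_intros AC_derivs_continuous[OF f r] AC_derivs_continuous[OF g r])
  qed
  then show "f y = g y" by simp
qed

subsection \<open>The inverse estimate\<close>

lemma Lp_le_0_AE:
  assumes p: "1 \<le> p" and f: "Lp_le p f 0"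
  shows "AE x in lebesgue_on {-1..1}. f x = 0"
proof (cases "p = \<infinity>")
  case True
  then have "AE x in lebesgue_on {-1..1}. \<bar>f x\<bar> \<le> 0" using f by (simp add: Lp_le_def)
  then show ?thesis by eventually_elim simp
next
  case False
  note [measurable] = Lp_leD(2)[OF f]
  have q: "enn2real p \<ge> 1" using enn2real_ge_1[OF p False] .
  have "(\<integral>\<^sup>+x. ennreal (\<bar>f x\<bar> powr enn2real p) \<partial>lebesgue_on {-1..1}) = 0"
    using f False q by (simp add: Lp_le_def)
  then have "AE x in lebesgue_on {-1..1}. ennreal (\<bar>f x\<bar> powr enn2real p) = 0"
    by (subst (asm) nn_integral_0_iff_AE) auto
  then show ?thesis by eventually_elim (simp add: powr_eq_0_iff)
qed

lemma Lp_le_weaken: "Lp_le p f K \<Longrightarrow> 1 \<le> p \<Longrightarrow> K \<le> K' \<Longrightarrow> Lp_le p f K'"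
  by (rule Lp_le_mono[where f = f]) (auto simp: Lp_leD)

text \<open>On a compact part of (-1, 1) the weight has a positive minimum. The constant is
  independent of the polynomial, which is what allows summation over the series.\<close>

lemma abs_integral_le_of_Lp_le:
  assumes ab: "-1 < a" "a < b" "b < 1"
  shows "\<exists>M\<ge>0. \<forall>p P K. 1 \<le> p \<longrightarrow> Lp_le p (\<lambda>x. jacobi_weight \<xi> \<zeta> x * poly P x) K \<longrightarrow> abs_integral a b P \<le> ennreal (M * K)"
proof -
  have "continuous_on {a..b} (jacobi_weight \<xi> \<zeta>)"
    unfolding jacobi_weight_def using ab by (intro continuous_intros) auto
  then obtain y where y: "y \<in> {a..b}" "\<And>x. x \<in> {a..b} \<Longrightarrow> jacobi_weight \<xi> \<zeta> y \<le> jacobi_weight \<xi> \<zeta> x"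
    using continuous_attains_inf[of "{a..b}" "jacobi_weight \<xi> \<zeta>"] ab by auto
  define m where "m = jacobi_weight \<xi> \<zeta> y"
  have m: "m > 0" unfolding m_def using y ab by (intro jacobi_weight_pos) auto
  have "abs_integral a b P \<le> ennreal (2 / m * K)"
    if p: "1 \<le> p" and P: "Lp_le p (\<lambda>x. jacobi_weight \<xi> \<zeta> x * poly P x) K" for p P K
  proof -
    have "abs_integral a b P \<le> (\<integral>\<^sup>+x. ennreal (1 / m) * (ennreal \<bar>jacobi_weight \<xi> \<zeta> x * poly P x\<bar> * indicator {-1..1} x) \<partial>lborel)"
      unfolding abs_integral_def
    proof (rule nn_integral_mono)
      fix x
      show "ennreal \<bar>poly P x\<bar> * indicator {a..b} x \<le> ennreal (1 / m) * (ennreal \<bar>jacobi_weight \<xi> \<zeta> x * poly P x\<bar> * indicator {-1..1} x)"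
      proof (cases "x \<in> {a..b}")
        case True
        have "m * \<bar>poly P x\<bar> \<le> \<bar>jacobi_weight \<xi> \<zeta> x * poly P x\<bar>"
          using y(2)[OF True] by (simp add: abs_mult jacobi_weight_nonneg m_def mult_right_mono)
        then have "\<bar>poly P x\<bar> \<le> 1 / m * \<bar>jacobi_weight \<xi> \<zeta> x * poly P x\<bar>" using m by (simp add: field_simps)
        then show ?thesis using True ab m by (simp add: ennreal_mult[symmetric] ennreal_leI)
      qed simp
    qed
    also have "\<dots> = ennreal (1 / m) * (\<integral>\<^sup>+x. ennreal \<bar>jacobi_weight \<xi> \<zeta> x * poly P x\<bar> * indicator {-1..1} x \<partial>lborel)"
      by (rule nn_integral_cmult) measurable
    also have "(\<integral>\<^sup>+x. ennreal \<bar>jacobi_weight \<xi> \<zeta> x * poly P x\<bar> * indicator {-1..1} x \<partial>lborel) \<le> ennreal (2 * K)"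
      using Lp_le_L1[OF P p] by (simp add: nn_integral_lebesgue_on)
    also have "ennreal (1 / m) * ennreal (2 * K) = ennreal (2 / m * K)"
      using m Lp_leD(1)[OF P] by (simp add: ennreal_mult[symmetric])
    finally show ?thesis by (simp add: mult_left_mono)
  qed
  then show ?thesis using m by (intro exI[of _ "2 / m"]) auto
qed

lemma abs_integral_finite: "\<exists>M\<ge>0. abs_integral a b P \<le> ennreal M"
proof -
  have "((\<lambda>x. \<bar>poly P x\<bar>) has_integral integral {a..b} (\<lambda>x. \<bar>poly P x\<bar>)) {a..b}"
    by (intro integrable_integral integrable_continuous_real continuous_intros)
  then have "abs_integral a b P = ennreal (integral {a..b} (\<lambda>x. \<bar>poly P x\<bar>))"
    unfolding abs_integral_def by (intro nn_integral_has_integral_on) auto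
  then show ?thesis by (intro exI[of _ "max 0 (integral {a..b} (\<lambda>x. \<bar>poly P x\<bar>))"]) (auto intro!: ennreal_leI)
qed

lemma pderiv_funpow_diff: "(pderiv ^^ i) (P - Q) = (pderiv ^^ i) P - (pderiv ^^ i) (Q :: real poly)"
  by (induction i) (auto simp: pderiv_diff)

lemma pderiv_funpow_add: "(pderiv ^^ i) (P + Q) = (pderiv ^^ i) P + (pderiv ^^ i) (Q :: real poly)"
  by (induction i) (auto simp: pderiv_add)

lemma pderiv_funpow_sum: "(pderiv ^^ i) (\<Sum>j\<in>A. F j) = (\<Sum>j\<in>A. (pderiv ^^ i) (F j :: real poly))"
proof (induction A rule: infinite_finite_induct)
  case (insert x A)
  then show ?case by (simp add: pderiv_funpow_add)
qed (induction i; simp)+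

lemma two_power_powr: "real (2 ^ m) powr x = (2 powr x) ^ m"
proof -
  have "real (2 ^ m) = 2 powr real m" by (simp add: powr_realpow)
  then have "real (2 ^ m) powr x = 2 powr (real m * x)" by (simp only: powr_powr)
  also have "\<dots> = (2 powr x) ^ m" by (simp add: powr_power mult.commute)
  finally show ?thesis .
qed

lemma AE_lebesgue_on_unit_interval: "(AE x in lebesgue_on {-1..1}. P x) \<longleftrightarrow> (AE x in lborel. x \<in> {-1..1::real} \<longrightarrow> P x)"
  by (rule AE_lebesgue_on) simp

lemma pderiv_funpow_eq_0: "degree (P :: real poly) < n \<Longrightarrow> (pderiv ^^ n) P = 0"
proof (induction n arbitrary: P)
  case (Suc n)
  show ?case
  proof (cases "n = 0")
    case True
    with Suc.prems show ?thesis by (simp add: pderiv_eq_0_iff)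
  next
    case False
    have "degree (pderiv P) < n" using Suc.prems False by (simp add: degree_pderiv)
    then have "(pderiv ^^ n) (pderiv P) = 0" by (rule Suc.IH)
    then show ?thesis by (simp add: funpow_swap1)
  qed
qed simp

text \<open>\<open>Q j\<close> is a near-best approximant of degree below 2^(l+j); the factor 2 in
  its error is there because an infimum need not be attained. The initial level \<open>l\<close> is
  later taken as N + k + r, so that the hypothesis on the best approximations applies at every
  level. \<open>Q0\<close> is near-best of degree below \<open>k + r\<close>, and \<open>E\<close>
  stands for a number slightly above the best approximation of order \<open>k + r\<close>;
  \<open>Q 0\<close> satisfies this bound as well. \<open>C i\<close> are the constants of the
  Bernstein inequality for derivatives of order \<open>i\<close>.\<close>

locale approximants =
  fixes k r l :: nat and p :: ennreal and \<alpha> \<beta> \<gamma> F E :: real and f :: "real \<Rightarrow> real"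
    and Q :: "nat \<Rightarrow> real poly" and Q0 :: "real poly" and C :: "nat \<Rightarrow> real"
  assumes k: "k \<ge> 1" and p: "1 \<le> p"
    and \<xi>: "real r / 2 + \<alpha> \<ge> 0" and \<zeta>: "real r / 2 + \<beta> \<ge> 0"
    and \<gamma>: "real r < \<gamma>" "\<gamma> < real (k + r)"
    and C: "\<And>i. 0 \<le> C i"
    and bernstein: "\<And>i n P K. n \<ge> 1 \<Longrightarrow> degree P < n \<Longrightarrow> Lp_le p (\<lambda>x. jacobi_weight \<alpha> \<beta> x * poly P x) K \<Longrightarrow>
      Lp_le p (\<lambda>x. jacobi_weight (\<alpha> + real i / 2) (\<beta> + real i / 2) x * poly ((pderiv ^^ i) P) x) (C i * real n ^ i * K)"
    and f: "Lp_le p (\<lambda>x. jacobi_weight \<alpha> \<beta> x * f x) F"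
    and Q_degree: "\<And>j. degree (Q j) < 2 ^ (l + j)"
    and Q_approx: "\<And>j. Lp_le p (\<lambda>x. jacobi_weight \<alpha> \<beta> x * (f x - poly (Q j) x)) (2 * real (2 ^ (l + j)) powr (- \<gamma>))"
    and Q_approx_E: "Lp_le p (\<lambda>x. jacobi_weight \<alpha> \<beta> x * (f x - poly (Q 0) x)) E"
    and Q0_degree: "degree Q0 < k + r" "k + r \<le> 2 ^ l"
    and Q0_approx: "Lp_le p (\<lambda>x. jacobi_weight \<alpha> \<beta> x * (f x - poly Q0 x)) E"
begin

definition S :: "nat \<Rightarrow> real poly" where
  "S j = (case j of 0 \<Rightarrow> Q 0 | Suc j \<Rightarrow> Q (Suc j) - Q j)"

lemma S_sum: "(\<Sum>j<Suc n. S j) = Q n"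
  by (induction n) (auto simp: S_def)

definition W :: "nat \<Rightarrow> real \<Rightarrow> real" where
  "W i = jacobi_weight (\<alpha> + real i / 2) (\<beta> + real i / 2)"

lemma borel_measurable_W [measurable]: "W i \<in> borel_measurable borel"
  by (simp add: W_def)

text \<open>Ratio at which the weighted derivatives of order \<open>r\<close> of the dyadic blocks
  decay; \<open>\<Lambda>\<close> is the ratio at which those of order \<open>k + r\<close>
  grow.\<close>

definition \<theta> :: real where "\<theta> = 2 powr (real r - \<gamma>)"
definition \<Lambda> :: real where "\<Lambda> = 2 powr (real (k + r) - \<gamma>)"

lemma \<theta>: "0 < \<theta>" "\<theta> < 1"
  using \<gamma> powr_less_cancel_iff[of 2 "real r - \<gamma>" 0] by (auto simp: \<theta>_def)

lemma \<Lambda>: "1 < \<Lambda>"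
  using \<gamma> powr_less_cancel_iff[of 2 0 "real (k + r) - \<gamma>"] by (auto simp: \<Lambda>_def)

text \<open>Both approximants are close to \<open>f\<close>, so their difference has weighted norm
  at most 4 (2^(l+j))^(-\<gamma>); the Bernstein inequality with degree bound 2^(l+j+1) supplies the
  factor \<open>2 ^ i\<close> and the change of exponent from -\<gamma> to i - \<gamma>.\<close>

lemma S_bound:
  "Lp_le p (\<lambda>x. W i x * poly ((pderiv ^^ i) (S (Suc j))) x) (4 * C i * 2 ^ i * (2 powr (real i - \<gamma>)) ^ (l + j))"
proof -
  let ?n = "2 ^ (l + j) :: nat"
  have d: "Lp_le p (\<lambda>x. jacobi_weight \<alpha> \<beta> x * (f x - poly (Q j) x) - jacobi_weight \<alpha> \<beta> x * (f x - poly (Q (Suc j)) x))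
     (2 * real ?n powr (- \<gamma>) + 2 * real (2 ^ (l + Suc j)) powr (- \<gamma>))"
    by (rule Lp_le_diff[OF Q_approx Q_approx p])
  have m: "2 * real (2 ^ (l + Suc j)) powr (- \<gamma>) \<le> 2 * real ?n powr (- \<gamma>)"
    using \<gamma> by (intro mult_left_mono powr_mono2') auto
  have "Lp_le p (\<lambda>x. jacobi_weight \<alpha> \<beta> x * (f x - poly (Q j) x) - jacobi_weight \<alpha> \<beta> x * (f x - poly (Q (Suc j)) x)) (4 * real ?n powr (- \<gamma>))"
    by (rule Lp_le_weaken[OF d p]) (use m in linarith)
  then have 1: "Lp_le p (\<lambda>x. jacobi_weight \<alpha> \<beta> x * poly (S (Suc j)) x) (4 * real ?n powr (- \<gamma>))"
    by (simp add: S_def algebra_simps)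
  have "degree (S (Suc j)) \<le> max (degree (Q (Suc j))) (degree (Q j))" by (simp add: S_def degree_diff_le_max)
  also have "\<dots> < 2 ^ (l + Suc j)" using Q_degree[of j] Q_degree[of "Suc j"] by simp
  finally have "Lp_le p (\<lambda>x. W i x * poly ((pderiv ^^ i) (S (Suc j))) x) (C i * real (2 ^ (l + Suc j)) ^ i * (4 * real ?n powr (- \<gamma>)))"
    unfolding W_def by (intro bernstein 1) auto
  moreover have "C i * real (2 ^ (l + Suc j)) ^ i * (4 * real ?n powr (- \<gamma>)) = 4 * C i * 2 ^ i * (2 powr (real i - \<gamma>)) ^ (l + j)"
  proof -
    have gen: "c * (x * y) * (4 * z) = 4 * c * x * (y * z)" for c x y z :: real by simp
    have e1: "real (2 ^ (l + Suc j)) ^ i = 2 ^ i * real ?n ^ i" by (simp add: power_mult_distrib)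
    have "real ?n ^ i = real ?n powr real i" by (rule powr_realpow[symmetric]) simp
    then have e2: "real ?n ^ i * real ?n powr (- \<gamma>) = real ?n powr (real i - \<gamma>)"
      by (simp only: powr_add[symmetric] diff_conv_add_uminus)
    have "C i * real (2 ^ (l + Suc j)) ^ i * (4 * real ?n powr (- \<gamma>)) = 4 * C i * 2 ^ i * (real ?n ^ i * real ?n powr (- \<gamma>))"
      unfolding e1 by (rule gen)
    then have "C i * real (2 ^ (l + Suc j)) ^ i * (4 * real ?n powr (- \<gamma>)) = 4 * C i * 2 ^ i * real ?n powr (real i - \<gamma>)"
      unfolding e2 .
    then show ?thesis by (simp only: two_power_powr)
  qed
  ultimately show ?thesis by (simp only:)
qed

text \<open>The sum of the geometric series of the blocks, unbounded as \<gamma> approaches r. The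
  summand 2 covers the direct approximation bound that is used when \<open>r = 0\<close>.\<close>

definition A :: real where "A = 2 + 4 * C r * 2 ^ r / (1 - \<theta>)"

lemma partial_sum_bound:
  "Lp_le p (\<lambda>x. W r x * (poly ((pderiv ^^ r) (Q (n + m))) x - poly ((pderiv ^^ r) (Q n)) x)) (A * \<theta> ^ (l + n))"
proof -
  have Qnm: "Q (n + m) - Q n = (\<Sum>j<m. S (Suc (n + j)))"
    by (induction m) (auto simp: S_def algebra_simps)
  have "Lp_le p (\<lambda>x. \<Sum>j<m. W r x * poly ((pderiv ^^ r) (S (Suc (n + j)))) x) (\<Sum>j<m. 4 * C r * 2 ^ r * \<theta> ^ (l + (n + j)))"
    unfolding \<theta>_def by (intro Lp_le_sum[OF p] S_bound)
  moreover have "(\<Sum>j<m. W r x * poly ((pderiv ^^ r) (S (Suc (n + j)))) x) = W r x * (poly ((pderiv ^^ r) (Q (n + m))) x - poly ((pderiv ^^ r) (Q n)) x)" for x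
    unfolding poly_diff[symmetric] pderiv_funpow_diff[symmetric] Qnm pderiv_funpow_sum
    by (simp add: poly_sum sum_distrib_left)
  moreover have "(\<Sum>j<m. 4 * C r * 2 ^ r * \<theta> ^ (l + (n + j))) \<le> A * \<theta> ^ (l + n)"
  proof -
    have "(\<Sum>j<m. 4 * C r * 2 ^ r * \<theta> ^ (l + (n + j))) = 4 * C r * 2 ^ r * \<theta> ^ (l + n) * (\<Sum>j<m. \<theta> ^ j)"
      by (simp add: sum_distrib_left power_add mult_ac)
    also have "(\<Sum>j<m. \<theta> ^ j) \<le> 1 / (1 - \<theta>)"
    proof -
      have "(\<Sum>j<m. \<theta> ^ j) = (1 - \<theta> ^ m) / (1 - \<theta>)" using \<theta> by (simp add: sum_gp_strict)
      also have "\<dots> \<le> 1 / (1 - \<theta>)" using \<theta> by (intro divide_right_mono) auto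
      finally show ?thesis .
    qed
    also have "4 * C r * 2 ^ r * \<theta> ^ (l + n) * (1 / (1 - \<theta>)) \<le> A * \<theta> ^ (l + n)"
      using \<theta> by (simp add: A_def algebra_simps)
    finally show ?thesis using C[of r] \<theta> by (simp add: mult_left_mono)
  qed
  ultimately show ?thesis by (simp add: Lp_le_weaken[OF _ p])
qed

text \<open>Qualitative input for the convergence of the series: \<open>K\<close> may depend on
  \<open>f\<close> and on the interval and does not enter the final constants. The ratio is raised
  to at least 3/4 since the differentiation argument asks for more than 1/2.\<close>

lemma abs_integral_S:
  assumes ab: "-1 < a" "a < b" "b < 1" and i: "i \<le> Suc r"
  defines "\<rho> \<equiv> max \<theta> (3 / 4)"
  shows "\<exists>K\<ge>0. \<forall>j. abs_integral a b ((pderiv ^^ i) (S j)) \<le> ennreal (K * (if i \<le> r then \<rho> else 2 * \<rho>) ^ j)"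
proof -
  let ?\<rho> = "if i \<le> r then \<rho> else 2 * \<rho>"
  have \<rho>: "\<rho> > 0" "?\<rho> > 0" by (auto simp: \<rho>_def)
  define x where "x = 2 powr (real i - \<gamma>)"
  have x: "0 \<le> x" "x \<le> ?\<rho>"
  proof -
    have "x \<le> \<theta>" if "i \<le> r" using that by (auto simp: x_def \<theta>_def intro!: powr_mono)
    moreover have "x = 2 * \<theta>" if "\<not> i \<le> r"
    proof -
      have "i = Suc r" using that i by simp
      then have "x = 2 powr (1 + (real r - \<gamma>))" by (simp add: x_def algebra_simps)
      then show ?thesis by (simp only: powr_add \<theta>_def) simp
    qed
    ultimately show "0 \<le> x" "x \<le> ?\<rho>" by (auto simp: \<rho>_def x_def)
  qed
  obtain M where M: "M \<ge> 0" "\<And>P K. Lp_le p (\<lambda>x. W i x * poly P x) K \<Longrightarrow> abs_integral a b P \<le> ennreal (M * K)"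
    using abs_integral_le_of_Lp_le[OF ab, of "\<alpha> + real i / 2" "\<beta> + real i / 2"] p unfolding W_def by auto
  \<comment> \<open>The initial block is not a difference of approximants; it is a single
    polynomial, and a finite value is enough for it.\<close>
  obtain M0 where M0: "M0 \<ge> 0" "abs_integral a b ((pderiv ^^ i) (S 0)) \<le> ennreal M0"
    using abs_integral_finite by blast
  define K where "K = M0 + M * (4 * C i * 2 ^ i * x ^ l) / ?\<rho>"
  have "abs_integral a b ((pderiv ^^ i) (S j)) \<le> ennreal (K * ?\<rho> ^ j)" for j
  proof (cases j)
    case 0
    have "M0 \<le> K" using M M0 C[of i] x \<rho> by (simp add: K_def)
    then show ?thesis using M0(2) 0 by (auto intro: order.trans ennreal_leI)
  next
    case (Suc j')
    have "abs_integral a b ((pderiv ^^ i) (S j)) \<le> ennreal (M * (4 * C i * 2 ^ i * x ^ (l + j')))"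
      unfolding Suc x_def by (rule M(2)[OF S_bound])
    also have "\<dots> \<le> ennreal (K * ?\<rho> ^ j)"
    proof (rule ennreal_leI)
      have "M * (4 * C i * 2 ^ i * x ^ (l + j')) = M * (4 * C i * 2 ^ i * x ^ l) * x ^ j'" by (simp add: power_add)
      also have "\<dots> \<le> M * (4 * C i * 2 ^ i * x ^ l) * ?\<rho> ^ j'"
        using M C[of i] x by (intro mult_left_mono power_mono) auto
      also have "\<dots> = M * (4 * C i * 2 ^ i * x ^ l) / ?\<rho> * ?\<rho> ^ j" using \<rho>(2) by (simp add: Suc)
      also have "\<dots> \<le> K * ?\<rho> ^ j"
        using M0 \<rho>(2) by (intro mult_right_mono) (auto simp: K_def)
      finally show "M * (4 * C i * 2 ^ i * x ^ (l + j')) \<le> K * ?\<rho> ^ j" .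
    qed
    finally show ?thesis .
  qed
  moreover have "K \<ge> 0" using M M0 C[of i] x \<rho> by (simp add: K_def)
  ultimately show ?thesis by blast
qed

lemma W_0: "W 0 = jacobi_weight \<alpha> \<beta>"
  by (simp add: W_def)

lemma ae_interior: "AE x in lebesgue_on {-1..1}. x \<in> {-1<..<1 :: real}"
proof -
  have "AE x in lborel. x \<noteq> 1 \<and> x \<noteq> (-1 :: real)"
    using AE_lborel_singleton[of 1] AE_lborel_singleton[of "-1"] by eventually_elim auto
  then have "AE x in lborel. x \<in> {-1..1} \<longrightarrow> x \<in> {-1<..<1 :: real}"
    by eventually_elim auto
  then show ?thesis unfolding AE_lebesgue_on_unit_interval .
qed

lemma weighted_0_AE:
  assumes "Lp_le p (\<lambda>x. W 0 x * u x) 0"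
  shows "AE x in lebesgue_on {-1..1}. u x = 0"
  using Lp_le_0_AE[OF p assms] ae_interior
proof eventually_elim
  case (elim x)
  then show ?case using jacobi_weight_pos[of x \<alpha> \<beta>] by (simp add: W_0)
qed

text \<open>The representative is the sum of the telescoping series. The bounds between two
  approximants, uniform in the second, pass to the limit by Fatou's lemma and become bounds for its
  derivative of order \<open>r\<close>.\<close>

lemma smooth_representative:
  assumes r: "r \<ge> 1"
  obtains g where "g \<in> AC_derivs r" "ae_eq f g"
    "\<And>n. Lp_le p (\<lambda>x. W r x * ((deriv ^^ r) g x - poly ((pderiv ^^ r) (Q n)) x)) (A * \<theta> ^ (l + n))"
proof -
  define \<rho> where "\<rho> = max \<theta> (3 / 4)"
  have \<rho>: "1 / 2 < \<rho>" "\<rho> < 1" using \<theta> by (auto simp: \<rho>_def)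
  define g where "g x = (\<Sum>j. poly (S j) x)" for x
  note series = poly_series_AC_derivs[OF r \<rho>, of S, folded \<rho>_def g_def[abs_def]]
  have V: "\<exists>K\<ge>0. \<forall>j. abs_integral a b ((pderiv ^^ i) (S j)) \<le> ennreal (K * (if i \<le> r then \<rho> else 2 * \<rho>) ^ j)"
    if "-1 < a" "a < b" "b < 1" "i \<le> Suc r" for a b i
    unfolding \<rho>_def by (rule abs_integral_S[OF that])
  have ser1: "g \<in> AC_derivs r" by (rule series(1)) (rule V)
  have ser2: "summable (\<lambda>j. poly (S j) x)" if "x \<in> {-1<..<1}" for x by (rule series(2)[OF _ that]) (rule V)
  have ser3: "AE x in lborel. x \<in> {-1<..<1} \<longrightarrow> summable (\<lambda>j. poly ((pderiv ^^ r) (S j)) x) \<and>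
      (deriv ^^ r) g x = (\<Sum>j. poly ((pderiv ^^ r) (S j)) x)" by (rule series(3)) (rule V)
  have part: "(\<Sum>j<Suc n. poly ((pderiv ^^ i) (S j)) x) = poly ((pderiv ^^ i) (Q n)) x" for i n x
    by (simp only: poly_sum[symmetric] pderiv_funpow_sum[symmetric] S_sum)
  \<comment> \<open>The approximants are eventually within any \<open>\<epsilon>\<close> of
    \<open>f\<close> in norm and converge pointwise to \<open>g\<close>, so Fatou's lemma bounds the
    weighted norm of \<open>f - g\<close> by every \<open>\<epsilon>\<close>.\<close>
  have "AE x in lebesgue_on {-1..1}. f x - g x = 0"
  proof (rule weighted_0_AE, rule Lp_le_epsilon[OF p order.refl])
    fix \<epsilon> :: real assume \<epsilon>: "0 < \<epsilon>"
    define x where "x = 2 powr (- \<gamma>)"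
    have \<gamma>0: "\<gamma> > 0" using \<gamma>(1) of_nat_0_le_iff[of r] by linarith
    have x: "0 \<le> x" "x < 1" using \<gamma>0 powr_less_cancel_iff[of 2 "- \<gamma>" 0] by (auto simp: x_def)
    have xj: "real (2 ^ (l + j)) powr (- \<gamma>) = x ^ (l + j)" for j
      unfolding x_def by (rule two_power_powr)
    have "(\<lambda>n. 2 * x ^ n) \<longlonglongrightarrow> 2 * 0" using x by (intro tendsto_mult tendsto_const LIMSEQ_power_zero) auto
    then have "eventually (\<lambda>n. 2 * x ^ n < \<epsilon>) sequentially" using \<epsilon> by (intro order_tendstoD(2)) auto
    then obtain n0 where n0: "\<And>n. n \<ge> n0 \<Longrightarrow> 2 * x ^ n < \<epsilon>" unfolding eventually_sequentially by auto
    have b: "Lp_le p (\<lambda>x. W 0 x * (f x - poly (Q (n0 + n)) x)) (0 + \<epsilon>)" for n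
      unfolding W_0 by (rule Lp_le_weaken[OF Q_approx p]) (use n0[of "l + (n0 + n)"] in \<open>simp only: xj, simp\<close>)
    show "Lp_le p (\<lambda>x. W 0 x * (f x - g x)) (0 + \<epsilon>)"
    proof (rule Lp_le_tendsto[OF p b])
      have fm: "f \<in> borel_measurable (lebesgue_on {-1..1})" by (rule weighted_measurableD[OF Lp_leD(2)[OF f]])
      have "g \<in> borel_measurable borel" unfolding g_def[abs_def] by measurable
      then show "(\<lambda>x. W 0 x * (f x - g x)) \<in> borel_measurable (lebesgue_on {-1..1})"
        by (intro borel_measurable_times borel_measurable_diff fm borel_measurable_lebesgue_onI borel_measurable_W)
      show "AE x in lebesgue_on {-1..1}. (\<lambda>n. W 0 x * (f x - poly (Q (n0 + n)) x)) \<longlonglongrightarrow> W 0 x * (f x - g x)"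
        using ae_interior
      proof eventually_elim
        case (elim x)
        have "(\<lambda>n. \<Sum>j<n. poly (S j) x) \<longlonglongrightarrow> g x"
          unfolding g_def using ser2[OF elim] by (rule summable_LIMSEQ)
        then have "(\<lambda>n. \<Sum>j<n + Suc n0. poly (S j) x) \<longlonglongrightarrow> g x" by (rule LIMSEQ_ignore_initial_segment)
        then have "(\<lambda>n. poly (Q (n0 + n)) x) \<longlonglongrightarrow> g x" using part[of 0] by (simp add: add.commute del: sum.lessThan_Suc)
        then show ?case by (intro tendsto_intros)
      qed
    qed
  qed
  then have fg: "ae_eq f g" unfolding ae_eq_def by eventually_elim simp
  have dm: "(deriv ^^ r) g \<in> borel_measurable (lebesgue_on {-1..1})"
  proof (rule borel_measurable_lebesgue_on_AE)
    show "(\<lambda>x. \<Sum>j. poly ((pderiv ^^ r) (S j)) x) \<in> borel_measurable borel" by measurable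
    have "AE x in lborel. x \<in> {-1..1} \<longrightarrow> x \<in> {-1<..<1 :: real}" using ae_interior unfolding AE_lebesgue_on_unit_interval .
    with ser3 show "AE x in lborel. x \<in> {-1..1} \<longrightarrow> (\<Sum>j. poly ((pderiv ^^ r) (S j)) x) = (deriv ^^ r) g x"
      by eventually_elim auto
  qed
  have "Lp_le p (\<lambda>x. W r x * ((deriv ^^ r) g x - poly ((pderiv ^^ r) (Q n)) x)) (A * \<theta> ^ (l + n))" for n
  proof (rule Lp_le_tendsto[OF p partial_sum_bound])
    show "(\<lambda>x. W r x * ((deriv ^^ r) g x - poly ((pderiv ^^ r) (Q n)) x)) \<in> borel_measurable (lebesgue_on {-1..1})"
      by (intro borel_measurable_times borel_measurable_diff dm borel_measurable_lebesgue_onI borel_measurable_W) measurable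
    have "AE x in lebesgue_on {-1..1}. x \<in> {-1<..<1} \<longrightarrow> summable (\<lambda>j. poly ((pderiv ^^ r) (S j)) x) \<and>
      (deriv ^^ r) g x = (\<Sum>j. poly ((pderiv ^^ r) (S j)) x)"
      unfolding AE_lebesgue_on_unit_interval using ser3 by eventually_elim blast
    with ae_interior show "AE x in lebesgue_on {-1..1}. (\<lambda>m. W r x * (poly ((pderiv ^^ r) (Q (n + m))) x - poly ((pderiv ^^ r) (Q n)) x)) \<longlonglongrightarrow> W r x * ((deriv ^^ r) g x - poly ((pderiv ^^ r) (Q n)) x)"
    proof eventually_elim
      case (elim x)
      then have "summable (\<lambda>j. poly ((pderiv ^^ r) (S j)) x)" "(deriv ^^ r) g x = (\<Sum>j. poly ((pderiv ^^ r) (S j)) x)" by auto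
      then have "(\<lambda>m. \<Sum>j<m. poly ((pderiv ^^ r) (S j)) x) \<longlonglongrightarrow> (deriv ^^ r) g x" using summable_LIMSEQ by metis
      then have "(\<lambda>m. \<Sum>j<m + Suc n. poly ((pderiv ^^ r) (S j)) x) \<longlonglongrightarrow> (deriv ^^ r) g x" by (rule LIMSEQ_ignore_initial_segment)
      then have "(\<lambda>m. poly ((pderiv ^^ r) (Q (n + m))) x) \<longlonglongrightarrow> (deriv ^^ r) g x" using part[of r] by (simp add: add.commute del: sum.lessThan_Suc)
      then show ?case by (intro tendsto_intros)
    qed
  qed
  with ser1 fg show ?thesis by (rule that)
qed

lemma A_pos: "2 \<le> A"
  using C[of r] \<theta> by (simp add: A_def)

text \<open>Transfers the bound to the derivative chosen in \<open>ae_deriv\<close>: for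
  \<open>r \<ge> 1\<close> by uniqueness of the representative, for \<open>r = 0\<close> by equality
  almost everywhere.\<close>

lemma ae_deriv_bound:
  "Lp_le p (\<lambda>x. W r x * (ae_deriv r f x - poly ((pderiv ^^ r) (Q n)) x)) (A * \<theta> ^ (l + n))"
proof (cases "r = 0")
  case True
  \<comment> \<open>For \<open>r = 0\<close> every function belongs to \<open>AC_derivs r\<close>,
    so the choice is an arbitrary function equal to \<open>f\<close> almost everywhere, and even its
    measurability has to be derived.\<close>
  define g where "g = (SOME g. g \<in> AC_derivs r \<and> ae_eq f g)"
  have "f \<in> AC_derivs r \<and> ae_eq f f" using True by (simp add: AC_derivs_def ae_eq_def)
  then have g: "ae_eq f g"
    using someI[of "\<lambda>g. g \<in> AC_derivs r \<and> ae_eq f g" f] by (simp add: g_def)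
  have W: "W r = jacobi_weight \<alpha> \<beta>" using True by (simp add: W_def)
  have fm: "f \<in> borel_measurable (lebesgue_on {-1..1})" by (rule weighted_measurableD[OF Lp_leD(2)[OF f]])
  obtain f0 where f0: "f0 \<in> borel_measurable borel" "AE x in lborel. x \<in> {-1..1} \<longrightarrow> f x = f0 x"
    using lebesgue_on_borel_representative[OF fm] .
  have "AE x in lborel. x \<in> {-1..1} \<longrightarrow> f x = g x" using g unfolding ae_eq_def AE_lebesgue_on_unit_interval .
  with f0(2) have "AE x in lborel. x \<in> {-1..1} \<longrightarrow> f0 x = g x" by eventually_elim auto
  then have gm: "g \<in> borel_measurable (lebesgue_on {-1..1})" by (rule borel_measurable_lebesgue_on_AE[OF f0(1)])
  have "Lp_le p (\<lambda>x. W r x * (g x - poly (Q n) x)) (A * \<theta> ^ (l + n))"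
  proof (rule Lp_le_mono[OF Q_approx[of n] p])
    show "(\<lambda>x. W r x * (g x - poly (Q n) x)) \<in> borel_measurable (lebesgue_on {-1..1})"
      by (intro borel_measurable_times borel_measurable_diff gm borel_measurable_lebesgue_onI borel_measurable_W) measurable
    show "AE x in lebesgue_on {-1..1}. \<bar>W r x * (g x - poly (Q n) x)\<bar> \<le> \<bar>jacobi_weight \<alpha> \<beta> x * (f x - poly (Q n) x)\<bar>"
      using g unfolding ae_eq_def by eventually_elim (simp add: W)
    have "\<theta> = 2 powr (- \<gamma>)" using True unfolding \<theta>_def by simp
    then have "2 * real (2 ^ (l + n)) powr (- \<gamma>) = 2 * \<theta> ^ (l + n)" by (simp only: two_power_powr)
    also have "\<dots> \<le> A * \<theta> ^ (l + n)" using A_pos \<theta> by (intro mult_right_mono) auto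
    finally show "2 * real (2 ^ (l + n)) powr (- \<gamma>) \<le> A * \<theta> ^ (l + n)" .
  qed
  then show ?thesis using True by (simp add: ae_deriv_def g_def)
next
  case False
  then have r: "r \<ge> 1" by simp
  obtain g where g: "g \<in> AC_derivs r" "ae_eq f g"
    "\<And>n. Lp_le p (\<lambda>x. W r x * ((deriv ^^ r) g x - poly ((pderiv ^^ r) (Q n)) x)) (A * \<theta> ^ (l + n))"
    using smooth_representative[OF r] by metis
  define g' where "g' = (SOME g. g \<in> AC_derivs r \<and> ae_eq f g)"
  have g': "g' \<in> AC_derivs r \<and> ae_eq f g'" unfolding g'_def by (rule someI[of _ g]) (use g in blast)
  have "AE x in lborel. x \<in> {-1..1} \<longrightarrow> f x = g x" "AE x in lborel. x \<in> {-1..1} \<longrightarrow> f x = g' x"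
    using g(2) g' unfolding ae_eq_def AE_lebesgue_on_unit_interval by blast+
  then have "AE x in lborel. x \<in> {-1..1} \<longrightarrow> g x = g' x" by eventually_elim auto
  then have eq: "(deriv ^^ r) g x = ae_deriv r f x" if "x \<in> {-1<..<1}" for x
    using AC_derivs_unique[OF g(1) _ r _ that, of g'] g' by (simp add: ae_deriv_def g'_def)
  have ae: "AE x in lborel. x \<in> {-1..1} \<longrightarrow> x \<in> {-1<..<1 :: real}" using ae_interior unfolding AE_lebesgue_on_unit_interval .
  have dm: "(deriv ^^ r) g \<in> borel_measurable (lebesgue_on {-1..1})"
  proof -
    have "(\<lambda>x. W r x * ((deriv ^^ r) g x - poly ((pderiv ^^ r) (Q n)) x)) \<in> borel_measurable (lebesgue_on {-1..1})"
      using g(3) by (rule Lp_leD(2))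
    then have "(\<lambda>x. (deriv ^^ r) g x - poly ((pderiv ^^ r) (Q n)) x) \<in> borel_measurable (lebesgue_on {-1..1})"
      unfolding W_def by (rule weighted_measurableD)
    then have "(\<lambda>x. ((deriv ^^ r) g x - poly ((pderiv ^^ r) (Q n)) x) + poly ((pderiv ^^ r) (Q n)) x) \<in> borel_measurable (lebesgue_on {-1..1})"
      by (rule borel_measurable_add) (rule borel_measurable_lebesgue_onI, measurable)
    then show ?thesis by simp
  qed
  obtain d0 where d0: "d0 \<in> borel_measurable borel" "AE x in lborel. x \<in> {-1..1} \<longrightarrow> (deriv ^^ r) g x = d0 x"
    using lebesgue_on_borel_representative[OF dm] .
  from d0(2) ae have "AE x in lborel. x \<in> {-1..1} \<longrightarrow> d0 x = ae_deriv r f x"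
    by eventually_elim (use eq in auto)
  then have am: "ae_deriv r f \<in> borel_measurable (lebesgue_on {-1..1})" by (rule borel_measurable_lebesgue_on_AE[OF d0(1)])
  show ?thesis
  proof (rule Lp_le_mono[OF g(3) p])
    show "(\<lambda>x. W r x * (ae_deriv r f x - poly ((pderiv ^^ r) (Q n)) x)) \<in> borel_measurable (lebesgue_on {-1..1})"
      by (intro borel_measurable_times borel_measurable_diff am borel_measurable_lebesgue_onI borel_measurable_W) measurable
    show "AE x in lebesgue_on {-1..1}. \<bar>W r x * (ae_deriv r f x - poly ((pderiv ^^ r) (Q n)) x)\<bar> \<le> \<bar>W r x * ((deriv ^^ r) g x - poly ((pderiv ^^ r) (Q n)) x)\<bar>"
      using ae_interior by eventually_elim (simp add: eq)
  qed simp
qed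

text \<open>Only finiteness is at stake: the derivative of the representative differs from that of
  \<open>Q 0\<close> by a function of finite norm, and the latter is bounded by the Bernstein
  inequality.\<close>

lemma f_in_B_space: "f \<in> B_space r p \<alpha> \<beta>"
proof (cases "r = 0")
  case True
  have "weighted_norm p \<alpha> \<beta> f \<le> ennreal F"
    unfolding weighted_norm_def using Lp_norm_le_iff[OF p Lp_leD(1)[OF f]] f by simp
  then show ?thesis using True by (auto simp: B_space_def weighted_Lp_def intro: le_less_trans)
next
  case False
  then have r: "r \<ge> 1" by simp
  obtain g where g: "g \<in> AC_derivs r" "ae_eq f g"
    "\<And>n. Lp_le p (\<lambda>x. W r x * ((deriv ^^ r) g x - poly ((pderiv ^^ r) (Q n)) x)) (A * \<theta> ^ (l + n))"
    using smooth_representative[OF r] by metis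
  have "Lp_le p (\<lambda>x. jacobi_weight \<alpha> \<beta> x * f x - jacobi_weight \<alpha> \<beta> x * (f x - poly (Q 0) x)) (F + E)"
    by (rule Lp_le_diff[OF f Q_approx_E p])
  then have "Lp_le p (\<lambda>x. jacobi_weight \<alpha> \<beta> x * poly (Q 0) x) (F + E)" by (simp add: algebra_simps)
  then have "Lp_le p (\<lambda>x. W r x * poly ((pderiv ^^ r) (Q 0)) x) (C r * real (2 ^ l) ^ r * (F + E))"
    unfolding W_def using Q_degree[of 0] by (intro bernstein) auto
  from Lp_le_add[OF g(3)[of 0] this p] obtain K where K: "Lp_le p (\<lambda>x. W r x * (deriv ^^ r) g x) K"
    by (auto simp: algebra_simps)
  have mm: "(\<lambda>x. jacobi_weight \<alpha> \<beta> x * (\<phi> x ^ r * (deriv ^^ r) g x)) \<in> borel_measurable (lebesgue_on {-1..1})"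
    by (intro borel_measurable_times borel_measurable_power weighted_measurableD[OF Lp_leD(2)[OF K, unfolded W_def]]
        borel_measurable_lebesgue_onI[OF borel_measurable_jacobi_weight] borel_measurable_lebesgue_onI[OF borel_measurable_phi])
  have "Lp_le p (\<lambda>x. jacobi_weight \<alpha> \<beta> x * (\<phi> x ^ r * (deriv ^^ r) g x)) K"
    by (rule Lp_le_mono[OF K p mm]) (use ae_interior in \<open>eventually_elim, auto simp: W_def jacobi_weight_phi\<close>)
  then have "weighted_norm p \<alpha> \<beta> (\<lambda>x. \<phi> x ^ r * (deriv ^^ r) g x) \<le> ennreal K"
    unfolding weighted_norm_def using Lp_norm_le_iff[OF p Lp_leD(1)[OF K]] by simp
  then have "(\<lambda>x. \<phi> x ^ r * (deriv ^^ r) g x) \<in> weighted_Lp p \<alpha> \<beta>"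
    by (auto simp: weighted_Lp_def intro: le_less_trans)
  then show ?thesis using g r by (auto simp: B_space_def)
qed

text \<open>The geometric sum of growing blocks relative to its next term; unbounded as \<gamma>
  approaches k + r.\<close>

definition B :: real where "B = 4 * C (k + r) * 2 ^ (k + r) / (\<Lambda> - 1)"

lemma B_nonneg: "0 \<le> B"
  using C \<Lambda> by (simp add: B_def)

text \<open>The blocks above \<open>Q 0\<close> form a growing geometric sum. For
  \<open>n = 0\<close> there are no blocks and no second term, which is essential for large
  \<open>t\<close>.\<close>

lemma high_derivative_bound:
  "Lp_le p (\<lambda>x. W (k + r) x * poly ((pderiv ^^ (k + r)) (Q n)) x)
     (2 * C (k + r) * (2 ^ l) ^ (k + r) * E + (if n = 0 then 0 else B * \<Lambda> ^ (l + n)))"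
proof -
  let ?i = "k + r"
  \<comment> \<open>Subtracting \<open>Q0\<close> leaves the derivative of order
    \<open>k + r\<close> unchanged and replaces the size of \<open>Q 0\<close> by that of
    \<open>Q 0 - Q0\<close>, at most \<open>2 * E\<close>.\<close>
  have "Lp_le p (\<lambda>x. jacobi_weight \<alpha> \<beta> x * (f x - poly Q0 x) - jacobi_weight \<alpha> \<beta> x * (f x - poly (Q 0) x)) (E + E)"
    by (rule Lp_le_diff[OF Q0_approx Q_approx_E p])
  then have 1: "Lp_le p (\<lambda>x. jacobi_weight \<alpha> \<beta> x * poly (Q 0 - Q0) x) (2 * E)" by (simp add: algebra_simps)
  have "degree (Q 0 - Q0) \<le> max (degree (Q 0)) (degree Q0)" by (rule degree_diff_le_max)
  also have "\<dots> < 2 ^ l" using Q_degree[of 0] Q0_degree by simp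
  finally have "Lp_le p (\<lambda>x. W ?i x * poly ((pderiv ^^ ?i) (Q 0 - Q0)) x) (C ?i * real (2 ^ l) ^ ?i * (2 * E))"
    unfolding W_def by (intro bernstein 1) auto
  moreover have "(pderiv ^^ ?i) (Q 0 - Q0) = (pderiv ^^ ?i) (Q 0)"
    unfolding pderiv_funpow_diff by (simp add: pderiv_funpow_eq_0[OF Q0_degree(1)])
  ultimately have base: "Lp_le p (\<lambda>x. W ?i x * poly ((pderiv ^^ ?i) (Q 0)) x) (2 * C ?i * (2 ^ l) ^ ?i * E)" by (simp add: mult_ac)
  have Qn: "Q n = Q 0 + (\<Sum>j<n. S (Suc j))"
    by (induction n) (auto simp: S_def algebra_simps)
  have "Lp_le p (\<lambda>x. \<Sum>j<n. W ?i x * poly ((pderiv ^^ ?i) (S (Suc j))) x) (\<Sum>j<n. 4 * C ?i * 2 ^ ?i * \<Lambda> ^ (l + j))"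
    unfolding \<Lambda>_def by (intro Lp_le_sum[OF p] S_bound)
  from Lp_le_add[OF base this p]
  have "Lp_le p (\<lambda>x. W ?i x * poly ((pderiv ^^ ?i) (Q n)) x) (2 * C ?i * (2 ^ l) ^ ?i * E + (\<Sum>j<n. 4 * C ?i * 2 ^ ?i * \<Lambda> ^ (l + j)))"
    unfolding Qn pderiv_funpow_add pderiv_funpow_sum poly_add poly_sum distrib_left sum_distrib_left .
  moreover have "(\<Sum>j<n. 4 * C ?i * 2 ^ ?i * \<Lambda> ^ (l + j)) \<le> (if n = 0 then 0 else B * \<Lambda> ^ (l + n))"
  proof (cases "n = 0")
    case False
    have "(\<Sum>j<n. 4 * C ?i * 2 ^ ?i * \<Lambda> ^ (l + j)) = 4 * C ?i * 2 ^ ?i * \<Lambda> ^ l * (\<Sum>j<n. \<Lambda> ^ j)"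
      by (simp add: sum_distrib_left power_add mult_ac)
    also have "(\<Sum>j<n. \<Lambda> ^ j) = (\<Lambda> ^ n - 1) / (\<Lambda> - 1)" using \<Lambda> by (intro geometric_sum) auto
    also have "4 * C ?i * 2 ^ ?i * \<Lambda> ^ l * ((\<Lambda> ^ n - 1) / (\<Lambda> - 1)) \<le> 4 * C ?i * 2 ^ ?i * \<Lambda> ^ l * (\<Lambda> ^ n / (\<Lambda> - 1))"
      using \<Lambda> C by (intro mult_left_mono divide_right_mono) auto
    also have "\<dots> = B * \<Lambda> ^ (l + n)" by (simp add: B_def power_add)
    finally show ?thesis using False by simp
  qed simp
  ultimately show ?thesis by (rule Lp_le_weaken[OF _ p add_left_mono])
qed

text \<open>The starting level \<open>l\<close>, and with it \<open>N\<close>, occurs in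
  \<open>cN\<close> and not in \<open>c0\<close>; this separation gives the two constants of the
  theorem their different dependence.\<close>

definition c0 :: real where "c0 = 2 ^ (k + 1) * A + 4 * real k ^ k * B * \<Lambda>"
definition cN :: real where "cN = 8 * real k ^ k * C (k + r) * (2 ^ l) ^ (k + r)"

text \<open>The derivative of \<open>f\<close> is split at the derivative of \<open>Q n\<close>: the
  difference is estimated by its norm, the polynomial by its derivative of order \<open>k\<close>,
  which is the derivative of order \<open>k + r\<close> of \<open>Q n\<close>.\<close>

lemma modulus_step_bound:
  assumes h: "0 \<le> h" "h \<le> t"
  shows "Lp_le p (\<lambda>x. mod_weight (real k * h) (real r / 2 + \<alpha>) (real r / 2 + \<beta>) x * sym_diff k (h * \<phi> x) (ae_deriv r f) x)
     (2 ^ (k + 1) * (A * \<theta> ^ (l + n)) + 4 * real k ^ k * t ^ k * (2 * C (k + r) * (2 ^ l) ^ (k + r) * E + (if n = 0 then 0 else B * \<Lambda> ^ (l + n))))"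
proof -
  let ?q = "(pderiv ^^ r) (Q n)" and ?w = "mod_weight (real k * h) (real r / 2 + \<alpha>) (real r / 2 + \<beta>)"
  let ?K = "2 * C (k + r) * (2 ^ l) ^ (k + r) * E + (if n = 0 then 0 else B * \<Lambda> ^ (l + n))"
  have W: "W r = jacobi_weight (real r / 2 + \<alpha>) (real r / 2 + \<beta>)" by (simp add: W_def add.commute)
  have 1: "Lp_le p (\<lambda>x. ?w x * sym_diff k (h * \<phi> x) (\<lambda>x. ae_deriv r f x - poly ?q x) x) (2 ^ (k + 1) * (A * \<theta> ^ (l + n)))"
    by (rule modulus_bound_weighted[OF p \<xi> \<zeta> h(1) ae_deriv_bound[of n, unfolded W]])
  have "W (k + r) = jacobi_weight (real r / 2 + \<alpha> + real k / 2) (real r / 2 + \<beta> + real k / 2)"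
    by (simp add: W_def add_divide_distrib add_ac)
  moreover have "(pderiv ^^ (k + r)) (Q n) = (pderiv ^^ k) ?q" by (simp add: funpow_add)
  ultimately have "Lp_le p (\<lambda>x. ?w x * sym_diff k (h * \<phi> x) (poly ?q) x) (4 * real k ^ k * h ^ k * ?K)"
    using high_derivative_bound[of n] by (intro modulus_bound_poly[OF p k \<xi> \<zeta> h(1)]) simp
  then have 2: "Lp_le p (\<lambda>x. ?w x * sym_diff k (h * \<phi> x) (poly ?q) x) (4 * real k ^ k * t ^ k * ?K)"
  proof (rule Lp_le_weaken[OF _ p])
    have "?K \<ge> 0" by (rule Lp_leD(1)[OF high_derivative_bound])
    then show "4 * real k ^ k * h ^ k * ?K \<le> 4 * real k ^ k * t ^ k * ?K"
      using h by (intro mult_right_mono mult_left_mono power_mono) auto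
  qed
  have "sym_diff k y (\<lambda>x. ae_deriv r f x - poly ?q x) x + sym_diff k y (poly ?q) x = sym_diff k y (ae_deriv r f) x" for x y
    by (simp add: sym_diff_def sum.distrib[symmetric] right_diff_distrib)
  then show ?thesis using Lp_le_add[OF 1 2 p] by (simp add: distrib_left[symmetric])
qed

lemma modulus_bound:
  assumes t: "0 < t"
  shows "jacobi_modulus k r (ae_deriv r f) t \<alpha> \<beta> p \<le> ennreal (c0 * t powr (\<gamma> - real r) + cN * t ^ k * E)"
proof -
  have bound: "\<exists>n. 2 ^ (k + 1) * (A * \<theta> ^ (l + n)) + 4 * real k ^ k * t ^ k * (2 * C (k + r) * (2 ^ l) ^ (k + r) * E + (if n = 0 then 0 else B * \<Lambda> ^ (l + n)))
     \<le> c0 * t powr (\<gamma> - real r) + cN * t ^ k * E"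
  proof -
    have th: "\<theta> ^ m = ((1 / 2) ^ m) powr (\<gamma> - real r)" for m
    proof -
      have "\<theta> = (1 / 2) powr (\<gamma> - real r)"
        by (simp add: \<theta>_def powr_divide powr_minus_divide[symmetric])
      then show ?thesis by (simp add: powr_power powr_realpow[symmetric] powr_powr mult.commute)
    qed
    have split: "2 ^ (k + 1) * (A * x) + 4 * real k ^ k * t ^ k * (2 * C (k + r) * (2 ^ l) ^ (k + r) * E + y) = (2 ^ (k + 1) * A * x + 4 * real k ^ k * (t ^ k * y)) + cN * t ^ k * E" for x y
      by (simp add: cN_def algebra_simps)
    have c0_ge: "2 ^ (k + 1) * A * x + 4 * real k ^ k * (t ^ k * y) \<le> c0 * z" if "x \<le> z" "t ^ k * y \<le> B * \<Lambda> * z" for x y z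
    proof -
      have "2 ^ (k + 1) * A * x + 4 * real k ^ k * (t ^ k * y) \<le> 2 ^ (k + 1) * A * z + 4 * real k ^ k * (B * \<Lambda> * z)"
        using that A_pos by (intro add_mono mult_left_mono) auto
      then show ?thesis by (simp add: c0_def algebra_simps)
    qed
    show ?thesis
    proof (cases "(1 / 2) ^ l \<le> t")
      case True
      \<comment> \<open>For \<open>t\<close> above 2^(-l) the lowest level is used: without blocks
        only the terms \<theta>^l and \<open>E\<close> occur, whereas t^k times a growing term could
        not be bounded by t^(\<gamma>-r) for all large \<open>t\<close>.\<close>
      have "\<theta> ^ (l + 0) \<le> t powr (\<gamma> - real r)"
        unfolding th using True \<gamma> by (intro powr_mono2) auto
      then show ?thesis
        unfolding split using B_nonneg \<Lambda> by (intro exI[of _ 0] add_right_mono c0_ge) auto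
    next
      case False
      then obtain m where m: "l \<le> m" "(1 / 2) ^ Suc m < t" "t \<le> (1 / 2) ^ m"
        using dyadic_scale_exists[OF t, of l] by auto
      \<comment> \<open>The level with 2^(l+n) = 2^(m+1), between 1/t and 2/t. With m + 1 in place
        of m, the decaying term is at most t^(\<gamma>-r) without a further constant, while the
        growing one costs a single \<open>\<Lambda>\<close>.\<close>
      define n where "n = Suc m - l"
      have ln: "l + n = Suc m" "n \<noteq> 0" using m by (auto simp: n_def)
      let ?y = "(1 / 2 :: real) ^ Suc m" and ?z = "t powr (\<gamma> - real r)"
      have "\<theta> ^ (l + n) \<le> ?z" unfolding th ln using m \<gamma> by (intro powr_mono2) auto
      moreover have "t ^ k * (B * \<Lambda> ^ (l + n)) \<le> B * \<Lambda> * ?z"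
      proof -
        have La: "\<Lambda> ^ Suc m = \<Lambda> * (2 ^ m) powr (real (k + r) - \<gamma>)"
          unfolding \<Lambda>_def using two_power_powr[of m "real (k + r) - \<gamma>"] by simp
        have "(2 :: real) ^ m \<le> 1 / t" using m(3) t by (simp add: power_divide field_simps)
        then have "(2 ^ m) powr (real (k + r) - \<gamma>) \<le> (1 / t) powr (real (k + r) - \<gamma>)"
          using \<gamma> by (intro powr_mono2) auto
        then have "t ^ k * (2 ^ m) powr (real (k + r) - \<gamma>) \<le> t ^ k * (1 / t) powr (real (k + r) - \<gamma>)"
          using t by (intro mult_left_mono) auto
        also have "\<dots> = t powr real k * t powr (\<gamma> - real (k + r))"
          using t by (simp add: powr_realpow powr_divide powr_minus_divide[symmetric])
        also have "\<dots> = ?z" by (simp add: powr_add[symmetric])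
        finally have "B * \<Lambda> * (t ^ k * (2 ^ m) powr (real (k + r) - \<gamma>)) \<le> B * \<Lambda> * ?z"
          using B_nonneg \<Lambda> by (intro mult_left_mono) auto
        then show ?thesis unfolding ln La by (simp add: mult_ac)
      qed
      ultimately show ?thesis
        unfolding split using ln by (intro exI[of _ n] add_right_mono c0_ge) auto
    qed
  qed
  then obtain n where n: "2 ^ (k + 1) * (A * \<theta> ^ (l + n)) + 4 * real k ^ k * t ^ k * (2 * C (k + r) * (2 ^ l) ^ (k + r) * E + (if n = 0 then 0 else B * \<Lambda> ^ (l + n)))
     \<le> c0 * t powr (\<gamma> - real r) + cN * t ^ k * E" by blast
  show ?thesis
    unfolding jacobi_modulus_def
  proof (rule SUP_least)
    fix h assume "h \<in> {0..t}"
    then have h: "0 \<le> h" "h \<le> t" by auto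
    have "Lp_le p (\<lambda>x. mod_weight (real k * h) (real r / 2 + \<alpha>) (real r / 2 + \<beta>) x * sym_diff k (h * \<phi> x) (ae_deriv r f) x) (c0 * t powr (\<gamma> - real r) + cN * t ^ k * E)"
      by (rule Lp_le_weaken[OF modulus_step_bound[OF h] p n])
    then show "Lp_norm p (\<lambda>x. mod_weight (real k * h) (real r / 2 + \<alpha>) (real r / 2 + \<beta>) x * sym_diff k (h * \<phi> x) (ae_deriv r f) x) \<le> ennreal (c0 * t powr (\<gamma> - real r) + cN * t ^ k * E)"
      using Lp_norm_le_iff[OF p] Lp_leD(1) by blast
  qed
qed

end


section \<open>Choice of the approximants and the final estimate\<close>

lemma best_approx_mono: "m \<le> n \<Longrightarrow> best_approx n f \<alpha> \<beta> p \<le> best_approx m f \<alpha> \<beta> p"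
  unfolding best_approx_def polys_def by (rule INF_superset_mono) auto

lemma best_approx_le: "n \<ge> 1 \<Longrightarrow> best_approx n f \<alpha> \<beta> p \<le> weighted_norm p \<alpha> \<beta> f"
  unfolding best_approx_def polys_def by (rule INF_lower2[of 0]) auto

lemma near_best_approximant:
  assumes p: "1 \<le> p" and n: "n \<ge> 1" and K: "best_approx n f \<alpha> \<beta> p < ennreal K" "0 \<le> K"
  shows "\<exists>q. degree q < n \<and> Lp_le p (\<lambda>x. jacobi_weight \<alpha> \<beta> x * (f x - poly q x)) K"
proof -
  obtain q where q: "q \<in> polys n" "weighted_norm p \<alpha> \<beta> (\<lambda>x. f x - poly q x) < ennreal K"
    using K(1) unfolding best_approx_def INF_less_iff by auto
  have "degree q < n" using q(1) n by (auto simp: polys_def)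
  moreover have "Lp_le p (\<lambda>x. jacobi_weight \<alpha> \<beta> x * (f x - poly q x)) K"
    using less_imp_le[OF q(2)] unfolding weighted_norm_def Lp_norm_le_iff[OF p K(2)] .
  ultimately show ?thesis by blast
qed

text \<open>Each \<open>Q j\<close> is taken close enough to the infimum to satisfy both bounds at
  once: the decay by hypothesis, and \<open>e + \<epsilon>\<close> because its degree bound is at
  least \<open>k + r\<close>.\<close>

lemma approximants_exist:
  fixes e \<epsilon> :: real
  assumes k: "k \<ge> 1" and p: "1 \<le> p" and \<xi>: "real r / 2 + \<alpha> \<ge> 0" "real r / 2 + \<beta> \<ge> 0"
    and \<gamma>: "real r < \<gamma>" "\<gamma> < real (k + r)" and C: "\<forall>i. 0 \<le> C i"
    and bernstein: "\<forall>i. \<forall>n\<ge>1. \<forall>(P :: real poly) K. degree P < n \<longrightarrow> Lp_le p (\<lambda>x. jacobi_weight \<alpha> \<beta> x * poly P x) K \<longrightarrow>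
      Lp_le p (\<lambda>x. jacobi_weight (\<alpha> + real i / 2) (\<beta> + real i / 2) x * poly ((pderiv ^^ i) P) x) (C i * real n ^ i * K)"
    and f: "f \<in> weighted_Lp p \<alpha> \<beta>"
    and approx: "\<forall>n\<ge>N. best_approx n f \<alpha> \<beta> p \<le> ennreal (real n powr (- \<gamma>))"
    and e: "best_approx (k + r) f \<alpha> \<beta> p = ennreal e" "0 \<le> e" and \<epsilon>: "0 < \<epsilon>"
  shows "\<exists>F Q Q0. approximants k r (N + k + r) p \<alpha> \<beta> \<gamma> F (e + \<epsilon>) f Q Q0 C"
proof -
  let ?l = "N + k + r"
  \<comment> \<open>Since the exponent is N + k + r, all dyadic degrees used are at least
    \<open>N\<close> and at least \<open>k + r\<close>.\<close>
  have ll: "?l < 2 ^ ?l" by (rule less_exp)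
  have pow: "?l \<le> 2 ^ (?l + j)" for j
  proof -
    have "(2::nat) ^ ?l \<le> 2 ^ (?l + j)" by (rule power_increasing) auto
    with ll show ?thesis by linarith
  qed
  have le: "ennreal e < ennreal (e + \<epsilon>)" using e \<epsilon> by (simp add: ennreal_less_iff)
  have "\<exists>q. degree q < 2 ^ (?l + j) \<and> Lp_le p (\<lambda>x. jacobi_weight \<alpha> \<beta> x * (f x - poly q x)) (min (2 * real (2 ^ (?l + j)) powr (- \<gamma>)) (e + \<epsilon>))" for j
  proof (rule near_best_approximant[OF p])
    let ?n = "2 ^ (?l + j) :: nat"
    have "N \<le> ?n" using pow[of j] by linarith
    then have "best_approx ?n f \<alpha> \<beta> p \<le> ennreal (real ?n powr (- \<gamma>))" using approx by blast
    also have "\<dots> < ennreal (2 * real ?n powr (- \<gamma>))" by (rule ennreal_lessI) auto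
    finally have 1: "best_approx ?n f \<alpha> \<beta> p < ennreal (2 * real ?n powr (- \<gamma>))" .
    have "best_approx ?n f \<alpha> \<beta> p \<le> best_approx (k + r) f \<alpha> \<beta> p" using pow[of j] by (intro best_approx_mono) simp
    then have "best_approx ?n f \<alpha> \<beta> p < ennreal (e + \<epsilon>)" using e(1) le by simp
    with 1 show "best_approx ?n f \<alpha> \<beta> p < ennreal (min (2 * real ?n powr (- \<gamma>)) (e + \<epsilon>))"
      by (cases "2 * real ?n powr (- \<gamma>) \<le> e + \<epsilon>") (simp_all only: min_def if_True if_False)
    show "0 \<le> min (2 * real ?n powr (- \<gamma>)) (e + \<epsilon>)" using e \<epsilon> by simp
  qed simp
  then obtain Q where Q: "\<And>j. degree (Q j) < 2 ^ (?l + j)"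
    "\<And>j. Lp_le p (\<lambda>x. jacobi_weight \<alpha> \<beta> x * (f x - poly (Q j) x)) (min (2 * real (2 ^ (?l + j)) powr (- \<gamma>)) (e + \<epsilon>))"
    by metis
  obtain Q0 where Q0: "degree Q0 < k + r" "Lp_le p (\<lambda>x. jacobi_weight \<alpha> \<beta> x * (f x - poly Q0 x)) (e + \<epsilon>)"
    using near_best_approximant[OF p, of "k + r" f \<alpha> \<beta> "e + \<epsilon>"] k e le \<epsilon> by auto
  obtain F where F0: "weighted_norm p \<alpha> \<beta> f = ennreal F" "0 \<le> F"
    using f by (cases "weighted_norm p \<alpha> \<beta> f") (auto simp: weighted_Lp_def)
  from eq_refl[OF F0(1)] have F: "Lp_le p (\<lambda>x. jacobi_weight \<alpha> \<beta> x * f x) F"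
    unfolding weighted_norm_def Lp_norm_le_iff[OF p F0(2)] .
  have "approximants k r ?l p \<alpha> \<beta> \<gamma> F (e + \<epsilon>) f Q Q0 C"
  proof unfold_locales
    show "Lp_le p (\<lambda>x. jacobi_weight (\<alpha> + real i / 2) (\<beta> + real i / 2) x * poly ((pderiv ^^ i) P) x) (C i * real n ^ i * K)"
      if "1 \<le> n" "degree P < n" "Lp_le p (\<lambda>x. jacobi_weight \<alpha> \<beta> x * poly P x) K" for i n P K
      using bernstein that by blast
    show "0 \<le> C i" for i using C by blast
    show "Lp_le p (\<lambda>x. jacobi_weight \<alpha> \<beta> x * (f x - poly (Q j) x)) (2 * real (2 ^ (?l + j)) powr (- \<gamma>))" for j
      by (rule Lp_le_weaken[OF Q(2) p]) simp
    show "Lp_le p (\<lambda>x. jacobi_weight \<alpha> \<beta> x * (f x - poly (Q 0) x)) (e + \<epsilon>)"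
      by (rule Lp_le_weaken[OF Q(2) p]) simp
    show "k + r \<le> 2 ^ ?l" using ll by linarith
  qed (rule k p \<xi> \<gamma> F Q(1) Q0)+
  then show ?thesis by blast
qed

lemma diff_domain_empty:
  assumes "1 < \<mu>" "x \<in> diff_domain \<mu>"
  shows "x = 1 \<or> x = -1"
proof (rule ccontr)
  assume "\<not> (x = 1 \<or> x = -1)"
  then have x: "\<bar>x\<bar> < 1" using assms(2) by (auto simp: diff_domain_def abs_if)
  have "\<mu>\<^sup>2 * (1 + \<bar>x\<bar>) \<le> 1 - \<bar>x\<bar>" by (rule diff_domain_bound[OF assms(2) _ x]) (use assms in simp)
  moreover have "1 * (1 + \<bar>x\<bar>) < \<mu>\<^sup>2 * (1 + \<bar>x\<bar>)"
    using assms(1) by (intro mult_strict_right_mono) (auto simp: power2_eq_square less_1_mult)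
  ultimately have "1 * (1 + \<bar>x\<bar>) < 1 - \<bar>x\<bar>" by (rule less_le_trans[rotated])
  then show False by simp
qed

text \<open>For steps beyond 2 / k the difference vanishes outside the two end points, so larger
  \<open>t\<close> add nothing to the supremum. This turns bounds for \<open>t \<le> 2 / k\<close>
  into bounds for all \<open>t\<close>.\<close>

lemma jacobi_modulus_saturates:
  assumes k: "k \<ge> 1" and p: "1 \<le> p" and t: "2 / real k \<le> t"
  shows "jacobi_modulus k r g t \<alpha> \<beta> p \<le> jacobi_modulus k r g (2 / real k) \<alpha> \<beta> p"
  unfolding jacobi_modulus_def
proof (rule SUP_least)
  let ?X = "\<lambda>h. Lp_norm p (\<lambda>x. mod_weight (real k * h) (real r / 2 + \<alpha>) (real r / 2 + \<beta>) x * sym_diff k (h * \<phi> x) g x)"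
  fix h assume h: "h \<in> {0..t}"
  show "?X h \<le> (SUP h\<in>{0..2 / real k}. ?X h)"
  proof (cases "h \<le> 2 / real k")
    case True
    then show ?thesis using h by (intro SUP_upper) auto
  next
    case False
    then have "1 < real k * h / 2" using k by (simp add: field_simps)
    then have dom: "x = 1 \<or> x = -1" if "x \<in> diff_domain (real k * h / 2)" for x using diff_domain_empty that by blast
    have zero: "mod_weight (real k * h) (real r / 2 + \<alpha>) (real r / 2 + \<beta>) x * sym_diff k (h * \<phi> x) g x = 0"
      if x: "x \<in> {-1..1}" "x \<noteq> 1" "x \<noteq> -1" for x
    proof -
      have "\<not> {x - real k * (h * \<phi> x) / 2 .. x + real k * (h * \<phi> x) / 2} \<subseteq> {-1..1}"
        using diff_domain_iff[OF x(1), of h k] h dom[of x] x by auto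
      then show ?thesis by (simp only: sym_diff_def if_False mult_zero_right)
    qed
    have ae: "AE x in lborel. x \<in> {-1..1} \<longrightarrow> 0 = mod_weight (real k * h) (real r / 2 + \<alpha>) (real r / 2 + \<beta>) x * sym_diff k (h * \<phi> x) g x"
      using AE_lborel_singleton[of 1] AE_lborel_singleton[of "-1"] by eventually_elim (use zero in auto)
    have "Lp_le p (\<lambda>x. mod_weight (real k * h) (real r / 2 + \<alpha>) (real r / 2 + \<beta>) x * sym_diff k (h * \<phi> x) g x) 0"
    proof (rule Lp_le_mono[OF Lp_le_zero[OF p] p])
      show "(\<lambda>x. mod_weight (real k * h) (real r / 2 + \<alpha>) (real r / 2 + \<beta>) x * sym_diff k (h * \<phi> x) g x) \<in> borel_measurable (lebesgue_on {-1..1})"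
        by (rule borel_measurable_lebesgue_on_AE[OF _ ae]) simp
      show "AE x in lebesgue_on {-1..1}. \<bar>mod_weight (real k * h) (real r / 2 + \<alpha>) (real r / 2 + \<beta>) x * sym_diff k (h * \<phi> x) g x\<bar> \<le> \<bar>0\<bar>"
        unfolding AE_lebesgue_on_unit_interval using ae by eventually_elim auto
    qed simp
    then have "?X h \<le> ennreal 0" using Lp_norm_le_iff[OF p order.refl] by blast
    then show ?thesis by simp
  qed
qed

text \<open>The constants of the locale depend neither on \<open>f\<close> nor on the approximants
  nor on \<open>\<epsilon>\<close>, so \<open>\<epsilon>\<close> may tend to 0 in the bound with
  \<open>e + \<epsilon>\<close>.\<close>

lemma inverse_estimate:
  assumes k: "k \<ge> 1" and p: "1 \<le> p" and \<xi>: "real r / 2 + \<alpha> \<ge> 0" "real r / 2 + \<beta> \<ge> 0"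
    and \<gamma>: "real r < \<gamma>" "\<gamma> < real (k + r)" and C: "\<forall>i. 0 \<le> C i"
    and bernstein: "\<forall>i. \<forall>n\<ge>1. \<forall>(P :: real poly) K. degree P < n \<longrightarrow> Lp_le p (\<lambda>x. jacobi_weight \<alpha> \<beta> x * poly P x) K \<longrightarrow>
      Lp_le p (\<lambda>x. jacobi_weight (\<alpha> + real i / 2) (\<beta> + real i / 2) x * poly ((pderiv ^^ i) P) x) (C i * real n ^ i * K)"
    and f: "f \<in> weighted_Lp p \<alpha> \<beta>"
    and approx: "\<forall>n\<ge>N. best_approx n f \<alpha> \<beta> p \<le> ennreal (real n powr (- \<gamma>))"
  shows "f \<in> B_space r p \<alpha> \<beta>"
    and "0 < t \<Longrightarrow> jacobi_modulus k r (ae_deriv r f) t \<alpha> \<beta> p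
       \<le> ennreal (approximants.c0 k r \<gamma> C * t powr (\<gamma> - real r)) + ennreal (approximants.cN k r (N + k + r) C * t ^ k) * best_approx (k + r) f \<alpha> \<beta> p"
    and "0 \<le> approximants.c0 k r \<gamma> C" "0 \<le> approximants.cN k r (N + k + r) C"
proof -
  have "best_approx (k + r) f \<alpha> \<beta> p < \<infinity>"
    using best_approx_le[of "k + r" f \<alpha> \<beta> p] f k by (auto simp: weighted_Lp_def intro: le_less_trans)
  then obtain e where e: "best_approx (k + r) f \<alpha> \<beta> p = ennreal e" "0 \<le> e"
    by (cases "best_approx (k + r) f \<alpha> \<beta> p") auto
  let ?c0 = "approximants.c0 k r \<gamma> C" and ?cN = "approximants.cN k r (N + k + r) C"
  note ex = approximants_exist[OF k p \<xi> \<gamma> C bernstein f approx e]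
  obtain F Q Q0 where "approximants k r (N + k + r) p \<alpha> \<beta> \<gamma> F (e + 1) f Q Q0 C" using ex[of 1] by auto
  then interpret a: approximants k r "N + k + r" p \<alpha> \<beta> \<gamma> F "e + 1" f Q Q0 C .
  show "f \<in> B_space r p \<alpha> \<beta>" by (rule a.f_in_B_space)
  show c0: "0 \<le> ?c0" using a.A_pos a.B_nonneg a.\<Lambda> by (simp add: a.c0_def)
  show cN: "0 \<le> ?cN" using C by (simp add: a.cN_def)
  show "jacobi_modulus k r (ae_deriv r f) t \<alpha> \<beta> p
       \<le> ennreal (?c0 * t powr (\<gamma> - real r)) + ennreal (?cN * t ^ k) * best_approx (k + r) f \<alpha> \<beta> p" if t: "0 < t"
  proof (rule ennreal_le_epsilon)
    fix d :: real assume d: "0 < d"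
    \<comment> \<open>Keeps the error \<open>cN * t ^ k * \<epsilon>\<close> below \<open>d\<close>;
      the summand 1 protects against a vanishing coefficient.\<close>
    define \<epsilon> where "\<epsilon> = d / (?cN * t ^ k + 1)"
    have pos: "0 \<le> ?cN * t ^ k" using cN t by simp
    have \<epsilon>: "0 < \<epsilon>" using d pos by (simp add: \<epsilon>_def)
    obtain F Q Q0 where "approximants k r (N + k + r) p \<alpha> \<beta> \<gamma> F (e + \<epsilon>) f Q Q0 C" using ex[OF \<epsilon>] by auto
    then have "jacobi_modulus k r (ae_deriv r f) t \<alpha> \<beta> p \<le> ennreal (?c0 * t powr (\<gamma> - real r) + ?cN * t ^ k * (e + \<epsilon>))"
      by (rule approximants.modulus_bound[OF _ t])
    also have "\<dots> \<le> ennreal (?c0 * t powr (\<gamma> - real r) + ?cN * t ^ k * e + d)"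
    proof (rule ennreal_leI)
      have "?cN * t ^ k * \<epsilon> \<le> d" using pos d by (simp add: \<epsilon>_def divide_le_eq)
      then show "?c0 * t powr (\<gamma> - real r) + ?cN * t ^ k * (e + \<epsilon>) \<le> ?c0 * t powr (\<gamma> - real r) + ?cN * t ^ k * e + d"
        by (simp add: distrib_left)
    qed
    also have "\<dots> = ennreal (?c0 * t powr (\<gamma> - real r)) + ennreal (?cN * t ^ k) * best_approx (k + r) f \<alpha> \<beta> p + ennreal d"
      using c0 pos e d by (simp add: ennreal_mult ennreal_plus mult_nonneg_nonneg)
    finally show "jacobi_modulus k r (ae_deriv r f) t \<alpha> \<beta> p
       \<le> ennreal (?c0 * t powr (\<gamma> - real r)) + ennreal (?cN * t ^ k) * best_approx (k + r) f \<alpha> \<beta> p + ennreal d" .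
  qed
qed

text \<open>The order of the quantifiers expresses the dependence of the constants: both functions
  are fixed before \<open>N\<close>, \<open>\<gamma>\<close> and \<open>f\<close>, and
  \<open>c\<close> is evaluated at \<open>\<gamma>\<close>, because the geometric sums behind it
  degenerate as \<gamma> approaches r or k + r.\<close>

theorem corollary1p10:
  fixes k r :: nat and p :: ennreal and \<alpha> \<beta> :: real
  assumes "k \<ge> 1" and "1 \<le> p" and "\<alpha> \<in> J p" and "\<beta> \<in> J p"
    and "real r / 2 + \<alpha> \<ge> 0" and "real r / 2 + \<beta> \<ge> 0"
  shows "\<exists>(c :: real \<Rightarrow> real) (cN :: nat \<Rightarrow> real).
    \<forall>(N :: nat) (\<gamma> :: real) (f :: real \<Rightarrow> real).
      N \<ge> 1 \<longrightarrow> real r < \<gamma> \<longrightarrow> \<gamma> < real (k + r) \<longrightarrow>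
      f \<in> weighted_Lp p \<alpha> \<beta> \<longrightarrow>
      (\<forall>n\<ge>N. best_approx n f \<alpha> \<beta> p \<le> ennreal (real n powr (- \<gamma>))) \<longrightarrow>
        f \<in> B_space r p \<alpha> \<beta> \<and>
        (\<forall>t>0. jacobi_modulus k r (ae_deriv r f) t \<alpha> \<beta> p
            \<le> ennreal (c \<gamma> * t powr (\<gamma> - real r))
              + ennreal (cN N * t ^ k) * best_approx (k + r) f \<alpha> \<beta> p) \<and>
        (N \<le> k + r \<longrightarrow>
          (\<forall>t>0. jacobi_modulus k r (ae_deriv r f) t \<alpha> \<beta> p
            \<le> ennreal (c \<gamma> * t powr (\<gamma> - real r))))"
proof -
  note k = assms(1) and p = assms(2) and \<xi> = assms(5,6)
  have "\<forall>i. \<exists>C\<ge>0. \<forall>n\<ge>1. \<forall>(P :: real poly) K. degree P < n \<longrightarrow>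
    Lp_le p (\<lambda>x. jacobi_weight \<alpha> \<beta> x * poly P x) K \<longrightarrow>
    Lp_le p (\<lambda>x. jacobi_weight (\<alpha> + real i / 2) (\<beta> + real i / 2) x * poly ((pderiv ^^ i) P) x) (C * real n ^ i * K)"
    using weighted_bernstein[OF p assms(3,4)] by blast
  from choice[OF this] obtain C where "\<forall>i. C i \<ge> 0 \<and> (\<forall>n\<ge>1. \<forall>(P :: real poly) K. degree P < n \<longrightarrow>
    Lp_le p (\<lambda>x. jacobi_weight \<alpha> \<beta> x * poly P x) K \<longrightarrow>
    Lp_le p (\<lambda>x. jacobi_weight (\<alpha> + real i / 2) (\<beta> + real i / 2) x * poly ((pderiv ^^ i) P) x) (C i * real n ^ i * K))"
    by blast
  then have C: "\<forall>i. 0 \<le> C i" and bernstein: "\<forall>i. \<forall>n\<ge>1. \<forall>(P :: real poly) K. degree P < n \<longrightarrow> Lp_le p (\<lambda>x. jacobi_weight \<alpha> \<beta> x * poly P x) K \<longrightarrow>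
      Lp_le p (\<lambda>x. jacobi_weight (\<alpha> + real i / 2) (\<beta> + real i / 2) x * poly ((pderiv ^^ i) P) x) (C i * real n ^ i * K)"
    by blast+
  define c0 where "c0 \<gamma> = approximants.c0 k r \<gamma> C" for \<gamma>
  define cN where "cN N = approximants.cN k r (N + k + r) C" for N
  \<comment> \<open>The second summand prepares the case \<open>N \<le> k + r\<close>, where the
    term with the best approximation is absorbed for \<open>t \<le> 2\<close>. The absolute value
    gives \<open>c0 \<gamma> \<le> c \<gamma>\<close> before the sign of \<open>cN\<close> is
    known.\<close>
  define c where "c \<gamma> = c0 \<gamma> + \<bar>cN (k + r)\<bar> * 2 ^ k" for \<gamma>
  show ?thesis
  proof (intro exI[of _ c] exI[of _ cN] allI impI)
    fix N :: nat and \<gamma> :: real and f :: "real \<Rightarrow> real"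
    assume N: "1 \<le> N" and \<gamma>: "real r < \<gamma>" "\<gamma> < real (k + r)" and f: "f \<in> weighted_Lp p \<alpha> \<beta>"
      and approx: "\<forall>n\<ge>N. best_approx n f \<alpha> \<beta> p \<le> ennreal (real n powr (- \<gamma>))"
    note est = inverse_estimate[OF k p \<xi> \<gamma> C bernstein f, folded c0_def cN_def]
    have c0: "0 \<le> c0 \<gamma>" by (rule est(3)[OF approx])
    have cc: "c0 \<gamma> \<le> c \<gamma>" by (simp add: c_def)
    have B: "f \<in> B_space r p \<alpha> \<beta>" by (rule est(1)[OF approx])
    have 1: "jacobi_modulus k r (ae_deriv r f) t \<alpha> \<beta> p
            \<le> ennreal (c \<gamma> * t powr (\<gamma> - real r)) + ennreal (cN N * t ^ k) * best_approx (k + r) f \<alpha> \<beta> p" if t: "0 < t" for t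
    proof -
      have "jacobi_modulus k r (ae_deriv r f) t \<alpha> \<beta> p
            \<le> ennreal (c0 \<gamma> * t powr (\<gamma> - real r)) + ennreal (cN N * t ^ k) * best_approx (k + r) f \<alpha> \<beta> p"
        by (rule est(2)[OF approx t])
      also have "\<dots> \<le> ennreal (c \<gamma> * t powr (\<gamma> - real r)) + ennreal (cN N * t ^ k) * best_approx (k + r) f \<alpha> \<beta> p"
        by (intro add_right_mono ennreal_leI mult_right_mono cc) simp
      finally show ?thesis .
    qed
    have 2: "jacobi_modulus k r (ae_deriv r f) t \<alpha> \<beta> p \<le> ennreal (c \<gamma> * t powr (\<gamma> - real r))" if Nk: "N \<le> k + r" and t: "0 < t" for t
    proof -
      \<comment> \<open>The estimate is applied with \<open>k + r\<close> in place of
        \<open>N\<close>, so that its constant does not depend on \<open>N\<close>.\<close>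
      have approx': "\<forall>n\<ge>k + r. best_approx n f \<alpha> \<beta> p \<le> ennreal (real n powr (- \<gamma>))" using approx Nk by auto
      have cN: "0 \<le> cN (k + r)" by (rule est(4)[OF approx'])
      have small: "jacobi_modulus k r (ae_deriv r f) t \<alpha> \<beta> p \<le> ennreal (c \<gamma> * t powr (\<gamma> - real r))" if t: "0 < t" "t \<le> 2 / real k" for t
      proof -
        \<comment> \<open>As \<open>N \<le> k + r\<close>, the hypothesis itself bounds this best
          approximation, by a number not exceeding 1.\<close>
        have "best_approx (k + r) f \<alpha> \<beta> p \<le> ennreal (real (k + r) powr (- \<gamma>))" using Nk approx by blast
        also have "\<dots> \<le> ennreal 1"
        proof (rule ennreal_leI)
          have "1 \<le> real (k + r)" using k by simp
          then show "real (k + r) powr (- \<gamma>) \<le> 1" using \<gamma> powr_mono2'[of "- \<gamma>" 1 "real (k + r)"] by simp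
        qed
        finally have E: "best_approx (k + r) f \<alpha> \<beta> p \<le> ennreal 1" .
        \<comment> \<open>For \<open>t \<le> 2\<close> the surplus power
          \<open>t powr (real (k + r) - \<gamma>)\<close> is at most \<open>2 ^ k\<close>, so
          \<open>t ^ k\<close> is bounded by a multiple of
          \<open>t powr (\<gamma> - real r)\<close>.\<close>
        have "2 / real k \<le> 2" using k by (simp add: divide_le_eq)
        with t(2) have "t \<le> 2" by linarith
        then have "t powr (real (k + r) - \<gamma>) \<le> 2 powr (real (k + r) - \<gamma>)" using t \<gamma> by (intro powr_mono2) auto
        also have "\<dots> \<le> 2 powr real k" using \<gamma> by (intro powr_mono) auto
        finally have tk: "t powr (real (k + r) - \<gamma>) \<le> 2 ^ k" by (simp add: powr_realpow)
        have "t ^ k = t powr (\<gamma> - real r) * t powr (real (k + r) - \<gamma>)"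
          using t by (simp add: powr_add[symmetric] powr_realpow)
        also have "\<dots> \<le> t powr (\<gamma> - real r) * 2 ^ k" by (intro mult_left_mono tk) simp
        finally have tk': "t ^ k \<le> t powr (\<gamma> - real r) * 2 ^ k" .
        have "jacobi_modulus k r (ae_deriv r f) t \<alpha> \<beta> p
            \<le> ennreal (c0 \<gamma> * t powr (\<gamma> - real r)) + ennreal (cN (k + r) * t ^ k) * best_approx (k + r) f \<alpha> \<beta> p"
          by (rule est(2)[OF approx' t(1)])
        also have "\<dots> \<le> ennreal (c0 \<gamma> * t powr (\<gamma> - real r)) + ennreal (cN (k + r) * (t powr (\<gamma> - real r) * 2 ^ k)) * ennreal 1"
          using cN by (intro add_left_mono mult_mono E ennreal_leI mult_left_mono tk') auto
        also have "\<dots> = ennreal (c \<gamma> * t powr (\<gamma> - real r))"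
          using c0 cN by (simp add: c_def ennreal_plus[symmetric] algebra_simps del: ennreal_plus)
        finally show ?thesis .
      qed
      show ?thesis
      proof (cases "t \<le> 2 / real k")
        case True
        then show ?thesis using small t by blast
      next
        case False
        \<comment> \<open>Beyond 2 / k the modulus no longer grows, while t^(\<gamma>-r)
          increases.\<close>
        have "jacobi_modulus k r (ae_deriv r f) t \<alpha> \<beta> p \<le> jacobi_modulus k r (ae_deriv r f) (2 / real k) \<alpha> \<beta> p"
          using False by (intro jacobi_modulus_saturates k p) simp
        also have "\<dots> \<le> ennreal (c \<gamma> * (2 / real k) powr (\<gamma> - real r))" using k by (intro small) auto
        also have "\<dots> \<le> ennreal (c \<gamma> * t powr (\<gamma> - real r))"
          using False \<gamma> c0 cc by (intro ennreal_leI mult_left_mono powr_mono2) auto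
        finally show ?thesis .
      qed
    qed
    show "f \<in> B_space r p \<alpha> \<beta> \<and>
        (\<forall>t>0. jacobi_modulus k r (ae_deriv r f) t \<alpha> \<beta> p
            \<le> ennreal (c \<gamma> * t powr (\<gamma> - real r)) + ennreal (cN N * t ^ k) * best_approx (k + r) f \<alpha> \<beta> p) \<and>
        (N \<le> k + r \<longrightarrow> (\<forall>t>0. jacobi_modulus k r (ae_deriv r f) t \<alpha> \<beta> p \<le> ennreal (c \<gamma> * t powr (\<gamma> - real r))))"
      using B 1 2 by blast
  qed
qed

end
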